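(* Let $p\in(1,\infty)$ and let $k\leqslant d$ be a non-negative odd integer. Let $P$ be a spherical harmonic of degree $k$ on $\mathbb{R}^d$. Then there is a constant $B(p,k)$, independent of the dimension $d$, such that $$\|R_P^*f\|_{L^p(\mathbb{R}^d)}\leqslant B(p,k)\,\|R_Pf\|_{L^p(\mathbb{R}^d)}$$ for all $f\in L^p(\mathbb{R}^d)$. Moreover, for fixed $k$ we have $B(p,k)=O(p^{2+k/2})$ as $p\to\infty$ and $B(p,k)=O((p-1)^{-2-k/2})$ as $p\to1$.
   Context: Spherical harmonics of degree $k$ on $\mathbb{R}^d$ are identified with homogeneous harmonic polynomials of degree $k$ on $\mathbb{R}^d$. For such $P$ and $t>0$, let $$R_P^tf(x)=\gamma_k\int_{|y|>t}\frac{P(y)}{|y|^{k+d}}f(x-y)\,dy,\qquad \gamma_k=\frac{\Gamma\left(\frac{k+d}{2}\right)}{\pi^{d/2}\Gamma\left(\frac{k}{2}\right)},$$ be the truncated Riesz transform; the Riesz transform is $R_Pf(x)=\lim_{t\to0}R_P^tf(x)$ and the maximal Riesz transform is $R_P^*f(x)=\sup_{t>0}|R_P^tf(x)|$. The notation $B(p,k)$ indicates a constant depending only on $p$ and $k$. *)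

theory Defs
  imports "HOL-Analysis.Analysis" "HOL-Library.Landau_Symbols"
begin

text \<open>
  The dimension is quantified inside the theorem (the constant must not depend on it), so it cannot
  be a type.  Points of \<open>\<real>\<^sup>d\<close> are therefore functions \<open>nat \<Rightarrow> real\<close> on the index set \<open>{..<d}\<close>,
  extended by \<open>undefined\<close> as in the library's product measure; the measure is the completed product,
  i.e. Lebesgue measure on \<open>\<real>\<^sup>d\<close>.
\<close>

definition Rd :: "nat \<Rightarrow> (nat \<Rightarrow> real) set" where
  "Rd d = {..<d} \<rightarrow>\<^sub>E UNIV"

definition leb :: "nat \<Rightarrow> (nat \<Rightarrow> real) measure" where
  "leb d = completion (Pi\<^sub>M {..<d} (\<lambda>_. lborel))"

lemma space_leb: "space (leb d) = Rd d"
  by (simp add: leb_def Rd_def space_PiM)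

definition enorm :: "nat \<Rightarrow> (nat \<Rightarrow> real) \<Rightarrow> real" where
  "enorm d x = sqrt (\<Sum>i<d. (x i)\<^sup>2)"

definition vdiff :: "nat \<Rightarrow> (nat \<Rightarrow> real) \<Rightarrow> (nat \<Rightarrow> real) \<Rightarrow> (nat \<Rightarrow> real)" where
  "vdiff d x y = (\<lambda>i\<in>{..<d}. x i - y i)"

definition multi_indices :: "nat \<Rightarrow> nat \<Rightarrow> (nat \<Rightarrow> nat) set" where
  "multi_indices d k = {\<alpha> \<in> {..<d} \<rightarrow>\<^sub>E UNIV. (\<Sum>i<d. \<alpha> i) = k}"

definition homogeneous_polynomial :: "nat \<Rightarrow> nat \<Rightarrow> ((nat \<Rightarrow> real) \<Rightarrow> complex) \<Rightarrow> bool" where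
  "homogeneous_polynomial d k P \<longleftrightarrow>
     (\<exists>c :: (nat \<Rightarrow> nat) \<Rightarrow> complex. \<forall>x\<in>Rd d.
        P x = (\<Sum>\<alpha>\<in>multi_indices d k. c \<alpha> * (\<Prod>i<d. complex_of_real (x i) ^ \<alpha> i)))"

definition partial_deriv ::
    "nat \<Rightarrow> ((nat \<Rightarrow> real) \<Rightarrow> complex) \<Rightarrow> (nat \<Rightarrow> real) \<Rightarrow> complex" where
  "partial_deriv j u x = vector_derivative (\<lambda>s. u (x(j := s))) (at (x j))"

definition laplacian ::
    "nat \<Rightarrow> ((nat \<Rightarrow> real) \<Rightarrow> complex) \<Rightarrow> (nat \<Rightarrow> real) \<Rightarrow> complex" where
  "laplacian d u x = (\<Sum>j<d. partial_deriv j (partial_deriv j u) x)"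

definition spherical_harmonic :: "nat \<Rightarrow> nat \<Rightarrow> ((nat \<Rightarrow> real) \<Rightarrow> complex) \<Rightarrow> bool" where
  "spherical_harmonic d k P \<longleftrightarrow>
     homogeneous_polynomial d k P \<and> (\<forall>x\<in>Rd d. laplacian d P x = 0)"

definition riesz_const :: "nat \<Rightarrow> nat \<Rightarrow> real" where
  "riesz_const d k =
     Gamma ((real k + real d) / 2) / (pi powr (real d / 2) * Gamma (real k / 2))"

definition riesz_trunc ::
    "nat \<Rightarrow> nat \<Rightarrow> ((nat \<Rightarrow> real) \<Rightarrow> complex) \<Rightarrow> real \<Rightarrow>
     ((nat \<Rightarrow> real) \<Rightarrow> complex) \<Rightarrow> (nat \<Rightarrow> real) \<Rightarrow> complex" where
  "riesz_trunc d k P t f x =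
     complex_of_real (riesz_const d k) *
     (LINT y:{y \<in> Rd d. enorm d y > t}|leb d.
        P y / complex_of_real (enorm d y ^ (k + d)) * f (vdiff d x y))"

text \<open>
  The pointwise limit exists for almost every \<open>x\<close>; \<open>Lim\<close> takes an unspecified value elsewhere.
  The supremum is taken in \<open>ennreal\<close> because it may be infinite on a null set.
\<close>

definition riesz ::
    "nat \<Rightarrow> nat \<Rightarrow> ((nat \<Rightarrow> real) \<Rightarrow> complex) \<Rightarrow>
     ((nat \<Rightarrow> real) \<Rightarrow> complex) \<Rightarrow> (nat \<Rightarrow> real) \<Rightarrow> complex" where
  "riesz d k P f x = Lim (at_right 0) (\<lambda>t. riesz_trunc d k P t f x)"

definition riesz_max ::
    "nat \<Rightarrow> nat \<Rightarrow> ((nat \<Rightarrow> real) \<Rightarrow> complex) \<Rightarrow>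
     ((nat \<Rightarrow> real) \<Rightarrow> complex) \<Rightarrow> (nat \<Rightarrow> real) \<Rightarrow> ennreal" where
  "riesz_max d k P f x = (SUP t\<in>{0<..}. ennreal (norm (riesz_trunc d k P t f x)))"

definition ennreal_powr :: "ennreal \<Rightarrow> real \<Rightarrow> ennreal" where
  "ennreal_powr a p = (if a = \<infinity> then \<infinity> else ennreal (enn2real a powr p))"

definition Lp_norm_nn :: "real \<Rightarrow> 'a measure \<Rightarrow> ('a \<Rightarrow> ennreal) \<Rightarrow> ennreal" where
  "Lp_norm_nn p M u = ennreal_powr (\<integral>\<^sup>+ x. ennreal_powr (u x) p \<partial>M) (1 / p)"

definition Lp_norm :: "real \<Rightarrow> 'a measure \<Rightarrow> ('a \<Rightarrow> complex) \<Rightarrow> ennreal" where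
  "Lp_norm p M f = Lp_norm_nn p M (\<lambda>x. ennreal (norm (f x)))"

definition Lp_space :: "real \<Rightarrow> 'a measure \<Rightarrow> ('a \<Rightarrow> complex) set" where
  "Lp_space p M = {f \<in> borel_measurable M. Lp_norm p M f < \<infinity>}"

end

theory Submission
 imports Defs "HOL-Probability.Probability" "HOL-Complex_Analysis.Complex_Analysis"
begin

text \<open>In polar coordinates the Gaussian average over \<open>z\<close> of \<open>P z\<close> times the Hilbert transform in direction \<open>z\<close>,
 truncated to \<open>(t / |z|, \<infinity>)\<close>, is a multiple of the truncated Riesz transform \<open>R\<^sup>t f\<close>; truncating to
 \<open>(e, 1 / e)\<close> instead gives operators \<open>S\<^sub>e\<close> that converge to a multiple of \<open>R\<close> as \<open>e \<rightarrow> 0\<close>.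
 Let \<open>U\<^sub>z\<close> be \<open>S\<^sub>e\<close> with \<open>P\<close> replaced by the zonal reproducing kernel at \<open>z\<close>, and let \<open>M\<^sub>t\<close> average over \<open>z\<close> the
 composition of the truncated Hilbert transform in direction \<open>z\<close> with \<open>U\<^sub>z\<close>. By the reproducing property on
 the Fourier side, \<open>M\<^sub>t (S\<^sub>e f)\<close> tends to \<open>- c R\<^sup>t f\<close>, so the maximal function of \<open>R f\<close> is
 controlled by \<open>sup\<^sub>t |M\<^sub>t|\<close>. The one-dimensional maximal Hilbert transform costs \<open>O(p + 1 / (p - 1))\<close>, as does
 the Hilbert transform inside \<open>U\<^sub>z\<close>, which gives the exponent \<open>2\<close>; hypercontractivity of the Gaussian measure on
 polynomials of degree \<open>k\<close> bounds the average over \<open>z\<close> without dependence on \<open>d\<close>, which gives \<open>k / 2\<close>.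
 General \<open>f\<close> follows by density of functions with integrable Fourier transform.\<close>

text \<open>Averaging Hilbert transforms over directions bounds the maximal function by
  \<open>f\<close>, with a moment of \<open>P\<close> in the constant; to have \<open>R f\<close> on
  the right, \<open>R\<^sup>t\<close> must be factored through \<open>R\<close>. On the Fourier side
  \<open>R\<^sup>t\<close> multiplies by \<open>P \<xi>\<close> times a radial function. That
  function cannot be isolated by division, since \<open>P\<close> has zeros; it is read off from the
  zonal kernel at \<open>\<xi>\<close>, whose value at \<open>\<xi>\<close> itself is
  \<open>zonal_diag d k * |\<xi>| ^ (2 * k)\<close>. A lower bound for \<open>zonal_diag d k\<close>
  free of \<open>d\<close> comes from testing with the product of the first \<open>k\<close>
  coordinates, which exists because \<open>k \<le> d\<close>. Gaussian measure in place of the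
  sphere makes the coordinates independent: integration by parts then yields orthogonality, the
  Fourier transform of \<open>P\<close> times a Gaussian and hypercontractivity, with constants free
  of \<open>d\<close>. Bounds that depend on \<open>d\<close> and \<open>P\<close> also occur, but
  they only supply dominating functions and convergence almost everywhere.\<close>

abbreviation "en == ennreal"
abbreviation "nd == std_normal_density"
abbreviation "bm == borel_measurable"
abbreviation "pd == partial_deriv"
abbreviation "np p x == ennreal (norm x powr p)"
abbreviation (input) LIM_seq (infix "---->" 60) where "X ----> l == X \<longlonglongrightarrow> l"
notation (input) iff (infixr "<->" 25)
syntax "_nn_int" :: "pttrn => 'a measure => ennreal => ennreal" ("(3NN _|_./ _)" [0, 0, 10] 10)
translations "NN x|M. f" == "CONST nn_integral M (%x. f)"

lemmas mlm = mult_left_mono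
  and mrm = mult_right_mono
  and int_bd = Bochner_Integration.integrable_bound
  and int_cong = Bochner_Integration.integral_cong
  and int_sum = Bochner_Integration.integral_sum
  and int_cmult = integral_mult_right_zero
  and nn_cmult = nn_integral_cmult
  and nn_mono = nn_integral_mono
  and nn_cong = nn_integral_cong
  and sum_cmult = sum_distrib_left
  and sq_eq = power2_eq_square
  and ind_def = indicator_def
  and int_mult = integrable_mult_right
  and int_add = Bochner_Integration.integrable_add
  and pow_mult = power_mult_distrib
  and scaleR_of_real = scaleR_conv_of_real
  and en_mult = ennreal_mult
  and en_leI = ennreal_leI
  and dom_conv = integral_dominated_convergence

section \<open>Contour integrals and the Poisson kernel of the half plane\<close>

lemma integrable_one_plus_abs_powr:
 fixes p :: real assumes "1 < p"
 shows "integrable lborel (%x::real. (1 + abs x) powr (-p))"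
proof -
 let ?A = "%x. en ((1 + x) powr (-p)) * indicator {0..} x"
 let ?B = "%x. (1 + x) powr (1 - p) / (1 - p)"
 let ?f = "%x::real. (1 + abs x) powr (-p)"
 have "(NN x|lborel. ?A x) = en (0 - (1 + 0) powr (1 - p) / (1 - p))"
 proof (rule nn_integral_FTC_atLeast)
 show "(?B has_real_derivative (1 + x) powr - p) (at x)" if "0 <= x" for x
 using that assms by (auto intro!: derivative_eq_intros)
 have "((%x. (1 + x) powr (1 - p)) \<longlongrightarrow> 0) at_top"
 using assms by (intro tendsto_neg_powr filterlim_tendsto_add_at_top[OF tendsto_const filterlim_ident]) auto
 thus "(?B \<longlongrightarrow> 0) at_top"
 using tendsto_divide[OF _ tendsto_const, of "%x. (1 + x) powr (1 - p)" 0 at_top "1 - p"] assms by simp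
 qed auto
 hence fin: "(NN x|lborel. en (?f x) * indicator {0..} x) < \<infinity>"
 by (subst nn_cong[where v="%x. ?A x"]) (auto simp: ind_def)
 have "(NN x|lborel. en (?f x)) <= (NN x|lborel. en (?f x) * indicator {0..} x + en (?f (- x)) * indicator {0..} (- x))"
 by (intro nn_mono) (auto simp: ind_def)
 also have "... = (NN x|lborel. en (?f x) * indicator {0..} x) + (NN x|lborel. en (?f (- x)) * indicator {0..} (- x))"
 by (rule nn_integral_add) auto
 also have "(NN x|lborel. en (?f (- x)) * indicator {0..} (- x)) = (NN x|lborel. en (?f x) * indicator {0..} x)"
 using nn_integral_real_affine[of "%x. en (?f x) * indicator {0..} x" "-1" 0] by simp
 finally have "(NN x|lborel. en (?f x)) < \<infinity>"
 using fin by (simp add: order_le_less_trans)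
 thus ?thesis by (intro integrableI_nonneg) auto
qed

text \<open>Closing the segment by the upper half circle of radius \<open>r\<close>, Cauchy's
  theorem trades the segment for an arc of length \<open>pi * r\<close> on which \<open>q\<close> is
  O(\<open>r powr (- 1 - \<alpha>)\<close>). The margin \<open>\<eta>\<close> puts the real axis
  inside the domain of holomorphy.\<close>

lemma half_plane_segment_bound:
 fixes q :: "complex => complex" and r :: real
 assumes "0 < \<eta>" and holo: "q holomorphic_on {z. Im z > - \<eta>}" and r: "1 <= r"
 and bound: "!!z. Im z >= 0 ==> r <= norm z ==> norm (q z) <= C * norm z powr (- 1 - \<alpha>)"
 shows "norm (integral {-r..r} (%x. q (of_real x))) <= C * pi * r powr (- \<alpha>)"
proof -
 let ?A = "%l. contour_integral l q"
 let ?B = "part_circlepath 0 r 0 pi"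
 let ?C = "- 1 - \<alpha>"
 define l where "l = linepath (-(of_real r)) (of_real r :: complex)"
 define c where "c = ?B"
 have arc: "Im w >= 0 & norm w = r" if "w : path_image c" for w
 using r that unfolding c_def
 by (auto simp: path_image_part_circlepath' norm_mult closed_segment_eq_real_ivl intro!: mult_nonneg_nonneg sin_ge_zero)
 have im: "path_image (l +++ c) <= {z. Im z > - \<eta>}"
 proof -
 have "Im w = 0" if "w : path_image l" for w
 using that by (auto simp: closed_segment_def l_def)
 moreover have "path_image (l +++ c) <= path_image l \<union> path_image c"
 by (rule path_image_join_subset)
 ultimately show ?thesis using arc `0 < \<eta>` by fastforce
 qed
 have vp: "valid_path l" "valid_path c" and fin: "pathfinish l = pathstart c" "pathfinish c = pathstart l"
 by (simp_all add: l_def c_def)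
 have 0: "(q has_contour_integral 0) (l +++ c)"
 using vp fin by (intro Cauchy_theorem_convex_simple[OF holo convex_halfspace_Im_gt _ im]) (auto intro: valid_path_join)
 have ci: "q contour_integrable_on l" "q contour_integrable_on c"
 using has_contour_integral_integrable[OF 0] vp by (auto simp: contour_integrable_join)
 have s: "?A l = - ?A c"
 using contour_integral_join[OF ci vp] contour_integral_unique[OF 0] by (simp add: eq_neg_iff_add_eq_0)
 have "(q has_contour_integral ?A l) (linepath (-(of_real r)) (of_real r))"
 using has_contour_integral_integral[OF ci(1)] by (simp add: l_def)
 hence "((%x. q (of_real x)) has_integral ?A l) {-r..r}"
 using r by (subst (asm) has_contour_integral_linepath_Reals_iff) auto
 hence "norm (integral {-r..r} (%x. q (of_real x))) = norm (?A c)"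
 using s by (simp add: integral_unique)
 also have "... <= (C * r powr ?C) * r * (pi - 0)"
 proof (rule has_contour_integral_bound_part_circlepath)
 show "(q has_contour_integral ?A c) ?B"
 using has_contour_integral_integral[OF ci(2)] by (simp add: c_def)
 show bb: "norm (q x) <= C * r powr ?C" if "x : path_image ?B" for x
 using bound[of x] arc[of x] that r by (auto simp: c_def)
 have "part_circlepath 0 r 0 pi 0 : path_image ?B"
 by (simp add: path_image_def)
 from order_trans[OF norm_ge_zero bb[OF this]] show "0 <= C * r powr ?C" .
 qed (use r in auto)
 also have "... = C * pi * (r * r powr ?C)" by simp
 also have "r * r powr ?C = r powr (- \<alpha>)"
 using powr_mult_base[of r "?C"] r by simp
 finally show ?thesis .
qed

lemma half_plane_Cauchy:
 fixes q :: "complex => complex"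
 assumes "0 < \<eta>" and holo: "q holomorphic_on {z. Im z > - \<eta>}"
 and int: "integrable lborel (%x. q (of_real x))"
 and "0 < \<alpha>" and bound: "!!z. Im z >= 0 ==> r0 <= norm z ==> norm (q z) <= C * norm z powr (- 1 - \<alpha>)"
 shows "(LINT x|lborel. q (of_real x)) = 0"
proof -
 let ?I = "%n::nat. (LINT x|lborel. indicator {-(real n)..real n} x *\<^sub>R q (of_real x))"
 let ?A = "%x. q (of_real x)"
 have lim1: "?I ----> (LINT x|lborel. ?A x)"
 proof (rule dom_conv[where w="%x. norm (?A x)"])
 show "AE x in lborel. (%i. indicator {-(real i)..real i} x *\<^sub>R ?A x) ----> ?A x"
 proof (rule AE_I2, rule tendsto_eventually)
 fix x :: real
 obtain n0 :: nat where "abs x <= real n0" using real_arch_simple by blast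
 thus "\<forall>\<^sub>F i in sequentially. indicator {-(real i)..real i} x *\<^sub>R ?A x = ?A x"
 by (intro eventually_sequentiallyI[of n0]) (auto simp: ind_def)
 qed
 qed (use int in \<open>auto simp: ind_def\<close>)
 have b: "norm (?I n) <= C * pi * real n powr (- \<alpha>)" if n: "nat \<lceil>max 1 r0\<rceil> <= n" for n
 proof -
 have "set_integrable lborel {-real n..real n} (%x. ?A x)"
 unfolding set_integrable_def by (rule integrable_mult_indicator[OF _ int]) auto
 from set_borel_integral_eq_integral(2)[OF this]
 have "?I n = integral {-real n..real n} (%x. ?A x)"
 unfolding set_lebesgue_integral_def .
 thus ?thesis using half_plane_segment_bound[OF assms(1,2), where r="real n" and C=C and \<alpha>=\<alpha>] bound n by (simp add: nat_le_iff ceiling_le_iff)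
 qed
 have "(%n. real n powr (- \<alpha>)) ----> 0"
 using `0 < \<alpha>` by (intro tendsto_neg_powr[OF _ filterlim_real_sequentially]) simp
 hence "(%n. C * pi * real n powr (- \<alpha>)) ----> 0"
 by (rule tendsto_mult_right_zero)
 hence "?I ----> 0"
 by (rule Lim_null_comparison[rotated]) (rule eventually_sequentiallyI[OF b])
 from LIMSEQ_unique[OF lim1 this] show ?thesis .
qed

definition poisson :: "real => real => real" where
 "poisson y x = y / (pi * (x^2 + y^2))"

lemma poisson_nonneg [simp]: "0 <= y ==> 0 <= poisson y x"
 by (simp add: poisson_def)

lemma poisson_even [simp]: "poisson y (- x) = poisson y x"
 by (simp add: poisson_def)

lemma poisson_minus_commute: "poisson y (x - t) = poisson y (t - x)"
 by (simp add: poisson_def power2_commute)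

lemma borel_measurable_poisson [measurable]: "poisson y : bm borel"
 unfolding poisson_def by measurable

lemma nn_integral_poisson:
 assumes y: "0 < y" shows "(NN x|lborel. en (poisson y x)) = 1"
proof -
 let ?A = "(NN x|lborel. en (poisson y x) * indicator {0..} x)"
 let ?B = "(NN x|lborel. en (poisson y (- x)) * indicator {0<..} (- x))"
 let ?C = "%x. (1/pi) * arctan (x / y)"
 let ?D = "%x. inverse (1 + (x/y)^2) * (1/y)"
 let ?E = "%x. x^2 + y^2"
 let ?F = "(NN x|lborel. en (poisson y x))"
 have half: "?A = en ((1/pi) * (pi/2) - (1/pi) * arctan (0 / y))"
 proof (rule nn_integral_FTC_atLeast)
 show "(?C has_real_derivative poisson y x) (at x)" for x
 proof -
 have nz: "?E x > 0" using y by (simp add: add_nonneg_pos)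
 have "1 + (x/y)^2 = (?E x) / y^2" using y by (simp add: field_simps)
 hence "?D x = y^2 / (?E x) * (1 / y)" by simp
 also have "... = y / (?E x)" using y by (simp add: sq_eq)
 finally have "(1/pi) * (?D x) = poisson y x" by (simp add: poisson_def)
 moreover have "(?C has_real_derivative (1/pi) * (?D x)) (at x)"
 using y by (auto intro!: derivative_eq_intros)
 ultimately show ?thesis by simp
 qed
 have "filterlim (%x. (1/y) * x) at_top at_top"
 using y by (intro filterlim_tendsto_pos_mult_at_top[OF tendsto_const _ filterlim_ident]) auto
 hence "((%x. arctan (x / y)) \<longlongrightarrow> pi/2) at_top"
 using filterlim_compose[OF tendsto_arctan_at_top] by (simp add: field_simps)
 thus "(?C \<longlongrightarrow> (1/pi) * (pi/2)) at_top"
 by (intro tendsto_mult tendsto_const)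
 qed (use y in auto)
 have "?F = (NN x|lborel. en (poisson y x) * indicator {0..} x + en (poisson y (- x)) * indicator {0<..} (- x))"
 by (intro nn_cong) (auto simp: ind_def)
 also have "... = ?A + ?B"
 by (rule nn_integral_add) auto
 also have "?B = (NN x|lborel. en (poisson y x) * indicator {0<..} x)"
 using nn_integral_real_affine[of "%x. en (poisson y x) * indicator {0<..} x" "-1" 0] by simp
 also have "... = ?A"
 by (intro nn_integral_cong_AE AE_I'[of "{0}"]) (auto simp: ind_def)
 finally have "?F = en (1/2) + en (1/2)" unfolding half by simp
 also have "... = 1" by (subst ennreal_plus[symmetric]) auto
 finally show ?thesis .
qed

lemma integrable_poisson: "0 < y ==> integrable lborel (poisson y)"
 and integral_poisson: "0 < y ==> (LINT x|lborel. poisson y x) = 1"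
proof -
 assume "0 < y"
 thus "integrable lborel (poisson y)"
 using nn_integral_poisson by (intro integrableI_nonneg) auto
 show "(LINT x|lborel. poisson y x) = 1"
 using nn_integral_poisson[OF `0 < y`] `0 < y` by (simp add: integral_eq_nn_integral)
qed

lemma nn_integral_lborel_minus:
 fixes f :: "real => ennreal" assumes [measurable]: "f : bm borel"
 shows "(NN t|lborel. f (x - t)) = (NN t|lborel. f t)"
 using nn_integral_real_affine[of f "-1" x] by simp

lemma integrable_lborel_minus:
 fixes f :: "real => 'a :: {banach, second_countable_topology}"
 shows "integrable lborel (%t. f (x - t)) <-> integrable lborel f"
 using lborel_integrable_real_affine_iff[of "-1" f x] by simp

lemma integral_lborel_minus:
 fixes f :: "real => 'a :: {banach, second_countable_topology}"
 shows "(LINT t|lborel. f (x - t)) = (LINT t|lborel. f t)"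
 using lborel_integral_real_affine[of "-1" f x] by simp

text \<open>With \<open>w = Complex x y\<close>, the function
  \<open>(F z - F w) / ((z - w) * (z - cnj w))\<close> has a removable singularity at
  \<open>w\<close> and decays like \<open>1 / |z|\<^sup>2\<close>, so its integral over the real
  line vanishes. There \<open>1 / ((t - w) * (t - cnj w))\<close> is a multiple of the Poisson
  kernel.\<close>

lemma poisson_representation:
 fixes F :: "complex => complex"
 assumes "0 < \<eta>" and holo: "F holomorphic_on {z. Im z > - \<eta>}"
 and bd: "!!z. Im z >= 0 ==> norm (F z) <= B" and y: "0 < y"
 shows "(LINT t|lborel. poisson y (x - t) *\<^sub>R F (of_real t)) = F (Complex x y)"
 and "integrable lborel (%t. poisson y (x - t) *\<^sub>R F (of_real t))"
proof -
 let ?A = "%t. F (of_real t)"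
 let ?B = "%t. poisson y (x - t)"
 let ?C = "%t. (x - t)^2 + y^2"
 let ?D = "%t. poisson y (x - t) *\<^sub>R ?A t"
 define w where "w = Complex x y"
 define S where "S = {z. Im z > - \<eta>}"
 have oS: "open S" unfolding S_def by (rule open_halfspace_Im_gt)
 have wS: "w : S" using `0 < \<eta>` y by (simp add: S_def w_def)
 have B: "0 <= B" using order_trans[OF norm_ge_zero bd[of 0]] by simp
 \<comment> \<open>The pole at \<open>cnj w\<close> lies at height \<open>- y\<close>; half of that
   depth keeps it outside.\<close>
 define \<eta>' where "\<eta>' = min \<eta> (y/2)"
 define D where "D = (%z. if z = w then deriv F w else (F z - F w) / (z - w))"
 have Dh: "D holomorphic_on S"
 unfolding D_def using pole_lemma_open[of F S w] holo oS by (simp add: S_def)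
 define q where "q = (%z. D z / (z - cnj w))"
 have qh: "q holomorphic_on {z. Im z > - \<eta>'}"
 unfolding q_def
 proof (intro holomorphic_intros)
 show "D holomorphic_on {z. Im z > - \<eta>'}"
 by (rule holomorphic_on_subset[OF Dh]) (auto simp: S_def \<eta>'_def)
 show "z - cnj w ~= 0" if "z : {z. Im z > - \<eta>'}" for z
 using that y by (auto simp: w_def \<eta>'_def complex_eq_iff)
 qed
 have real_ne: "complex_of_real t ~= w" for t using y by (auto simp: w_def complex_eq_iff)
 have prod: "(complex_of_real t - w) * (complex_of_real t - cnj w) = of_real (?C t)" for t
 by (simp add: w_def complex_eq_iff sq_eq algebra_simps)
 have q_real: "q (of_real t) = (pi / y * ?B t) *\<^sub>R (?A t - F w)" for t
 proof -
 have "q (of_real t) = (?A t - F w) / ((of_real t - w) * (of_real t - cnj w))"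
 using real_ne[of t] by (simp add: q_def D_def)
 also have "... = (?A t - F w) / of_real (?C t)" unfolding prod ..
 also have "... = (1 / (?C t)) *\<^sub>R (?A t - F w)"
 by (simp add: scaleR_of_real)
 also have "1 / (?C t) = pi / y * ?B t" using y by (simp add: poisson_def)
 finally show ?thesis .
 qed
 have cont: "continuous_on UNIV (%t::real. ?A t)"
 by (rule continuous_on_compose2[OF holomorphic_on_imp_continuous_on[OF holo]])
 (use `0 < \<eta>` in \<open>auto intro!: continuous_intros\<close>)
 hence [measurable]: "(%t::real. ?A t) : bm borel"
 by (rule borel_measurable_continuous_onI)
 have ip: "integrable lborel (%t. ?B t)"
 using integrable_poisson[OF y] by (simp add: integrable_lborel_minus)
 show int1: "integrable lborel (%t. ?D t)"
 by (rule int_bd[OF integrable_mult_left[OF ip, of B]])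
 (use bd y B in \<open>auto intro!: AE_I2 mlm\<close>)
 have int2: "integrable lborel (%t. poisson y (x - t) *\<^sub>R F w)"
 by (rule integrable_scaleR_left) (rule ip)
 have intq: "integrable lborel (%t. q (of_real t))"
 unfolding q_real using integrable_scaleR_right[OF Bochner_Integration.integrable_diff[OF int1 int2], of "pi / y"]
 by (simp add: scaleR_diff_right)
 have "(LINT t|lborel. q (of_real t)) = 0"
 proof (rule half_plane_Cauchy[OF _ qh intq, of 1 "2 * norm w + 1" "8 * B"])
 fix z assume z: "0 <= Im z" "2 * norm w + 1 <= norm z"
 have nz: "norm z > 0" using z(2) norm_ge_zero[of w] by linarith
 have a: "norm z / 2 <= norm (z - w)" "norm z / 2 <= norm (z - cnj w)"
 using norm_triangle_ineq2[of z w] norm_triangle_ineq2[of z "cnj w"] z(2) by auto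
 hence ne: "z ~= w" using nz by auto
 have "norm (q z) = norm (F z - F w) / (norm (z - w) * norm (z - cnj w))"
 using ne by (simp add: q_def D_def norm_divide norm_mult)
 also have "... <= (2 * B) / (norm z / 2 * (norm z / 2))"
 proof (rule frac_le)
 show "norm (F z - F w) <= 2 * B"
 using norm_triangle_ineq4[of "F z" "F w"] bd[of z] bd[of w] z y by (simp add: w_def)
 show "norm z / 2 * (norm z / 2) <= norm (z - w) * norm (z - cnj w)"
 by (rule mult_mono[OF a]) auto
 qed (use nz B in auto)
 also have "... = 8 * B * (1 / (norm z)^2)" by (simp add: sq_eq)
 also have "1 / (norm z)^2 = norm z powr (- 1 - 1)"
 using nz powr_minus_divide[of "norm z" 2] by simp
 finally show "norm (q z) <= 8 * B * norm z powr (- 1 - 1)" .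
 qed (use `0 < \<eta>` y in \<open>auto simp: \<eta>'_def\<close>)
 moreover have "q (of_real t) = (pi / y) *\<^sub>R (?B t *\<^sub>R ?A t - ?B t *\<^sub>R F w)" for t
 by (simp add: q_real scaleR_diff_right)
 ultimately have "(LINT t|lborel. poisson y (x - t) *\<^sub>R ?A t - ?B t *\<^sub>R F w) = 0"
 using y by simp
 hence "(LINT t|lborel. ?D t) = (LINT t|lborel. poisson y (x - t) *\<^sub>R F w)"
 by (simp add: Bochner_Integration.integral_diff[OF int1 int2])
 also have "... = (LINT t|lborel. ?B t) *\<^sub>R F w"
 using ip by simp
 also have "... = F w"
 using integral_poisson[OF y] integral_lborel_minus[of "poisson y" x] by simp
 finally show "(LINT t|lborel. ?D t) = F (Complex x y)" by (simp add: w_def)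
qed

text \<open>The representation formula is applied to \<open>\<i> / (pi * (z + \<i> * b))\<close>,
  whose real part at height \<open>s\<close> is the Poisson kernel of parameter
  \<open>s + b\<close>.\<close>

lemma poisson_semigroup:
 assumes a: "0 < a" and b: "0 < b"
 shows "(NN t|lborel. en (poisson a (x - t) * poisson b t)) = en (poisson (a + b) x)"
proof -
 let ?A = "%t F. poisson a (x - t) *\<^sub>R F (of_real t)"
 let ?B = "%t. poisson a (x - t) * poisson b t"
 let ?C = "%z. z + \<i> * of_real b"
 define F where "F = (%z. \<i> / (of_real pi * (?C z)))"
 have ReF: "Re (F (Complex t s)) = poisson (s + b) t" for t s
 proof -
 have "F (Complex t s) = (\<i> / (Complex t s + \<i> * of_real b)) / of_real pi" by (simp add: F_def field_simps)
 hence "Re (F (Complex t s)) = Re (\<i> / (Complex t s + \<i> * of_real b)) / pi" by (simp only: Re_divide_of_real)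
 thus ?thesis by (simp add: Re_divide poisson_def)
 qed
 have h: "F holomorphic_on {z. Im z > - b}"
 unfolding F_def by (intro holomorphic_intros) (auto simp: complex_eq_iff)
 have bd: "norm (F z) <= 1 / (pi * b)" if "Im z >= 0" for z
 proof -
 have "b <= Im (?C z)" using that by simp
 also have "... <= norm (?C z)" using abs_Im_le_cmod[of "?C z"] by linarith
 finally show ?thesis using b by (simp add: F_def norm_divide norm_mult frac_le)
 qed
 have P: "(LINT t|lborel. ?A t F) = F (Complex x a)"
 "integrable lborel (%t. ?A t F)"
 by (rule poisson_representation[OF b h _ a], erule bd)+
 have eq: "Re (?A t F) = ?B t" for t
 using ReF[of t 0] by (simp add: complex_of_real_def)
 have "integrable lborel (%t. ?B t)"
 using integrable_Re[OF P(2)] unfolding eq .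
 moreover have "(LINT t|lborel. ?B t) = poisson (a + b) x"
 using integral_Re[OF P(2)] unfolding eq P(1) ReF by simp
 ultimately show ?thesis using a b by (subst nn_integral_eq_integral) auto
qed

section \<open>Square integrability of the Poisson maximal function\<close>

definition pconv :: "real => (real => ennreal) => real => ennreal" where
 "pconv a g x = (NN t|lborel. en (poisson a (x - t)) * g t)"

lemma borel_measurable_pconv [measurable]:
 assumes [measurable]: "g : bm borel"
 shows "pconv a g : bm borel"
 unfolding pconv_def by measurable

lemma pconv_mono: "(!!t. f t <= g t) ==> pconv a f x <= pconv a g x"
 unfolding pconv_def by (intro nn_mono mlm) auto

lemma pconv_sum:
 assumes "!!i. i : I ==> g i : bm borel"
 shows "pconv a (%t. SUM i:I. g i t) x = (SUM i:I. pconv a (g i) x)"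
 using assms unfolding pconv_def sum_cmult by (intro nn_integral_sum) auto

lemma pconv_symmetric:
 assumes [measurable]: "f : bm borel" "g : bm borel"
 shows "(NN x|lborel. f x * pconv a g x) = (NN x|lborel. pconv a f x * g x)"
proof -
 have "(NN x|lborel. f x * pconv a g x) = (NN x|lborel. (NN t|lborel. f x * (en (poisson a (x - t)) * g t)))"
 unfolding pconv_def by (intro nn_cong nn_cmult[symmetric]) auto
 also have "... = (NN t|lborel. (NN x|lborel. f x * (en (poisson a (x - t)) * g t)))"
 by (rule lborel_pair.Fubini'[symmetric]) measurable
 also have "... = (NN t|lborel. (NN x|lborel. en (poisson a (t - x)) * f x * g t))"
 by (intro nn_cong) (simp add: poisson_minus_commute mult_ac)
 also have "... = (NN x|lborel. pconv a f x * g x)"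
 unfolding pconv_def by (intro nn_cong nn_integral_multc) auto
 finally show ?thesis .
qed

lemma pconv_pconv:
 assumes [measurable]: "g : bm borel" and a: "0 < a" and b: "0 < b"
 shows "pconv a (pconv b g) x = pconv (a + b) g x"
proof -
 let ?A = "%t s. en (poisson a (x - t) * poisson b (t - s))"
 let ?B = "%t s. en (poisson a (x - t)) * (en (poisson b (t - s)) * g s)"
 have "pconv a (pconv b g) x = (NN t|lborel. (NN s|lborel. ?B t s))"
 unfolding pconv_def by (intro nn_cong nn_cmult[symmetric]) auto
 also have "... = (NN s|lborel. (NN t|lborel. ?B t s))"
 by (rule lborel_pair.Fubini'[symmetric]) measurable
 also have "... = (NN s|lborel. (NN t|lborel. ?A t s) * g s)"
 using a b by (intro nn_cong) (subst nn_integral_multc[symmetric], auto simp: ennreal_mult' mult.assoc)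
 also have "... = (NN s|lborel. en (poisson (a + b) (x - s)) * g s)"
 proof (intro nn_cong)
 fix s
 have "(NN t|lborel. ?A t s) = (NN t|lborel. en (poisson a ((x - s) - t) * poisson b t))"
 using nn_integral_real_affine[of "%t. ?A t s" 1 s] by (simp add: algebra_simps)
 thus "(NN t|lborel. ?A t s) * g s = en (poisson (a + b) (x - s)) * g s"
 using poisson_semigroup[OF a b, of "x - s"] by simp
 qed
 finally show ?thesis by (simp add: pconv_def)
qed

lemma poisson_add_le:
 assumes "0 < a" "0 < b"
 shows "poisson (a + b) x <= 2 * poisson a x + 2 * poisson b x"
proof -
 have *: "poisson (a + b) x <= 2 * poisson a x" if "0 < b" "b <= a" for a b
 proof -
 have "(a + b) / (pi * (x^2 + (a + b)^2)) <= (2 * a) / (pi * (x^2 + a^2))"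
 using that by (intro frac_le mlm add_left_mono power_mono mult_pos_pos add_nonneg_pos) auto
 thus ?thesis by (simp add: poisson_def)
 qed
 show ?thesis
 using *[of b a] *[of a b] assms poisson_nonneg[of a x] poisson_nonneg[of b x]
 by (cases "b <= a") (auto simp: add.commute intro: order_trans)
qed

lemma pconv_add_le:
 assumes [measurable]: "g : bm borel" and a: "0 < a" and b: "0 < b"
 shows "pconv (a + b) g x <= 2 * pconv a g x + 2 * pconv b g x"
proof -
 let ?A = "%t. 2 * (en (poisson a (x - t)) * g t) + 2 * (en (poisson b (x - t)) * g t)"
 let ?B = "%t. 2 * en (poisson a (x - t)) + 2 * en (poisson b (x - t))"
 let ?C = "%t. en (poisson (a + b) (x - t))"
 have "pconv (a + b) g x <= (NN t|lborel. ?A t)"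
 unfolding pconv_def
 proof (intro nn_mono)
 fix t
 have "?C t <= en (2 * poisson a (x - t) + 2 * poisson b (x - t))"
 using poisson_add_le[OF a b] by (intro en_leI)
 also have "... = ?B t"
 using a b by (simp add: ennreal_plus ennreal_mult')
 finally show "?C t * g t <= ?A t"
 using mrm[of "?C t" "?B t" "g t"]
 by (simp add: distrib_right mult.assoc)
 qed
 also have "... = 2 * pconv a g x + 2 * pconv b g x"
 unfolding pconv_def by (simp add: nn_integral_add nn_cmult)
 finally show ?thesis .
qed

text \<open>Linearises a finite maximum: \<open>e i\<close> is the indicator of a measurable set on
  which \<open>u i\<close> is largest, and the sets for different \<open>i\<close> are disjoint. A
  tie is left to the earlier index.\<close>

lemma SUP_as_selection:
 fixes u :: "nat => 'a => ennreal"
 assumes "!!i. u i : bm M"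
 shows "EX e. (ALL i. e i : bm M) & (ALL x. (SUM i<n. e i x) <= (1::ennreal)) &
 (ALL x. (SUM i<n. e i x * u i x) = (SUP i\<in>{..<n}. u i x))"
proof (induction n)
 case 0 show ?case by (intro exI[of _ "%_ _. 0"]) (auto simp: bot_ennreal)
next
 case (Suc n)
 note [measurable] = assms
 from Suc obtain e where [measurable]: "!!i. e i : bm M"
 and e: "!!x. (SUM i<n. e i x) <= 1" "!!x. (SUM i<n. e i x * u i x) = (SUP i\<in>{..<n}. u i x)" by blast
 define e' where "e' i x = (if i < n then (if u n x <= (SUP i\<in>{..<n}. u i x) then e i x else 0)
 else (if u n x <= (SUP i\<in>{..<n}. u i x) then 0 else 1))" for i x
 have m: "!!i. e' i : bm M" unfolding e'_def by measurable
 have s: "(SUP i\<in>{..<Suc n}. u i x) = sup (u n x) (SUP i\<in>{..<n}. u i x)" for x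
 by (simp add: lessThan_Suc)
 have "(SUM i<Suc n. e' i x) <= 1" "(SUM i<Suc n. e' i x * u i x) = (SUP i\<in>{..<Suc n}. u i x)" for x
 using e[of x] by (auto simp: e'_def s sup_absorb1 sup_absorb2 not_le less_imp_le)
 with m show ?case by blast
qed

definition pmax :: "nat => (nat => real) => (real => ennreal) => real => ennreal" where
 "pmax n y f x = (SUP i\<in>{..<n}. pconv (y i) f x)"

lemma borel_measurable_pmax [measurable]:
 assumes [measurable]: "f : bm borel"
 shows "pmax n y f : bm borel"
 unfolding pmax_def by measurable

text \<open>The kernel is split into two square roots for Cauchy-Schwarz; its total mass is
  1.\<close>

lemma pconv_square_le:
 assumes [measurable]: "f : bm borel" and a: "0 < a"
 shows "(pconv a f x)^2 <= pconv a (%t. (f t)^2) x"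
proof -
 let ?A = "%t. en (sqrt (poisson a (x - t)))"
 let ?k = "%t. en (poisson a (x - t))"
 have k1: "(NN t|lborel. ?k t) = 1"
 using nn_integral_lborel_minus[of "%t. en (poisson a t)"] nn_integral_poisson[OF a] by simp
 have sq: "(?A t)^2 = ?k t" for t
 using a by (simp add: ennreal_power)
 have "pconv a f x = (NN t|lborel. en (sqrt (poisson a (x - t))) * (?A t * f t))"
 unfolding pconv_def by (simp add: sq[symmetric] sq_eq mult_ac)
 hence "(pconv a f x)^2 <= (NN t|lborel. (?A t)^2) *
 (NN t|lborel. (?A t * f t)^2)"
 by (simp only:) (rule Cauchy_Schwarz_nn_integral; measurable)
 also have "... = pconv a (%t. (f t)^2) x"
 by (simp add: sq k1 pow_mult pconv_def)
 finally show ?thesis .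
qed

lemma nn_integral_pconv:
 assumes [measurable]: "f : bm borel" and a: "0 < a"
 shows "(NN x|lborel. pconv a f x) = (NN x|lborel. f x)"
proof -
 have "pconv a (%_. 1) x = 1" for x
 using nn_integral_lborel_minus[of "%t. en (poisson a t)" x] nn_integral_poisson[OF a] by (simp add: pconv_def)
 thus ?thesis using pconv_symmetric[of "%_. 1" f a] by simp
qed

text \<open>A crude bound that grows with \<open>n\<close>. It serves only to make the integrals in
  \<open>pmax_L2\<close> finite, so that a common factor may be cancelled there.\<close>

lemma pmax_L2_finite:
 assumes y: "!!i. 0 < y i" and f [measurable]: "f : bm borel"
 shows "(NN x|lborel. (pmax n y f x)^2) <= of_nat n * (NN x|lborel. (f x)^2)"
proof -
 let ?A = "%x. (SUM i<n. pconv (y i) (%t. (f t)^2) x)"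
 have "(pmax n y f x)^2 <= ?A x" for x
 proof (cases "n = 0")
 case False
 hence "pmax n y f x : (%i. pconv (y i) f x) ` {..<n}"
 unfolding pmax_def using Max_in[of "(%i. pconv (y i) f x) ` {..<n}"]
 by (simp add: Max_Sup lessThan_empty_iff)
 then obtain i where i: "i < n" "pmax n y f x = pconv (y i) f x" by auto
 have "(pmax n y f x)^2 <= pconv (y i) (%t. (f t)^2) x" unfolding i by (rule pconv_square_le[OF f y])
 also have "... <= ?A x" using i by (intro member_le_sum) auto
 finally show ?thesis .
 qed (simp add: pmax_def bot_ennreal)
 hence "(NN x|lborel. (pmax n y f x)^2) <= (NN x|lborel. ?A x)"
 by (rule nn_mono)
 also have "... = of_nat n * (NN x|lborel. (f x)^2)"
 by (subst nn_integral_sum) (auto simp: nn_integral_pconv y)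
 finally show ?thesis .
qed

lemma ennreal_le_of_power2_le_mult:
 fixes a b :: ennreal assumes "a^2 <= a * b" "a < \<infinity>" shows "a <= b"
 using assms by (cases "a = 0") (auto simp: sq_eq ennreal_mult_le_mult_iff)

text \<open>The \<open>T T\<^sup>*\<close> argument for the linearised maximal function \<open>T f = (\<Sum>i. e i * pconv (y i) f)\<close>:
  since \<open>poisson (a + b) \<le> 2 * poisson a + 2 * poisson b\<close>, the square norm of \<open>g = T\<^sup>* (T f)\<close> is at most
  \<open>4\<close> times the scalar product of \<open>g\<close> and \<open>T f\<close>.\<close>

theorem pmax_L2:
 assumes y: "!!i. 0 < y i" and [measurable]: "f : bm borel"
 shows "(NN x|lborel. (pmax n y f x)^2) <= 16 * (NN x|lborel. (f x)^2)"
proof (cases "(NN x|lborel. (f x)^2) = \<infinity>")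
 case True
 thus ?thesis by (simp add: ennreal_mult_top)
next
 case False
 let ?m = "pmax n y f" and ?P = "%i. pconv (y i)"
 define I where "I = (NN x|lborel. (?m x)^2)"
 define J where "J = (NN x|lborel. (f x)^2)"
 obtain e where [measurable]: "!!i. e i : bm borel"
 and e1: "!!x. (SUM i<n. e i x) <= 1" and e2: "!!x. (SUM i<n. e i x * ?P i f x) = ?m x"
 using SUP_as_selection[of "%i. ?P i f" borel n] unfolding pmax_def by auto
 \<comment> \<open>\<open>h i = e i * T f\<close>, where \<open>T f\<close> is the maximal function
   itself; hence \<open>g\<close>, the sum of the \<open>?P i (h i)\<close>, is the adjoint of
   \<open>T\<close> applied to \<open>T f\<close>.\<close>
 define h where "h i x = e i x * ?m x" for i x
 have [measurable]: "h i : bm borel" for i unfolding h_def by measurable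
 have hm: "(SUM i<n. h i x) <= ?m x" for x
 unfolding h_def sum_distrib_right[symmetric] using mrm[OF e1[of x], of "?m x"] by simp
 define g where "g x = (SUM i<n. ?P i (h i) x)" for x
 have [measurable]: "g : bm borel" unfolding g_def by measurable
 define G where "G = (NN x|lborel. (g x)^2)"
 have dual: "(NN x|lborel. g x * u x) = (SUM i<n. (NN x|lborel. h i x * ?P i u x))"
 if [measurable]: "u : bm borel" for u
 unfolding g_def sum_distrib_right by (subst nn_integral_sum) (auto simp: pconv_symmetric)
 have "I = (NN x|lborel. (SUM i<n. h i x * ?P i f x))"
 unfolding I_def sq_eq by (subst (2) e2[symmetric]) (simp add: h_def sum_cmult mult_ac)
 hence I1: "I = (NN x|lborel. g x * f x)" by (simp add: dual nn_integral_sum)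
 have I2: "I^2 <= G * J" unfolding I1 J_def G_def by (rule Cauchy_Schwarz_nn_integral) auto
 have cross: "(NN x|lborel. ?P i (h i) x * ?P j (h j) x) <=
 2 * (NN x|lborel. h i x * ?P i (h j) x) + 2 * (NN x|lborel. h j x * ?P j (h i) x)" for i j
 proof -
 have "(NN x|lborel. ?P i (h i) x * ?P j (h j) x) = (NN x|lborel. h i x * pconv (y i + y j) (h j) x)"
 by (simp add: pconv_symmetric[symmetric] pconv_pconv y)
 also have "... <= (NN x|lborel. h i x * (2 * ?P i (h j) x + 2 * ?P j (h j) x))"
 by (intro nn_mono mlm pconv_add_le y) auto
 also have "... = 2 * (NN x|lborel. h i x * ?P i (h j) x) + 2 * (NN x|lborel. h i x * ?P j (h j) x)"
 by (simp add: distrib_left mult.left_commute[of _ 2] nn_integral_add nn_cmult)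
 also have "(NN x|lborel. h i x * ?P j (h j) x) = (NN x|lborel. h j x * ?P j (h i) x)"
 by (subst pconv_symmetric) (auto simp: mult.commute)
 finally show ?thesis .
 qed
 let ?X = "SUM i<n. SUM j<n. (NN x|lborel. h i x * ?P i (h j) x)"
 have "G = (SUM i<n. SUM j<n. (NN x|lborel. ?P i (h i) x * ?P j (h j) x))"
 unfolding G_def g_def sq_eq sum_product by (simp add: nn_integral_sum)
 also have "... <= (SUM i<n. SUM j<n. 2 * (NN x|lborel. h i x * ?P i (h j) x) + 2 * (NN x|lborel. h j x * ?P j (h i) x))"
 by (intro sum_mono cross)
 also have "... = 4 * ?X"
 unfolding sum.distrib sum_cmult[symmetric] sum.swap[of "%i j. (NN x|lborel. h j x * ?P j (h i) x)"]
 by (simp add: distrib_right[symmetric])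
 also have "?X = (SUM i<n. (NN x|lborel. h i x * ?P i (%t. SUM j<n. h j t) x))"
 by (simp add: pconv_sum nn_integral_sum sum_cmult)
 also have "... <= (SUM i<n. (NN x|lborel. h i x * ?P i ?m x))"
 by (intro sum_mono nn_mono mlm pconv_mono hm) auto
 also have "... = (NN x|lborel. g x * ?m x)" by (simp add: dual)
 finally have G1: "G <= 4 * (NN x|lborel. g x * ?m x)" by (simp add: mlm)
 \<comment> \<open>Finiteness of \<open>I\<close> and of \<open>G\<close> allows the cancellations
   that turn \<open>G^2 <= 16 * G * I\<close> and \<open>I^2 <= G * J\<close> into
   \<open>I <= 16 * J\<close>.\<close>
 have I_fin: "I < \<infinity>"
 using order_le_less_trans[OF pmax_L2_finite[OF y, of f n]] False
 by (auto simp: I_def ennreal_mult_less_top less_top of_nat_less_top)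
 have gle: "g x <= of_nat n * pmax n y ?m x" for x
 proof -
 have hi: "h i t <= ?m t" if "i < n" for i t
 using member_le_sum[of i "{..<n}" "%i. h i t"] that hm[of t] by (auto intro: order_trans)
 have "g x <= (SUM i<n. pmax n y ?m x)"
 unfolding g_def by (intro sum_mono order_trans[OF pconv_mono[OF hi]]) (auto simp: pmax_def[of n y "pmax n y f"] intro: SUP_upper)
 thus ?thesis by simp
 qed
 have "G <= (NN x|lborel. (of_nat n)^2 * (pmax n y ?m x)^2)"
 unfolding G_def pow_mult[symmetric] by (intro nn_mono power_mono gle) auto
 also have "... <= (of_nat n)^2 * (of_nat n * I)"
 unfolding I_def by (subst nn_cmult, measurable) (intro mlm pmax_L2_finite y, auto)
 also have "... < \<infinity>" using I_fin by (simp add: ennreal_mult_less_top sq_eq of_nat_less_top)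
 finally have G_fin: "G < \<infinity>" .
 have "G^2 <= (4 * (NN x|lborel. g x * ?m x))^2" by (rule power_mono[OF G1]) simp
 also have "... <= 16 * (G * I)"
 unfolding pow_mult G_def I_def by (simp add: Cauchy_Schwarz_nn_integral mlm)
 finally have "G^2 <= G * (16 * I)" by (simp only: mult_ac)
 hence "G <= 16 * I" using G_fin by (rule ennreal_le_of_power2_le_mult)
 hence "G * J <= I * (16 * J)" using mrm[of G "16 * I" J] by (simp add: mult_ac)
 with I2 have "I^2 <= I * (16 * J)" by (rule order_trans)
 thus ?thesis using I_fin unfolding I_def[symmetric] J_def[symmetric] by (rule ennreal_le_of_power2_le_mult)
qed

section \<open>Tangent lines and Jensen's inequality for powers\<close>

text \<open>The convex function \<open>h powr p\<close> lies above its tangent at \<open>c\<close>;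
  Young's inequality gives this without differentiation.\<close>

lemma powr_tangent_le:
 fixes h c p :: real assumes "0 <= h" "0 < c" "1 < p"
 shows "p * (h * c powr (p - 1)) <= h powr p + (p - 1) * c powr p"
proof -
 define q where "q = p / (p - 1)"
 have q: "1 < q" "1 / p + 1 / q = 1" using assms by (auto simp: q_def field_simps)
 have "h * c powr (p - 1) <= h powr p / p + (c powr (p - 1)) powr q / q"
 using Youngs_inequality[of p q h "c powr (p - 1)"] q assms by auto
 also have "(c powr (p - 1)) powr q = c powr p"
 using assms by (simp add: powr_powr q_def)
 also have "h powr p / p + c powr p / q = (h powr p + (p - 1) * c powr p) / p"
 using assms by (simp add: q_def field_simps)
 finally show ?thesis using assms by (simp add: field_simps)
qed

text \<open>The Bochner integral on the left is \<open>0\<close> when \<open>k * h\<close> is not integrable, so integrability need not be assumed.\<close>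

lemma nn_integral_Jensen_powr:
 fixes k h :: "'a => real"
 assumes [measurable]: "k : bm M" "h : bm M"
 and k: "!!t. 0 <= k t" and h: "!!t. 0 <= h t" and k1: "(NN t|M. en (k t)) = 1" and p: "1 < p"
 shows "en ((LINT t|M. k t * h t) powr p) <= (NN t|M. en (k t) * en (h t powr p))"
proof (cases "(NN t|M. en (k t) * en (h t powr p)) = \<infinity> | (LINT t|M. k t * h t) = 0")
 case True thus ?thesis by auto
next
 case False
 define c where "c = (LINT t|M. k t * h t)"
 have "0 <= c" unfolding c_def using k h by simp
 with False have c: "0 < c" by (simp add: c_def)
 have int: "integrable M (%t. k t * h t)"
 using False by (auto intro: ccontr simp: not_integrable_integral_eq)
 have ik: "integrable M k" using k1 k by (intro integrableI_nonneg) auto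
 have k1': "(LINT t|M. k t) = 1" using k1 k by (simp add: integral_eq_nn_integral)
 have ip: "integrable M (%t. k t * h t powr p)"
 using False k by (intro integrableI_nonneg) (auto simp: en_mult top.not_eq_extremum)
 \<comment> \<open>The tangent inequality is taken at the mean \<open>c\<close> and integrated
   against the probability density \<open>k\<close>.\<close>
 have "p * c powr (p - 1) * c - (p - 1) * c powr p = (LINT t|M. p * c powr (p - 1) * (k t * h t) - (p - 1) * c powr p * k t)"
 using int ik by (simp add: k1' flip: c_def)
 also have "... <= (LINT t|M. k t * h t powr p)"
 proof (rule integral_mono)
 fix t
 have "k t * (p * (h t * c powr (p - 1))) <= k t * (h t powr p + (p - 1) * c powr p)"
 using powr_tangent_le[OF h c p] k by (intro mlm)
 thus "p * c powr (p - 1) * (k t * h t) - (p - 1) * c powr p * k t <= k t * h t powr p"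
 by (simp add: algebra_simps)
 qed (use int ik ip in auto)
 finally have "p * (c * c powr (p - 1)) - (p - 1) * c powr p <= (LINT t|M. k t * h t powr p)"
 by (simp add: mult_ac)
 hence "c powr p <= (LINT t|M. k t * h t powr p)"
 using powr_mult_base[of c "p - 1"] c by (simp add: algebra_simps)
 hence "en (c powr p) <= en (LINT t|M. k t * h t powr p)" by (rule en_leI)
 also have "... = (NN t|M. en (k t * h t powr p))"
 using ip k by (intro nn_integral_eq_integral[symmetric]) auto
 finally show ?thesis using k by (simp add: c_def en_mult)
qed

section \<open>The Cauchy transform of a nonnegative function\<close>

text \<open>One \<open>R\<close> serves both as bound and as radius of the support. Nonnegativity is
  part of the class because it makes the real part of the Cauchy transform nonnegative.\<close>

definition bcs :: "(real => real) => bool" where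
 "bcs f <-> f : bm borel & (EX R>0. ALL t. 0 <= f t & f t <= R * indicator {-R..R} t)"

lemma bcsE:
 assumes "bcs f"
 obtains R where "0 < R" "!!t. f t <= R * indicator {-R..R} t"
 using assms unfolding bcs_def by blast

lemma bcs_measurable [measurable_dest]: "bcs f ==> f : bm borel"
 and bcs_nonneg: "bcs f ==> 0 <= f t"
 unfolding bcs_def by blast+

lemma integrable_bcs: assumes f: "bcs f" shows "integrable lborel f"
proof -
 obtain R where R: "0 < R" "!!t. f t <= R * indicator {-R..R} t" using bcsE[OF f] by blast
 have "integrable lborel (%t::real. R * indicator {-R..R} t)"
 using R(1) by (intro int_mult integrable_real_indicator) (auto simp: emeasure_lborel_Icc_eq)
 thus ?thesis
 by (rule int_bd) (use f R bcs_nonneg[OF f] in \<open>auto dest: bcs_measurable intro!: AE_I2\<close>)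
qed

text \<open>Normalised so that at height \<open>y\<close> the real part is the Poisson average of
  \<open>f\<close> and the imaginary part the conjugate Poisson average, which stands in for the
  Hilbert transform.\<close>

definition cauchy_tr :: "(real => real) => complex => complex" where
 "cauchy_tr f z = (LINT t|lborel. f t *\<^sub>R (\<i> / (of_real pi * (z - of_real t))))"

lemma norm_ge_Im: "Im z <= norm (z - complex_of_real t)"
 using abs_Im_le_cmod[of "z - complex_of_real t"] by simp

lemma integrable_cauchy_tr:
 assumes f: "bcs f" and z: "0 < Im z"
 shows "integrable lborel (%t. f t *\<^sub>R (\<i> / (of_real pi * (z - of_real t))))"
proof (rule int_bd)
 let ?A = "1 / (pi * Im z)"
 let ?B = "%t. norm (f t *\<^sub>R (\<i> / (of_real pi * (z - of_real t))))"
 show "integrable lborel (%t. f t * ?A)" using integrable_bcs[OF f] by simp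
 show "AE t in lborel. ?B t <= norm (f t * ?A)"
 proof (rule AE_I2)
 fix t
 have "1 / (pi * norm (z - of_real t)) <= ?A"
 using norm_ge_Im[of z t] z by (intro divide_left_mono mlm) (auto intro!: mult_pos_pos)
 hence "abs (f t) * (1 / (pi * norm (z - of_real t))) <= abs (f t) * ?A"
 by (rule mlm) simp
 thus "?B t <= norm (f t * ?A)"
 using z by (simp add: norm_mult norm_divide abs_mult)
 qed
qed (use bcs_measurable[OF f] in measurable)

lemma cauchy_kernel_Re_Im:
 assumes "0 < y"
 shows "\<i> / (of_real pi * (Complex x y - of_real t)) = Complex (poisson y (x - t)) ((x - t) / (pi * ((x - t)^2 + y^2)))"
proof -
 let ?A = "Complex y (x - t)"
 define N where "N = (x - t)^2 + y^2"
 have N: "N > 0" using assms by (simp add: add_nonneg_pos N_def)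
 define w where "w = Complex x y - of_real t"
 have w: "w ~= 0" using assms by (auto simp: complex_eq_iff w_def)
 have "?A * w = \<i> * of_real N"
 by (simp add: w_def complex_eq_iff N_def sq_eq algebra_simps)
 hence "\<i> = ?A * w / of_real N" using N by (simp add: field_simps)
 hence "\<i> / (of_real pi * w) = ?A * w / of_real N / (of_real pi * w)" by simp
 also have "... = ?A / of_real (pi * N)" using w by simp
 also have "... = Complex (y / (pi * N)) ((x - t) / (pi * N))"
 by (simp add: complex_eq_iff Re_divide_of_real Im_divide_of_real del: of_real_mult)
 finally show ?thesis by (simp add: N_def w_def poisson_def)
qed

lemma Re_cauchy_tr:
 assumes f: "bcs f" and y: "0 < y"
 shows "Re (cauchy_tr f (Complex x y)) = (LINT t|lborel. poisson y (x - t) * f t)"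
 and "integrable lborel (%t. poisson y (x - t) * f t)"
 using integral_Re[OF integrable_cauchy_tr[OF f, of "Complex x y"]] integrable_Re[OF integrable_cauchy_tr[OF f, of "Complex x y"]] y
 unfolding cauchy_tr_def by (simp_all add: cauchy_kernel_Re_Im mult.commute)

lemma Im_cauchy_tr:
 assumes f: "bcs f" and y: "0 < y"
 shows "Im (cauchy_tr f (Complex x y)) = (LINT t|lborel. (x - t) / (pi * ((x - t)^2 + y^2)) * f t)"
 and "integrable lborel (%t. (x - t) / (pi * ((x - t)^2 + y^2)) * f t)"
 using integral_Im[OF integrable_cauchy_tr[OF f, of "Complex x y"]] integrable_Im[OF integrable_cauchy_tr[OF f, of "Complex x y"]] y
 unfolding cauchy_tr_def by (simp_all add: cauchy_kernel_Re_Im mult.commute)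

text \<open>Decay of order \<open>1 / |z|\<close> above a fixed height: it makes \<open>p\<close>-th
  powers with \<open>p > 1\<close> integrable on lines and negligible on large arcs.\<close>

lemma cauchy_tr_bound:
 assumes f: "bcs f" and \<eta>: "0 < \<eta>"
 shows "EX C>=0. ALL z. \<eta> <= Im z --> norm (cauchy_tr f z) <= C / (1 + norm z)"
proof -
 let ?A = "%t R z. norm (f t *\<^sub>R (\<i> / (of_real pi * (z - of_real t))))"
 let ?B = "(LINT t|lborel. f t)"
 obtain R where R: "0 < R" "!!t. f t <= R * indicator {-R..R} t" using bcsE[OF f] by blast
 \<comment> \<open>For \<open>|t| <= R\<close> and \<open>d = |z - t| >= \<eta>\<close>, the
   quantity \<open>1 + |z|\<close> is at most \<open>d + (1 + R)\<close>, and
   \<open>1 + R <= (1 + R) / \<eta> * d\<close>.\<close>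
 define K where "K = ((1 + R) / \<eta> + 1) / pi"
 have K: "0 < K" using \<eta> R by (simp add: K_def add_pos_pos)
 have "norm (cauchy_tr f z) <= (?B * K) / (1 + norm z)" if z: "\<eta> <= Im z" for z
 proof -
 have "norm (cauchy_tr f z) <= (LINT t|lborel. ?A t R z)"
 unfolding cauchy_tr_def by (rule integral_norm_bound)
 also have "... <= (LINT t|lborel. f t * (K / (1 + norm z)))"
 proof (rule integral_mono)
 show "integrable lborel (%t. ?A t R z)"
 using integrable_cauchy_tr[OF f, of z] z \<eta> by (intro integrable_norm) simp
 show "integrable lborel (%t. f t * (K / (1 + norm z)))" using integrable_bcs[OF f] by simp
 fix t
 show "?A t R z <= f t * (K / (1 + norm z))"
 proof (cases "f t = 0")
 case False
 with R(2)[of t] bcs_nonneg[OF f, of t] have t: "abs t <= R"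
 by (cases "t : {-R..R}") auto
 let ?d = "norm (z - of_real t)"
 have d: "\<eta> <= ?d" using norm_ge_Im[of z t] z by linarith
 have "norm z <= ?d + R" using norm_triangle_ineq[of "z - of_real t" "of_real t"] t by simp
 moreover have "(1 + R) <= (1 + R) / \<eta> * ?d"
 using mlm[OF d, of "(1 + R) / \<eta>"] \<eta> R(1) by simp
 moreover have "K * (pi * ?d) = (1 + R) / \<eta> * ?d + ?d"
 proof -
 have "K * pi = (1 + R) / \<eta> + 1" by (simp add: K_def)
 thus ?thesis by (metis (no_types, opaque_lifting) distrib_right mult.assoc mult_1)
 qed
 ultimately have "1 + norm z <= K * (pi * ?d)" by linarith
 moreover have "0 < ?d" "0 < 1 + norm z" using d \<eta> by (auto simp: add_pos_nonneg)
 ultimately have "1 / (pi * ?d) <= K / (1 + norm z)"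
 by (simp add: field_simps)
 thus ?thesis
 using bcs_nonneg[OF f, of t] mlm[of "1 / (pi * ?d)" "K / (1 + norm z)" "f t"]
 by (simp add: norm_mult norm_divide)
 qed simp
 qed
 also have "... = (?B * K) / (1 + norm z)" using integrable_bcs[OF f] by simp
 finally show ?thesis .
 qed
 thus ?thesis
 using K bcs_nonneg[OF f] by (intro exI[of _ "?B * K"]) auto
qed

text \<open>Differentiation under the integral by hand: for \<open>|w - z| < Im z / 2\<close> the
  difference quotient minus the candidate derivative is at most a constant times
  \<open>|w - z|\<close>.\<close>

lemma holomorphic_cauchy_tr:
 assumes f: "bcs f" shows "cauchy_tr f holomorphic_on {z. 0 < Im z}"
proof -
 let ?A = "%z t. z - of_real t"
 let ?B = "%t w z. (f t *\<^sub>R (\<i> / (of_real pi * (?A w t))) - f t *\<^sub>R (\<i> / (of_real pi * (?A z t)))) / (w - z) - f t *\<^sub>R (- \<i> / (of_real pi * (?A z t)^2))"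
 let ?C = "%t z. f t *\<^sub>R (- \<i> / (of_real pi * (?A z t)^2))"
 let ?D = "%w z D. (cauchy_tr f w - cauchy_tr f z) / (w - z) - D"
 let ?E = "%t z w. f t * (2 / (pi * (Im z) ^ 3) * norm (w - z))"
 let ?F = "%z. 1 / (pi * (Im z)^2)"
 let ?G = "%z t w. (norm (?A z t))^2 * norm (?A w t)"
 have "cauchy_tr f field_differentiable at z" if z: "0 < Im z" for z
 proof -
 define D where "D = (LINT t|lborel. ?C t z)"
 have bdz: "Im z <= norm (?A z t)" for t by (rule norm_ge_Im)
 have ne: "?A z t ~= 0" for t using z bdz[of t] by auto
 have intD: "integrable lborel (%t. ?C t z)"
 proof (rule int_bd)
 show "integrable lborel (%t. f t * (?F z))" using integrable_bcs[OF f] by simp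
 show "AE t in lborel. norm (?C t z) <= norm (f t * (?F z))"
 proof (rule AE_I2)
 fix t
 have "1 / (pi * (norm (?A z t))^2) <= ?F z"
 using bdz[of t] z by (intro divide_left_mono mlm power_mono) (auto intro!: mult_pos_pos)
 hence "abs (f t) * (1 / (pi * (norm (?A z t))^2)) <= abs (f t) * (?F z)"
 by (rule mlm) simp
 thus "norm (?C t z) <= norm (f t * (?F z))"
 by (simp add: norm_mult norm_divide norm_power abs_mult)
 qed
 qed (use bcs_measurable[OF f] in measurable)
 define C where "C = (LINT t|lborel. f t) * (2 / (pi * (Im z) ^ 3))"
 have est: "norm (?D w z D) <= C * norm (w - z)"
 if w: "w ~= z" "norm (w - z) < Im z / 2" for w
 proof -
 have Imw: "Im z / 2 <= Im w" using abs_Im_le_cmod[of "w - z"] w by simp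
 hence w0: "0 < Im w" using z by simp
 have new: "?A w t ~= 0" for t using w0 norm_ge_Im[of w t] by auto
 have alg: "(1 / (w - a) - 1 / (z - a)) / (w - z) + 1 / (z - a)^2 = (w - z) / ((z - a)^2 * (w - a))"
 if "w - a ~= 0" "z - a ~= 0" for a
 proof -
 define u v where "u = w - a" and "v = z - a"
 have uv: "u ~= 0" "v ~= 0" "u - v ~= 0" and wz: "w - z = u - v" using that w(1) by (auto simp: u_def v_def)
 have "1 / u - 1 / v = (u - v) * (- 1 / (u * v))" using uv by (simp add: field_simps)
 hence "(1 / u - 1 / v) / (u - v) = - 1 / (u * v)" using uv by simp
 moreover have "- 1 / (u * v) + 1 / v^2 = (u - v) / (v^2 * u)"
 using uv(1,2) by (simp add: field_simps sq_eq)
 ultimately show ?thesis unfolding wz u_def[symmetric] v_def[symmetric] by simp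
 qed
 let ?k = "%t. f t *\<^sub>R (\<i> / of_real pi * ((w - z) / ((?A z t)^2 * (?A w t))))"
 have eqk: "?B t w z = ?k t" for t
 proof -
 have "?B t w z =
 f t *\<^sub>R (\<i> / of_real pi * ((1 / (?A w t) - 1 / (?A z t)) / (w - z) + 1 / (?A z t)^2))"
 proof -
 have "(c * A - c * B) / d + c * E = c * ((A - B) / d + E)" for c A B d E :: complex
 by (simp add: algebra_simps diff_divide_distrib)
 from this[of "of_real (f t) * (\<i> / of_real pi)" "1 / (?A w t)" "1 / (?A z t)" "w - z" "1 / (?A z t)^2"]
 show ?thesis by (simp add: scaleR_of_real)
 qed
 thus ?thesis unfolding alg[OF new ne] .
 qed
 have i1: "integrable lborel (%t. (f t *\<^sub>R (\<i> / (of_real pi * (?A w t))) - f t *\<^sub>R (\<i> / (of_real pi * (?A z t)))) / (w - z))"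
 using integrable_cauchy_tr[OF f w0] integrable_cauchy_tr[OF f z] by simp
 have "?D w z D = (LINT t|lborel. ?k t)"
 unfolding eqk[symmetric] cauchy_tr_def D_def
 using integrable_cauchy_tr[OF f w0] integrable_cauchy_tr[OF f z] intD i1 by simp
 also have "norm ... <= (LINT t|lborel. norm (?k t))" by (rule integral_norm_bound)
 also have "... <= (LINT t|lborel. ?E t z w)"
 proof (rule integral_mono)
 show "integrable lborel (%t. norm (?k t))"
 unfolding eqk[symmetric] using i1 intD by simp
 show "integrable lborel (%t. ?E t z w)" using integrable_bcs[OF f] by simp
 fix t
 have "(Im z)^2 * (Im z / 2) <= ?G z t w"
 using bdz[of t] norm_ge_Im[of w t] Imw z by (intro mult_mono power_mono) auto
 hence "1 / (pi * (?G z t w)) <= 1 / (pi * ((Im z)^2 * (Im z / 2)))"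
 using z ne[of t] new[of t] by (intro divide_left_mono mlm) (auto intro!: mult_pos_pos)
 also have "... = 2 / (pi * (Im z) ^ 3)" by (simp add: sq_eq power3_eq_cube)
 finally have "f t * (1 / (pi * (?G z t w)) * norm (w - z)) <= ?E t z w"
 using bcs_nonneg[OF f] by (intro mlm mrm) auto
 thus "norm (?k t) <= ?E t z w"
 using bcs_nonneg[OF f, of t] by (simp add: norm_mult norm_divide norm_power)
 qed
 also have "... = C * norm (w - z)" using integrable_bcs[OF f] by (simp add: C_def)
 finally show ?thesis .
 qed
 have "((%w. ?D w z D) \<longlongrightarrow> 0) (at z)"
 proof (rule Lim_null_comparison)
 show "\<forall>\<^sub>F w in at z. norm (?D w z D) <= C * norm (w - z)"
 unfolding eventually_at using est z by (intro exI[of _ "Im z / 2"]) (auto simp: dist_norm)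
 have "((%w. C * norm (w - z)) \<longlongrightarrow> C * norm (z - z)) (at z)" by (intro tendsto_intros)
 thus "((%w. C * norm (w - z)) \<longlongrightarrow> 0) (at z)" by simp
 qed
 hence "(cauchy_tr f has_field_derivative D) (at z)"
 by (simp add: has_field_derivative_iff Lim_null[symmetric])
 thus ?thesis unfolding field_differentiable_def by blast
 qed
 thus ?thesis by (auto simp: holomorphic_on_def intro: field_differentiable_at_within)
qed

section \<open>The Cauchy transform on Lp for exponents up to 2\<close>

text \<open>\<open>s * ln s >= - 1\<close>, so \<open>s powr s\<close> stays away from 0 as
  \<open>s\<close> tends to 0. With \<open>s = p - 1\<close> this keeps \<open>1 / (p - 1)\<close>
  to the first power in \<open>sector_inequality\<close>.\<close>

lemma powr_self_ge:
 fixes s :: real assumes "0 < s" "s <= 1" shows "1 / 24 <= (s / 8) powr s"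
proof -
 have "1 / 3 <= exp (- 1 :: real)" using exp_le by (simp add: exp_minus field_simps)
 also have "exp (- 1) <= s powr s"
 proof -
 have "ln (1 / s) <= 1 / s - 1" using assms by (intro ln_le_minus_one) simp
 hence "- ln s <= 1 / s - 1" using assms by (simp add: ln_div)
 hence "s * (- ln s) <= s * (1 / s - 1)" using assms by (intro mlm) auto
 hence "- 1 <= s * ln s" using assms by (simp add: algebra_simps)
 thus ?thesis using assms by (simp add: powr_def)
 qed
 finally have a: "1 / 3 <= s powr s" .
 have b: "1 / 8 <= (1 / 8) powr s"
 using powr_mono'[of s 1 "1/8 :: real"] assms by simp
 have "(s / 8) powr s = s powr s * (1 / 8) powr s"
 using powr_mult[of s "1/8" s] assms by simp
 with mult_mono[OF a b] show ?thesis by simp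
qed

lemma sin_ge_half: fixes x :: real assumes "0 <= x" "x <= pi / 2" shows "x / 2 <= sin x"
proof (cases "x <= pi / 3")
 case True
 have "EX z. 0 < z & z < x & sin x - sin 0 = (x - 0) * cos z" if "0 < x"
 by (rule MVT2[OF that]) (auto intro!: derivative_eq_intros)
 moreover have "1 / 2 <= cos z" if "0 < z" "z < x" for z
 using cos_monotone_0_pi_le[of z "pi/3"] that True by (simp add: cos_60)
 ultimately show ?thesis using assms
 by (cases "x = 0") (auto intro: order_trans[OF _ mlm])
next
 case False
 have "sin (pi / 3) <= sin x" using False assms by (intro sin_monotone_2pi_le) auto
 moreover have "sin (pi / 3) = sqrt 3 / 2" by (rule sin_60)
 moreover have "17 / 10 <= sqrt 3" by (rule real_le_rsqrt) (simp add: sq_eq)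
 moreover have "x <= 17 / 10" using assms pi_less_4 pi_approx by simp
 ultimately show ?thesis by linarith
qed

lemma cos_diff_le: fixes a b :: real assumes "0 <= b" shows "cos (a - b) <= cos a + b"
proof -
 have "cos (a - b) - cos a = 2 * (sin (a - b / 2) * sin (b / 2))"
 using cos_diff_cos[of "a - b" a] by (simp add: field_simps)
 also have "... <= 2 * (1 * (b / 2))"
 proof -
 have "abs (sin (a - b / 2) * sin (b / 2)) <= 1 * (b / 2)"
 unfolding abs_mult using abs_sin_le_one[of "a - b/2"] abs_sin_x_le_abs_x[of "b / 2"] assms
 by (intro mult_mono) auto
 thus ?thesis by linarith
 qed
 finally show ?thesis by simp
qed

text \<open>For \<open>w = exp (\<i> \<theta>)\<close> and \<open>\<phi> = \<pi>/2 - \<bar>\<theta>\<bar>\<close>, the term \<open>cos (p \<theta>)\<close> is at most \<open>- sin ((p - 1) \<pi> / 2) + p \<phi>\<close>,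
  hence negative near the imaginary axis. This is what makes the constant \<open>O(1/(p - 1))\<close>.\<close>

lemma sector_inequality:
 fixes w :: complex and p :: real
 assumes p: "1 < p" "p <= 2" and w: "0 < Re w"
 shows "norm w powr p <= 800 / (p - 1) * Re w powr p - 4 / (p - 1) * Re (w powr of_real p)"
proof -
 let ?A = "%s \<phi>. 800 / s * sin \<phi> powr p"
 define s where "s = p - 1"
 have s: "0 < s" "s <= 1" using p by (auto simp: s_def)
 have w0: "w ~= 0" using w by auto
 define \<theta> where "\<theta> = abs (Arg w)"
 define \<phi> where "\<phi> = pi / 2 - \<theta>"
 have th: "\<theta> < pi / 2" "0 <= \<theta>" using Arg_Re_pos[of w] w by (auto simp: \<theta>_def)
 have ph: "0 < \<phi>" "\<phi> <= pi / 2" using th by (auto simp: \<phi>_def)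
 have Rew: "Re w = norm w * sin \<phi>"
 proof -
 have "Re w = norm w * cos (Arg w)" using arg_cong[OF rcis_cmod_Arg[of w], of Re] by simp
 also have "cos (Arg w) = cos \<theta>" by (simp add: \<theta>_def)
 also have "cos \<theta> = sin \<phi>" by (simp add: \<phi>_def sin_diff)
 finally show ?thesis .
 qed
 have Rep: "Re (w powr of_real p) = norm w powr p * cos (p * \<theta>)"
 proof -
 have "Re (w powr of_real p) = exp (p * ln (norm w)) * cos (p * Arg w)"
 using w0 by (simp add: powr_def Re_exp Arg_eq_Im_Ln)
 moreover have "cos (p * Arg w) = cos (abs (p * Arg w))" by simp
 moreover have "abs (p * Arg w) = p * \<theta>" using p by (simp add: \<theta>_def abs_mult)
 ultimately show ?thesis using w0 by (simp add: powr_def)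
 qed
 have c: "cos (p * \<theta>) <= - (s / 2) + p * \<phi>"
 proof -
 have "cos (p * \<theta>) = cos (p * (pi / 2) - p * \<phi>)" by (simp add: \<phi>_def algebra_simps)
 also have "... <= cos (p * (pi / 2)) + p * \<phi>" using p ph by (intro cos_diff_le) simp
 also have "cos (p * (pi / 2)) = - sin (s * (pi / 2))"
 proof -
 have "p * (pi / 2) = s * (pi / 2) + pi / 2" by (simp only: s_def left_diff_distrib mult_1 diff_add_cancel)
 thus ?thesis by (simp only: cos_add cos_pi_half sin_pi_half mult_zero_right mult_1_right diff_0)
 qed
 also have "- sin (s * (pi / 2)) <= - (s / 2)"
 proof -
 have "s * (pi / 2) / 2 <= sin (s * (pi / 2))" using s by (intro sin_ge_half) auto
 moreover have "s / 2 <= s * (pi / 2) / 2" using s pi_ge_two by simp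
 ultimately show ?thesis by linarith
 qed
 finally show ?thesis by linarith
 qed
 have main: "1 + 4 / s * cos (p * \<theta>) <= ?A s \<phi>"
 proof -
 have "4 / s * cos (p * \<theta>) <= 4 / s * (- (s / 2) + p * \<phi>)" using c s by (intro mlm) auto
 also have "... = - 2 + 4 * p * \<phi> / s" using s by (simp add: field_simps)
 finally have le: "1 + 4 / s * cos (p * \<theta>) <= 4 * p * \<phi> / s - 1" by simp
 have nn: "0 <= ?A s \<phi>" using s by simp
 show ?thesis
 \<comment> \<open>Near the imaginary axis the left side is at most 0. Elsewhere
   \<open>\<phi> powr s >= 1 / 24\<close> and \<open>(1 / 2) powr p >= 1 / 4\<close> give
   \<open>sin \<phi> powr p >= \<phi> / 96\<close>; the constant 800 covers
   \<open>8 * 96\<close>.\<close>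
 proof (cases "\<phi> <= s / 8")
 case True
 have "4 * p * \<phi> <= 4 * 2 * \<phi>" using p ph by (intro mrm) auto
 also have "... <= s" using True by simp
 finally have "4 * p * \<phi> / s <= 1" using s by simp
 thus ?thesis using le nn by linarith
 next
 case False
 have "(s / 8) powr s <= \<phi> powr s" using False s by (intro powr_mono2) auto
 with powr_self_ge[OF s] have p1: "1 / 24 <= \<phi> powr s" by linarith
 have "(1/2) powr 2 <= (1/2 :: real) powr p" using p by (intro powr_mono') auto
 hence p2: "1 / 4 <= (1/2 :: real) powr p" by (simp add: sq_eq)
 have "\<phi> / 96 <= (1/2) powr p * (\<phi> * \<phi> powr s)"
 using mult_mono[OF p2 mlm[OF p1, of \<phi>]] ph by simp
 also have "\<phi> * \<phi> powr s = \<phi> powr p" using powr_mult_base[of \<phi> s] ph by (simp add: s_def)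
 also have "(1/2) powr p * \<phi> powr p = (\<phi> / 2) powr p" using ph powr_mult[of "1/2" \<phi> p] by simp
 also have "... <= sin \<phi> powr p" using sin_ge_half[of \<phi>] ph p by (intro powr_mono2) auto
 finally have "\<phi> / 96 <= sin \<phi> powr p" .
 hence "800 / s * (\<phi> / 96) <= ?A s \<phi>" using s by (intro mlm) auto
 moreover have "4 * p * \<phi> / s <= 4 * 2 * \<phi> / s" using p ph s by (intro divide_right_mono mrm) auto
 moreover have "4 * 2 * \<phi> / s <= 800 / s * (\<phi> / 96)" using ph s by (simp add: field_simps)
 ultimately show ?thesis using le by linarith
 qed
 qed
 have "norm w powr p * (1 + 4 / s * cos (p * \<theta>)) <= norm w powr p * (?A s \<phi>)"
 by (intro mlm main) simp
 also have "norm w powr p * (?A s \<phi>) = 800 / s * Re w powr p"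
 using ph by (subst Rew, subst powr_mult) (auto intro!: sin_ge_zero)
 finally show ?thesis unfolding Rep s_def[symmetric] by (simp add: algebra_simps)
qed


lemma continuous_on_cauchy_tr_line:
 assumes f: "bcs f" and y: "0 < y"
 shows "continuous_on UNIV (%x. cauchy_tr f (Complex x y))"
proof -
 have "continuous_on {z. 0 < Im z} (cauchy_tr f)"
 using holomorphic_cauchy_tr[OF f] by (rule holomorphic_on_imp_continuous_on)
 hence "continuous_on UNIV (%x. cauchy_tr f (of_real x + \<i> * of_real y))"
 by (rule continuous_on_compose2) (use y in \<open>auto intro!: continuous_intros\<close>)
 thus ?thesis by (simp add: Complex_eq)
qed

lemma meas_cauchy_line [measurable (raw)]:
 assumes f: "bcs f" and y: "0 < y" and [measurable]: "g : bm M"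
 shows "(%x. cauchy_tr f (Complex (g x) y)) : bm M"
 using measurable_compose[OF `g : bm M` borel_measurable_continuous_onI[OF continuous_on_cauchy_tr_line[OF f y]]] .

lemma Re_cauchy_tr_Jensen:
 assumes f: "bcs f" and y: "0 < y" and p: "1 < p"
 shows "en (Re (cauchy_tr f (Complex x y)) powr p) <= pconv y (%t. en (f t powr p)) x"
proof -
 have [measurable]: "f : bm borel" using f by (rule bcs_measurable)
 have "(NN t|lborel. en (poisson y (x - t))) = 1"
 using nn_integral_lborel_minus[of "%t. en (poisson y t)" x] nn_integral_poisson[OF y] by simp
 with nn_integral_Jensen_powr[of "%t. poisson y (x - t)" lborel f p] y p bcs_nonneg[OF f]
 show ?thesis by (simp add: Re_cauchy_tr[OF f y] pconv_def)
qed

text \<open>Strict positivity keeps the values off the branch cut, so that fractional powers of the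
  Cauchy transform are holomorphic.\<close>

lemma Re_cauchy_tr_pos:
 assumes f: "bcs f" and nz: "\<not> (AE t in lborel. f t = 0)" and z: "0 < Im z"
 shows "0 < Re (cauchy_tr f z)"
proof -
 let ?h = "%t. poisson (Im z) (Re z - t) * f t"
 have pp: "0 < poisson (Im z) u" for u using z by (simp add: poisson_def add_nonneg_pos)
 have eq: "Re (cauchy_tr f z) = (LINT t|lborel. ?h t)" and int: "integrable lborel ?h"
 using Re_cauchy_tr[OF f z, of "Re z"] by simp_all
 have nn: "0 <= ?h t" for t using pp[of "Re z - t"] bcs_nonneg[OF f, of t] by simp
 have "(LINT t|lborel. ?h t) ~= 0"
 proof
 assume "(LINT t|lborel. ?h t) = 0"
 hence "AE t in lborel. ?h t = 0" using integral_nonneg_eq_0_iff_AE[OF int] nn by simp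
 hence "AE t in lborel. f t = 0" by eventually_elim (use pp in \<open>auto simp: less_le\<close>)
 with nz show False by simp
 qed
 moreover have "0 <= (LINT t|lborel. ?h t)" using nn by (intro integral_nonneg_AE) simp
 ultimately show ?thesis unfolding eq by linarith
qed

text \<open>\<open>sector_inequality\<close> is integrated along the line at height
  \<open>y\<close>. The integral of the complex power vanishes by Cauchy's theorem, as the power
  decays like \<open>|z| powr (- p)\<close>, and the power of the real part is controlled by
  Jensen's inequality for the Poisson average.\<close>

lemma cauchy_tr_Lp_small:
 assumes f: "bcs f" and y: "0 < y" and p: "1 < p" "p <= 2"
 shows "(NN x|lborel. np p (cauchy_tr f (Complex x y))) <= en (800 / (p - 1)) * (NN t|lborel. en (f t powr p))"
proof (cases "AE t in lborel. f t = 0")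
 case True
 have "cauchy_tr f z = 0" for z
 unfolding cauchy_tr_def by (rule integral_eq_zero_AE) (use True in auto)
 thus ?thesis by simp
next
 case False
 have [measurable]: "f : bm borel" using f by (rule bcs_measurable)
 note [measurable] = meas_cauchy_line[OF f y]
 \<comment> \<open>Shifting by \<open>y\<close> turns the line at height \<open>y\<close> into the
   real axis and leaves a margin \<open>y\<close> below it.\<close>
 define F where "F = (%z. cauchy_tr f (z + \<i> * of_real y))"
 have Fx: "F (of_real x) = cauchy_tr f (Complex x y)" for x by (simp add: F_def Complex_eq)
 have pos: "0 < Re (F z)" if "- y < Im z" for z
 unfolding F_def by (rule Re_cauchy_tr_pos[OF f False]) (use that in simp)
 have Fh: "F holomorphic_on {z. - y < Im z}"
 proof -
 have "(cauchy_tr f o (%z. z + \<i> * of_real y)) holomorphic_on {z. - y < Im z}"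
 by (rule holomorphic_on_compose_gen[OF _ holomorphic_cauchy_tr[OF f]]) (auto intro!: holomorphic_intros)
 thus ?thesis by (simp add: F_def o_def)
 qed
 define q where "q = (%z. F z powr of_real p)"
 have qh: "q holomorphic_on {z. - y < Im z}"
 unfolding q_def using Fh pos
 by (intro holomorphic_intros) (force simp: complex_nonpos_Reals_iff)+
 obtain C where C: "0 <= C" "!!z. y <= Im z ==> norm (cauchy_tr f z) <= C / (1 + norm z)"
 using cauchy_tr_bound[OF f y] by blast
 have nq: "norm (q z) = norm (F z) powr p" for z by (simp add: q_def norm_powr_real_powr')
 have bF: "norm (F z) powr p <= C powr p * (1 + norm z) powr (- p)" if "0 <= Im z" for z
 proof -
 have "norm z <= norm (z + \<i> * of_real y)"
 using that y unfolding cmod_def by (intro real_sqrt_le_mono add_left_mono power_mono) auto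
 hence "norm (F z) <= C / (1 + norm z)"
 unfolding F_def using that C(1) by (intro order_trans[OF C(2)] divide_left_mono) (auto intro!: mult_pos_pos add_pos_nonneg)
 hence "norm (F z) powr p <= (C / (1 + norm z)) powr p" using p by (intro powr_mono2) auto
 also have "... = C powr p * (1 + norm z) powr (- p)"
 using C(1) by (subst powr_divide) (auto simp: powr_minus_divide add_nonneg_nonneg)
 finally show ?thesis .
 qed
 have dom: "integrable lborel (%x::real. C powr p * (1 + abs x) powr (- p))"
 using integrable_one_plus_abs_powr[OF p(1)] by simp
 have bFx: "norm (cauchy_tr f (Complex x y)) powr p <= C powr p * (1 + abs x) powr (- p)" for x
 using bF[of "of_real x"] by (simp add: Fx)
 have intF: "integrable lborel (%x. norm (cauchy_tr f (Complex x y)) powr p)"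
 by (rule int_bd[OF dom]) (use bFx C(1) in auto)
 have intq: "integrable lborel (%x. q (of_real x))"
 by (rule int_bd[OF dom]) (use bFx C(1) in \<open>auto simp: nq Fx q_def norm_powr_real_powr'\<close>)
 have "(LINT x|lborel. q (of_real x)) = 0"
 proof (rule half_plane_Cauchy[OF y qh intq, of "p - 1" 1 "C powr p"])
 fix z assume z: "0 <= Im z" "1 <= norm z"
 have "(1 + norm z) powr (- p) <= norm z powr (- p)" using z p by (intro powr_mono2') auto
 hence "C powr p * (1 + norm z) powr (- p) <= C powr p * norm z powr (- p)" by (intro mlm) auto
 thus "norm (q z) <= C powr p * norm z powr (- 1 - (p - 1))"
 using bF[OF z(1)] by (simp add: nq)
 qed (use p in auto)
 hence q0: "(LINT x|lborel. Re (q (of_real x))) = 0" using integral_Re[OF intq] by simp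
 have Rle: "Re (cauchy_tr f (Complex x y)) powr p <= norm (cauchy_tr f (Complex x y)) powr p" for x
 using complex_Re_le_cmod[of "cauchy_tr f (Complex x y)"] pos[of "of_real x"] y p by (intro powr_mono2) (auto simp: Fx)
 have intR: "integrable lborel (%x. Re (cauchy_tr f (Complex x y)) powr p)"
 by (rule int_bd[OF intF]) (use Rle in auto)
 have "(NN x|lborel. np p (cauchy_tr f (Complex x y))) = en (LINT x|lborel. norm (cauchy_tr f (Complex x y)) powr p)"
 by (rule nn_integral_eq_integral[OF intF]) simp
 also have "... <= en (LINT x|lborel. 800 / (p - 1) * Re (cauchy_tr f (Complex x y)) powr p - 4 / (p - 1) * Re (q (of_real x)))"
 proof (intro en_leI integral_mono intF)
 show "integrable lborel (%x. 800 / (p - 1) * Re (cauchy_tr f (Complex x y)) powr p - 4 / (p - 1) * Re (q (of_real x)))"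
 using intR integrable_Re[OF intq] by simp
 fix x :: real
 show "norm (cauchy_tr f (Complex x y)) powr p <= 800 / (p - 1) * Re (cauchy_tr f (Complex x y)) powr p - 4 / (p - 1) * Re (q (of_real x))"
 using sector_inequality[OF p, of "cauchy_tr f (Complex x y)"] pos[of "of_real x"] y by (simp add: q_def Fx)
 qed
 also have "(LINT x|lborel. 800 / (p - 1) * Re (cauchy_tr f (Complex x y)) powr p - 4 / (p - 1) * Re (q (of_real x)))
 = 800 / (p - 1) * (LINT x|lborel. Re (cauchy_tr f (Complex x y)) powr p)"
 using intR integrable_Re[OF intq] q0 by simp
 also have "en ... = en (800 / (p - 1)) * en (LINT x|lborel. Re (cauchy_tr f (Complex x y)) powr p)"
 using p by (intro en_mult) auto
 also have "en (LINT x|lborel. Re (cauchy_tr f (Complex x y)) powr p) = (NN x|lborel. en (Re (cauchy_tr f (Complex x y)) powr p))"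
 by (rule nn_integral_eq_integral[OF intR, symmetric]) simp
 also have "... <= (NN x|lborel. pconv y (%t. en (f t powr p)) x)"
 by (intro nn_mono Re_cauchy_tr_Jensen f y p)
 also have "... = (NN t|lborel. en (f t powr p))"
 by (rule nn_integral_pconv) (use y in auto)
 finally show ?thesis by (simp add: mlm)
qed

text \<open>The growth of the norm of the Hilbert transform: comparable to \<open>p\<close> for
  large \<open>p\<close> and to \<open>1 / (p - 1)\<close> near 1.\<close>

definition line_const :: "real => real" where "line_const p = p + 1 / (p - 1)"

lemma line_const_ge: "1 < p ==> 1 <= line_const p" "1 < p ==> p <= line_const p" "1 < p ==> 1 / (p - 1) <= line_const p"
 by (auto simp: line_const_def intro: add_increasing2)

lemma powr_add_le:
 fixes a b p :: real assumes "0 <= a" "0 <= b" "0 <= p"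
 shows "(a + b) powr p <= 2 powr p * (a powr p + b powr p)"
proof -
 have "(a + b) powr p <= (2 * max a b) powr p" using assms by (intro powr_mono2) auto
 also have "... = 2 powr p * (max a b) powr p" by (simp add: powr_mult)
 also have "... <= 2 powr p * (a powr p + b powr p)"
 by (intro mlm) (auto simp: max_def)
 finally show ?thesis .
qed

section \<open>Exponents above 2 by duality, and the maximal Cauchy transform\<close>

lemma integrable_pair_mult:
 fixes f g :: "real => real"
 assumes f: "integrable lborel f" and g: "integrable lborel g"
 shows "integrable (lborel \<Otimes>\<^sub>M lborel) (%(x, t). f x * g t)"
proof (rule lborel_pair.Fubini_integrable)
 show "(%(x, t). f x * g t) : bm (lborel \<Otimes>\<^sub>M lborel)"
 using f g by measurable
qed (use f g in \<open>auto simp: abs_mult\<close>)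

text \<open>The conjugate Poisson kernel is odd, which produces the sign, and bounded by
  \<open>1 / (pi * y)\<close>, which justifies Fubini for integrable \<open>f\<close> and
  \<open>g\<close>.\<close>

lemma cauchy_Im_duality:
 assumes f: "bcs f" and g: "bcs g" and y: "0 < y"
 shows "(LINT x|lborel. Im (cauchy_tr f (Complex x y)) * g x) = - (LINT x|lborel. f x * Im (cauchy_tr g (Complex x y)))"
proof -
 let ?A = "%u. u^2 + y^2"
 have [measurable]: "f : bm borel" "g : bm borel"
 using f g by (auto dest: bcs_measurable)
 define Q where "Q u = u / (pi * (?A u))" for u :: real
 have [measurable]: "Q : bm borel" unfolding Q_def by measurable
 have Qb: "abs (Q u) <= 1 / (pi * y)" for u
 proof -
 have "2 * (abs u * y) <= ?A u" using sum_squares_bound[of "abs u" y] by simp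
 moreover have "0 <= abs u * y" using y by simp
 ultimately have "abs u * y <= ?A u" by linarith
 moreover have N: "0 < ?A u" using y by (simp add: add_nonneg_pos)
 ultimately have "abs u <= (?A u) / y" using y by (simp add: field_simps)
 hence "abs u / (pi * (?A u)) <= (?A u) / y / (pi * (?A u))"
 using N by (intro divide_right_mono) auto
 also have "... = 1 / (pi * y)" using N by simp
 finally show ?thesis using N by (simp add: Q_def abs_mult)
 qed
 have Qodd: "Q (x - t) = - Q (t - x)" for x t
 by (simp add: Q_def power2_commute minus_divide_left)
 have Imf: "Im (cauchy_tr f (Complex x y)) = (LINT t|lborel. Q (x - t) * f t)" for x
 using Im_cauchy_tr(1)[OF f y] by (simp add: Q_def)
 have Img: "Im (cauchy_tr g (Complex x y)) = (LINT t|lborel. Q (x - t) * g t)" for x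
 using Im_cauchy_tr(1)[OF g y] by (simp add: Q_def)
 have int: "integrable (lborel \<Otimes>\<^sub>M lborel) (%(x, t). Q (x - t) * f t * g x)"
 proof (rule int_bd)
 show "integrable (lborel \<Otimes>\<^sub>M lborel) (%(x, t). (1 / (pi * y) * g x) * f t)"
 using integrable_bcs[OF f] integrable_bcs[OF g] by (intro integrable_pair_mult) auto
 show "AE xt in lborel \<Otimes>\<^sub>M lborel. norm (case xt of (x, t) => Q (x - t) * f t * g x) <= norm (case xt of (x, t) => 1 / (pi * y) * g x * f t)"
 proof (rule AE_I2)
 fix xt :: "real \<times> real"
 obtain x t where xt: "xt = (x, t)" by (cases xt)
 have "abs (Q (x - t)) * (f t * g x) <= 1 / (pi * y) * (f t * g x)"
 by (intro mrm Qb mult_nonneg_nonneg bcs_nonneg f g)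
 thus "norm (case xt of (x, t) => Q (x - t) * f t * g x) <= norm (case xt of (x, t) => 1 / (pi * y) * g x * f t)"
 using y bcs_nonneg[OF f, of t] bcs_nonneg[OF g, of x] by (simp add: xt abs_mult mult_ac)
 qed
 qed measurable
 have "(LINT x|lborel. Im (cauchy_tr f (Complex x y)) * g x) = (LINT x|lborel. (LINT t|lborel. Q (x - t) * f t * g x))"
 unfolding Imf by simp
 also have "... = (LINT t|lborel. (LINT x|lborel. Q (x - t) * f t * g x))"
 using lborel_pair.Fubini_integral[OF int] by simp
 also have "... = (LINT t|lborel. - (f t * (LINT x|lborel. Q (t - x) * g x)))"
 by (intro int_cong refl) (subst Qodd, simp add: mult_ac flip: int_cmult)
 finally show ?thesis unfolding Img by simp
qed


lemma cauchy_tr_line_bounded: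
 assumes f: "bcs f" and y: "0 < y"
 shows "EX C. ALL x. norm (cauchy_tr f (Complex x y)) <= C"
proof -
 obtain C where C: "0 <= C" "!!z. y <= Im z ==> norm (cauchy_tr f z) <= C / (1 + norm z)"
 using cauchy_tr_bound[OF f y] by blast
 have "norm (cauchy_tr f (Complex x y)) <= C" for x
 proof -
 have "norm (cauchy_tr f (Complex x y)) <= C / (1 + norm (Complex x y))" by (rule C) simp
 also have "... <= C / 1" using C(1) by (intro divide_left_mono) (auto intro!: add_pos_nonneg)
 finally show ?thesis by simp
 qed
 thus ?thesis by blast
qed

text \<open>The extremal function of the duality argument; the indicator gives it bounded support,
  so that it is again an admissible input.\<close>

lemma bcs_powr_part:
 assumes f: "bcs f" and y: "0 < y" and p: "1 < p"
 shows "bcs (%x. max 0 (\<epsilon> * Im (cauchy_tr f (Complex x y))) powr (p - 1) * indicator {-r..r} x)"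
proof -
 let ?A = "%x. cauchy_tr f (Complex x y)"
 let ?B = "%x. max 0 (\<epsilon> * Im (?A x)) powr (p - 1) * indicator {-r..r} x"
 let ?C = "%C. abs \<epsilon> * C"
 note [measurable] = meas_cauchy_line[OF f y]
 obtain C where C: "!!x. norm (?A x) <= C" using cauchy_tr_line_bounded[OF f y] by blast
 have C0: "0 <= C" using order_trans[OF norm_ge_zero C] .
 define K where "K = (?C C) powr (p - 1)"
 have b: "max 0 (\<epsilon> * Im (?A x)) powr (p - 1) <= K" for x
 proof -
 from C[of x] have "abs (Im (?A x)) <= C"
 using abs_Im_le_cmod[of "?A x"] by simp
 hence "abs (\<epsilon> * Im (?A x)) <= ?C C" unfolding abs_mult by (intro mlm) auto
 hence "max 0 (\<epsilon> * Im (?A x)) <= ?C C" using C0 by auto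
 thus ?thesis unfolding K_def using p by (intro powr_mono2) auto
 qed
 define R where "R = max (abs r + 1) K"
 have "0 < R" by (simp add: R_def)
 moreover have "?B x <= R * indicator {-R..R} x" for x
 using b[of x] by (auto simp: R_def ind_def le_max_iff_disj)
 moreover have "(%x. ?B x) : bm borel"
 by measurable
 ultimately show ?thesis unfolding bcs_def by (intro conjI exI[of _ R]) auto
qed

text \<open>Duality with the dual exponent; Young's inequality with parameter \<open>A\<close> replaces the Hoelder inequality.\<close>

lemma Im_cauchy_tr_Lp_large_local:
 assumes f: "bcs f" and y: "0 < y" and p: "2 < p" and e: "\<epsilon> = 1 | \<epsilon> = - 1"
 shows "(NN x|lborel. en (max 0 (\<epsilon> * Im (cauchy_tr f (Complex x y))) powr p * indicator {-r..r} x))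
 <= en ((800 * p) powr p) * (NN t|lborel. en (f t powr p))"
proof -
 let ?A = "(NN x|lborel. en (f x powr p))"
 let ?B = "%g x. cauchy_tr g (Complex x y)"
 let ?C = "%x. cauchy_tr f (Complex x y)"
 let ?D = "%A q. en (A powr (- q) / q)"
 let ?E = "%A. en (A powr p / p)"
 let ?F = "%F. (NN x|lborel. en (f x * F x))"
 let ?G = "%x g. f x * Im (?B g x)"
 let ?H = "%x. \<epsilon> * Im (?C x)"
 note [measurable] = meas_cauchy_line[OF f y] bcs_measurable[OF f]
 \<comment> \<open>The dual exponent lies between 1 and 2, where \<open>cauchy_tr_Lp_small\<close>
   applies.\<close>
 define q where "q = p / (p - 1)"
 have q: "1 < q" "q <= 2" "1 / p + 1 / q = 1" and q1: "q - 1 = 1 / (p - 1)" using p by (auto simp: q_def field_simps)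
 have qp: "(p - 1) * q = p" using p by (simp add: q_def)
 define g where "g x = max 0 (?H x) powr (p - 1) * indicator {-r..r} x" for x
 have g: "bcs g" unfolding g_def using bcs_powr_part[OF f y, of p] p by simp
 note [measurable] = meas_cauchy_line[OF g y] bcs_measurable[OF g]
 define u where "u x = max 0 (?H x) powr p * indicator {-r..r} x" for x
 have ug: "u x = \<epsilon> * Im (?C x) * g x" for x
 proof (cases "0 < ?H x")
 case True
 thus ?thesis using powr_mult_base[of "?H x" "p - 1"]
 by (simp add: u_def g_def max_def)
 qed (use p in \<open>simp add: u_def g_def max_def\<close>)
 have gq: "g x powr q = u x" for x
 using p q by (auto simp: g_def u_def powr_mult powr_powr qp ind_def)
 have unn: "0 <= u x" for x by (simp add: u_def)
 have [measurable]: "u : bm borel" unfolding u_def[abs_def] by measurable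
 obtain C where C: "!!x. norm (?C x) <= C" using cauchy_tr_line_bounded[OF f y] by blast
 have intu: "integrable lborel u"
 proof (rule int_bd)
 show "integrable lborel (%x. C * g x)" using integrable_bcs[OF g] by simp
 show "AE x in lborel. norm (u x) <= norm (C * g x)"
 proof (rule AE_I2)
 fix x
 have "abs (\<epsilon> * Im (?C x)) <= abs C"
 using e C[of x] abs_Im_le_cmod[of "?C x"] by (auto simp: abs_mult)
 thus "norm (u x) <= norm (C * g x)" unfolding ug real_norm_def abs_mult by (intro mrm) (auto simp: abs_mult)
 qed
 qed simp
 \<comment> \<open>\<open>A powr q\<close> equals \<open>800 / (q - 1)\<close>, the constant of
   \<open>cauchy_tr_Lp_small\<close> at \<open>q\<close>. The second term of Young's inequality
   thereby becomes \<open>V / q\<close>, which the left side absorbs.\<close>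
 define A where "A = (800 * (p - 1)) powr (1 / q)"
 have A: "0 < A" "A powr q = 800 * (p - 1)" using p q by (auto simp: A_def powr_powr)
 have A': "A powr p <= (800 * p) powr p"
 proof -
 have "A <= (800 * (p - 1)) powr 1" unfolding A_def using p q by (intro powr_mono) auto
 thus ?thesis using p A by (intro powr_mono2) auto
 qed
 define F where "F x = norm (?B g x)" for x
 have [measurable]: "F : bm borel" unfolding F_def by measurable
 have Fq: "(NN x|lborel. en (F x powr q)) <= en (A powr q) * (NN x|lborel. en (u x))"
 using cauchy_tr_Lp_small[OF g y q(1,2)] by (simp add: F_def gq A(2) q1)
 define V where "V = (LINT x|lborel. u x)"
 have V: "(NN x|lborel. en (u x)) = en V" "0 <= V"
 unfolding V_def using intu unn by (auto intro: nn_integral_eq_integral)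
 have "?F F <= (NN x|lborel. en (A powr p / p) * en (f x powr p) + ?D A q * en (F x powr q))"
 proof (intro nn_mono)
 fix x
 have "(A * f x) * (F x / A) <= (A * f x) powr p / p + (F x / A) powr q / q"
 using p q A bcs_nonneg[OF f, of x] by (intro Youngs_inequality) (auto simp: F_def)
 hence "f x * F x <= A powr p / p * f x powr p + A powr (- q) / q * F x powr q"
 using A bcs_nonneg[OF f, of x] by (simp add: powr_mult powr_divide powr_minus_divide F_def)
 thus "en (f x * F x) <= ?E A * en (f x powr p) + ?D A q * en (F x powr q)"
 using p q by (simp add: en_leI flip: en_mult ennreal_plus)
 qed
 also have "... = ?E A * ?A + ?D A q * (NN x|lborel. en (F x powr q))"
 by (simp add: nn_integral_add nn_cmult)
 also have "... <= ?E A * ?A + ?D A q * (en (A powr q) * en V)"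
 using Fq unfolding V(1) by (intro add_left_mono mlm) auto
 also have "?D A q * (en (A powr q) * en V) = en (V / q)"
 proof -
 have "A powr (- q) / q * (A powr q * V) = V / q" using A(1) by (simp add: powr_minus_divide)
 thus ?thesis using q V by (simp flip: en_mult)
 qed
 finally have le1: "?F F <= ?E A * ?A + en (V / q)" .
 obtain D where D: "!!x. norm (?B g x) <= D" using cauchy_tr_line_bounded[OF g y] by blast
 have intIm: "integrable lborel (%x. ?G x g)"
 proof (rule int_bd)
 show "integrable lborel (%x. f x * D)" using integrable_bcs[OF f] by simp
 show "AE x in lborel. norm (?G x g) <= norm (f x * D)"
 proof (rule AE_I2)
 fix x
 have "abs (Im (?B g x)) <= abs D"
 using D[of x] abs_Im_le_cmod[of "?B g x"] by auto
 thus "norm (?G x g) <= norm (f x * D)"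
 unfolding real_norm_def abs_mult by (intro mlm) auto
 qed
 qed simp
 have "V = \<epsilon> * (LINT x|lborel. Im (?C x) * g x)"
 unfolding V_def ug by (simp add: mult.assoc)
 also have "... = - \<epsilon> * (LINT x|lborel. ?G x g)"
 unfolding cauchy_Im_duality[OF f g y] by simp
 also have "... <= abs (LINT x|lborel. ?G x g)" using e by auto
 finally have "en V <= en (norm (LINT x|lborel. ?G x g))" by (simp add: en_leI)
 also have "... <= (NN x|lborel. norm (?G x g))"
 by (rule integral_norm_bound_ennreal[OF intIm])
 also have "... <= ?F F"
 using bcs_nonneg[OF f] by (intro nn_mono en_leI) (auto simp: abs_mult F_def abs_Im_le_cmod intro!: mlm)
 also note le1
 finally have le2: "en V <= ?E A * ?A + en (V / q)" .
 have "en V <= en (A powr p) * ?A"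
 proof (cases "?A")
 case (real m)
 with le2 have "en V <= en (A powr p / p * m + V / q)"
 using p q V by (simp flip: en_mult ennreal_plus)
 hence "V <= A powr p / p * m + V / q" using p q V real by (subst (asm) ennreal_le_iff) auto
 \<comment> \<open>\<open>V\<close> is a finite real number, so \<open>V / q\<close> may be
   subtracted; what remains on the left is \<open>V / p\<close>.\<close>
 moreover have "V / q = V - V / p" using q(3) p q(1) by (simp add: field_simps)
 ultimately have "V / p <= A powr p * m / p" by simp
 hence "V <= A powr p * m" using p by (simp add: divide_le_cancel)
 thus ?thesis using real by (simp add: en_leI flip: en_mult)
 next
 case top thus ?thesis using A by (simp add: ennreal_mult_top)
 qed
 also have "... <= en ((800 * p) powr p) * ?A"
 by (intro mrm en_leI A') auto
 finally show ?thesis using V(1) by (simp add: u_def)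
qed


text \<open>The local bounds for both signs are added, and the cut-off interval grows by monotone
  convergence; this accounts for the factor 2.\<close>

lemma Im_cauchy_tr_Lp_large:
 assumes f: "bcs f" and y: "0 < y" and p: "2 < p"
 shows "(NN x|lborel. en (abs (Im (cauchy_tr f (Complex x y))) powr p))
 <= en (2 * (800 * p) powr p) * (NN t|lborel. en (f t powr p))"
proof -
 let ?A = "en (2 * (800 * p) powr p)"
 note [measurable] = meas_cauchy_line[OF f y]
 let ?v = "%x. Im (cauchy_tr f (Complex x y))"
 let ?h = "%n::nat. %x. en (abs (?v x) powr p) * indicator {- real n..real n} x"
 let ?N = "(NN t|lborel. en (f t powr p))"
 have mono: "incseq ?h"
 by (auto simp: incseq_def le_fun_def ind_def)
 have sup: "(SUP n. ?h n x) = en (abs (?v x) powr p)" for x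
 proof (rule antisym)
 show "(SUP n. ?h n x) <= en (abs (?v x) powr p)" by (rule SUP_least) (auto simp: ind_def)
 obtain n :: nat where "abs x <= real n" using real_arch_simple by blast
 hence "en (abs (?v x) powr p) = ?h n x" by (auto simp: ind_def)
 also have "... <= (SUP n. ?h n x)" by (rule SUP_upper) simp
 finally show "en (abs (?v x) powr p) <= (SUP n. ?h n x)" .
 qed
 have bd: "(NN x|lborel. ?h n x) <= ?A * ?N" for n
 proof -
 have "(NN x|lborel. ?h n x) = (NN x|lborel. en (max 0 (1 * ?v x) powr p * indicator {- real n..real n} x) + en (max 0 (- 1 * ?v x) powr p * indicator {- real n..real n} x))"
 using p by (intro nn_cong) (auto simp: ind_def max_def)
 also have "... = (NN x|lborel. en (max 0 (1 * ?v x) powr p * indicator {- real n..real n} x)) + (NN x|lborel. en (max 0 (- 1 * ?v x) powr p * indicator {- real n..real n} x))"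
 by (rule nn_integral_add) measurable
 also have "... <= en ((800 * p) powr p) * ?N + en ((800 * p) powr p) * ?N"
 by (intro add_mono Im_cauchy_tr_Lp_large_local f y p) auto
 also have "... = ?A * ?N"
 by (simp add: en_mult mult.assoc mult_2[symmetric])
 finally show ?thesis .
 qed
 have "(NN x|lborel. en (abs (?v x) powr p)) = (NN x|lborel. (SUP n. ?h n x))"
 by (simp only: sup)
 also have "... = (SUP n. (NN x|lborel. ?h n x))"
 by (rule nn_integral_monotone_convergence_SUP[OF mono]) measurable
 also have "... <= ?A * ?N" by (rule SUP_least) (rule bd)
 finally show ?thesis .
qed

text \<open>Above 2 the real part is a Poisson average, controlled by Jensen, and only the imaginary
  part needs duality. Up to 2 the constant \<open>800 / (p - 1)\<close> is at least no larger than
  the uniform form, since \<open>5000 * line_const p >= 1\<close> may be raised to the power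
  \<open>p\<close>.\<close>

lemma cauchy_tr_Lp:
 assumes f: "bcs f" and y: "0 < y" and p: "1 < p"
 shows "(NN x|lborel. np p (cauchy_tr f (Complex x y)))
 <= en ((5000 * line_const p) powr p) * (NN t|lborel. en (f t powr p))"
proof (cases "p <= 2")
 case True
 have "800 / (p - 1) = 800 * (1 / (p - 1))" by simp
 also have "... <= 5000 * line_const p" using line_const_ge(1,3)[OF p] by linarith
 also have "... <= (5000 * line_const p) powr p" using line_const_ge(1)[OF p] p powr_mono[of 1 p "5000 * line_const p"] by simp
 finally have "en (800 / (p - 1)) <= en ((5000 * line_const p) powr p)" by (rule en_leI)
 from order_trans[OF cauchy_tr_Lp_small[OF f y p True] mrm[OF this]] show ?thesis by simp
next
 case False
 hence p2: "2 < p" by simp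
 note [measurable] = meas_cauchy_line[OF f y] bcs_measurable[OF f]
 let ?N = "(NN t|lborel. en (f t powr p))"
 let ?c = "%x. cauchy_tr f (Complex x y)"
 have Re0: "0 <= Re (?c x)" for x
 unfolding Re_cauchy_tr(1)[OF f y] using y bcs_nonneg[OF f] by (intro integral_nonneg_AE AE_I2) simp
 have ReN: "(NN x|lborel. en (Re (?c x) powr p)) <= ?N"
 proof -
 have "(NN x|lborel. en (Re (?c x) powr p)) <= (NN x|lborel. pconv y (%t. en (f t powr p)) x)"
 by (intro nn_mono Re_cauchy_tr_Jensen f y p)
 also have "... = ?N" by (rule nn_integral_pconv) (use y in auto)
 finally show ?thesis .
 qed
 have "(NN x|lborel. np p (?c x)) <= (NN x|lborel. en (2 powr p) * (en (Re (?c x) powr p) + en (abs (Im (?c x)) powr p)))"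
 proof (intro nn_mono)
 fix x
 have "norm (?c x) powr p <= (Re (?c x) + abs (Im (?c x))) powr p"
 using cmod_le[of "?c x"] Re0[of x] p by (intro powr_mono2) auto
 also have "... <= 2 powr p * (Re (?c x) powr p + abs (Im (?c x)) powr p)" using Re0 p by (intro powr_add_le) auto
 finally show "np p (?c x) <= en (2 powr p) * (en (Re (?c x) powr p) + en (abs (Im (?c x)) powr p))"
 by (simp add: en_leI flip: en_mult ennreal_plus)
 qed
 also have "... = en (2 powr p) * ((NN x|lborel. en (Re (?c x) powr p)) + (NN x|lborel. en (abs (Im (?c x)) powr p)))"
 by (simp add: nn_cmult nn_integral_add)
 also have "... <= en (2 powr p) * (?N + en (2 * (800 * p) powr p) * ?N)"
 by (intro mlm add_mono ReN Im_cauchy_tr_Lp_large f y p2) auto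
 also have "... = en (2 powr p * (1 + 2 * (800 * p) powr p)) * ?N"
 by (simp add: en_mult ennreal_plus distrib_right mult.assoc)
 also have "... <= en ((5000 * line_const p) powr p) * ?N"
 proof (intro mrm en_leI)
 have "1 <= (800 * p) powr p" using p by (intro ge_one_powr_ge_zero) auto
 hence "2 powr p * (1 + 2 * (800 * p) powr p) <= 2 powr p * (3 * (800 * p) powr p)" by simp
 also have "... <= 2 powr p * (3 powr p * (800 * p) powr p)"
 using powr_mono[of 1 p 3] p by (intro mlm mrm) auto
 also have "... = (4800 * p) powr p" using p by (simp flip: powr_mult)
 also have "... <= (5000 * line_const p) powr p" using p line_const_ge(2)[OF p] by (intro powr_mono2) auto
 finally show "2 powr p * (1 + 2 * (800 * p) powr p) <= (5000 * line_const p) powr p" .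
 qed auto
 finally show ?thesis .
qed

text \<open>Since \<open>cauchy_tr f\<close> has nonnegative real part, its square root is holomorphic; this trades the exponent
  \<open>p\<close> for \<open>2p\<close> in the maximal inequality, so that no power of \<open>1/(p - 1)\<close> is lost.\<close>

lemma ennreal_powr_half_square: "(en (a powr (p / 2)))^2 = en (a powr p)"
proof -
 have "(a powr (p / 2))^2 = a powr p" by (simp add: sq_eq flip: powr_add)
 thus ?thesis by (simp add: ennreal_power)
qed

text \<open>The square root of the shifted transform is bounded and holomorphic, hence the Poisson
  average of its boundary values. Jensen with exponent \<open>p\<close> for its modulus gives a
  bound for \<open>|F| powr (p / 2)\<close>, which is then squared.\<close>

lemma cauchy_tr_sqrt_Jensen:
 assumes f: "bcs f" and \<eta>: "0 < \<eta>" and y: "0 < y" and p: "1 < p"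
 shows "np p (cauchy_tr f (Complex x (y + \<eta>)))
 <= (pconv y (%t. en (norm (cauchy_tr f (Complex t \<eta>)) powr (p / 2))) x)^2"
proof (cases "AE t in lborel. f t = 0")
 case True
 have "cauchy_tr f z = 0" for z
 unfolding cauchy_tr_def by (rule integral_eq_zero_AE) (use True in auto)
 thus ?thesis by simp
next
 case False
 note [measurable] = meas_cauchy_line[OF f \<eta>]
 define F where "F = (%z. cauchy_tr f (z + \<i> * of_real \<eta>))"
 have Fx: "F (Complex x s) = cauchy_tr f (Complex x (s + \<eta>))" for x s
 by (simp add: F_def Complex_eq algebra_simps)
 have Fr: "F (of_real t) = cauchy_tr f (Complex t \<eta>)" for t by (simp add: F_def Complex_eq)
 have pos: "0 < Re (F z)" if "- \<eta> < Im z" for z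
 unfolding F_def by (rule Re_cauchy_tr_pos[OF f False]) (use that in simp)
 have Fh: "F holomorphic_on {z. - \<eta> < Im z}"
 proof -
 have "(cauchy_tr f o (%z. z + \<i> * of_real \<eta>)) holomorphic_on {z. - \<eta> < Im z}"
 by (rule holomorphic_on_compose_gen[OF _ holomorphic_cauchy_tr[OF f]]) (auto intro!: holomorphic_intros)
 thus ?thesis by (simp add: F_def o_def)
 qed
 define q where "q = (%z. F z powr of_real (1/2))"
 have qh: "q holomorphic_on {z. - \<eta> < Im z}"
 unfolding q_def using Fh pos
 by (intro holomorphic_intros) (force simp: complex_nonpos_Reals_iff)+
 have nq: "norm (q z) = norm (F z) powr (1/2)" for z unfolding q_def by (subst norm_powr_real_powr') auto
 obtain C where C: "0 <= C" "!!z. \<eta> <= Im z ==> norm (cauchy_tr f z) <= C / (1 + norm z)"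
 using cauchy_tr_bound[OF f \<eta>] by blast
 have bd: "norm (q z) <= C powr (1/2)" if "0 <= Im z" for z
 proof -
 have "norm (F z) <= C / (1 + norm (z + \<i> * of_real \<eta>))" unfolding F_def using that by (intro C(2)) simp
 also have "... <= C / 1" using C(1) by (intro divide_left_mono) (auto intro!: add_pos_nonneg)
 finally show ?thesis unfolding nq by (intro powr_mono2) auto
 qed
 have rep: "(LINT t|lborel. poisson y (x - t) *\<^sub>R q (of_real t)) = q (Complex x y)"
 by (rule poisson_representation(1)[OF \<eta> qh _ y]) (rule bd)
 let ?h = "%t. norm (cauchy_tr f (Complex t \<eta>)) powr (1/2)"
 have "norm (cauchy_tr f (Complex x (y + \<eta>))) powr (1/2) = norm (q (Complex x y))" by (simp add: nq Fx)
 also have "... <= (LINT t|lborel. norm (poisson y (x - t) *\<^sub>R q (of_real t)))"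
 unfolding rep[symmetric] by (rule integral_norm_bound)
 also have "... = (LINT t|lborel. poisson y (x - t) * ?h t)" using y by (simp add: nq Fr)
 finally have le: "norm (cauchy_tr f (Complex x (y + \<eta>))) powr (1/2) <= (LINT t|lborel. poisson y (x - t) * ?h t)" .
 have k1: "(NN t|lborel. en (poisson y (x - t))) = 1"
 using nn_integral_lborel_minus[of "%t. en (poisson y t)" x] nn_integral_poisson[OF y] by simp
 have "en (norm (cauchy_tr f (Complex x (y + \<eta>))) powr (p / 2)) = en ((norm (cauchy_tr f (Complex x (y + \<eta>))) powr (1/2)) powr p)"
 by (simp add: powr_powr)
 also have "... <= en ((LINT t|lborel. poisson y (x - t) * ?h t) powr p)"
 using le p by (intro en_leI powr_mono2) auto
 also have "... <= (NN t|lborel. en (poisson y (x - t)) * en (?h t powr p))"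
 using y p k1 by (intro nn_integral_Jensen_powr) auto
 also have "... = pconv y (%t. en (norm (cauchy_tr f (Complex t \<eta>)) powr (p / 2))) x"
 by (simp add: pconv_def powr_powr)
 finally have "(en (norm (cauchy_tr f (Complex x (y + \<eta>))) powr (p / 2)))^2 <= (pconv y (%t. en (norm (cauchy_tr f (Complex t \<eta>)) powr (p / 2))) x)^2"
 by (rule power_mono) simp
 moreover have "(en (norm (cauchy_tr f (Complex x (y + \<eta>))) powr (p / 2)))^2 = np p (cauchy_tr f (Complex x (y + \<eta>)))"
 by (rule ennreal_powr_half_square)
 ultimately show ?thesis by simp
qed

text \<open>All heights exceed some \<open>\<eta>\<close>, so the \<open>p\<close>-th powers are
  dominated by squares of Poisson averages of one function \<open>g\<close> on the line at height
  \<open>\<eta>\<close>. The bound \<open>pmax_L2\<close>, with constant 16 for every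
  \<open>p\<close>, then reduces the claim to \<open>cauchy_tr_Lp\<close>.\<close>

lemma cauchy_tr_maximal:
 fixes n :: nat
 assumes f: "bcs f" and y: "!!i. 0 < y i" and p: "1 < p"
 shows "(NN x|lborel. (SUP i\<in>{..<n}. np p (cauchy_tr f (Complex x (y i)))))
 <= en (16 * (5000 * line_const p) powr p) * (NN t|lborel. en (f t powr p))"
proof -
 let ?A = "%x i. np p (cauchy_tr f (Complex x (y i)))"
 let ?B = "Min (insert 1 (y ` {..<n}))"
 let ?C = "(NN t|lborel. en (f t powr p))"
 \<comment> \<open>Half of the least height; the inserted 1 covers \<open>n = 0\<close>.\<close>
 define \<eta> where "\<eta> = ?B / 2"
 have m0: "0 < ?B" using y by (subst Min_gr_iff) auto
 hence \<eta>: "0 < \<eta>" by (simp add: \<eta>_def)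
 have yi: "\<eta> < y i" if "i < n" for i
 proof -
 have "?B <= y i" using that by (intro Min_le) auto
 thus ?thesis using m0 unfolding \<eta>_def by linarith
 qed
 note [measurable] = meas_cauchy_line[OF f \<eta>]
 define g where "g t = en (norm (cauchy_tr f (Complex t \<eta>)) powr (p / 2))" for t
 have [measurable]: "g : bm borel" unfolding g_def by measurable
 define y' where "y' i = (if i < n then y i - \<eta> else 1)" for i
 have y': "0 < y' i" for i using yi by (simp add: y'_def)
 have "(NN x|lborel. (SUP i\<in>{..<n}. ?A x i)) <= (NN x|lborel. (pmax n y' g x)^2)"
 proof (intro nn_mono SUP_least)
 fix x i assume i: "i : {..<n}"
 have "?A x i <= (pconv (y' i) g x)^2"
 using cauchy_tr_sqrt_Jensen[OF f \<eta> y' p, of x i] i by (simp add: y'_def g_def[abs_def])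
 also have "... <= (pmax n y' g x)^2"
 unfolding pmax_def using i by (intro power_mono SUP_upper) auto
 finally show "?A x i <= (pmax n y' g x)^2" .
 qed
 also have "... <= 16 * (NN x|lborel. (g x)^2)" by (rule pmax_L2[OF y']) measurable
 also have "(NN x|lborel. (g x)^2) = (NN x|lborel. np p (cauchy_tr f (Complex x \<eta>)))"
 by (simp add: g_def ennreal_powr_half_square)
 also have "16 * ... <= 16 * (en ((5000 * line_const p) powr p) * ?C)"
 by (intro mlm cauchy_tr_Lp f \<eta> p) auto
 also have "... = en (16 * (5000 * line_const p) powr p) * ?C"
 by (simp add: en_mult mult.assoc)
 finally show ?thesis .
qed

section \<open>Truncated Hilbert transforms on the line\<close>

definition htr :: "real => real => (real => complex) => real => complex" where
 "htr a b f x = (LINT r|lborel. (indicator {r. a < abs r & abs r <= b} r / r) *\<^sub>R f (x - r))"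

text \<open>The truncated kernel \<open>1/r\<close> differs from the conjugate Poisson kernel by at most a Poisson kernel.\<close>

lemma truncated_minus_conjugate_le:
 fixes a r :: real assumes a: "0 < a"
 shows "abs (indicator {r. a < abs r} r / r - r / (r^2 + a^2)) <= pi * poisson a r"
proof -
 let ?A = "r^2 + a^2"
 have N: "0 < ?A" using a by (simp add: add_nonneg_pos)
 have P: "pi * poisson a r = a / ?A" by (simp add: poisson_def)
 show ?thesis
 proof (cases "a < abs r")
 case True
 hence r0: "r ~= 0" using a by auto
 have "1 / r - r / ?A = (a / r) * (a / ?A)"
 using r0 N by (simp add: field_simps sq_eq)
 hence "abs (1 / r - r / ?A) = (a / abs r) * (a / ?A)"
 using a N by (simp add: abs_mult)
 also have "... <= 1 * (a / ?A)"
 using True a N by (intro mrm) auto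
 finally show ?thesis using True by (simp add: P)
 next
 case False
 hence "abs r / ?A <= a / ?A" using N by (intro divide_right_mono) auto
 thus ?thesis using False N by (simp add: P abs_divide)
 qed
qed

text \<open>The conjugate Poisson part contributes \<open>pi\<close> times the imaginary part of the
  Cauchy transform; the kernel error is at most \<open>pi\<close> times a Poisson kernel and, as
  \<open>f\<close> is nonnegative, contributes at most \<open>pi\<close> times the real
  part.\<close>

lemma truncated_le_cauchy_tr:
 assumes f: "bcs f" and a: "0 < a"
 shows "integrable lborel (%t. indicator {r. a < abs r} (x - t) / (x - t) * f t)" (is "integrable _ ?h")
 and "abs (LINT t|lborel. indicator {r. a < abs r} (x - t) / (x - t) * f t) <= 2 * pi * norm (cauchy_tr f (Complex x a))"
proof -
 let ?A = "cauchy_tr f (Complex x a)"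
 let ?B = "%t. (x - t)^2 + a^2"
 note [measurable] = bcs_measurable[OF f]
 let ?q = "%t. pi * ((x - t) / (pi * (?B t)) * f t)"
 let ?p = "%t. pi * (poisson a (x - t) * f t)"
 have iq: "integrable lborel ?q" using Im_cauchy_tr(2)[OF f a, of x] by (rule int_mult)
 have ip: "integrable lborel ?p" using Re_cauchy_tr(2)[OF f a, of x] by (rule int_mult)
 have le: "abs (?h t - ?q t) <= ?p t" for t
 proof -
 have "abs (indicator {r. a < abs r} (x - t) / (x - t) - (x - t) / (?B t)) * f t <= pi * poisson a (x - t) * f t"
 by (intro mrm truncated_minus_conjugate_le a bcs_nonneg f)
 moreover have "?h t - ?q t = (indicator {r. a < abs r} (x - t) / (x - t) - (x - t) / (?B t)) * f t"
 proof -
 have "?q t = (x - t) / (?B t) * f t" by simp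
 thus ?thesis by (simp only: left_diff_distrib)
 qed
 ultimately show ?thesis using bcs_nonneg[OF f, of t] by (simp add: abs_mult mult.assoc)
 qed
 have id: "integrable lborel (%t. ?h t - ?q t)"
 proof (rule int_bd[OF ip])
 show "AE t in lborel. norm (?h t - ?q t) <= norm (?p t)"
 using le by (intro AE_I2) (auto intro: order_trans[OF _ abs_ge_self])
 qed measurable
 show ih: "integrable lborel ?h"
 using int_add[OF id iq] by simp
 have "abs ((LINT t|lborel. ?h t) - (LINT t|lborel. ?q t)) = abs (LINT t|lborel. ?h t - ?q t)"
 using ih iq by simp
 also have "... <= (LINT t|lborel. abs (?h t - ?q t))"
 using integral_norm_bound[of lborel "%t. ?h t - ?q t"] by simp
 also have "... <= (LINT t|lborel. ?p t)"
 using id ip le by (intro integral_mono) auto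
 also have "... = pi * Re ?A" using Re_cauchy_tr[OF f a] by simp
 also have "... <= pi * norm ?A" by (intro mlm complex_Re_le_cmod) simp
 finally have "abs ((LINT t|lborel. ?h t) - (LINT t|lborel. ?q t)) <= pi * norm ?A" .
 moreover have "(LINT t|lborel. ?q t) = pi * Im ?A"
 unfolding Im_cauchy_tr(1)[OF f a] by (rule int_cmult)
 moreover have "abs (pi * Im ?A) <= pi * norm ?A"
 unfolding abs_mult by (simp add: abs_Im_le_cmod mlm)
 ultimately show "abs (LINT t|lborel. ?h t) <= 2 * pi * norm ?A"
 by linarith
qed

lemma htr_bcs_le:
 assumes f: "bcs f" and a: "0 < a" and b: "a <= b"
 shows "norm (htr a b (%t. complex_of_real (f t)) x) <= 2 * pi * (norm (cauchy_tr f (Complex x a)) + norm (cauchy_tr f (Complex x b)))"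
proof -
 let ?A = "%t. (indicator {r. a < abs r & abs r <= b} (x - t) / (x - t)) *\<^sub>R complex_of_real (f t)"
 let ?B = "htr a b (%t. complex_of_real (f t)) x"
 let ?h = "%c t. indicator {r. c < abs r} (x - t) / (x - t) * f t"
 have "?B = (LINT t|lborel. ?A t)"
 unfolding htr_def using integral_lborel_minus[of "%t. ?A t" x] by simp
 also have "... = (LINT t|lborel. complex_of_real (?h a t - ?h b t))"
 using b by (intro int_cong) (auto simp: ind_def scaleR_of_real)
 also have "... = complex_of_real (LINT t|lborel. ?h a t - ?h b t)" by (rule integral_complex_of_real)
 also have "(LINT t|lborel. ?h a t - ?h b t) = (LINT t|lborel. ?h a t) - (LINT t|lborel. ?h b t)"
 by (rule Bochner_Integration.integral_diff[OF truncated_le_cauchy_tr(1)[OF f a] truncated_le_cauchy_tr(1)[OF f order_less_le_trans[OF a b]]])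
 finally have "norm ?B = abs ((LINT t|lborel. ?h a t) - (LINT t|lborel. ?h b t))"
 by (simp only: norm_of_real)
 also have "... <= abs (LINT t|lborel. ?h a t) + abs (LINT t|lborel. ?h b t)" by (rule abs_triangle_ineq4)
 also have "... <= 2 * pi * norm (cauchy_tr f (Complex x a)) + 2 * pi * norm (cauchy_tr f (Complex x b))"
 by (intro add_mono truncated_le_cauchy_tr(2)[OF f a] truncated_le_cauchy_tr(2)[OF f order_less_le_trans[OF a b]])
 finally show ?thesis unfolding distrib_left .
qed

lemma htr_degenerate: "b <= a ==> htr a b f x = 0"
proof -
 assume "b <= a"
 hence "{r::real. a < abs r & abs r <= b} = {}" by auto
 thus ?thesis by (simp add: htr_def)
qed

lemma htr_bcs_maximal:
 fixes n :: nat
 assumes f: "bcs f" and a: "!!i. 0 < a i" and p: "1 < p"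
 shows "(NN x|lborel. (SUP i\<in>{..<n}. np p (htr (a i) (b i) (%t. complex_of_real (f t)) x)))
 <= en (16 * (100000 * line_const p) powr p) * (NN t|lborel. en (f t powr p))"
proof -
 let ?C = "%i x. norm (htr (a i) (b i) (%t. complex_of_real (f t)) x)"
 let ?D = "en ((4 * pi) powr p)"
 let ?E = "5000 * line_const p"
 let ?F = "(NN t|lborel. en (f t powr p))"
 let ?G = "100000 * line_const p"
 \<comment> \<open>The heights \<open>a i\<close> and \<open>b i\<close> are interleaved at even and
   odd places. The maximum keeps the odd ones positive when \<open>b i < a i\<close>, a case in
   which \<open>htr\<close> vanishes.\<close>
 define y where "y j = (if even j then a (j div 2) else max (a (j div 2)) (b (j div 2)))" for j :: nat
 have y: "0 < y j" for j using a[of "j div 2"] by (auto simp: y_def less_max_iff_disj)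
 note [measurable] = meas_cauchy_line[OF f y]
 let ?S = "%x. SUP j\<in>{..<2 * n}. np p (cauchy_tr f (Complex x (y j)))"
 have pw: "en (?C i x powr p) <= ?D * ?S x" if i: "i < n" for i x
 proof (cases "a i <= b i")
 case True
 let ?A = "norm (cauchy_tr f (Complex x (y (2 * i))))" and ?B = "norm (cauchy_tr f (Complex x (y (2 * i + 1))))"
 have "?C i x <= 2 * pi * (?A + ?B)"
 using htr_bcs_le[OF f a True, of x] True by (simp add: y_def max_def)
 also have "... <= 4 * pi * max ?A ?B" by (simp add: max_def)
 finally have "?C i x powr p <= (4 * pi * max ?A ?B) powr p"
 using p by (intro powr_mono2) auto
 also have "... = (4 * pi) powr p * max ?A ?B powr p" by (simp add: powr_mult)
 finally have "en (?C i x powr p) <= ?D * en (max ?A ?B powr p)"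
 by (simp add: en_leI flip: en_mult)
 also have "... <= ?D * ?S x"
 proof (rule mlm)
 have "en (?A powr p) <= ?S x" "en (?B powr p) <= ?S x"
 using i by (intro SUP_upper; simp)+
 thus "en (max ?A ?B powr p) <= ?S x" by (auto simp: max_def)
 qed simp
 finally show ?thesis .
 qed (use htr_degenerate[of "b i" "a i"] in simp)
 have "(NN x|lborel. (SUP i\<in>{..<n}. en (?C i x powr p)))
 <= (NN x|lborel. en ((4 * pi) powr p) * ?S x)"
 by (intro nn_mono SUP_least pw) auto
 also have "... = ?D * (NN x|lborel. ?S x)"
 by (rule nn_cmult) measurable
 also have "... <= ?D * (en (16 * ?E powr p) * ?F)"
 by (intro mlm cauchy_tr_maximal f y p) auto
 also have "... = en ((4 * pi) powr p * (16 * ?E powr p)) * ?F"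
 by (simp add: en_mult mult.assoc)
 also have "... <= en (16 * ?G powr p) * ?F"
 proof (intro mrm en_leI)
 have "(4 * pi) powr p * ?E powr p = (4 * pi * ?E) powr p"
 by (rule powr_mult[symmetric])
 also have "... <= ?G powr p"
 using p line_const_ge(1)[OF p] pi_less_4 by (intro powr_mono2) auto
 finally show "(4 * pi) powr p * (16 * ?E powr p) <= 16 * ?G powr p" by simp
 qed auto
 finally show ?thesis .
qed

lemma htr_integrable:
 assumes [measurable]: "f : bm borel" and p: "1 < p"
 and fin: "(NN t|lborel. np p (f t)) < \<infinity>" and a: "0 < a"
 shows "integrable lborel (%r. (indicator {r. a < abs r & abs r <= b} r / r) *\<^sub>R (f (x - r) :: complex))"
proof (rule int_bd)
 let ?A = "%r. (1 / a) * (norm (f (x - r)) powr p + indicator {- abs b..abs b} r)"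
 let ?B = "%r. (indicator {r. a < abs r & abs r <= b} r / r) *\<^sub>R (f (x - r) :: complex)"
 let ?C = "%r. norm (f (x - r))"
 have 1: "integrable lborel (%t. norm (f t) powr p)"
 using fin by (intro integrableI_nonneg) auto
 have 2: "integrable lborel (%r. norm (f (x - r)) powr p)"
 using 1 integrable_lborel_minus[of "%t. norm (f t) powr p" x] by simp
 have 3: "integrable lborel (%r. indicator {- abs b..abs b} r :: real)"
 by (intro integrable_real_indicator) (auto simp: emeasure_lborel_Icc_eq)
 show "integrable lborel (%r. ?A r)"
 using 2 3 by simp
 show "AE r in lborel. norm (?B r) <= norm (?A r)"
 proof (rule AE_I2)
 fix r :: real
 show "norm (?B r) <= norm (?A r)"
 proof (cases "a < abs r & abs r <= b")
 case True
 have c: "?C r <= ?C r powr p + 1"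
 proof (cases "?C r <= 1")
 case False thus ?thesis using powr_mono[of 1 p "?C r"] p by simp
 qed (simp add: add_increasing)
 have "1 / abs r <= 1 / a" using True a by (intro divide_left_mono) auto
 hence "1 / abs r * ?C r <= (1 / a) * (?C r powr p + 1)"
 using a c by (intro mult_mono) auto
 moreover have "indicator {- abs b..abs b} r = (1 :: real)" using True by (auto simp: ind_def)
 ultimately show ?thesis using True a by (simp add: add_nonneg_nonneg)
 qed (use a in \<open>auto simp: ind_def\<close>)
 qed
qed measurable


lemma htr_measurable [measurable]:
 assumes [measurable]: "f : bm borel"
 shows "htr a b f : bm borel"
 unfolding htr_def[abs_def] by measurable


text \<open>The four parts are ordered so that the coefficient of part \<open>j\<close> in the
  decomposition of \<open>z\<close> is \<open>\<i> ^ j\<close>.\<close>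

definition cparts :: "complex => nat => real" where
 "cparts z j = (if j = 0 then max 0 (Re z) else if j = 1 then max 0 (Im z) else if j = 2 then max 0 (- Re z) else max 0 (- Im z))"

lemma cparts_nonneg [simp]: "0 <= cparts z j" by (simp add: cparts_def)

lemma cparts_le_norm: "cparts z j <= norm z"
 using abs_Re_le_cmod[of z] abs_Im_le_cmod[of z] by (auto simp: cparts_def)

lemma cparts_sum: "z = (SUM j<4. \<i> ^ j * complex_of_real (cparts z j))"
proof -
 have "{..<4::nat} = {0, 1, 2, 3}" by auto
 thus ?thesis by (auto simp: cparts_def complex_eq_iff max_def power3_eq_cube)
qed

lemma borel_measurable_cparts [measurable (raw)]:
 assumes [measurable]: "f : bm M" shows "(%x. cparts (f x) j) : bm M"
 unfolding cparts_def by measurable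

text \<open>A general \<open>f\<close> is split into four nonnegative parts, each cut off in size
  and support. The operators converge pointwise by dominated convergence, and Fatou's lemma carries
  the bound over.\<close>

theorem htr_maximal:
 fixes f :: "real => complex" and n :: nat
 assumes [measurable]: "f : bm borel" and a: "!!i. 0 < a i" and p: "1 < p"
 shows "(NN x|lborel. (SUP i\<in>{..<n}. np p (htr (a i) (b i) f x)))
 <= en ((10 ^ 8 * line_const p) powr p) * (NN t|lborel. np p (f t))"
proof (cases "(NN t|lborel. np p (f t)) = \<infinity>")
 case True
 have "0 < (10 ^ 8 * line_const p) powr p" using line_const_ge(1)[OF p] by simp
 thus ?thesis unfolding True by (simp add: ennreal_mult_top)
next
 case False
 let ?N = "(NN t|lborel. np p (f t))"
 have fin: "?N < \<infinity>" using False by (simp add: top.not_eq_extremum)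
 define g where "g m j t = cparts (f t) j * indicator {t. abs t <= real m & norm (f t) <= real m} t" for m j t
 have g_meas [measurable]: "g m j : bm borel" for m j unfolding g_def by measurable
 have gle: "g m j t <= norm (f t)" and gnn: "0 <= g m j t" for m j t
 using cparts_le_norm[of "f t" j] by (auto simp: g_def ind_def)
 have gb: "bcs (g m j)" for m j
 unfolding bcs_def
 proof (intro conjI exI[of _ "real m + 1"] allI)
 fix t
 show "g m j t <= (real m + 1) * indicator {- (real m + 1)..real m + 1} t"
 using cparts_le_norm[of "f t" j] by (auto simp: g_def ind_def)
 qed (auto simp: gnn)
 define G where "G m j i x = np p (htr (a i) (b i) (%t. complex_of_real (g m j t)) x)" for m j i x
 have [measurable]: "(%t. complex_of_real (g m j t)) : bm borel" for m j by measurable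
 have [measurable]: "G m j i : bm borel" for m j i unfolding G_def by measurable
 let ?H = "%m x. en (4 powr p) * (SUM j<4. SUP i\<in>{..<n}. G m j i x)"
 have lim: "(%m. htr (a i) (b i) (%t. complex_of_real (g m j t)) x) ----> htr (a i) (b i) (%t. complex_of_real (cparts (f t) j)) x" for i j x
 unfolding htr_def
 proof (rule dom_conv)
 let ?k = "%r. indicator {r. a i < abs r & abs r <= b i} r / r :: real"
 show "integrable lborel (%r. norm (?k r *\<^sub>R f (x - r)))"
 using htr_integrable[OF _ p fin a] by (intro integrable_norm) auto
 show "AE r in lborel. (%m. ?k r *\<^sub>R complex_of_real (g m j (x - r))) ----> ?k r *\<^sub>R complex_of_real (cparts (f (x - r)) j)"
 proof (rule AE_I2, rule tendsto_eventually)
 fix r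
 obtain m0 :: nat where m0: "max (abs (x - r)) (norm (f (x - r))) <= real m0" using real_arch_simple by blast
 have "g m j (x - r) = cparts (f (x - r)) j" if "m0 <= m" for m
 using m0 that by (auto simp: g_def ind_def)
 thus "\<forall>\<^sub>F m in sequentially. ?k r *\<^sub>R complex_of_real (g m j (x - r)) = ?k r *\<^sub>R complex_of_real (cparts (f (x - r)) j)"
 by (intro eventually_sequentiallyI[of m0]) auto
 qed
 show "AE r in lborel. norm (?k r *\<^sub>R complex_of_real (g m j (x - r))) <= norm (?k r *\<^sub>R f (x - r))" for m
 using gle gnn by (intro AE_I2) (simp only: norm_scaleR norm_of_real abs_of_nonneg mlm abs_ge_zero)
 qed measurable
 have dec: "htr (a i) (b i) f x = (SUM j<4. \<i> ^ j * htr (a i) (b i) (%t. complex_of_real (cparts (f t) j)) x)" for i x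
 proof -
 let ?k = "%r. indicator {r. a i < abs r & abs r <= b i} r / r :: real"
 have int: "integrable lborel (%r. ?k r *\<^sub>R complex_of_real (cparts (f (x - r)) j))" for j
 proof (rule int_bd[OF htr_integrable[OF _ p fin a[of i], where x=x and b="b i"]])
 show "AE r in lborel. norm (?k r *\<^sub>R complex_of_real (cparts (f (x - r)) j)) <= norm (?k r *\<^sub>R f (x - r))"
 using cparts_le_norm by (intro AE_I2) (simp only: norm_scaleR norm_of_real abs_of_nonneg cparts_nonneg mlm abs_ge_zero)
 qed measurable
 have "htr (a i) (b i) f x = (LINT r|lborel. (SUM j<4. \<i> ^ j * (?k r *\<^sub>R complex_of_real (cparts (f (x - r)) j))))"
 unfolding htr_def
 by (intro int_cong refl) (subst cparts_sum, simp add: scaleR_sum_right)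
 also have "... = (SUM j<4. \<i> ^ j * htr (a i) (b i) (%t. complex_of_real (cparts (f t) j)) x)"
 unfolding htr_def
 by (subst int_sum, intro int_mult int, simp only: int_cmult)
 finally show ?thesis .
 qed
 have pw: "np p (htr (a i) (b i) f x) <= liminf (%m. ?H m x)" if i: "i < n" for i x
 proof -
 let ?s = "%m. SUM j<4. \<i> ^ j * htr (a i) (b i) (%t. complex_of_real (g m j t)) x"
 have "?s ----> htr (a i) (b i) f x" unfolding dec by (intro tendsto_sum tendsto_mult_left lim)
 hence "(%m. norm (?s m)) ----> norm (htr (a i) (b i) f x)" by (rule tendsto_norm)
 hence "(%m. norm (?s m) powr p) ----> norm (htr (a i) (b i) f x) powr p"
 using p by (intro tendsto_powr2[OF _ tendsto_const]) auto
 hence "(%m. np p (?s m)) ----> np p (htr (a i) (b i) f x)"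
 by (rule tendsto_ennrealI)
 hence "np p (htr (a i) (b i) f x) = liminf (%m. np p (?s m))"
 by (rule lim_imp_Liminf[OF trivial_limit_sequentially, symmetric])
 also have "... <= liminf (%m. ?H m x)"
 proof (intro Liminf_mono always_eventually allI)
 fix m
 let ?t = "%j. norm (htr (a i) (b i) (%t. complex_of_real (g m j t)) x)"
 \<comment> \<open>The sum of the four pieces is at most four times the largest; this gives
   \<open>4 powr p\<close> outside the sum of the four suprema.\<close>
 define M where "M = Max (?t ` {..<4})"
 have Mi: "M : ?t ` {..<4}" unfolding M_def by (intro Max_in) (auto simp: lessThan_empty_iff)
 then obtain j where j: "j < 4" "M = ?t j" by auto
 have "norm (?s m) <= (SUM j<4. ?t j)" by (intro order_trans[OF norm_sum] sum_mono) (simp add: norm_mult norm_power)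
 also have "... <= (SUM j<4::nat. M)" unfolding M_def by (intro sum_mono Max_ge) auto
 finally have "norm (?s m) powr p <= (4 * M) powr p" using p by (intro powr_mono2) auto
 also have "... = 4 powr p * ?t j powr p" unfolding j by (rule powr_mult)
 finally have "np p (?s m) <= en (4 powr p) * G m j i x"
 by (simp add: G_def en_leI flip: en_mult)
 also have "... <= ?H m x"
 proof (rule mlm)
 have "G m j i x <= (SUP i\<in>{..<n}. G m j i x)" using i by (intro SUP_upper) simp
 also have "... <= (SUM j<4. SUP i\<in>{..<n}. G m j i x)" using j by (intro member_le_sum) auto
 finally show "G m j i x <= (SUM j<4. SUP i\<in>{..<n}. G m j i x)" .
 qed simp
 finally show "np p (?s m) <= ?H m x" .
 qed
 finally show ?thesis .
 qed
 have "(NN x|lborel. (SUP i\<in>{..<n}. np p (htr (a i) (b i) f x))) <= (NN x|lborel. liminf (%m. ?H m x))"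
 by (intro nn_mono SUP_least pw) auto
 also have "... <= liminf (%m. (NN x|lborel. ?H m x))"
 by (rule nn_integral_liminf) measurable
 also have "... <= liminf (%m::nat. en ((10 ^ 8 * line_const p) powr p) * ?N)"
 proof (intro Liminf_mono always_eventually allI)
 fix m
 have "(NN x|lborel. ?H m x) = en (4 powr p) * (SUM j<4. (NN x|lborel. (SUP i\<in>{..<n}. G m j i x)))"
 by (simp add: nn_cmult nn_integral_sum)
 also have "... <= en (4 powr p) * (SUM j<4::nat. en (16 * (100000 * line_const p) powr p) * ?N)"
 proof (intro mlm sum_mono)
 fix j
 have "(NN x|lborel. (SUP i\<in>{..<n}. G m j i x)) <= en (16 * (100000 * line_const p) powr p) * (NN t|lborel. en (g m j t powr p))"
 unfolding G_def by (rule htr_bcs_maximal[OF gb a p])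
 also have "... <= en (16 * (100000 * line_const p) powr p) * ?N"
 using p gle gnn by (intro mlm nn_mono en_leI powr_mono2) auto
 finally show "(NN x|lborel. (SUP i\<in>{..<n}. G m j i x)) <= en (16 * (100000 * line_const p) powr p) * ?N" .
 qed simp
 also have "... = en (4 powr p * (4 * (16 * (100000 * line_const p) powr p))) * ?N"
 by (simp add: en_mult mult.assoc)
 also have "... <= en ((10 ^ 8 * line_const p) powr p) * ?N"
 proof (intro mrm en_leI)
 have "4 powr p * (4 * (16 * (100000 * line_const p) powr p)) = 64 powr 1 * (4 powr p * (100000 * line_const p) powr p)" by simp
 also have "... <= 64 powr p * (4 powr p * (100000 * line_const p) powr p)"
 using p by (intro mrm powr_mono) auto
 also have "... = (64 * (4 * (100000 * line_const p))) powr p" by (simp only: powr_mult)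
 also have "... <= (10 ^ 8 * line_const p) powr p" using p line_const_ge(1)[OF p] by (intro powr_mono2) auto
 finally show "4 powr p * (4 * (16 * (100000 * line_const p) powr p)) <= (10 ^ 8 * line_const p) powr p" .
 qed simp
 finally show "(NN x|lborel. ?H m x) <= en ((10 ^ 8 * line_const p) powr p) * ?N" .
 qed
 finally show ?thesis by (simp add: Liminf_const)
qed

section \<open>Lebesgue and Gaussian measure in \<open>d\<close> dimensions\<close>

text \<open>Lebesgue measure before completion: measurability of sections and Fubini are available
  here, and the completed \<open>leb d\<close> returns only in \<open>riesz_bound\<close>.\<close>

definition ld :: "nat => (nat => real) measure" where
 "ld d = Pi\<^sub>M {..<d} (%_. lborel)"

text \<open>Standard Gaussian measure, the law of the random direction \<open>z\<close>;
  \<open>z\<close> is not normalised to length 1.\<close>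

definition gd :: "nat => (nat => real) measure" where
 "gd d = Pi\<^sub>M {..<d} (%_. density lborel nd)"

definition vadd :: "nat => (nat => real) => real => (nat => real) => (nat => real)" where
 "vadd d x r z = (\<lambda>i\<in>{..<d}. x i + r * z i)"

definition vscale :: "nat => real => (nat => real) => (nat => real)" where
 "vscale d r z = (\<lambda>i\<in>{..<d}. r * z i)"

lemma sets_ld_gd [measurable_cong]: "sets (gd d) = sets (ld d)"
 unfolding ld_def gd_def by (intro sets_PiM_cong) auto

lemma space_gd: "space (gd d) = space (ld d)"
 using sets_ld_gd by (rule sets_eq_imp_space_eq)

lemma space_ld: "space (ld d) = {..<d} \<rightarrow>\<^sub>E UNIV"
 by (simp add: ld_def space_PiM)

interpretation lebP: product_sigma_finite "%_::nat. lborel :: real measure"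
 by standard

lemma sigma_finite_ld: "sigma_finite_measure (ld d)"
 unfolding ld_def by (rule lebP.sigma_finite) simp

interpretation std_normal: prob_space "density lborel nd"
 by (rule prob_space_normal_density) simp

interpretation gaussP: product_sigma_finite "%_::nat. density lborel nd"
 by standard

lemma prob_space_gd: "prob_space (gd d)"
 unfolding gd_def by (intro prob_space_PiM std_normal.prob_space_axioms)

lemma sigma_finite_gd: "sigma_finite_measure (gd d)"
 using prob_space_gd prob_space_imp_sigma_finite by blast

lemma pair_sigma_finite_ld: "pair_sigma_finite (ld d) (ld d)" "pair_sigma_finite (ld d) (gd d)" "pair_sigma_finite (gd d) (ld d)"
 "pair_sigma_finite (gd d) (gd d)"  "pair_sigma_finite (gd d) (lborel :: real measure)" "pair_sigma_finite (ld d) (lborel :: real measure)"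
 "pair_sigma_finite (lborel :: real measure) (ld d)"  "pair_sigma_finite (lborel :: real measure) (gd d)"
 by (intro pair_sigma_finite.intro sigma_finite_ld sigma_finite_gd sigma_finite_lborel)+

lemma ld_comp: "i < d ==> (%x. x i) : bm (ld d)"
 unfolding ld_def using measurable_component_singleton[of i "{..<d}" "%_. lborel :: real measure"] by simp

lemma measurable_ld_const: "x : space (ld d) ==> (%_. x) : measurable N (ld d)"
 by simp

lemma measurable_ldI:
 assumes "!!i. i < d ==> (%x. F x i) : bm M"
 shows "(%x. \<lambda>i\<in>{..<d}. F x i) : measurable M (ld d)"
 unfolding ld_def by (rule measurable_restrict) (use assms in simp)

lemma measurable_vadd [measurable (raw)]:
 assumes [measurable]: "f : measurable M (ld d)" "g : bm M" "h : measurable M (ld d)"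
 shows "(%x. vadd d (f x) (g x) (h x)) : measurable M (ld d)"
 unfolding vadd_def
proof (rule measurable_ldI)
 fix i assume i: "i < d"
 have [measurable]: "(%x. f x i) : bm M" "(%x. h x i) : bm M"
 using measurable_compose[OF assms(1) ld_comp[OF i]] measurable_compose[OF assms(3) ld_comp[OF i]] by auto
 show "(%x. f x i + g x * h x i) : bm M" by measurable
qed

lemma measurable_vscale [measurable (raw)]:
 assumes [measurable]: "g : bm M" "h : measurable M (ld d)"
 shows "(%x. vscale d (g x) (h x)) : measurable M (ld d)"
 unfolding vscale_def
proof (rule measurable_ldI)
 fix i assume i: "i < d"
 have [measurable]: "(%x. h x i) : bm M"
 using measurable_compose[OF assms(2) ld_comp[OF i]] by auto
 show "(%x. g x * h x i) : bm M" by measurable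
qed

lemma ld_affine:
 fixes a :: "nat => real" and c :: real assumes c: "c ~= 0"
 shows "density (distr (ld d) (ld d) (%x. \<lambda>i\<in>{..<d}. a i + c * x i)) (%_. en (abs c ^ d)) = ld d"
 (is "?P = _")
proof -
 let ?T = "%x. \<lambda>i\<in>{..<d}. a i + c * x i :: real"
 let ?A = "%i A. en (abs c) * emeasure lborel {x. a i + c * x : A i}"
 let ?B = "%A. Pi\<^sub>E {..<d} (%i. {x. a i + c * x : A i})"
 let ?C = "%A i. emeasure lborel (A i)"
 have T [measurable]: "?T : measurable (ld d) (ld d)"
 by (rule measurable_ldI) (intro borel_measurable_add borel_measurable_times borel_measurable_const ld_comp)
 have "?P = Pi\<^sub>M {..<d} (%_. lborel)"
 proof (rule lebP.PiM_eqI)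
 show "sets ?P = sets (Pi\<^sub>M {..<d} (%_. lborel))" by (simp add: ld_def)
 next
 fix A :: "nat => real set" assume A: "!!i. i : {..<d} ==> A i : sets lborel"
 have PA [measurable]: "Pi\<^sub>E {..<d} A : sets (ld d)" unfolding ld_def using A by (intro sets_PiM_I_finite) auto
 have eq: "?T -` Pi\<^sub>E {..<d} A Int space (ld d) = ?B A"
 by (rule set_eqI) (simp add: space_ld restrict_PiE_iff PiE_iff conj_commute)
 have one: "?A i A = ?C A i" if i: "i < d" for i
 proof -
 have [measurable]: "A i : sets borel" using A[of i] i by simp
 have "?C A i = emeasure (density (distr lborel borel (%x. a i + c * x)) (%_. en (abs c))) (A i)"
 using lborel_real_affine[OF c, of "a i"] by simp
 also have "... = ?A i A"
 by (subst emeasure_density_const) (auto simp: emeasure_distr vimage_def)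
 finally show ?thesis ..
 qed
 have "emeasure ?P (Pi\<^sub>E {..<d} A) = en (abs c ^ d) * emeasure (ld d) (?B A)"
 by (subst emeasure_density_const) (auto simp: emeasure_distr eq)
 also have "emeasure (ld d) (?B A) = (\<Prod>i<d. emeasure lborel {x. a i + c * x : A i})"
 unfolding ld_def
 proof (rule lebP.emeasure_PiM)
 fix i assume "i : {..<d}"
 hence [measurable]: "A i : sets borel" using A[of i] by simp
 show "{x. a i + c * x : A i} : sets lborel" by simp
 qed simp
 also have "en (abs c ^ d) * ... = (\<Prod>i<d. ?A i A)"
 by (simp add: prod.distrib ennreal_power)
 also have "... = (\<Prod>i<d. ?C A i)" by (intro prod.cong) (auto simp: one)
 finally show "emeasure ?P (Pi\<^sub>E {..<d} A) = (\<Prod>i\<in>{..<d}. ?C A i)" .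
 qed simp
 thus ?thesis by (simp add: ld_def)
qed

lemma nn_integral_ld_affine:
 fixes a :: "nat => real" and c :: real
 assumes c: "c ~= 0" and [measurable]: "f : bm (ld d)"
 shows "en (abs c ^ d) * (NN x|ld d. f (\<lambda>i\<in>{..<d}. a i + c * x i)) = (NN x|ld d. f x)"
proof -
 have [measurable]: "(%x. \<lambda>i\<in>{..<d}. a i + c * x i) : measurable (ld d) (ld d)"
 by (rule measurable_ldI) (intro borel_measurable_add borel_measurable_times borel_measurable_const ld_comp)
 have "(NN x|ld d. f x) = (NN x|density (distr (ld d) (ld d) (%x. \<lambda>i\<in>{..<d}. a i + c * x i)) (%_. en (abs c ^ d)). f x)"
 by (simp only: ld_affine[OF c])
 also have "... = en (abs c ^ d) * (NN x|ld d. f (\<lambda>i\<in>{..<d}. a i + c * x i))"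
 by (simp add: nn_integral_density nn_integral_distr nn_cmult)
 finally show ?thesis ..
qed

lemma nn_integral_ld_vadd:
 assumes [measurable]: "f : bm (ld d)"
 shows "(NN x|ld d. f (vadd d x r z)) = (NN x|ld d. f x)"
 using nn_integral_ld_affine[of 1 f d "%i. r * z i"] by (simp add: vadd_def add.commute)

lemma nn_integral_ld_vscale:
 assumes "r ~= 0" and [measurable]: "f : bm (ld d)"
 shows "en (abs r ^ d) * (NN x|ld d. f (vscale d r x)) = (NN x|ld d. f x)"
 using nn_integral_ld_affine[of r f d "%i. 0"] assms by (simp add: vscale_def)

definition gdens :: "nat => (nat => real) => real" where
 "gdens d x = (\<Prod>i<d. nd (x i))"

lemma gdens_nonneg: "0 <= gdens d x"
 unfolding gdens_def by (intro prod_nonneg) simp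

lemma gdens_eq: "gdens d x = (2 * pi) powr (- real d / 2) * exp (- (SUM i<d. (x i)^2) / 2)"
proof -
 have "gdens d x = (1 / sqrt (2 * pi)) ^ d * exp (SUM i<d. - (x i)\<^sup>2 / 2)"
 unfolding gdens_def std_normal_density_def prod.distrib exp_sum[OF finite_lessThan] by simp
 also have "(1 / sqrt (2 * pi)) ^ d = ((2 * pi) powr (- 1 / 2)) ^ d"
 by (simp add: powr_half_sqrt[symmetric] powr_minus_divide)
 also have "... = (2 * pi) powr (- real d / 2)"
 by (subst powr_realpow[symmetric]) (auto simp: powr_powr)
 also have "(SUM i<d. - (x i)\<^sup>2 / 2) = - (SUM i<d. (x i)^2) / 2" by (simp add: sum_divide_distrib sum_negf)
 finally show ?thesis .
qed

lemma borel_measurable_gdens [measurable]: "gdens d : bm (ld d)"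
 unfolding gdens_def
 by (intro borel_measurable_prod measurable_compose[OF ld_comp borel_measurable_normal_density]) simp

lemma gd_density: "gd d = density (ld d) (%x. en (gdens d x))"
proof -
 let ?A = "density (ld d) (%x. en (gdens d x))"
 let ?B = "density lborel nd"
 let ?C = "%A. Pi\<^sub>E {..<d} A"
 let ?D = "%x A. (\<Prod>i<d. en (nd (x i)) * indicator (A i) (x i))"
 have "?A = Pi\<^sub>M {..<d} (%_. ?B)"
 proof (rule gaussP.PiM_eqI)
 show "sets ?A = sets (Pi\<^sub>M {..<d} (%_. ?B))"
 using sets_ld_gd[of d] by (simp add: gd_def)
 next
 fix A :: "nat => real set" assume A: "!!i. i : {..<d} ==> A i : sets ?B"
 have PA [measurable]: "?C A : sets (ld d)" unfolding ld_def using A by (intro sets_PiM_I_finite) auto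
 have "emeasure ?A (?C A)
 = (NN x|ld d. en (gdens d x) * indicator (?C A) x)"
 by (rule emeasure_density) auto
 also have "... = (NN x|ld d. ?D x A)"
 proof (rule nn_cong)
 fix x assume x: "x : space (ld d)"
 have "indicator (?C A) x = (\<Prod>i<d. indicator (A i) (x i) :: ennreal)"
 proof (cases "x : ?C A")
 case False
 then obtain i where "i < d" "x i ~: A i" using x by (auto simp: PiE_iff space_ld)
 hence "(\<Prod>i<d. indicator (A i) (x i) :: ennreal) = 0" by (auto simp: ind_def)
 thus ?thesis using False by simp
 qed (auto simp: PiE_iff)
 thus "en (gdens d x) * indicator (?C A) x = ?D x A"
 by (simp add: gdens_def prod_ennreal prod.distrib)
 qed
 also have "... = (\<Prod>i<d. (NN x|lborel. en (nd x) * indicator (A i) x))"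
 unfolding ld_def using A by (intro lebP.product_nn_integral_prod) auto
 also have "... = (\<Prod>i\<in>{..<d}. emeasure ?B (A i))"
 using A by (intro prod.cong refl emeasure_density[symmetric]) auto
 finally show "emeasure ?A (?C A) = ..." .
 qed simp
 thus ?thesis by (simp add: gd_def)
qed

text \<open>Disintegration along the direction \<open>z\<close>: the weight \<open>w\<close> has integral \<open>1\<close> on every line parallel to \<open>z\<close>.\<close>

lemma nn_integral_ld_lines:
 assumes z: "z : space (ld d)" and i: "i < d" "z i ~= 0" and [measurable]: "\<Phi> : bm (ld d)"
 shows "(NN x|ld d. \<Phi> x) = (NN x|ld d. indicator {x. 0 <= x i / z i & x i / z i < 1} x * (NN s|lborel. \<Phi> (vadd d x s z)))"
proof -
 let ?A = "%w x s. w (vadd d x (- s) z) * \<Phi> x"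
 let ?B = "%x s. \<Phi> (vadd d x s z)"
 interpret P: pair_sigma_finite "ld d" "lborel :: real measure" by (rule pair_sigma_finite_ld)
 have xi: "(%x. x i) : bm (ld d)" using i by (simp add: ld_comp)
 note [measurable] = z
 define w :: "(nat => real) => ennreal" where "w = indicator {x. 0 <= x i / z i & x i / z i < 1}"
 have wdef: "w x = (if 0 <= x i / z i & x i / z i < 1 then 1 else 0)" for x by (simp add: w_def ind_def)
 have [measurable]: "w : bm (ld d)"
 proof -
 note [measurable] = xi
 show ?thesis unfolding wdef by measurable
 qed
 have w1: "(NN s|lborel. w (vadd d x (- s) z)) = 1" for x
 proof -
 have "(NN s|lborel. w (vadd d x (- s) z)) = (NN s|lborel. indicator {x i / z i - 1 <.. x i / z i} s)"
 using i by (intro nn_cong) (auto simp: wdef vadd_def diff_divide_distrib)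
 also have "... = 1" by simp
 finally show ?thesis .
 qed
 have inv: "vadd d (vadd d x s z) (- s) z = x" if "x : space (ld d)" for x s
 using that by (auto simp: vadd_def space_ld PiE_iff extensional_def fun_eq_iff)
 have "(NN x|ld d. w x * (NN s|lborel. ?B x s)) = (NN x|ld d. (NN s|lborel. w x * ?B x s))"
 proof (rule nn_cong)
 fix x assume x: "x : space (ld d)"
 have "(%s. ?B x s) : bm lborel"
 using measurable_ld_const[OF x, of lborel] by measurable
 thus "w x * (NN s|lborel. ?B x s) = (NN s|lborel. w x * ?B x s)"
 by (rule nn_cmult[symmetric])
 qed
 also have "... = (NN s|lborel. (NN x|ld d. w x * ?B x s))"
 proof -
 have "(%(x, s). w x * ?B x s) : bm (ld d \<Otimes>\<^sub>M lborel)" by measurable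
 from P.Fubini'[OF this] show ?thesis by simp
 qed
 \<comment> \<open>For fixed \<open>s\<close> a translation by \<open>s\<close> along
   \<open>z\<close> moves the shift from \<open>\<Phi>\<close> to the weight.\<close>
 also have "... = (NN s|lborel. (NN x|ld d. ?A w x s))"
 proof (rule nn_cong)
 fix s
 have "(NN x|ld d. w x * ?B x s) = (NN x|ld d. w (vadd d (vadd d x s z) (- s) z) * ?B x s)"
 by (intro nn_cong) (simp add: inv)
 also have "... = (NN x|ld d. ?A w x s)"
 proof -
 have "(%x. ?A w x s) : bm (ld d)" by measurable
 from nn_integral_ld_vadd[OF this, of s z] show ?thesis .
 qed
 finally show "(NN x|ld d. w x * ?B x s) = (NN x|ld d. ?A w x s)" .
 qed
 also have "... = (NN x|ld d. (NN s|lborel. ?A w x s))"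
 proof -
 have "(%(x, s). ?A w x s) : bm (ld d \<Otimes>\<^sub>M lborel)" by measurable
 thus ?thesis by (rule P.Fubini'[where f="%x s. ?A w x s"])
 qed
 also have "... = (NN x|ld d. \<Phi> x)"
 proof (rule nn_cong)
 fix x assume x: "x : space (ld d)"
 have "(%s. w (vadd d x (- s) z)) : bm lborel"
 using measurable_ld_const[OF x, of lborel] by measurable
 thus "(NN s|lborel. ?A w x s) = \<Phi> x"
 by (simp add: nn_integral_multc w1)
 qed
 finally show ?thesis unfolding w_def ..
qed

section \<open>Hilbert transforms along a direction\<close>

definition dtr :: "nat => real => real => (nat => real) => ((nat => real) => complex) => (nat => real) => complex" where
 "dtr d a b z f x = (LINT r|lborel. (indicator {r. a < abs r & abs r <= b} r / r) *\<^sub>R f (vadd d x (- r) z))"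

lemma vadd_vadd: "vadd d (vadd d x s z) r z = vadd d x (s + r) z"
 by (auto simp: vadd_def distrib_right fun_eq_iff)

lemma dtr_line: "dtr d a b z f (vadd d x s z) = htr a b (%s. f (vadd d x s z)) s"
 by (simp add: dtr_def htr_def vadd_vadd)

lemma borel_measurable_dtr:
 assumes [measurable]: "F : bm (M \<Otimes>\<^sub>M ld d)" "a : bm M" "b : bm M"
 "z : measurable M (ld d)" "g : measurable M (ld d)"
 shows "(%y. dtr d (a y) (b y) (z y) (%x. F (y, x)) (g y)) : bm M"
proof -
 have "(%yr. F (fst yr, vadd d (g (fst yr)) (- snd yr) (z (fst yr)))) : bm (M \<Otimes>\<^sub>M lborel)"
 by measurable
 hence [measurable]: "(%(y, r). F (y, vadd d (g y) (- r) (z y))) : bm (M \<Otimes>\<^sub>M lborel)"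
 by (simp add: case_prod_unfold)
 have "(%y. (LINT r|lborel. ((if a y < abs r & abs r <= b y then 1 else 0) / r) *\<^sub>R F (y, vadd d (g y) (- r) (z y)))) : bm M"
 by measurable
 thus ?thesis unfolding dtr_def ind_def[abs_def] by (simp add: of_bool_def)
qed

lemma borel_measurable_dtr_fixed [measurable (raw)]:
 assumes [measurable]: "f : bm (ld d)" "a : bm M" "b : bm M"
 "z : measurable M (ld d)" "g : measurable M (ld d)"
 shows "(%y. dtr d (a y) (b y) (z y) f (g y)) : bm M"
 using borel_measurable_dtr[of "%yx. f (snd yx)" M d a b z g] by simp

text \<open>On every line parallel to \<open>z\<close> the operator is \<open>htr\<close>, and
  \<open>nn_integral_ld_lines\<close> reassembles the lines; so the constant is the one of the line
  and free of \<open>d\<close>.\<close>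

theorem dtr_maximal:
 fixes n :: nat
 assumes z: "z : space (ld d)" and nz: "EX i<d. z i ~= 0" and [measurable]: "f : bm (ld d)"
 and a: "!!i. 0 < a i" and p: "1 < p"
 shows "(NN x|ld d. (SUP i\<in>{..<n}. np p (dtr d (a i) (b i) z f x)))
 <= en ((10 ^ 8 * line_const p) powr p) * (NN x|ld d. np p (f x))"
proof -
 let ?B = "%x. (NN s|lborel. np p (f (vadd d x s z)))"
 let ?C = "%x. (NN s|lborel. (SUP i\<in>{..<n}. np p (dtr d (a i) (b i) z f (vadd d x s z))))"
 note [measurable] = z
 obtain i where i: "i < d" "z i ~= 0" using nz by blast
 let ?w = "indicator {x. 0 <= x i / z i & x i / z i < 1} :: _ => ennreal"
 let ?A = "en ((10 ^ 8 * line_const p) powr p)"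
 have xi: "(%x. x i) : bm (ld d)" using i by (simp add: ld_comp)
 have wm [measurable]: "?w : bm (ld d)"
 proof -
 note [measurable] = xi
 have "(%x. if 0 <= x i / z i & x i / z i < 1 then 1 else 0 :: ennreal) : bm (ld d)" by measurable
 thus ?thesis by (simp add: ind_def[abs_def] of_bool_def)
 qed
 have [measurable]: "(%x. dtr d (a i) (b i) z f x) : bm (ld d)" for i by measurable
 have "(NN x|ld d. (SUP i\<in>{..<n}. np p (dtr d (a i) (b i) z f x)))
 = (NN x|ld d. ?w x * (?C x))"
 by (rule nn_integral_ld_lines[OF z i]) measurable
 also have "... <= (NN x|ld d. ?w x * (?A * (?B x)))"
 proof (rule nn_mono)
 fix x assume x: "x : space (ld d)"
 have [measurable]: "(%s. f (vadd d x s z)) : bm lborel"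
 using measurable_ld_const[OF x, of lborel] by measurable
 have "(?C x) <= ?A * (?B x)"
 unfolding dtr_line by (rule htr_maximal[OF _ a p]) simp
 thus "?w x * (?C x) <= ?w x * (?A * (?B x))"
 by (rule mlm) simp
 qed
 also have "... = (NN x|ld d. ?A * (?w x * (?B x)))"
 by (simp add: mult_ac)
 also have "... = ?A * (NN x|ld d. ?w x * (?B x))"
 proof (rule nn_cmult)
 have "(%x. (NN s|lborel. np p (f (vadd d x s z)))) : bm (ld d)" by measurable
 with wm show "(%x. ?w x * (?B x)) : bm (ld d)"
 by (rule borel_measurable_times_ennreal)
 qed
 also have "(NN x|ld d. ?w x * (?B x)) = (NN x|ld d. np p (f x))"
 by (rule nn_integral_ld_lines[OF z i, symmetric]) measurable
 finally show ?thesis .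
qed

section \<open>Homogeneous polynomials and their derivatives\<close>

text \<open>The recursive form makes every fact about homogeneous polynomials an induction on the
  degree. The functions \<open>Q j\<close> are not unique. The predicate speaks of all points of
  type \<open>nat => real\<close>, not only of \<open>Rd d\<close>.\<close>

fun HP :: "nat => nat => ((nat => real) => complex) => bool" where
 "HP d 0 P <-> (EX c. P = (%_. c))"
| "HP d (Suc k) P <-> (EX Q. (ALL j<d. HP d k (Q j)) & P = (%x. SUM j<d. of_real (x j) * Q j x))"

lemma HP_SucI: "(!!j. j < d ==> HP d k (Q j)) ==> HP d (Suc k) (%x. SUM j<d. of_real (x j) * Q j x)"
 by auto

lemma HP_SucE:
 assumes "HP d (Suc k) P"
 obtains Q where "!!j. j < d ==> HP d k (Q j)" "P = (%x. SUM j<d. of_real (x j) * Q j x)"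
 using assms by auto

declare HP.simps(2) [simp del]

lemma HP_zero: "HP d k (%_. 0)"
proof (induction k)
 case (Suc k)
 hence "HP d (Suc k) (%x. SUM j<d. of_real (x j) * (%_ _. 0) j x)" by (intro HP_SucI)
 thus ?case by simp
qed auto

lemma HP_add: "HP d k P ==> HP d k Q ==> HP d k (%x. P x + Q x)"
proof (induction k arbitrary: P Q)
 case (Suc k)
 from Suc.prems(1) obtain A where A: "!!j. j < d ==> HP d k (A j)" "P = (%x. SUM j<d. of_real (x j) * A j x)" by (rule HP_SucE) blast
 from Suc.prems(2) obtain B where B: "!!j. j < d ==> HP d k (B j)" "Q = (%x. SUM j<d. of_real (x j) * B j x)" by (rule HP_SucE) blast
 have "HP d (Suc k) (%x. SUM j<d. of_real (x j) * (A j x + B j x))"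
 using A B Suc.IH by (intro HP_SucI) auto
 thus ?case using A(2) B(2) by (simp add: distrib_left sum.distrib)
qed auto

lemma HP_cmult: "HP d k P ==> HP d k (%x. c * P x)"
proof (induction k arbitrary: P)
 case (Suc k)
 from Suc.prems obtain A where A: "!!j. j < d ==> HP d k (A j)" "P = (%x. SUM j<d. of_real (x j) * A j x)" by (rule HP_SucE) blast
 have "HP d (Suc k) (%x. SUM j<d. of_real (x j) * (c * A j x))"
 using A Suc.IH by (intro HP_SucI) auto
 thus ?case using A(2) by (simp add: sum_cmult mult_ac)
qed auto

lemma HP_sum: "(!!i. i : I ==> HP d k (P i)) ==> HP d k (%x. SUM i:I. P i x)"
 by (induction I rule: infinite_finite_induct) (auto simp: HP_zero HP_add)

lemma HP_coord: assumes "j < d" "HP d k P" shows "HP d (Suc k) (%x. of_real (x j) * P x)"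
proof -
 have "HP d (Suc k) (%x. SUM i<d. of_real (x i) * (if i = j then P else (%_. 0)) x)"
 using assms by (intro HP_SucI) (auto simp: HP_zero)
 moreover have "(SUM i<d. of_real (x i) * (if i = j then P else (%_. 0)) x) = of_real (x j) * P x" for x
 using assms(1) by (subst sum.remove[of _ j]) (auto intro!: sum.neutral)
 ultimately show ?thesis by simp
qed

lemma HP_cnj: "HP d k P ==> HP d k (%x. cnj (P x))"
proof (induction k arbitrary: P)
 case (Suc k)
 from Suc.prems obtain A where A: "!!j. j < d ==> HP d k (A j)" "P = (%x. SUM j<d. of_real (x j) * A j x)" by (rule HP_SucE) blast
 have "HP d (Suc k) (%x. SUM j<d. of_real (x j) * cnj (A j x))" using A(1) Suc.IH by (intro HP_SucI) auto
 thus ?case by (simp add: A(2))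
qed auto

lemma HP_mult: "HP d k P ==> HP d l Q ==> HP d (k + l) (%x. P x * Q x)"
proof (induction k arbitrary: P)
 case 0 thus ?case using HP_cmult by auto
next
 case (Suc k)
 from Suc.prems(1) obtain A where A: "!!j. j < d ==> HP d k (A j)" "P = (%x. SUM j<d. of_real (x j) * A j x)" by (rule HP_SucE) blast
 have "HP d (Suc (k + l)) (%x. SUM j<d. of_real (x j) * (A j x * Q x))"
 using A Suc.IH Suc.prems(2) by (intro HP_SucI) auto
 moreover have "(%x. P x * Q x) = (%x. SUM j<d. of_real (x j) * (A j x * Q x))"
 unfolding A(2) by (simp add: sum_distrib_right mult.assoc)
 ultimately show ?case by simp
qed

lemma HP_depends: "HP d k P ==> (!!i. i < d ==> x i = y i) ==> P x = P y"
proof (induction k arbitrary: P)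
 case (Suc k)
 from Suc.prems(1) obtain A where A: "!!j. j < d ==> HP d k (A j)" "P = (%x. SUM j<d. of_real (x j) * A j x)" by (rule HP_SucE) blast
 thus ?case using Suc by (auto intro!: sum.cong)
qed auto

lemma HP_homogeneous: "HP d k P ==> (!!i. i < d ==> y i = c * x i) ==> P y = of_real c ^ k * P x"
proof (induction k arbitrary: P)
 case (Suc k)
 from Suc.prems(1) obtain A where A: "!!j. j < d ==> HP d k (A j)" "P = (%x. SUM j<d. of_real (x j) * A j x)" by (rule HP_SucE) blast
 have "P y = (SUM j<d. of_real (c * x j) * (of_real c ^ k * A j x))"
 unfolding A(2) using Suc A by (intro sum.cong) auto
 thus ?case by (simp add: A(2) sum_cmult mult_ac)
qed auto

definition l1 :: "nat => (nat => real) => real" where "l1 d x = (SUM i<d. abs (x i))"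

lemma l1_nonneg [simp]: "0 <= l1 d x" by (simp add: l1_def sum_nonneg)

lemma HP_bound: "HP d k P ==> EX C>=0. ALL x. norm (P x) <= C * l1 d x ^ k"
proof (induction k arbitrary: P)
 case 0
 then obtain c where "P = (%_. c)" by auto
 thus ?case by (intro exI[of _ "norm c"]) auto
next
 case (Suc k)
 from Suc.prems(1) obtain A where A: "!!j. j < d ==> HP d k (A j)" "P = (%x. SUM j<d. of_real (x j) * A j x)" by (rule HP_SucE) blast
 have "ALL j. EX C>=0. j < d --> (ALL x. norm (A j x) <= C * l1 d x ^ k)"
 using Suc.IH[OF A(1)] by (metis order_refl)
 then obtain C where C: "!!j. 0 <= C j" "!!j x. j < d ==> norm (A j x) <= C j * l1 d x ^ k" by metis
 have "norm (P x) <= (SUM j<d. C j) * l1 d x ^ Suc k" for x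
 proof -
 have "norm (P x) <= (SUM j<d. abs (x j) * (C j * l1 d x ^ k))"
 unfolding A(2) by (intro order_trans[OF norm_sum] sum_mono) (auto simp: norm_mult intro!: mlm C)
 also have "... <= (SUM j<d. l1 d x * (C j * l1 d x ^ k))"
 using C(1) by (intro sum_mono mrm) (auto simp: l1_def intro!: member_le_sum)
 finally show ?thesis by (simp add: sum_distrib_right sum_cmult mult_ac)
 qed
 thus ?case using C(1) by (intro exI[of _ "SUM j<d. C j"]) (auto intro: sum_nonneg)
qed

lemma HP_measurable [measurable_dest]: "HP d k P ==> P : bm (ld d)"
proof (induction k arbitrary: P)
 case (Suc k)
 from Suc.prems(1) obtain A where A: "!!j. j < d ==> HP d k (A j)" "P = (%x. SUM j<d. of_real (x j) * A j x)" by (rule HP_SucE) blast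
 have "(%x. of_real (x j) * A j x) : bm (ld d)" if "j < d" for j
 proof -
 have [measurable]: "A j : bm (ld d)" "(%x. x j) : bm (ld d)"
 using Suc.IH A(1) that by (auto intro: ld_comp)
 show ?thesis by measurable
 qed
 thus ?case unfolding A(2) by (intro borel_measurable_sum) auto
qed auto

definition has_pd :: "nat => ((nat => real) => complex) => ((nat => real) => complex) => bool" where
 "has_pd j u D <-> (ALL x. ((%s. u (x(j := s))) has_vector_derivative D x) (at (x j)))"

lemma has_pd_pd: "has_pd j u D ==> pd j u = D"
 by (auto simp: has_pd_def partial_deriv_def vector_derivative_at fun_eq_iff)

lemma has_pd_const: "has_pd j (%_. c) (%_. 0)"
 by (simp add: has_pd_def)

lemma has_pd_coord: "has_pd j (%x. of_real (x i)) (%_. if i = j then 1 else 0)"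
 unfolding has_pd_def
 by (auto intro!: derivative_eq_intros has_vector_derivative_of_real[where D=1, simplified])

lemma has_pd_add: "has_pd j u D ==> has_pd j v E ==> has_pd j (%x. u x + v x) (%x. D x + E x)"
 unfolding has_pd_def by (auto intro: has_vector_derivative_add)

lemma has_pd_mult: "has_pd j u D ==> has_pd j v E ==> has_pd j (%x. u x * v x) (%x. D x * v x + u x * E x)"
 unfolding has_pd_def
proof
 fix x assume u: "ALL x. ((%s. u (x(j := s))) has_vector_derivative D x) (at (x j))"
 and v: "ALL x. ((%s. v (x(j := s))) has_vector_derivative E x) (at (x j))"
 from has_vector_derivative_mult[OF u[rule_format, of x] v[rule_format, of x]]
 show "((%s. u (x(j := s)) * v (x(j := s))) has_vector_derivative D x * v x + u x * E x) (at (x j))"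
 by (simp add: add.commute)
qed

lemma has_pd_sum:
 "(!!i. i : I ==> has_pd j (u i) (D i)) ==> has_pd j (%x. SUM i:I. u i x) (%x. SUM i:I. D i x)"
 by (induction I rule: infinite_finite_induct) (auto intro: has_pd_const has_pd_add)

lemma has_pd_cnj: "has_pd j u D ==> has_pd j (%x. cnj (u x)) (%x. cnj (D x))"
 unfolding has_pd_def by (auto intro: has_vector_derivative_cnj)

lemma HP_has_pd: "HP d k P ==> has_pd j P (pd j P)"
proof (induction k arbitrary: P)
 case 0
 then obtain c where "P = (%_. c)" by auto
 thus ?case using has_pd_const[of j c] has_pd_pd[OF has_pd_const[of j c]] by simp
next
 case (Suc k)
 from Suc.prems(1) obtain A where A: "!!j. j < d ==> HP d k (A j)" "P = (%x. SUM j<d. of_real (x j) * A j x)" by (rule HP_SucE) blast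
 have "has_pd j P (%x. SUM i<d. (if i = j then 1 else 0) * A i x + of_real (x i) * pd j (A i) x)"
 unfolding A(2) by (intro has_pd_sum has_pd_mult has_pd_coord Suc.IH A(1)) auto
 thus ?case by (simp add: has_pd_pd)
qed

lemma partial_deriv_HP_0: "HP d 0 P ==> pd j P = (%_. 0)"
 using has_pd_pd[OF has_pd_const[of j]] by auto

lemma partial_deriv_HP_Suc:
 assumes "!!i. i < d ==> HP d k (A i)" "j < d"
 shows "pd j (%x. SUM i<d. of_real (x i) * A i x) = (%x. A j x + (SUM i<d. of_real (x i) * pd j (A i) x))"
proof -
 have "has_pd j (%x. SUM i<d. of_real (x i) * A i x) (%x. SUM i<d. (if i = j then 1 else 0) * A i x + of_real (x i) * pd j (A i) x)"
 by (intro has_pd_sum has_pd_mult has_pd_coord HP_has_pd[OF assms(1)]) auto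
 moreover have "(SUM i<d. (if i = j then 1 else 0) * A i x) = A j x" for x
 using assms(2) by (simp add: if_distrib[of "%c. c * _"] cong: if_cong)
 ultimately show ?thesis by (simp add: has_pd_pd sum.distrib)
qed

lemma HP_partial_deriv: "HP d (Suc k) P ==> j < d ==> HP d k (pd j P)"
proof (induction k arbitrary: P)
 case 0
 from 0(1) obtain A where A: "!!j. j < d ==> HP d 0 (A j)" "P = (%x. SUM j<d. of_real (x j) * A j x)" by (rule HP_SucE) blast
 have pdA: "pd j P = (%x. A j x + (SUM i<d. of_real (x i) * pd j (A i) x))"
 unfolding A(2) by (rule partial_deriv_HP_Suc[OF A(1) 0(2)])
 have "pd j P = A j"
 unfolding pdA using partial_deriv_HP_0[OF A(1)] by auto
 thus ?case using A(1)[OF 0(2)] by simp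
next
 case (Suc k)
 from Suc.prems(1) obtain A where A: "!!j. j < d ==> HP d (Suc k) (A j)" "P = (%x. SUM j<d. of_real (x j) * A j x)" by (rule HP_SucE) blast
 have pdA: "pd j P = (%x. A j x + (SUM i<d. of_real (x i) * pd j (A i) x))"
 unfolding A(2) by (rule partial_deriv_HP_Suc[OF A(1) Suc.prems(2)])
 show ?case unfolding pdA
 using A(1) Suc.IH Suc.prems(2) by (intro HP_add HP_SucI) auto
qed

lemma HP_Euler: "HP d k P ==> (SUM j<d. of_real (x j) * pd j P x) = of_nat k * P x"
proof (induction k arbitrary: P)
 case 0 thus ?case using partial_deriv_HP_0 by simp
next
 case (Suc k)
 from Suc.prems(1) obtain A where A: "!!j. j < d ==> HP d k (A j)" "P = (%x. SUM j<d. of_real (x j) * A j x)" by (rule HP_SucE) blast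
 have "(SUM j<d. of_real (x j) * pd j P x) = (SUM j<d. of_real (x j) * (A j x + (SUM i<d. of_real (x i) * pd j (A i) x)))"
 unfolding A(2) by (intro sum.cong refl) (simp add: partial_deriv_HP_Suc[OF A(1)])
 also have "... = P x + (SUM j<d. SUM i<d. of_real (x i) * (of_real (x j) * pd j (A i) x))"
 by (simp add: A(2) distrib_left sum.distrib sum_cmult mult_ac)
 also have "(SUM j<d. SUM i<d. of_real (x i) * (of_real (x j) * pd j (A i) x)) = (SUM i<d. of_real (x i) * (SUM j<d. of_real (x j) * pd j (A i) x))"
 by (subst sum.swap) (simp add: sum_cmult)
 also have "... = (SUM i<d. of_real (x i) * (of_nat k * A i x))" by (intro sum.cong refl) (simp add: Suc.IH A(1))
 also have "... = of_nat k * P x" by (simp add: A(2) sum_cmult mult_ac)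
 finally show ?case by (simp add: algebra_simps)
qed

lemma HP_0_or_pd: "HP d k P ==> j < d ==> HP d (k - 1) (pd j P)"
 by (cases k) (auto simp: partial_deriv_HP_0 HP_zero simp del: HP.simps intro: HP_partial_deriv)

text \<open>The product rule expresses the mixed derivative through those of the factors by a
  formula whose terms are merely permuted when \<open>i\<close> and \<open>j\<close> are exchanged,
  once the induction hypothesis is used.\<close>

lemma HP_pd_commute: "HP d k P ==> i < d ==> j < d ==> pd i (pd j P) = pd j (pd i P)"
proof (induction k arbitrary: P)
 case 0
 have "pd i (%_. 0) = (%_. 0)" for i using has_pd_pd[OF has_pd_const] by blast
 thus ?case using partial_deriv_HP_0[OF 0(1)] by simp
next
 case (Suc k)
 from Suc.prems(1) obtain A where A: "!!j. j < d ==> HP d k (A j)" "P = (%x. SUM j<d. of_real (x j) * A j x)" by (rule HP_SucE) blast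
 have *: "pd i (pd j P) = (%x. pd i (A j) x + (pd j (A i) x + (SUM l<d. of_real (x l) * pd i (pd j (A l)) x)))"
 if ij: "i < d" "j < d" for i j
 proof -
 have "has_pd i (%x. A j x + (SUM l<d. of_real (x l) * pd j (A l) x))
 (%x. pd i (A j) x + (SUM l<d. (if l = i then 1 else 0) * pd j (A l) x + of_real (x l) * pd i (pd j (A l)) x))"
 using ij by (intro has_pd_add has_pd_sum has_pd_mult has_pd_coord HP_has_pd[OF A(1)] HP_has_pd[OF HP_0_or_pd[OF A(1)]]) auto
 moreover have "(SUM l<d. (if l = i then 1 else 0) * pd j (A l) x) = pd j (A i) x" for x
 using ij by (simp add: if_distrib[of "%c. c * _"] cong: if_cong)
 moreover have "pd j P = (%x. A j x + (SUM i<d. of_real (x i) * pd j (A i) x))"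
 unfolding A(2) by (rule partial_deriv_HP_Suc[OF A(1) ij(2)])
 ultimately show ?thesis by (simp add: has_pd_pd sum.distrib)
 qed
 show ?case
 unfolding *[OF Suc.prems(2,3)] *[OF Suc.prems(3,2)]
 using Suc.IH[OF A(1) Suc.prems(2,3)] by (auto simp: fun_eq_iff intro!: sum.cong)
qed

lemma laplacian_HP_0: "HP d 0 P ==> laplacian d P x = 0" "HP d (Suc 0) P ==> laplacian d P x = 0"
proof -
 have z: "pd i (%_. 0) = (%_. 0)" for i using has_pd_pd[OF has_pd_const] by blast
 show "laplacian d P x = 0" if "HP d 0 P" unfolding laplacian_def by (simp add: partial_deriv_HP_0[OF that] z)
 show "laplacian d P x = 0" if "HP d (Suc 0) P"
 proof -
 have "pd j (pd j P) x = 0" if "j < d" for j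
 using partial_deriv_HP_0[OF HP_partial_deriv[OF `HP d (Suc 0) P` that]] by simp
 thus ?thesis by (simp add: laplacian_def)
 qed
qed

section \<open>Harmonic polynomials\<close>

text \<open>Harmonicity is demanded at every point of type \<open>nat => real\<close>, so that
  partial derivatives, which change single coordinates, stay in the class.\<close>

definition HH :: "nat => nat => ((nat => real) => complex) => bool" where
 "HH d k P <-> HP d k P & (ALL x. laplacian d P x = 0)"

lemma HH_imp_HP: "HH d k P ==> HP d k P" by (simp add: HH_def)

lemma HH_partial_deriv:
 assumes P: "HH d (Suc k) P" and j: "j < d" shows "HH d k (pd j P)"
proof -
 let ?A = "%x. SUM i<d. pd i (pd i P) x"
 have HP: "HP d (Suc k) P" using P by (rule HH_imp_HP)
 have "laplacian d (pd j P) x = 0" for x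
 proof -
 have "laplacian d (pd j P) x = (SUM i<d. pd j (pd i (pd i P)) x)"
 unfolding laplacian_def
 proof (intro sum.cong refl)
 fix i assume "i : {..<d}"
 hence i: "i < d" by simp
 have "pd i (pd i (pd j P)) = pd i (pd j (pd i P))"
 using HP_pd_commute[OF HP i j] by simp
 also have "... = pd j (pd i (pd i P))"
 by (rule HP_pd_commute[OF HP_partial_deriv[OF HP i] i j])
 finally show "pd i (pd i (pd j P)) x = pd j (pd i (pd i P)) x" by simp
 qed
 also have "... = pd j ?A x"
 proof -
 have "has_pd j ?A (%x. SUM i<d. pd j (pd i (pd i P)) x)"
 by (intro has_pd_sum HP_has_pd[OF HP_0_or_pd[OF HP_partial_deriv[OF HP]]]) auto
 thus ?thesis by (simp add: has_pd_pd)
 qed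
 also have "?A = (%_. 0)"
 using P by (simp add: HH_def laplacian_def)
 also have "pd j (%_. 0 :: complex) = (%_. 0)" using has_pd_pd[OF has_pd_const] by blast
 finally show ?thesis .
 qed
 thus ?thesis using HP_partial_deriv[OF HP j] by (simp add: HH_def)
qed

lemma HP_monomial: "finite I ==> I <= {..<d} ==> HP d (SUM i:I. \<alpha> i) (%x. \<Prod>i\<in>I. complex_of_real (x i) ^ \<alpha> i)"
proof (induction rule: finite_induct[of I])
 case (insert j I)
 have "HP d n (%x. complex_of_real (x j) ^ n)" for n
 using insert by (induction n) (auto intro: HP_coord simp del: HP.simps(2))
 thus ?case using insert HP_mult by auto
qed auto

lemma homogeneous_polynomial_HP:
 assumes "homogeneous_polynomial d k P"
 obtains P' where "HP d k P'" "!!x. x : Rd d ==> P x = P' x"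
proof -
 from assms obtain c where c: "!!x. x : Rd d ==> P x = (SUM \<alpha>:multi_indices d k. c \<alpha> * (\<Prod>i<d. complex_of_real (x i) ^ \<alpha> i))"
 unfolding homogeneous_polynomial_def by blast
 have "HP d k (%x. SUM \<alpha>:multi_indices d k. c \<alpha> * (\<Prod>i<d. complex_of_real (x i) ^ \<alpha> i))"
 proof (intro HP_sum HP_cmult)
 fix \<alpha> assume "\<alpha> : multi_indices d k"
 hence "(SUM i<d. \<alpha> i) = k" by (simp add: multi_indices_def)
 thus "HP d k (%x. \<Prod>i<d. complex_of_real (x i) ^ \<alpha> i)" using HP_monomial[of "{..<d}" d \<alpha>] by simp
 qed
 thus ?thesis using that c by blast
qed

text \<open>\<open>P\<close> is known on \<open>Rd d\<close> only; it agrees there with a polynomial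
  defined everywhere, to which the algebra of \<open>HP\<close> applies.\<close>

lemma spherical_harmonic_HH:
 assumes "spherical_harmonic d k P"
 obtains P' where "HH d k P'" "!!x. x : Rd d ==> P x = P' x"
proof -
 from assms obtain P' where HP: "HP d k P'" and eq: "!!x. x : Rd d ==> P x = P' x"
 unfolding spherical_harmonic_def using homogeneous_polynomial_HP by blast
 have up: "x(j := s) : Rd d" if "x : Rd d" "j < d" for x j s
 using that by (auto simp: Rd_def PiE_iff extensional_def)
 have pd: "pd j u x = pd j v x" if "x : Rd d" "j < d" "!!x. x : Rd d ==> u x = v x" for u v j x
 using that up by (simp add: partial_deriv_def)
 have lap: "laplacian d P' x = 0" if x: "x : Rd d" for x
 proof -
 have "laplacian d P' x = laplacian d P x"
 unfolding laplacian_def by (intro sum.cong refl pd[OF x]) (auto simp: eq intro!: pd)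
 thus ?thesis using assms x by (simp add: spherical_harmonic_def)
 qed
 have "laplacian d P' x = 0" for x
 \<comment> \<open>From degree 2 on, the Laplacian is again in \<open>HP\<close>, of degree
   \<open>k - 2\<close>. It depends on the coordinates below \<open>d\<close> alone, so its
   vanishing on \<open>Rd d\<close> spreads to all points.\<close>
 proof (cases "k < 2")
 case True
 hence "k = 0 | k = Suc 0" by auto
 thus ?thesis using HP laplacian_HP_0 by blast
 next
 case False
 then obtain l where k: "k = Suc (Suc l)" by (metis less_2_cases_iff not0_implies_Suc)
 define y where "y = restrict x {..<d}"
 have "y : Rd d" by (simp add: y_def Rd_def)
 have "HP d l (%x. laplacian d P' x)"
 unfolding laplacian_def using HP by (intro HP_sum HP_partial_deriv) (auto simp: k simp del: HP.simps)
 from HP_depends[OF this, of x y] lap[OF `y : Rd d`] show ?thesis by (simp add: y_def)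
 qed
 thus ?thesis using that HP eq by (auto simp: HH_def)
qed

section \<open>Gaussian integration by parts\<close>

lemma integrable_std_normal_one_plus_power:
 "integrable (density lborel nd) (%x::real. (1 + abs x) ^ n)"
proof -
 let ?A = "%x. 2 ^ n * (nd x * abs x ^ 0 + nd x * abs x ^ n)"
 let ?B = "%x. nd x *\<^sub>R (1 + abs x) ^ n"
 have "integrable lborel (%x. ?A x)"
 by (intro int_mult int_add integrable_std_normal_moment_abs)
 hence "integrable lborel (%x. ?B x)"
 proof (rule int_bd)
 show "AE x in lborel. norm (?B x) <= norm (?A x)"
 proof (rule AE_I2)
 fix x :: real
 have "(1 + abs x) ^ n <= (2 * max 1 (abs x)) ^ n" by (intro power_mono) auto
 also have "... <= 2 ^ n * (1 + abs x ^ n)" by (auto simp: pow_mult max_def)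
 finally have "nd x * (1 + abs x) ^ n <= nd x * (2 ^ n * (1 + abs x ^ n))"
 by (intro mlm) auto
 thus "norm (?B x) <= norm (?A x)"
 by (simp add: algebra_simps)
 qed
 qed measurable
 thus ?thesis by (subst integrable_density) auto
qed

lemma std_normal_decay:
 "((%s. nd s * (1 + abs s) ^ n) \<longlongrightarrow> 0) at_top" "((%s. nd s * (1 + abs s) ^ n) \<longlongrightarrow> 0) at_bot"
proof -
 let ?A = "%s. 1 + abs s"
 let ?B = "%s. nd s * (?A s) ^ n"
 let ?C = "(%s. ?B s) \<longlongrightarrow> 0"
 let ?b = "%s::real. exp (3/2) * ((?A s) ^ n / exp (?A s))"
 have le: "norm (?B s) <= ?b s" for s
 proof -
 have "0 <= (abs s - 1)^2" by simp
 hence "- s\<^sup>2 / 2 <= 3/2 - (?A s)" by (simp add: power2_diff)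
 hence "exp (- s\<^sup>2 / 2) <= exp (3/2) / exp (?A s)" by (simp flip: exp_diff)
 moreover have "1 <= sqrt (2 * pi)" using pi_ge_two by simp
 hence "1 / sqrt (2 * pi) <= 1" by simp
 ultimately have "nd s <= 1 * (exp (3/2) / exp (?A s))"
 unfolding std_normal_density_def by (intro mult_mono) auto
 hence "?B s <= exp (3/2) / exp (?A s) * (?A s) ^ n" by (intro mrm) auto
 thus ?thesis by (simp add: abs_mult)
 qed
 have A: "(?b \<longlongrightarrow> 0) F" if "filterlim (%s::real. ?A s) at_top F" for F
 using tendsto_mult_right_zero[OF filterlim_compose[OF tendsto_power_div_exp_0 that]] .
 have f1: "filterlim (%s::real. ?A s) at_top at_top"
 by (rule filterlim_at_top_mono[OF filterlim_ident]) (auto intro!: always_eventually)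
 have f2: "filterlim (%s::real. ?A s) at_top at_bot"
 by (rule filterlim_at_top_mono[OF filterlim_uminus_at_top_at_bot]) (auto intro!: always_eventually)
 show "?C at_top" "?C at_bot"
 by (rule Lim_null_comparison[OF always_eventually[OF allI[OF le]]], rule A, rule f1 f2)+
qed

text \<open>The derivative of \<open>nd * \<phi>\<close> is \<open>nd * \<phi>'\<close> minus
  \<open>s * nd * \<phi>\<close>; its integral over the line is 0 because \<open>nd\<close>
  outweighs polynomial growth.\<close>

lemma std_normal_by_parts:
 fixes \<phi> \<phi>' :: "real => complex"
 assumes d: "!!s. (\<phi> has_vector_derivative \<phi>' s) (at s)" and c: "continuous_on UNIV \<phi>'"
 and b: "!!s. norm (\<phi> s) <= C * (1 + abs s) ^ n" "!!s. norm (\<phi>' s) <= C * (1 + abs s) ^ n"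
 shows "(LINT s|density lborel nd. s *\<^sub>R \<phi> s) = (LINT s|density lborel nd. \<phi>' s)"
proof -
 let ?A = "%s. 1 + abs s"
 let ?B = "%s. s *\<^sub>R \<phi> s"
 let ?C = "%s. nd s * (?A s) ^ n"
 let ?D = "%s. C * (?A s) ^ Suc n"
 have C: "0 <= C" using order_trans[OF norm_ge_zero b(1)[of 0]] by simp
 have c\<phi>: "continuous_on UNIV \<phi>" using d by (intro continuous_at_imp_continuous_on ballI) (auto intro: has_vector_derivative_continuous)
 have [measurable]: "\<phi> : bm borel" "\<phi>' : bm borel"
 using c c\<phi> by (auto intro: borel_measurable_continuous_onI)
 let ?N = "density lborel nd"
 have bd: "integrable ?N (%s. ?D s)"
 using integrable_std_normal_one_plus_power by (rule int_mult)
 have i1: "integrable ?N (%s. ?B s)"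
 proof (rule int_bd[OF bd])
 have "norm (?B s) <= ?D s" for s
 proof -
 have "abs s * norm (\<phi> s) <= (?A s) * (C * (?A s) ^ n)" using b(1)[of s] by (intro mult_mono) auto
 thus ?thesis by (simp add: mult_ac)
 qed
 thus "AE s in ?N. norm (?B s) <= norm (?D s)"
 by (intro AE_I2) (simp add: order_trans[OF _ abs_ge_self])
 qed simp
 have i2: "integrable ?N \<phi>'"
 proof (rule int_bd[OF bd])
 have "norm (\<phi>' s) <= ?D s" for s
 proof -
 have "C * (?A s) ^ n <= ?D s" using C by (intro mlm power_increasing) auto
 thus ?thesis using b(2)[of s] by linarith
 qed
 thus "AE s in ?N. norm (\<phi>' s) <= norm (?D s)"
 by (intro AE_I2) (simp add: order_trans[OF _ abs_ge_self])
 qed simp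
 let ?G = "%s. nd s *\<^sub>R \<phi> s"
 let ?g = "%s. nd s *\<^sub>R \<phi>' s - nd s *\<^sub>R (?B s)"
 have l1: "integrable lborel (%s. nd s *\<^sub>R (?B s))" "integrable lborel (%s. nd s *\<^sub>R \<phi>' s)"
 using integrable_density[of "%s. ?B s" lborel std_normal_density] integrable_density[of \<phi>' lborel std_normal_density] i1 i2 by auto
 have dG: "(?G has_vector_derivative ?g s) (at s)" for s
 proof -
 have "(nd has_real_derivative - s * nd s) (at s)"
 proof -
 define c where "c = 1 / sqrt (2 * pi)"
 have eq: "nd = (%s. c * exp (- s\<^sup>2 / 2))" by (auto simp: std_normal_density_def c_def)
 show ?thesis unfolding eq by (auto intro!: derivative_eq_intros)
 qed
 from has_vector_derivative_scaleR[OF this d[of s]] show ?thesis by (simp add: algebra_simps)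
 qed
 have contd: "continuous_on UNIV nd" unfolding std_normal_density_def by (intro continuous_intros) auto
 have cg: "isCont ?g s" for s
 proof -
 have "continuous_on UNIV ?g" by (intro continuous_intros contd c c\<phi>)
 thus ?thesis by (simp add: continuous_on_eq_continuous_at)
 qed
 have G0: "(?G \<longlongrightarrow> 0) F" if "((%s. ?C s) \<longlongrightarrow> 0) F" for F
 proof (rule Lim_null_comparison)
 show "((%s. C * (?C s)) \<longlongrightarrow> 0) F" using that by (rule tendsto_mult_right_zero)
 have "norm (?G s) <= C * (?C s)" for s
 using mlm[OF b(1)[of s], of "nd s"] by (simp add: mult_ac)
 thus "\<forall>\<^sub>F s in F. norm (?G s) <= C * (?C s)" by simp
 qed
 have "interval_lebesgue_integral lborel (-\<infinity>) \<infinity> ?g = 0 - 0"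
 proof (rule interval_integral_FTC_integrable)
 show "set_integrable lborel (einterval (-\<infinity>) \<infinity>) ?g" using l1 by (simp add: set_integrable_def)
 show "((?G o real_of_ereal) \<longlongrightarrow> 0) (at_right (- \<infinity>))" "((?G o real_of_ereal) \<longlongrightarrow> 0) (at_left \<infinity>)"
 unfolding ereal_tendsto_simps by (intro G0 std_normal_decay)+
 qed (use dG cg in auto)
 hence "(LINT s|lborel. ?g s) = 0"
 by (simp add: interval_lebesgue_integral_def set_lebesgue_integral_def)
 hence "(LINT s|lborel. nd s *\<^sub>R \<phi>' s) = (LINT s|lborel. nd s *\<^sub>R (?B s))"
 using l1 by simp
 thus ?thesis by (simp add: integral_density)
qed

text \<open>Polynomial growth, measured by \<open>l1\<close> because \<open>1 + l1 d x\<close> is at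
  most the product of the \<open>1 + |x i|\<close>; a product of one-dimensional moments then bounds
  the Gaussian integral.\<close>

definition tame :: "nat => ((nat => real) => complex) => bool" where
 "tame d u <-> u : bm (ld d) & (EX C n. ALL x. norm (u x) <= C * (1 + l1 d x) ^ n)"

lemma tameE:
 assumes "tame d u" obtains C n where "0 <= C" "!!x. norm (u x) <= C * (1 + l1 d x) ^ n"
proof -
 from assms obtain C n where C: "!!x. norm (u x) <= C * (1 + l1 d x) ^ n" unfolding tame_def by blast
 have "norm (u x) <= abs C * (1 + l1 d x) ^ n" for x
 using C[of x] mrm[of C "abs C" "(1 + l1 d x) ^ n"] by (auto intro: order_trans)
 thus ?thesis using that[of "abs C" n] by simp
qed

lemma tame_measurable: "tame d u ==> u : bm (ld d)" by (simp add: tame_def)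

lemma tame_bounded: "u : bm (ld d) ==> (!!x. norm (u x) <= C) ==> tame d u"
 unfolding tame_def by (intro conjI exI[of _ C] exI[of _ 0]) auto

lemma tame_const [simp]: "tame d (%_. c)"
 by (rule tame_bounded[of _ _ "norm c"]) auto

lemma tame_HP: assumes "HP d k P" shows "tame d P"
proof -
 obtain C where C: "0 <= C" "!!x. norm (P x) <= C * l1 d x ^ k" using HP_bound[OF assms] by blast
 have "norm (P x) <= C * (1 + l1 d x) ^ k" for x
 using C(2)[of x] mlm[OF power_mono[of "l1 d x" "1 + l1 d x" k] C(1)] by auto
 thus ?thesis unfolding tame_def using HP_measurable[OF assms] by blast
qed

lemma tame_mult: assumes "tame d u" "tame d v" shows "tame d (%x. u x * v x)"
proof -
 obtain C n where C: "0 <= C" "!!x. norm (u x) <= C * (1 + l1 d x) ^ n" using tameE[OF assms(1)] by blast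
 obtain D m where D: "0 <= D" "!!x. norm (v x) <= D * (1 + l1 d x) ^ m" using tameE[OF assms(2)] by blast
 have "norm (u x * v x) <= (C * D) * (1 + l1 d x) ^ (n + m)" for x
 proof -
 have "norm (u x) * norm (v x) <= (C * (1 + l1 d x) ^ n) * (D * (1 + l1 d x) ^ m)"
 using C D by (intro mult_mono) auto
 thus ?thesis by (simp add: norm_mult power_add mult_ac)
 qed
 moreover have [measurable]: "u : bm (ld d)" "v : bm (ld d)" using assms by (auto dest: tame_measurable)
 ultimately show ?thesis unfolding tame_def by (intro conjI exI) auto
qed

lemma tame_add: assumes "tame d u" "tame d v" shows "tame d (%x. u x + v x)"
proof -
 obtain C n where C: "0 <= C" "!!x. norm (u x) <= C * (1 + l1 d x) ^ n" using tameE[OF assms(1)] by blast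
 obtain D m where D: "0 <= D" "!!x. norm (v x) <= D * (1 + l1 d x) ^ m" using tameE[OF assms(2)] by blast
 have "norm (u x + v x) <= (C + D) * (1 + l1 d x) ^ (n + m)" for x
 proof -
 have "norm (u x + v x) <= C * (1 + l1 d x) ^ n + D * (1 + l1 d x) ^ m"
 using C(2)[of x] D(2)[of x] norm_triangle_ineq[of "u x" "v x"] by linarith
 also have "... <= C * (1 + l1 d x) ^ (n + m) + D * (1 + l1 d x) ^ (n + m)"
 using C(1) D(1) by (intro add_mono mlm power_increasing) auto
 finally show ?thesis by (simp add: distrib_right)
 qed
 moreover have [measurable]: "u : bm (ld d)" "v : bm (ld d)" using assms by (auto dest: tame_measurable)
 ultimately show ?thesis unfolding tame_def by (intro conjI exI) auto
qed

lemma tame_sum: "(!!i. i : I ==> tame d (u i)) ==> tame d (%x. SUM i:I. u i x)"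
 by (induction I rule: infinite_finite_induct) (auto intro: tame_add)

lemma tame_power: "tame d u ==> tame d (%x. u x ^ n)"
 by (induction n) (auto intro: tame_mult)

lemma tame_cnj: "tame d u ==> tame d (%x. cnj (u x))"
 unfolding tame_def using borel_measurable_continuous_on[OF continuous_on_cnj[OF continuous_on_id]] by auto

lemma tame_norm: "tame d u ==> tame d (%x. of_real (norm (u x)))"
 unfolding tame_def by auto

lemma one_plus_sum_le_prod:
 fixes a :: "'a => real"
 assumes "!!i. 0 <= a i" shows "1 + (SUM i:I. a i) <= (\<Prod>i\<in>I. 1 + a i)"
proof (induction I rule: infinite_finite_induct)
 case (insert i I)
 have "1 <= (\<Prod>i\<in>I. 1 + a i)" using assms by (intro prod_ge_1) simp
 hence "a i * 1 <= a i * (\<Prod>i\<in>I. 1 + a i)" using assms by (intro mlm) auto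
 thus ?case using insert by (simp add: distrib_right)
qed auto

lemma int_tame: assumes "tame d u" shows "integrable (gd d) u"
proof -
 let ?A = "%x n. \<Prod>i<d. (1 + abs (x i)) ^ n"
 obtain C n where C: "0 <= C" "!!x. norm (u x) <= C * (1 + l1 d x) ^ n" using tameE[OF assms] by blast
 have [measurable]: "u : bm (gd d)"
 using tame_measurable[OF assms] by (simp add: measurable_cong_sets[OF sets_ld_gd refl])
 have "integrable (gd d) (%x. C * (?A x n))"
 unfolding gd_def by (intro int_mult gaussP.product_integrable_prod integrable_std_normal_one_plus_power) simp
 thus ?thesis
 proof (rule int_bd)
 show "AE x in gd d. norm (u x) <= norm (C * (?A x n))"
 proof (rule AE_I2)
 fix x
 have "1 + l1 d x <= (\<Prod>i<d. 1 + abs (x i))"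
 unfolding l1_def by (rule one_plus_sum_le_prod) simp
 hence "(1 + l1 d x) ^ n <= (?A x n)"
 by (simp add: prod_power_distrib[symmetric] power_mono)
 hence "C * (1 + l1 d x) ^ n <= C * (?A x n)" using C(1) by (rule mlm)
 thus "norm (u x) <= norm (C * (?A x n))"
 using C(2)[of x] by (simp add: order_trans[OF _ abs_ge_self])
 qed
 qed simp
qed

definition cont_in :: "nat => ((nat => real) => complex) => bool" where
 "cont_in j u <-> (ALL x. continuous_on UNIV (%s. u (x(j := s))))"

lemma has_pd_at: "has_pd j u D ==> ((%s. u (x(j := s))) has_vector_derivative D (x(j := s))) (at s)"
 unfolding has_pd_def by (drule spec[of _ "x(j := s)"]) simp

lemma has_pd_cont_in: assumes "has_pd j u D" shows "cont_in j u"
 unfolding cont_in_def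
proof (intro allI continuous_at_imp_continuous_on ballI)
 fix x s
 show "isCont (%s. u (x(j := s))) s" using has_pd_at[OF assms] by (rule has_vector_derivative_continuous)
qed

lemma cont_in_mult: "cont_in j u ==> cont_in j v ==> cont_in j (%x. u x * v x)"
 unfolding cont_in_def by (auto intro: continuous_on_mult)

lemma cont_in_add: "cont_in j u ==> cont_in j v ==> cont_in j (%x. u x + v x)"
 unfolding cont_in_def by (auto intro: continuous_on_add)

lemma gaussian_by_parts:
 assumes j: "j < d" and u: "tame d u" "has_pd j u D" and D: "tame d D" "cont_in j D"
 shows "(LINT x|gd d. of_real (x j) * u x) = (LINT x|gd d. D x)"
proof -
 let ?A = "%x y. (1 + l1 d x) * (1 + abs y)"
 have I: "{..<d} = insert j ({..<d} - {j})" using j by auto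
 let ?N = "density lborel nd"
 let ?J = "{..<d} - {j}"
 have tx: "tame d (%x. of_real (x j) * u x)"
 proof -
 have "HP d (Suc 0) (%x. of_real (x j) * (%_. 1) x)" by (rule HP_coord[OF j]) auto
 thus ?thesis using tame_mult[OF tame_HP u(1)] by simp
 qed
 have split: "(LINT x|gd d. f x) = (LINT x|Pi\<^sub>M ?J (%_. ?N). (LINT y|?N. f (x(j := y))))" if "tame d f" for f
 proof -
 have "integrable (Pi\<^sub>M (insert j ?J) (%_. ?N)) f" using int_tame[OF that] I by (simp add: gd_def)
 from gaussP.product_integral_insert[OF _ _ this] show ?thesis using I by (simp add: gd_def)
 qed
 obtain C n where C: "0 <= C" "!!x. norm (u x) <= C * (1 + l1 d x) ^ n" using tameE[OF u(1)] by blast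
 obtain E m where E: "0 <= E" "!!x. norm (D x) <= E * (1 + l1 d x) ^ m" using tameE[OF D(1)] by blast
 have l1: "1 + l1 d (x(j := y)) <= ?A x y" for x y
 proof -
 have "l1 d (x(j := y)) <= abs y + l1 d x"
 proof -
 have "l1 d (x(j := y)) = abs y + (SUM i:?J. abs (x i))"
 unfolding l1_def using j by (subst sum.remove[of _ j]) auto
 also have "(SUM i:?J. abs (x i)) <= l1 d x" unfolding l1_def by (intro sum_mono2) auto
 finally show ?thesis by simp
 qed
 moreover have "0 <= l1 d x * abs y" by simp
 moreover have "?A x y = 1 + l1 d x + abs y + l1 d x * abs y" by (simp add: algebra_simps)
 ultimately show ?thesis by linarith
 qed
 have "(LINT y|?N. of_real ((x(j := y)) j) * u (x(j := y))) = (LINT y|?N. D (x(j := y)))" for x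
 proof -
 let ?K = "(C + E) * (1 + l1 d x) ^ (n + m)"
 have bnd: "F * (1 + l1 d (x(j := y))) ^ k <= ?K * (1 + abs y) ^ (n + m)" if "0 <= F" "F <= C + E" "k <= n + m" for F k y
 proof -
 have "(1 + l1 d (x(j := y))) ^ k <= (1 + l1 d (x(j := y))) ^ (n + m)" using that by (intro power_increasing) auto
 also have "... <= (?A x y) ^ (n + m)" by (intro power_mono l1) auto
 finally have "F * (1 + l1 d (x(j := y))) ^ k <= (C + E) * (?A x y) ^ (n + m)"
 using that by (intro mult_mono) auto
 thus ?thesis by (simp add: pow_mult mult_ac)
 qed
 have "(LINT y|?N. y *\<^sub>R u (x(j := y))) = (LINT y|?N. D (x(j := y)))"
 proof (rule std_normal_by_parts[where C="?K" and n="n + m"])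
 show "((%y. u (x(j := y))) has_vector_derivative D (x(j := s))) (at s)" for s using u(2) by (rule has_pd_at)
 show "continuous_on UNIV (%y. D (x(j := y)))" using D(2) by (simp add: cont_in_def)
 show "norm (u (x(j := s))) <= ?K * (1 + abs s) ^ (n + m)" for s
 using C(2)[of "x(j := s)"] bnd[of C n s] C(1) E(1) by auto
 show "norm (D (x(j := s))) <= ?K * (1 + abs s) ^ (n + m)" for s
 using E(2)[of "x(j := s)"] bnd[of E m s] C(1) E(1) by auto
 qed
 thus ?thesis by (simp add: scaleR_of_real)
 qed
 thus ?thesis unfolding split[OF tx] split[OF D(1)] by simp
qed

text \<open>Euler's identity replaces \<open>(k + 1) * P\<close> by the sum of
  \<open>x j * pd j P\<close>, and \<open>gaussian_by_parts\<close> removes each \<open>x j\<close>.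
  The second derivatives add up to the Laplacian of \<open>P\<close>, which is 0. This identity
  lowers the degree and drives the inductions below.\<close>

theorem HH_by_parts:
 assumes P: "HH d (Suc k) P" and F: "tame d F" "!!j. j < d ==> has_pd j F (F' j)"
 "!!j. j < d ==> tame d (F' j)" "!!j. j < d ==> cont_in j (F' j)"
 shows "of_nat (Suc k) * (LINT x|gd d. P x * F x) = (SUM j<d. (LINT x|gd d. pd j P x * F' j x))"
proof -
 let ?D = "%j. pd j P"
 let ?A = "%j x. pd j (?D j) x * F x + ?D j x * F' j x"
 let ?B = "(LINT x|gd d. (SUM j<d. pd j (?D j) x * F x))"
 let ?C = "%x j. of_real (x j) * (?D j x * F x)"
 have HP: "HP d (Suc k) P" using P by (rule HH_imp_HP)
 have HD: "HP d k (?D j)" if "j < d" for j using HP_partial_deriv[OF HP that] .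
 have HDD: "HP d (k - 1) (pd j (?D j))" if "j < d" for j using HP_0_or_pd[OF HD[OF that] that] .
 have tD: "tame d (?D j)" "tame d (pd j (?D j))" if "j < d" for j
 using HD[OF that] HDD[OF that] by (auto intro: tame_HP)
 have x1: "tame d (%x. ?C x j)" if "j < d" for j
 proof -
 have "HP d (Suc k) (%x. of_real (x j) * ?D j x)" by (rule HP_coord[OF that HD[OF that]])
 from tame_mult[OF tame_HP[OF this] F(1)] show ?thesis by (simp add: mult.assoc)
 qed
 have "of_nat (Suc k) * (LINT x|gd d. P x * F x) = (LINT x|gd d. (of_nat (Suc k) * P x) * F x)"
 by (simp add: mult.assoc)
 also have "... = (LINT x|gd d. (SUM j<d. ?C x j))"
 by (subst HP_Euler[OF HP, symmetric]) (simp add: sum_distrib_right mult.assoc)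
 also have "... = (SUM j<d. (LINT x|gd d. ?C x j))"
 by (rule int_sum) (auto intro: int_tame x1)
 also have "... = (SUM j<d. (LINT x|gd d. ?A j x))"
 proof (intro sum.cong refl gaussian_by_parts)
 fix j assume "j : {..<d}"
 hence j: "j < d" by simp
 show "j < d" by (rule j)
 show "tame d (%x. ?D j x * F x)" by (intro tame_mult tD j F)
 show "has_pd j (%x. ?D j x * F x) (%x. ?A j x)"
 by (intro has_pd_mult HP_has_pd[OF HD] j F)
 show "tame d (%x. ?A j x)" by (intro tame_add tame_mult tD j F)
 show "cont_in j (%x. ?A j x)"
 using has_pd_cont_in[OF HP_has_pd[OF HDD[OF j]]] has_pd_cont_in[OF HP_has_pd[OF HD[OF j]]] has_pd_cont_in[OF F(2)[OF j]] F(4)[OF j]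
 by (intro cont_in_add cont_in_mult)
 qed
 also have "... = (SUM j<d. (LINT x|gd d. pd j (?D j) x * F x) + (LINT x|gd d. ?D j x * F' j x))"
 by (intro sum.cong refl Bochner_Integration.integral_add int_tame tame_mult tD F) auto
 also have "... = ?B + (SUM j<d. (LINT x|gd d. ?D j x * F' j x))"
 unfolding sum.distrib
 by (subst int_sum) (auto intro!: int_tame tame_mult tD F)
 also have "?B = 0"
 using P by (simp add: HH_def laplacian_def sum_distrib_right[symmetric])
 finally show ?thesis by simp
qed

section \<open>Orthogonality and Fourier transform of harmonic polynomials\<close>

definition ip :: "nat => (nat => real) => (nat => real) => real" where "ip d x y = (SUM i<d. x i * y i)"
definition nsq :: "nat => (nat => real) => real" where "nsq d x = (SUM i<d. (x i)^2)"

lemma nsq_nonneg [simp]: "0 <= nsq d x" by (simp add: nsq_def sum_nonneg)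

lemma HP_ip: "HP d 1 (%x. of_real (ip d y x))"
proof -
 have "HP d (Suc 0) (%x. SUM i<d. of_real (x i) * (%_. of_real (y i)) x)" by (rule HP_SucI) auto
 thus ?thesis by (simp add: ip_def mult.commute)
qed

lemma HP_nsq: "HP d 2 (%x. of_real (nsq d x))"
proof -
 have "HP d (Suc (Suc 0)) (%x. SUM i<d. of_real (x i) * (of_real (x i) * (%_. 1) x))"
 by (intro HP_sum HP_coord) auto
 thus ?thesis by (simp add: nsq_def sq_eq numeral_2_eq_2)
qed

lemma HP_power: "HP d k P ==> HP d (n * k) (%x. P x ^ n)"
proof (induction n)
 case (Suc n)
 from HP_mult[OF Suc.prems Suc.IH[OF Suc.prems]] show ?case by simp
qed auto

lemma has_pd_power: "has_pd j u D ==> has_pd j (%x. u x ^ n) (%x. of_nat n * u x ^ (n - 1) * D x)"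
proof (induction n)
 case 0 thus ?case using has_pd_const[of j 1] by simp
next
 case (Suc n)
 have "has_pd j (%x. u x * u x ^ n) (%x. D x * u x ^ n + u x * (of_nat n * u x ^ (n - 1) * D x))"
 by (rule has_pd_mult[OF Suc.prems Suc.IH[OF Suc.prems]])
 moreover have "D x * u x ^ n + u x * (of_nat n * u x ^ (n - 1) * D x) = of_nat (Suc n) * u x ^ (Suc n - 1) * D x" for x
 by (cases n) (auto simp: algebra_simps)
 ultimately show ?case by simp
qed

lemma has_pd_ip: assumes "j < d" shows "has_pd j (%x. of_real (ip d y x)) (%_. of_real (y j))"
proof -
 have "has_pd j (%x. SUM i<d. of_real (y i) * of_real (x i)) (%x. SUM i<d. 0 * of_real (x i) + of_real (y i) * (if i = j then 1 else 0))"
 by (intro has_pd_sum has_pd_mult has_pd_const has_pd_coord)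
 moreover have "(SUM i<d. 0 * of_real (x i) + of_real (y i) * (if i = j then 1 else 0 :: complex)) = of_real (y j)" for x :: "nat => real"
 using assms by (simp add: if_distrib[of "%c. _ * c"] cong: if_cong)
 ultimately show ?thesis by (simp add: ip_def)
qed

lemma has_pd_nsq: assumes "j < d" shows "has_pd j (%x. of_real (nsq d x)) (%x. 2 * of_real (x j))"
proof -
 have "has_pd j (%x. SUM i<d. of_real (x i) * of_real (x i))
 (%x. SUM i<d. (if i = j then 1 else 0) * of_real (x i) + of_real (x i) * (if i = j then 1 else 0))"
 by (intro has_pd_sum has_pd_mult has_pd_const has_pd_coord)
 moreover have "(SUM i<d. (if i = j then 1 else 0) * of_real (x i) + of_real (x i) * (if i = j then 1 else 0 :: complex)) = 2 * of_real (x j)" for x :: "nat => real"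
 using assms by (simp add: sum.distrib if_distrib[of "%c. _ * c"] if_distrib[of "%c. c * _"] cong: if_cong)
 ultimately show ?thesis by (simp add: nsq_def sq_eq)
qed

lemma HP_F_assms:
 assumes "HP d l W"
 shows "tame d W" "has_pd j W (pd j W)" "j < d ==> tame d (pd j W)" "j < d ==> cont_in j (pd j W)"
 using assms HP_0_or_pd[OF assms] by (auto intro: tame_HP HP_has_pd has_pd_cont_in)

lemma HH_by_parts_HP:
 assumes "HH d (Suc k) Q" "HP d l W"
 shows "of_nat (Suc k) * (LINT x|gd d. Q x * W x) = (SUM j<d. (LINT x|gd d. pd j Q x * pd j W x))"
 by (rule HH_by_parts[OF assms(1)]) (use HP_F_assms[OF assms(2)] in auto)

text \<open>Each integration by parts lowers both degrees by one; the smaller one reaches 0 first,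
  where the derivative of \<open>W\<close> vanishes.\<close>

lemma HH_orth_lower: "HH d k Q ==> HP d l W ==> l < k ==> (LINT x|gd d. Q x * W x) = 0"
proof (induction k arbitrary: l Q W)
 case (Suc k)
 have "(LINT x|gd d. pd j Q x * pd j W x) = 0" if j: "j < d" for j
 proof (cases l)
 case 0 thus ?thesis using partial_deriv_HP_0 Suc.prems(2) by simp
 next
 case (Suc l')
 thus ?thesis using Suc.IH[OF HH_partial_deriv[OF Suc.prems(1) j] HP_partial_deriv[of d l' W j]] Suc.prems j by simp
 qed
 hence "of_nat (Suc k) * (LINT x|gd d. Q x * W x) = 0"
 unfolding HH_by_parts_HP[OF Suc.prems(1,2)] by (intro sum.neutral) auto
 thus ?case by (simp del: of_nat_Suc)
qed simp

text \<open>By the product rule the gradient of \<open>|x|\<^sup>2 * W\<close> has two parts. The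
  part with \<open>|x|\<^sup>2\<close> times a derivative of \<open>W\<close> is handled by
  induction; the part \<open>2 * x j * W\<close> sums by Euler's identity to a multiple of the
  integral of \<open>Q * W\<close>, which is 0 by \<open>HH_orth_lower\<close>.\<close>

lemma HH_orth_nsq: "HH d k Q ==> HP d l W ==> l + 2 <= k ==> (LINT x|gd d. Q x * (of_real (nsq d x) * W x)) = 0"
proof (induction k arbitrary: l Q W)
 let ?A = "%x. of_real (nsq d x)"
 case (Suc k)
 let ?D = "%j. pd j Q"
 have HW: "HP d (2 + l) (%x. of_real (nsq d x) * W x)" by (rule HP_mult[OF HP_nsq Suc.prems(2)])
 have HQ: "HP d (Suc k) Q" using Suc.prems(1) by (rule HH_imp_HP)
 have pdW: "pd j (%x. of_real (nsq d x) * W x) = (%x. 2 * of_real (x j) * W x + ?A x * pd j W x)" if "j < d" for j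
 by (intro has_pd_pd has_pd_mult has_pd_nsq that HP_has_pd[OF Suc.prems(2)])
 have t1: "tame d (%x. of_real (x j) * ?D j x * W x)" if "j < d" for j
 by (rule tame_mult[OF tame_HP[OF HP_coord[OF that HP_partial_deriv[OF HQ that]]] tame_HP[OF Suc.prems(2)]])
 have t2: "tame d (%x. ?D j x * (?A x * pd j W x))" if "j < d" for j
 by (intro tame_mult[OF tame_HP[OF HP_partial_deriv[OF HQ that]] tame_mult[OF tame_HP[OF HP_nsq] HP_F_assms(3)[OF Suc.prems(2) that]]])
 have z: "(LINT x|gd d. ?D j x * (?A x * pd j W x)) = 0" if j: "j < d" for j
 proof (cases l)
 case 0 thus ?thesis using partial_deriv_HP_0 Suc.prems(2) by simp
 next
 case (Suc l')
 thus ?thesis using Suc.IH[OF HH_partial_deriv[OF Suc.prems(1) j] HP_partial_deriv[of d l' W j]] Suc.prems j by simp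
 qed
 have "of_nat (Suc k) * (LINT x|gd d. Q x * (?A x * W x))
 = (SUM j<d. (LINT x|gd d. 2 * (of_real (x j) * ?D j x * W x) + ?D j x * (?A x * pd j W x)))"
 unfolding HH_by_parts_HP[OF Suc.prems(1) HW]
 proof (intro sum.cong refl)
 fix j assume "j : {..<d}"
 hence j: "j < d" by simp
 show "(LINT x|gd d. ?D j x * pd j (%x. of_real (nsq d x) * W x) x)
 = (LINT x|gd d. 2 * (of_real (x j) * ?D j x * W x) + ?D j x * (?A x * pd j W x))"
 unfolding pdW[OF j] by (intro int_cong refl) (simp add: algebra_simps)
 qed
 also have "... = (SUM j<d. 2 * (LINT x|gd d. of_real (x j) * ?D j x * W x))"
 proof (intro sum.cong refl)
 fix j assume "j : {..<d}"
 hence j: "j < d" by simp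
 show "(LINT x|gd d. 2 * (of_real (x j) * ?D j x * W x) + ?D j x * (?A x * pd j W x)) = 2 * (LINT x|gd d. of_real (x j) * ?D j x * W x)"
 using int_tame[OF t1[OF j]] int_tame[OF t2[OF j]] z[OF j]
 by (subst Bochner_Integration.integral_add) auto
 qed
 also have "... = 2 * (LINT x|gd d. (SUM j<d. of_real (x j) * ?D j x * W x))"
 by (subst int_sum) (auto intro!: int_tame t1 simp: sum_cmult)
 also have "(LINT x|gd d. (SUM j<d. of_real (x j) * ?D j x * W x)) = of_nat (Suc k) * (LINT x|gd d. Q x * W x)"
 unfolding sum_distrib_right[symmetric] HP_Euler[OF HQ] by (simp add: mult.assoc)
 also have "(LINT x|gd d. Q x * W x) = 0" by (rule HH_orth_lower[OF Suc.prems(1,2)]) (use Suc.prems(3) in simp)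
 finally show ?case by (simp del: of_nat_Suc)
qed simp

text \<open>Differentiating the power yields \<open>y j\<close> times a power one lower; Euler's
  identity at \<open>y\<close> reassembles the derivatives of \<open>Q\<close>, and the factors from
  the powers build \<open>fact k\<close>.\<close>

lemma HH_inner_power: "HH d k Q ==> (LINT x|gd d. Q x * of_real (ip d y x) ^ k) = fact k * Q y"
proof (induction k arbitrary: Q)
 case 0
 then obtain c where "Q = (%_. c)" by (auto simp: HH_def)
 thus ?case using prob_space.prob_space[OF prob_space_gd] by simp
next
 case (Suc k)
 have HQ: "HP d (Suc k) Q" using Suc.prems by (rule HH_imp_HP)
 have HW: "HP d (Suc k * 1) (%x. of_real (ip d y x) ^ Suc k)" by (rule HP_power[OF HP_ip])
 have pdW: "pd j (%x. of_real (ip d y x) ^ Suc k) = (%x. of_nat (Suc k) * of_real (ip d y x) ^ k * of_real (y j))" if "j < d" for j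
 using has_pd_pd[OF has_pd_power[OF has_pd_ip[OF that], where n="Suc k"]] by (simp del: power_Suc)
 have "of_nat (Suc k) * (LINT x|gd d. Q x * of_real (ip d y x) ^ Suc k)
 = (SUM j<d. of_nat (Suc k) * of_real (y j) * (LINT x|gd d. pd j Q x * of_real (ip d y x) ^ k))"
 unfolding HH_by_parts_HP[OF Suc.prems HW]
 proof (intro sum.cong refl)
 fix j assume "j : {..<d}"
 hence j: "j < d" by simp
 have "(LINT x|gd d. pd j Q x * pd j (%x. of_real (ip d y x) ^ Suc k) x)
 = (LINT x|gd d. of_nat (Suc k) * of_real (y j) * (pd j Q x * of_real (ip d y x) ^ k))"
 by (simp add: pdW[OF j] mult_ac del: of_nat_Suc power_Suc)
 thus "(LINT x|gd d. pd j Q x * pd j (%x. of_real (ip d y x) ^ Suc k) x)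
 = of_nat (Suc k) * of_real (y j) * (LINT x|gd d. pd j Q x * of_real (ip d y x) ^ k)"
 by (simp only: int_cmult)
 qed
 also have "... = (SUM j<d. of_nat (Suc k) * of_real (y j) * (fact k * pd j Q y))"
 by (intro sum.cong refl) (simp add: Suc.IH[OF HH_partial_deriv[OF Suc.prems]])
 also have "... = of_nat (Suc k) * fact k * (SUM j<d. of_real (y j) * pd j Q y)"
 by (simp add: sum_cmult mult_ac del: of_nat_Suc)
 also have "... = of_nat (Suc k) * (fact (Suc k) * Q y)"
 unfolding HP_Euler[OF HQ] by (simp add: mult_ac)
 finally show ?case by (simp del: of_nat_Suc fact_Suc power_Suc)
qed

lemma gaussian_char: "(LINT x|gd d. exp (\<i> * of_real (ip d xi x))) = of_real (exp (- nsq d xi / 2))"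
proof -
 let ?N = "density lborel nd"
 have int: "integrable ?N (%y. iexp (t * y))" for t
 by (rule std_normal.integrable_const_bound[where B=1]) auto
 have e: "exp (\<i> * of_real (ip d xi x)) = (\<Prod>i<d. iexp (xi i * x i))" for x
 by (simp add: ip_def sum_cmult exp_sum)
 have "(LINT x|gd d. exp (\<i> * of_real (ip d xi x))) = (\<Prod>i<d. (LINT y|?N. iexp (xi i * y)))"
 unfolding gd_def e by (rule gaussP.product_integral_prod[OF _ int]) simp
 also have "... = (\<Prod>i<d. of_real (exp (- (xi i)\<^sup>2 / 2)))"
 using char_std_normal_distribution by (simp add: char_def fun_eq_iff)
 also have "... = of_real (exp (SUM i<d. - (xi i)\<^sup>2 / 2))" by (simp add: exp_sum)
 finally show ?thesis by (simp add: nsq_def sum_divide_distrib sum_negf)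
qed

text \<open>Hecke's identity. Integration by parts against the exponential produces
  \<open>\<i> * xi j\<close> for each derivative, and Euler's identity at \<open>xi\<close> closes
  the induction on the degree.\<close>

theorem HH_fourier:
 "HH d k P ==> (LINT x|gd d. P x * exp (\<i> * of_real (ip d xi x))) = \<i> ^ k * P xi * of_real (exp (- nsq d xi / 2))"
proof (induction k arbitrary: P)
 case 0
 then obtain c where "P = (%_. c)" by (auto simp: HH_def)
 thus ?case using gaussian_char[of d xi] by simp
next
 case (Suc k)
 let ?F = "%x. exp (\<i> * of_real (ip d xi x))"
 have [measurable]: "?F : bm (ld d)"
 using HP_measurable[OF HP_ip[of d xi]] by measurable
 have tF: "tame d ?F" by (rule tame_bounded[of _ _ 1]) auto
 have pdF: "has_pd j ?F (%x. \<i> * of_real (xi j) * ?F x)" if "j < d" for j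
 unfolding has_pd_def
 proof
 fix x
 have "((%s. \<i> * of_real (ip d xi (x(j := s)))) has_vector_derivative (\<i> * of_real (xi j))) (at (x j))"
 using has_vector_derivative_mult_right[OF has_pd_ip[OF that, unfolded has_pd_def, rule_format, of xi x], of \<i>] .
 from field_vector_diff_chain_at[OF this DERIV_exp]
 show "((%s. ?F (x(j := s))) has_vector_derivative \<i> * of_real (xi j) * ?F x) (at (x j))"
 by (simp add: o_def)
 qed
 have "of_nat (Suc k) * (LINT x|gd d. P x * ?F x) = (SUM j<d. (LINT x|gd d. pd j P x * (\<i> * of_real (xi j) * ?F x)))"
 by (rule HH_by_parts[OF Suc.prems tF pdF]) (auto intro: tame_mult tF cont_in_mult has_pd_cont_in[OF pdF] has_pd_cont_in[OF has_pd_const])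
 also have "... = (SUM j<d. \<i> * of_real (xi j) * (\<i> ^ k * pd j P xi * of_real (exp (- nsq d xi / 2))))"
 proof (intro sum.cong refl)
 fix j assume "j : {..<d}"
 hence "(LINT x|gd d. pd j P x * ?F x) = \<i> ^ k * pd j P xi * of_real (exp (- nsq d xi / 2))"
 by (intro Suc.IH HH_partial_deriv[OF Suc.prems]) simp
 moreover have "(LINT x|gd d. pd j P x * (\<i> * of_real (xi j) * ?F x)) = (LINT x|gd d. \<i> * of_real (xi j) * (pd j P x * ?F x))"
 by (simp add: mult_ac)
 ultimately show "(LINT x|gd d. pd j P x * (\<i> * of_real (xi j) * ?F x)) = \<i> * of_real (xi j) * (\<i> ^ k * pd j P xi * of_real (exp (- nsq d xi / 2)))"
 by (simp only: int_cmult)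
 qed
 also have "... = \<i> ^ Suc k * of_real (exp (- nsq d xi / 2)) * (SUM j<d. of_real (xi j) * pd j P xi)"
 by (simp add: sum_cmult mult_ac)
 also have "... = of_nat (Suc k) * (\<i> ^ Suc k * P xi * of_real (exp (- nsq d xi / 2)))"
 unfolding HP_Euler[OF HH_imp_HP[OF Suc.prems]] by (simp add: mult_ac)
 finally show ?case by (simp del: of_nat_Suc power_Suc)
qed

section \<open>Hypercontractivity for harmonic polynomials\<close>

text \<open>Moments are estimated for finite families because the induction passes from a family to
  the family of all its partial derivatives.\<close>

definition sqs :: "nat set => (nat => (nat => real) => complex) => (nat => real) => real" where
 "sqs I P x = (SUM i:I. (norm (P i x))^2)"

lemma sqs_nonneg [simp]: "0 <= sqs I P x" by (simp add: sqs_def sum_nonneg)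

lemma of_real_sqs: "of_real (sqs I P x) = (SUM i:I. P i x * cnj (P i x))"
 by (simp only: sqs_def of_real_sum complex_norm_square)

lemma tame_sqs: "(!!i. i : I ==> tame d (P i)) ==> tame d (%x. of_real (sqs I P x))"
 unfolding of_real_sqs by (intro tame_sum tame_mult tame_cnj)

lemma integrable_tame_real: "tame d (%x. of_real (f x)) ==> integrable (gd d) (f :: _ => real)"
 using int_tame complex_of_real_integrable_eq by blast

lemma norm_sum_cnj_le: "(norm (SUM i:I. a i * cnj (b i)))^2 <= (SUM i:I. (norm (a i))^2) * (SUM i:I. (norm (b i :: complex))^2)"
proof -
 have "norm (SUM i:I. a i * cnj (b i)) <= (SUM i:I. norm (a i) * norm (b i))"
 by (rule order_trans[OF norm_sum]) (simp add: norm_mult)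
 hence "(norm (SUM i:I. a i * cnj (b i)))^2 <= (SUM i:I. norm (a i) * norm (b i))^2" by (intro power_mono) auto
 also have "... <= (SUM i:I. (norm (a i))^2) * (SUM i:I. (norm (b i))^2)" by (rule Cauchy_Schwarz_ineq_sum)
 finally show ?thesis .
qed

text \<open>\<open>HH_by_parts\<close> is applied with \<open>cnj (P i) * N ^ n\<close>, where
  \<open>N\<close> is the sum of squares. Differentiating \<open>cnj (P i)\<close> gives
  \<open>N' * N ^ n\<close>. Differentiating \<open>N ^ n\<close> gives \<open>n\<close> terms with
  a derivative of \<open>N\<close>, which Cauchy-Schwarz over the family bounds by twice as much
  each; hence \<open>2 * n + 1\<close>.\<close>

lemma HH_sqs_step:
 assumes HH: "!!i. i : I ==> HH d (Suc k) (P i)"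
 defines "N' \<equiv> %x. SUM j<d. sqs I (%i. pd j (P i)) x"
 shows "real (Suc k) * (LINT x|gd d. sqs I P x ^ Suc n) <= (2 * real n + 1) * (LINT x|gd d. N' x * sqs I P x ^ n)"
 and "(LINT x|gd d. N' x) = real (Suc k) * (LINT x|gd d. sqs I P x)"
 and "tame d (%x. of_real (N' x))" "tame d (%x. of_real (sqs I P x))"
proof -
 let ?A = "of_nat (Suc k)"
 let ?B = "2 * real n + 1"
 let ?C = "(LINT x|gd d. N' x)"
 let ?N = "%x. sqs I P x" and ?D = "%i j. pd j (P i)"
 let ?S = "%j x. SUM i:I. ?D i j x * cnj (P i x)"
 let ?DN = "%j x. ?S j x + cnj (?S j x)"
 let ?F = "%i x. cnj (P i x) * of_real (?N x) ^ n"
 let ?F' = "%i j x. cnj (?D i j x) * of_real (?N x) ^ n + cnj (P i x) * (of_nat n * of_real (?N x) ^ (n - 1) * ?DN j x)"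
 have HP: "HP d (Suc k) (P i)" if "i : I" for i using HH[OF that] by (rule HH_imp_HP)
 have HD: "HP d k (?D i j)" if "i : I" "j < d" for i j using HP_partial_deriv[OF HP[OF that(1)] that(2)] .
 have tP: "tame d (P i)" if "i : I" for i using tame_HP[OF HP[OF that]] .
 have tD: "tame d (?D i j)" if "i : I" "j < d" for i j using tame_HP[OF HD[OF that]] .
 show tN: "tame d (%x. of_real (?N x))" by (rule tame_sqs[OF tP])
 show tN': "tame d (%x. of_real (N' x))" unfolding N'_def of_real_sum by (intro tame_sum tame_sqs tD) auto
 have pdN: "has_pd j (%x. of_real (?N x)) (?DN j)" if j: "j < d" for j
 proof -
 have "has_pd j (%x. SUM i:I. P i x * cnj (P i x)) (%x. SUM i:I. ?D i j x * cnj (P i x) + P i x * cnj (?D i j x))"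
 by (intro has_pd_sum has_pd_mult has_pd_cnj HP_has_pd[OF HP])
 moreover have "(SUM i:I. ?D i j x * cnj (P i x) + P i x * cnj (?D i j x)) = ?DN j x" for x
 by (simp add: sum.distrib mult.commute)
 ultimately show ?thesis by (simp add: of_real_sqs)
 qed
 have pdF: "has_pd j (?F i) (?F' i j)" if "i : I" "j < d" for i j
 by (intro has_pd_mult has_pd_cnj has_pd_power HP_has_pd[OF HP] pdN that)
 have HN: "HP d (Suc k + Suc k) (%x. of_real (?N x))" unfolding of_real_sqs by (intro HP_sum HP_mult HP_cnj HP)
 have HF: "HP d (Suc k + n * (Suc k + Suc k)) (?F i)" if "i : I" for i by (intro HP_mult HP_power HP_cnj HP HN that)
 have F': "pd j (?F i) = ?F' i j" if "i : I" "j < d" for i j by (rule has_pd_pd[OF pdF[OF that]])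
 have tF: "tame d (?F i)" if "i : I" for i by (rule tame_HP[OF HF[OF that]])
 have tF': "tame d (?F' i j)" if "i : I" "j < d" for i j
 unfolding F'[OF that, symmetric] by (rule tame_HP[OF HP_0_or_pd[OF HF]]) (rule that)+
 have bp: "?A * (LINT x|gd d. P i x * ?F i x) = (SUM j<d. (LINT x|gd d. ?D i j x * ?F' i j x))" if i: "i : I" for i
 unfolding HH_by_parts_HP[OF HH[OF i] HF[OF i]] using F'[OF i] by (intro sum.cong refl) simp
 have iDF: "integrable (gd d) (%x. ?D i j x * ?F' i j x)" if "i : I" "j < d" for i j
 by (intro int_tame tame_mult tD tF' that)
 have e1: "?A * (LINT x|gd d. of_real (?N x ^ Suc n)) = (LINT x|gd d. (SUM i:I. SUM j<d. ?D i j x * ?F' i j x))" (is "?L = ?R")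
 proof -
 have "(SUM i:I. P i x * ?F i x) = of_real (?N x ^ Suc n)" for x
 proof -
 have "(SUM i:I. P i x * ?F i x) = (SUM i:I. P i x * cnj (P i x)) * of_real (?N x) ^ n"
 by (simp only: sum_distrib_right mult.assoc)
 thus ?thesis by (simp flip: of_real_sqs)
 qed
 hence "?L = ?A * (LINT x|gd d. (SUM i:I. P i x * ?F i x))" by simp
 also have "... = (SUM i:I. of_nat (Suc k) * (LINT x|gd d. P i x * ?F i x))"
 unfolding sum_cmult[symmetric]
 by (intro arg_cong2[where f="(*)"] refl int_sum int_tame tame_mult tP tF)
 also have "... = (SUM i:I. SUM j<d. (LINT x|gd d. ?D i j x * ?F' i j x))" by (intro sum.cong refl bp)
 also have "... = (SUM i:I. (LINT x|gd d. (SUM j<d. ?D i j x * ?F' i j x)))"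
 by (intro sum.cong refl int_sum[symmetric] iDF) auto
 also have "... = ?R"
 by (intro int_sum[symmetric] Bochner_Integration.integrable_sum iDF) auto
 finally show ?thesis .
 qed
 have e2: "(SUM i:I. SUM j<d. ?D i j x * ?F' i j x)
 = of_real (N' x * ?N x ^ n) + of_nat n * of_real (?N x) ^ (n - 1) * (SUM j<d. ?S j x * ?DN j x)" for x
 proof -
 have "(SUM i:I. SUM j<d. ?D i j x * ?F' i j x) = (SUM j<d. SUM i:I. ?D i j x * ?F' i j x)" by (rule sum.swap)
 also have "... = (SUM j<d. of_real (sqs I (%i. ?D i j) x) * of_real (?N x) ^ n + of_nat n * of_real (?N x) ^ (n - 1) * (?S j x * ?DN j x))"
 proof (intro sum.cong refl)
 fix j
 have "(SUM i:I. ?D i j x * ?F' i j x) = (SUM i:I. ?D i j x * cnj (?D i j x)) * of_real (?N x) ^ n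
 + ?S j x * (of_nat n * of_real (?N x) ^ (n - 1) * ?DN j x)"
 unfolding sum_distrib_right sum.distrib[symmetric] by (intro sum.cong refl) (simp only: distrib_left mult.assoc)
 thus "(SUM i:I. ?D i j x * ?F' i j x) = of_real (sqs I (%i. ?D i j) x) * of_real (?N x) ^ n + of_nat n * of_real (?N x) ^ (n - 1) * (?S j x * ?DN j x)"
 by (simp only: of_real_sqs mult_ac)
 qed
 also have "... = of_real (N' x * ?N x ^ n) + of_nat n * of_real (?N x) ^ (n - 1) * (SUM j<d. ?S j x * ?DN j x)"
 by (simp add: sum.distrib N'_def sum_cmult sum_distrib_right)
 finally show ?thesis .
 qed
 have e3: "norm (SUM i:I. SUM j<d. ?D i j x * ?F' i j x) <= ?B * (N' x * ?N x ^ n)" for x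
 proof -
 have N'0: "0 <= N' x" by (simp add: N'_def sum_nonneg)
 have "norm (?S j x * ?DN j x) <= 2 * (sqs I (%i. ?D i j) x * ?N x)" for j
 proof -
 have "norm (?DN j x) <= norm (?S j x) + norm (cnj (?S j x))" by (rule norm_triangle_ineq)
 hence "norm (?DN j x) <= 2 * norm (?S j x)" unfolding complex_mod_cnj by simp
 hence "norm (?S j x * ?DN j x) <= norm (?S j x) * (2 * norm (?S j x))"
 unfolding norm_mult by (rule mlm) simp
 also have "... = 2 * (norm (?S j x))^2" by (simp add: sq_eq)
 also have "... <= 2 * (sqs I (%i. ?D i j) x * ?N x)" unfolding sqs_def using norm_sum_cnj_le by simp
 finally show ?thesis .
 qed
 hence "norm (SUM j<d. ?S j x * ?DN j x) <= (SUM j<d. 2 * (sqs I (%i. ?D i j) x * ?N x))"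
 by (intro order_trans[OF norm_sum] sum_mono)
 also have "... = 2 * (N' x * ?N x)" by (simp add: N'_def sum_cmult sum_distrib_right)
 finally have s: "norm (SUM j<d. ?S j x * ?DN j x) <= 2 * (N' x * ?N x)" .
 have "norm (of_nat n * of_real (?N x) ^ (n - 1) * (SUM j<d. ?S j x * ?DN j x)) <= real n * ?N x ^ (n - 1) * (2 * (N' x * ?N x))"
 unfolding norm_mult norm_power norm_of_nat norm_of_real abs_of_nonneg[OF sqs_nonneg] by (intro mlm s) simp
 also have "... = 2 * real n * (N' x * ?N x ^ n)" by (cases n) (simp_all del: of_nat_Suc)
 finally have "norm (SUM i:I. SUM j<d. ?D i j x * ?F' i j x) <= norm (of_real (N' x * ?N x ^ n) :: complex) + 2 * real n * (N' x * ?N x ^ n)"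
 unfolding e2 by (intro order_trans[OF norm_triangle_ineq] add_mono order_refl)
 also have "norm (of_real (N' x * ?N x ^ n) :: complex) = N' x * ?N x ^ n"
 using N'0 by (simp only: norm_of_real abs_of_nonneg mult_nonneg_nonneg zero_le_power sqs_nonneg)
 finally show ?thesis by (simp only: distrib_right mult_1 add.commute)
 qed
 have tNN: "tame d (%x. of_real (N' x * ?N x ^ n))" "tame d (%x. of_real (?N x ^ Suc n))"
 unfolding of_real_mult of_real_power by (intro tame_mult tame_power tN tN')+
 have "real (Suc k) * (LINT x|gd d. ?N x ^ Suc n) = norm (?A * (LINT x|gd d. of_real (?N x ^ Suc n)) :: complex)"
 unfolding norm_mult integral_complex_of_real norm_of_nat norm_of_real by (simp add: integral_nonneg_AE)
 also have "... <= (LINT x|gd d. norm (SUM i:I. SUM j<d. ?D i j x * ?F' i j x))" unfolding e1 by (rule integral_norm_bound)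
 also have "... <= (LINT x|gd d. ?B * (N' x * ?N x ^ n))"
 proof (intro integral_mono e3)
 show "integrable (gd d) (%x. norm (SUM i:I. SUM j<d. ?D i j x * ?F' i j x))"
 by (intro integrable_norm Bochner_Integration.integrable_sum iDF) auto
 show "integrable (gd d) (%x. ?B * (N' x * ?N x ^ n))"
 by (intro int_mult integrable_tame_real tNN)
 qed
 finally show "real (Suc k) * (LINT x|gd d. ?N x ^ Suc n) <= ?B * (LINT x|gd d. N' x * ?N x ^ n)" by simp
 show "?C = real (Suc k) * (LINT x|gd d. ?N x)"
 proof -
 have bp: "?A * (LINT x|gd d. P i x * cnj (P i x)) = (SUM j<d. (LINT x|gd d. ?D i j x * cnj (?D i j x)))" if i: "i : I" for i
 unfolding HH_by_parts_HP[OF HH[OF i] HP_cnj[OF HP[OF i]]]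
 by (simp add: has_pd_pd[OF has_pd_cnj[OF HP_has_pd[OF HP[OF i]]]])
 have "of_real ?C = (LINT x|gd d. (SUM j<d. SUM i:I. ?D i j x * cnj (?D i j x)))"
 unfolding N'_def integral_complex_of_real[symmetric] of_real_sum of_real_sqs ..
 also have "... = (SUM j<d. SUM i:I. (LINT x|gd d. ?D i j x * cnj (?D i j x)))"
 by (subst int_sum; (intro sum.cong refl int_sum int_tame tame_mult tame_cnj tD tame_sum)?) auto
 also have "... = (SUM i:I. of_nat (Suc k) * (LINT x|gd d. P i x * cnj (P i x)))"
 by (subst sum.swap) (intro sum.cong refl bp[symmetric])
 also have "... = ?A * (LINT x|gd d. of_real (?N x))"
 unfolding of_real_sqs sum_cmult[symmetric]
 by (intro arg_cong2[where f="(*)"] refl int_sum[symmetric] int_tame tame_mult tP tame_cnj)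
 finally have "complex_of_real ?C = of_real (real (Suc k) * (LINT x|gd d. ?N x))"
 by (simp add: integral_complex_of_real)
 thus ?thesis by (simp only: of_real_eq_iff)
 qed
qed

lemma power_tangent_le:
 fixes h c :: real
 assumes "0 <= h" "0 <= c" shows "real (Suc n) * (h * c ^ n) <= h ^ Suc n + real n * c ^ Suc n"
proof (cases "n = 0 | c = 0")
 case False
 hence "real (Suc n) * (h * c powr (real (Suc n) - 1)) <= h powr real (Suc n) + (real (Suc n) - 1) * c powr real (Suc n)"
 using assms by (intro powr_tangent_le) auto
 moreover have "real (Suc n) - 1 = real n" by simp
 moreover have "h powr real (Suc n) = h ^ Suc n" "c powr real (Suc n) = c ^ Suc n" "c powr real n = c ^ n"
 using assms False by (intro powr_realpow'; simp)+
 ultimately show ?thesis by simp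
next
 case True
 thus ?thesis using assms by (cases n) auto
qed

text \<open>With \<open>q = 2 * n + 2\<close> the constant is
  \<open>(q - 1) powr (k * q / 2)\<close>, as in Nelson's theorem. The step and a tangent inequality
  bound the moment of \<open>N\<close> by that of \<open>A * N'\<close>, where
  \<open>A = (2 * n + 1) / (k + 1)\<close>. As the mean of \<open>N'\<close> is
  \<open>(k + 1)\<close> times that of \<open>N\<close>, one degree costs
  \<open>(2 * n + 1) ^ (n + 1)\<close>.\<close>

theorem HH_hypercontractive:
 assumes "finite I" "!!i. i : I ==> HH d k (P i)"
 shows "(LINT x|gd d. sqs I P x ^ Suc n) <= (2 * real n + 1) ^ (k * Suc n) * (LINT x|gd d. sqs I P x) ^ Suc n"
 using assms
proof (induction k arbitrary: I P)
 case 0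
 have "EX c. P i = (%_. c)" if "i : I" for i using 0(2)[OF that] by (auto simp: HH_def)
 then obtain c where "!!i. i : I ==> P i = (%_. c i)" by metis
 hence "sqs I P = (%_. SUM i:I. (norm (c i))^2)" by (auto simp: sqs_def fun_eq_iff)
 thus ?case using prob_space.prob_space[OF prob_space_gd[of d]] by (simp del: power_Suc)
next
 case (Suc k)
 let ?N = "sqs I P" and ?N' = "%x. SUM j<d. sqs I (%i. pd j (P i)) x"
 \<comment> \<open>Pairs of a family index and a coordinate are coded as natural numbers, since
   \<open>sqs\<close> indexes families by \<open>nat\<close>.\<close>
 let ?Q = "%l. pd (snd (prod_decode l)) (P (fst (prod_decode l)))"
 let ?J = "prod_encode ` (I \<times> {..<d})"
 note st = HH_sqs_step[OF Suc.prems(2)]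
 have N'0: "0 <= ?N' x" for x by (simp add: sum_nonneg)
 have N': "?N' x = sqs ?J ?Q x" for x
 proof -
 have "sqs ?J ?Q x = (\<Sum>(i, j)\<in>I \<times> {..<d}. (norm (pd j (P i) x))^2)"
 unfolding sqs_def by (subst sum.reindex) (auto simp: inj_prod_encode inj_on_def case_prod_beta)
 also have "... = (SUM i:I. SUM j<d. (norm (pd j (P i) x))^2)" by (simp add: sum.cartesian_product)
 finally show ?thesis unfolding sqs_def by (subst (asm) sum.swap) simp
 qed
 have IH: "(LINT x|gd d. ?N' x ^ Suc n) <= (2 * real n + 1) ^ (k * Suc n) * (LINT x|gd d. ?N' x) ^ Suc n"
 unfolding N'
 proof (rule Suc.IH)
 show "finite ?J" using Suc.prems(1) by simp
 show "HH d k (?Q l)" if "l : ?J" for l using that Suc.prems(2) by (auto intro: HH_partial_deriv)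
 qed
 define A where "A = (2 * real n + 1) / real (Suc k)"
 have A: "0 <= A" by (simp add: A_def)
 have i1: "integrable (gd d) (%x. ?N' x * ?N x ^ n)" "integrable (gd d) (%x. ?N' x ^ Suc n)" "integrable (gd d) (%x. ?N x ^ Suc n)"
 by (rule integrable_tame_real; unfold of_real_mult of_real_power; intro tame_mult tame_power st(3,4); assumption)+
 have "(LINT x|gd d. ?N x ^ Suc n) <= A * (LINT x|gd d. ?N' x * ?N x ^ n)"
 using st(1)[where n=n] by (simp add: A_def field_simps del: of_nat_Suc power_Suc)
 hence "real (Suc n) * (LINT x|gd d. ?N x ^ Suc n) <= (LINT x|gd d. real (Suc n) * (A * ?N' x * ?N x ^ n))"
 by (simp add: mult.assoc mlm del: of_nat_Suc power_Suc)
 also have "... <= (LINT x|gd d. A ^ Suc n * ?N' x ^ Suc n + real n * ?N x ^ Suc n)"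
 proof (intro integral_mono)
 show "real (Suc n) * (A * ?N' x * ?N x ^ n) <= A ^ Suc n * ?N' x ^ Suc n + real n * ?N x ^ Suc n" for x
 using power_tangent_le[of "A * ?N' x" "?N x" n] A N'0[of x] by (simp add: pow_mult del: of_nat_Suc power_Suc)
 show "integrable (gd d) (%x. real (Suc n) * (A * ?N' x * ?N x ^ n))"
 using i1(1) by (simp add: mult.assoc del: of_nat_Suc)
 show "integrable (gd d) (%x. A ^ Suc n * ?N' x ^ Suc n + real n * ?N x ^ Suc n)"
 using i1 by (intro int_add int_mult)
 qed
 also have "... = A ^ Suc n * (LINT x|gd d. ?N' x ^ Suc n) + real n * (LINT x|gd d. ?N x ^ Suc n)"
 using i1 by (subst Bochner_Integration.integral_add) (auto simp del: power_Suc)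
 finally have "(LINT x|gd d. ?N x ^ Suc n) <= A ^ Suc n * (LINT x|gd d. ?N' x ^ Suc n)"
 by (simp add: distrib_right del: power_Suc)
 also have "... <= A ^ Suc n * ((2 * real n + 1) ^ (k * Suc n) * (real (Suc k) * (LINT x|gd d. ?N x)) ^ Suc n)"
 proof (intro mlm)
 have st2: "(LINT x|gd d. ?N' x) = real (Suc k) * (LINT x|gd d. ?N x)" by (rule st(2))
 show "(LINT x|gd d. ?N' x ^ Suc n) <= (2 * real n + 1) ^ (k * Suc n) * (real (Suc k) * (LINT x|gd d. ?N x)) ^ Suc n"
 using IH unfolding st2 .
 qed (simp add: A)
 also have "... = (A * real (Suc k)) ^ Suc n * (2 * real n + 1) ^ (k * Suc n) * (LINT x|gd d. ?N x) ^ Suc n"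
 by (simp only: pow_mult mult_ac)
 also have "A * real (Suc k) = 2 * real n + 1" by (simp add: A_def del: of_nat_Suc)
 also have "(2 * real n + 1) ^ Suc n * (2 * real n + 1) ^ (k * Suc n) = (2 * real n + 1) ^ (Suc k * Suc n)"
 by (simp add: power_add)
 finally show ?case .
qed

lemma tame_measurable_gd: "tame d u ==> u : bm (gd d)"
 using tame_measurable measurable_cong_sets[OF sets_ld_gd refl] by blast

text \<open>Jensen passes from \<open>p\<close> to the next even exponent
  \<open>2 * (n + 1)\<close>. Since \<open>2 * n <= p\<close>, the base \<open>2 * n + 1\<close> is
  at most \<open>p + 1\<close>; this is where the exponent \<open>k / 2\<close> of the final
  constant originates.\<close>

theorem HH_powr_le:
 assumes u: "HH d k u" and p: "1 < p"
 shows "(NN x|gd d. np p (u x))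
 <= en ((p + 1) powr (real k * p / 2) * (LINT x|gd d. (norm (u x))^2) powr (p / 2))"
proof -
 let ?A = "%x. norm (u x) powr p"
 let ?B = "%x. (norm (u x))^2"
 let ?C = "(LINT x|gd d. ?A x)"
 let ?D = "%n. (LINT x|gd d. (?B x) ^ Suc n)"
 define n where "n = nat \<lfloor>p / 2\<rfloor>"
 define m where "m = real (Suc n)"
 have nf: "real n = of_int \<lfloor>p / 2\<rfloor>" using p by (simp add: n_def)
 have n: "2 * real n <= p" using nf by linarith
 have m: "p < 2 * m" "0 < m" using nf by (simp add: m_def, linarith) (simp add: m_def)
 define q where "q = 2 * m / p"
 have q: "1 < q" using m p by (simp add: q_def)
 let ?E = "(LINT x|gd d. ?B x)"
 have E0: "0 <= ?E" by simp
 have t: "tame d u" using u HH_imp_HP tame_HP by blast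
 note [measurable] = tame_measurable_gd[OF t]
 have s: "sqs {0} (%_. u) x = ?B x" for x by (simp add: sqs_def)
 have hc: "(?D n) <= (2 * real n + 1) ^ (k * Suc n) * ?E ^ Suc n"
 using HH_hypercontractive[of "{0}" d k "%_. u" n] u by (simp add: s del: power_Suc)
 have tp: "tame d (%x. of_real ((?B x) ^ Suc n))"
 unfolding of_real_power by (intro tame_power tame_norm t)
 have pw: "(?A x) powr q = (?B x) ^ Suc n" for x
 proof -
 have "(?A x) powr q = norm (u x) powr (p * q)" by (rule powr_powr)
 also have "p * q = real (2 * Suc n)" using p by (simp add: q_def m_def)
 also have "norm (u x) powr real (2 * Suc n) = norm (u x) ^ (2 * Suc n)" by (rule powr_realpow') auto
 finally show ?thesis by (simp only: power_mult)
 qed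
 have "?C powr q <= (2 * real n + 1) ^ (k * Suc n) * ?E ^ Suc n"
 proof -
 have "en ((LINT x|gd d. 1 * norm (u x) powr p) powr q) <= (NN x|gd d. en 1 * en ((?A x) powr q))"
 by (rule nn_integral_Jensen_powr[where k="%_. 1", OF _ _ _ _ _ q]) (use prob_space.emeasure_space_1[OF prob_space_gd[of d]] in auto)
 also have "... = (NN x|gd d. en ((?B x) ^ Suc n))" by (simp add: pw del: power_Suc)
 also have "... = en (?D n)"
 by (intro nn_integral_eq_integral integrable_tame_real[OF tp]) simp
 finally have "?C powr q <= (?D n)"
 by (simp add: ennreal_le_iff integral_nonneg_AE del: power_Suc)
 with hc show ?thesis by linarith
 qed
 also have "... = (2 * real n + 1) powr (real k * m) * ?E powr m"
 proof -
 have "(2 * real n + 1) ^ (k * Suc n) = (2 * real n + 1) powr real (k * Suc n)" by (rule powr_realpow[symmetric]) simp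
 moreover have "?E ^ Suc n = ?E powr real (Suc n)" by (rule powr_realpow'[symmetric]) auto
 ultimately show ?thesis unfolding m_def of_nat_mult by simp
 qed
 also have "... <= (p + 1) powr (real k * m) * ?E powr m"
 using n p m by (intro mrm powr_mono2) auto
 finally have le: "?C powr q <= (p + 1) powr (real k * m) * ?E powr m" .
 have I0: "0 <= ?C" by simp
 have "?C = (?C powr q) powr (1 / q)"
 using q I0 by (simp add: powr_powr)
 also have "... <= ((p + 1) powr (real k * m) * ?E powr m) powr (1 / q)"
 using q by (intro powr_mono2 le) auto
 also have "... = (p + 1) powr (real k * p / 2) * ?E powr (p / 2)"
 using p m q by (simp add: powr_mult powr_powr q_def field_simps)
 finally have le2: "?C <= (p + 1) powr (real k * p / 2) * ?E powr (p / 2)" .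
 have "integrable (gd d) (%x. ?A x)"
 proof (rule int_bd)
 show "integrable (gd d) (%x. 1 + (?B x) ^ Suc n)"
 using prob_space.finite_measure[OF prob_space_gd[of d]]
 by (intro int_add integrable_tame_real[OF tp] finite_measure.integrable_const)
 show "AE x in gd d. norm (?A x) <= norm (1 + (?B x) ^ Suc n)"
 proof (rule AE_I2)
 fix x
 have "?A x <= 1 + (?A x) powr q"
 proof (cases "?A x <= 1")
 case False
 hence "(?A x) powr 1 <= (?A x) powr q" using q by (intro powr_mono[of 1 q]) linarith+
 moreover have "(?A x) powr 1 = ?A x" by (rule powr_one) simp
 ultimately show ?thesis by linarith
 qed (auto intro: add_increasing2)
 thus "norm (?A x) <= norm (1 + (?B x) ^ Suc n)" unfolding pw by (simp del: power_Suc)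
 qed
 qed measurable
 hence "(NN x|gd d. en (?A x)) = en ?C"
 by (intro nn_integral_eq_integral) auto
 also have "... <= en ((p + 1) powr (real k * p / 2) * ?E powr (p / 2))" by (intro en_leI le2)
 finally show ?thesis .
qed

section \<open>Kernels in two variables and the zonal kernel\<close>

text \<open>For such kernels, measurability, growth, Laplacians under the integral and exchange of
  integrals need only be checked on a single product.\<close>

inductive sep :: "nat => nat => nat => ((nat => real) => (nat => real) => complex) => bool" for d k l where
 sep_prod: "HP d k A ==> HP d l B ==> sep d k l (%z w. A z * B w)"
| sep_add: "sep d k l \<Phi> ==> sep d k l \<Psi> ==> sep d k l (%z w. \<Phi> z w + \<Psi> z w)"

lemma sep_sum: "(!!i. i : I ==> sep d k l (\<Phi> i)) ==> sep d k l (%z w. SUM i:I. \<Phi> i z w)"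
proof (induction I rule: infinite_finite_induct)
 case (insert i I)
 have "sep d k l (%z w. \<Phi> i z w + (SUM i:I. \<Phi> i z w))" by (intro sep_add insert.IH insert.prems) auto
 thus ?case using insert by simp
qed (use sep_prod[OF HP_zero HP_zero, of d k l] in auto)

lemma sep_mult_prod: "sep d k' l' \<Psi> ==> HP d k A ==> HP d l B ==> sep d (k + k') (l + l') (%z w. (A z * B w) * \<Psi> z w)"
proof (induction rule: sep.induct)
 case (sep_prod A' B')
 have "sep d (k + k') (l + l') (%z w. (A z * A' z) * (B w * B' w))" by (intro sep.sep_prod HP_mult sep_prod)
 thus ?case by (simp add: mult_ac)
next
 case (sep_add \<Phi> \<Psi>)
 from sep.sep_add[OF sep_add.IH(1)[OF sep_add.prems] sep_add.IH(2)[OF sep_add.prems]]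
 show ?case by (simp add: distrib_left)
qed

lemma sep_mult: "sep d k l \<Phi> ==> sep d k' l' \<Psi> ==> sep d (k + k') (l + l') (%z w. \<Phi> z w * \<Psi> z w)"
proof (induction rule: sep.induct)
 case (sep_prod A B)
 thus ?case by (intro sep_mult_prod)
next
 case (sep_add \<Phi> \<Phi>')
 from sep.sep_add[OF sep_add.IH(1)[OF sep_add.prems] sep_add.IH(2)[OF sep_add.prems]]
 show ?case by (simp add: distrib_right)
qed

lemma HP_const: "HP d 0 (%_. c)"
 unfolding HP.simps(1) by blast

lemma sep_power: "sep d k l \<Phi> ==> sep d (n * k) (n * l) (%z w. \<Phi> z w ^ n)"
proof (induction n)
 case 0 thus ?case using sep_prod[OF HP_const HP_const, of d 1 1] by simp
next
 case (Suc n) from sep_mult[OF Suc.prems Suc.IH[OF Suc.prems]] show ?case by simp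
qed

lemma HP_coord1: "j < d ==> HP d 1 (%x. of_real (x j))"
 using HP_coord[OF _ HP_const, of j d 1] by simp

lemma sep_ip: "sep d 1 1 (%z w. of_real (ip d z w))"
 unfolding ip_def of_real_sum of_real_mult by (intro sep_sum sep_prod HP_coord1) auto

lemma sep_HP_left: "sep d k l \<Phi> ==> HP d k (%z. \<Phi> z w)"
proof (induction rule: sep.induct)
 case (sep_prod A B)
 from HP_cmult[OF sep_prod(1), of "B w"] show ?case by (simp add: mult.commute)
qed (auto intro: HP_add)

lemma sep_HP_right: "sep d k l \<Phi> ==> HP d l (\<Phi> z)"
 by (induction rule: sep.induct) (auto intro: HP_add HP_cmult)

lemma sep_measurable:
 assumes "sep d k l \<Phi>" and [measurable]: "f : measurable M (ld d)" "g : measurable M (ld d)"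
 shows "(%y. \<Phi> (f y) (g y)) : bm M"
 using assms(1)
proof (induction rule: sep.induct)
 case (sep_prod A B)
 have [measurable]: "A : bm (ld d)" "B : bm (ld d)" using sep_prod HP_measurable by auto
 show ?case by measurable
qed auto

lemma laplacian_add:
 assumes "HP d k P" "HP d k Q" shows "laplacian d (%x. P x + Q x) x = laplacian d P x + laplacian d Q x"
 unfolding laplacian_def sum.distrib[symmetric]
proof (intro sum.cong refl)
 fix j assume j: "j : {..<d}"
 have 1: "pd j (%x. P x + Q x) = (%x. pd j P x + pd j Q x)"
 by (intro has_pd_pd has_pd_add HP_has_pd[OF assms(1)] HP_has_pd[OF assms(2)])
 have "HP d (k - 1) (pd j P)" "HP d (k - 1) (pd j Q)" using HP_0_or_pd assms j by auto
 thus "pd j (pd j (%x. P x + Q x)) x = pd j (pd j P) x + pd j (pd j Q) x"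
 unfolding 1 by (intro fun_cong[OF has_pd_pd] has_pd_add HP_has_pd)
qed

lemma has_pd_cmult: "has_pd j u D ==> has_pd j (%x. c * u x) (%x. c * D x)"
 using has_pd_mult[OF has_pd_const[of j c]] by fastforce

lemma laplacian_cmult:
 assumes "HP d k P" shows "laplacian d (%x. c * P x) x = c * laplacian d P x"
 unfolding laplacian_def sum_cmult
proof (intro sum.cong refl)
 fix j assume j: "j : {..<d}"
 have 1: "pd j (%x. c * P x) = (%x. c * pd j P x)"
 by (intro has_pd_pd has_pd_cmult HP_has_pd[OF assms])
 have "HP d (k - 1) (pd j P)" using HP_0_or_pd assms j by auto
 thus "pd j (pd j (%x. c * P x)) x = c * pd j (pd j P) x"
 unfolding 1 by (intro fun_cong[OF has_pd_pd] has_pd_cmult HP_has_pd)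
qed

lemma sep_integral:
 assumes "sep d k l \<Phi>" and F: "!!B. HP d l B ==> integrable M (%w. B w * F w)"
 shows "integrable M (%w. \<Phi> z w * F w)" "HP d k (%z. (LINT w|M. \<Phi> z w * F w))"
 "integrable M (%w. laplacian d (%z. \<Phi> z w) z * F w)"
 "laplacian d (%z. (LINT w|M. \<Phi> z w * F w)) z = (LINT w|M. laplacian d (%z. \<Phi> z w) z * F w)"
proof -
 let ?A = "%\<Phi>. %z. (LINT w|M. \<Phi> z w * F w)"
 let ?B = "%\<Phi> w z. laplacian d (%z. \<Phi> z w) z * F w"
 show i: "integrable M (%w. \<Phi> z w * F w)" for z by (rule F[OF sep_HP_right[OF assms(1)]])
 have "HP d k (?A \<Phi>) & integrable M (%w. ?B \<Phi> w z) &
 laplacian d (?A \<Phi>) z = (LINT w|M. ?B \<Phi> w z)"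
 using assms(1)
 proof (induction rule: sep.induct)
 case (sep_prod A B)
 have e: "(%z. (LINT w|M. A z * B w * F w)) = (%z. (LINT w|M. B w * F w) * A z)"
 by (simp add: mult.assoc mult.commute[of _ "A _"])
 have l: "laplacian d (%z. A z * B w) z = B w * laplacian d A z" for w
 using laplacian_cmult[OF sep_prod(1), of "B w" z] by (simp add: mult.commute)
 have "integrable M (%w. laplacian d A z * (B w * F w))" using F[OF sep_prod(2)] by simp
 moreover have "B w * laplacian d A z * F w = laplacian d A z * (B w * F w)" for w by simp
 moreover have "(LINT w|M. B w * F w) * laplacian d A z = (LINT w|M. laplacian d A z * (B w * F w))"
 unfolding int_cmult by (rule mult.commute)
 ultimately show ?case unfolding e l laplacian_cmult[OF sep_prod(1)]
 by (simp only: HP_cmult[OF sep_prod(1)] simp_thms)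
 next
 case (sep_add \<Phi> \<Psi>)
 have I: "integrable M (%w. \<Phi> z w * F w)" "integrable M (%w. \<Psi> z w * F w)" for z
 using F[OF sep_HP_right] sep_add(1,2) by auto
 have e: "(%z. (LINT w|M. (\<Phi> z w + \<Psi> z w) * F w)) = (%z. (LINT w|M. \<Phi> z w * F w) + (LINT w|M. \<Psi> z w * F w))"
 using I by (simp add: distrib_right)
 have l: "laplacian d (%z. \<Phi> z w + \<Psi> z w) z = laplacian d (%z. \<Phi> z w) z + laplacian d (%z. \<Psi> z w) z" for w
 by (rule laplacian_add[OF sep_HP_left[OF sep_add(1)] sep_HP_left[OF sep_add(2)]])
 show ?case unfolding e l using sep_add.IH HP_add laplacian_add by (auto simp: distrib_right)
 qed
 thus "HP d k (?A \<Phi>)" "integrable M (%w. ?B \<Phi> w z)"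
 "laplacian d (?A \<Phi>) z = (LINT w|M. ?B \<Phi> w z)" by auto
qed

lemma sep_fubini:
 assumes "sep d k l \<Phi>" and F: "!!B. HP d l B ==> integrable M (%w. B w * F w)"
 and v: "!!A. HP d k A ==> integrable N (%z. A z * v z)"
 shows "(LINT z|N. (LINT w|M. \<Phi> z w * F w) * v z) = (LINT w|M. (LINT z|N. \<Phi> z w * v z) * F w)
 & integrable M (%w. (LINT z|N. \<Phi> z w * v z) * F w)"
 using assms(1)
proof (induction rule: sep.induct)
 case (sep_prod A B)
 have "(LINT z|N. A z * B w * v z) = (LINT z|N. A z * v z) * B w" for w
 by (simp add: mult.assoc mult.left_commute[of _ "B w"] mult.commute[of _ "B w"])
 moreover have "(LINT w|M. A z * B w * F w) = A z * (LINT w|M. B w * F w)" for z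
 by (simp add: mult.assoc)
 ultimately show ?case using F[OF sep_prod(2)] by (simp add: mult.assoc mult.left_commute[of _ "integral\<^sup>L M _"] mult.commute[of _ "integral\<^sup>L M _"])
next
 case (sep_add \<Phi> \<Psi>)
 have I: "integrable M (%w. \<Phi> z w * F w)" "integrable M (%w. \<Psi> z w * F w)" for z
 using F[OF sep_HP_right] sep_add(1,2) by auto
 have J: "integrable N (%z. \<Phi> z w * v z)" "integrable N (%z. \<Psi> z w * v z)" for w
 using v[OF sep_HP_left] sep_add(1,2) by auto
 have K: "integrable N (%z. (LINT w|M. \<Phi> z w * F w) * v z)" "integrable N (%z. (LINT w|M. \<Psi> z w * F w) * v z)"
 using sep_integral(2)[OF sep_add(1) F] sep_integral(2)[OF sep_add(2) F] v by auto
 show ?case using I J K sep_add.IH by (simp add: distrib_right)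
qed

text \<open>Coefficients of Gegenbauer type, determined by \<open>zc d k 0 = 1\<close> and the
  requirement that consecutive terms of the Laplacian in \<open>HH_zonal\<close> cancel. For
  \<open>2 * m + 2 <= k\<close> all subtractions are exact.\<close>

fun zc :: "nat => nat => nat => real" where
 "zc d k 0 = 1"
| "zc d k (Suc m) = - zc d k m * (real (k - 2 * m) * real (k - 2 * m - 1)) / (2 * real (Suc m) * real (d + 2 * k - 2 * m - 4))"

text \<open>Normalised to have coefficient 1 at \<open>(y . x) ^ k\<close>, hence a reproducing
  kernel up to the factor \<open>fact k\<close>. It is a polynomial of degree \<open>k\<close> in
  each variable and symmetric.\<close>

definition zonal :: "nat => nat => (nat => real) => (nat => real) => complex" where
 "zonal d k y x = (SUM m<=k div 2. of_real (zc d k m) * (of_real (nsq d y) ^ m * of_real (nsq d x) ^ m) * of_real (ip d y x) ^ (k - 2 * m))"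

lemma ip_commute: "ip d x y = ip d y x" by (simp add: ip_def mult.commute)

lemma zonal_commute: "zonal d k x y = zonal d k y x"
 by (simp add: zonal_def ip_commute[of d x y] mult_ac)

lemma cnj_zonal [simp]: "cnj (zonal d k x y) = zonal d k x y"
 by (simp add: zonal_def)

lemma sep_zonal: "sep d k k (zonal d k)"
 unfolding zonal_def[abs_def]
proof (intro sep_sum)
 fix m assume m: "m : {..k div 2}"
 have "sep d (m * 2) (m * 2) (%y x. (of_real (zc d k m) * of_real (nsq d y) ^ m) * of_real (nsq d x) ^ m)"
 by (intro sep_prod HP_cmult HP_power HP_nsq)
 from sep_mult[OF this sep_power[OF sep_ip, where n="k - 2 * m"]] m
 show "sep d k k (%y x. of_real (zc d k m) * (of_real (nsq d y) ^ m * of_real (nsq d x) ^ m) * of_real (ip d y x) ^ (k - 2 * m))"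
 by (simp add: mult.assoc mult.commute[of m 2])
qed

lemma HP_zonal: "HP d k (zonal d k y)"
 by (rule sep_HP_right[OF sep_zonal])

lemma laplacian_nsq_ip_power:
 "laplacian d (%x. of_real (nsq d x) ^ m * of_real (ip d y x) ^ l) x
 = of_nat (2 * m) * (of_nat d + 2 * of_nat l + 2 * of_nat (m - 1)) * of_real (nsq d x) ^ (m - 1) * of_real (ip d y x) ^ l
 + of_nat (l * (l - 1)) * of_real (nsq d y) * of_real (nsq d x) ^ m * of_real (ip d y x) ^ (l - 2)"
proof -
 let ?A = "of_nat (4 * m * (m - 1))"
 let ?B = "of_nat (4 * m * l)"
 let ?C = "%j. of_real (y j)"
 let ?D = "%x j. of_real (x j)"
 let ?E = "of_nat (2 * m)"
 let ?N = "%x. of_real (nsq d x) :: complex" and ?L = "%x. of_real (ip d y x) :: complex"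
 have h1: "has_pd j (%x. ?N x ^ m * ?L x ^ l)
 (%x. (of_nat m * ?N x ^ (m - 1) * (2 * ?D x j)) * ?L x ^ l + ?N x ^ m * (of_nat l * ?L x ^ (l - 1) * ?C j))" if "j < d" for j
 by (intro has_pd_mult has_pd_power has_pd_nsq has_pd_ip that)
 have h2: "pd j (pd j (%x. ?N x ^ m * ?L x ^ l)) x
 = ?A * ?N x ^ (m - 1 - 1) * ?L x ^ l * (?D x j * ?D x j)
 + ?E * ?N x ^ (m - 1) * ?L x ^ l
 + ?B * ?N x ^ (m - 1) * ?L x ^ (l - 1) * (?C j * ?D x j)
 + of_nat (l * (l - 1)) * ?N x ^ m * ?L x ^ (l - 1 - 1) * (?C j * ?C j)" if "j < d" for j
 proof -
 have "pd j (%x. (of_nat m * ?N x ^ (m - 1) * (2 * ?D x j)) * ?L x ^ l + ?N x ^ m * (of_nat l * ?L x ^ (l - 1) * ?C j)) =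
 (%x. (((0 * ?N x ^ (m - 1) + of_nat m * (of_nat (m - 1) * ?N x ^ (m - 1 - 1) * (2 * ?D x j))) * (2 * ?D x j)
 + of_nat m * ?N x ^ (m - 1) * (0 * ?D x j + 2 * (if j = j then 1 else 0))) * ?L x ^ l
 + (of_nat m * ?N x ^ (m - 1) * (2 * ?D x j)) * (of_nat l * ?L x ^ (l - 1) * ?C j))
 + ((of_nat m * ?N x ^ (m - 1) * (2 * ?D x j)) * (of_nat l * ?L x ^ (l - 1) * ?C j)
 + ?N x ^ m * ((0 * ?L x ^ (l - 1) + of_nat l * (of_nat (l - 1) * ?L x ^ (l - 1 - 1) * ?C j)) * ?C j
 + of_nat l * ?L x ^ (l - 1) * 0)))"
 by (rule has_pd_pd) (intro has_pd_add has_pd_mult has_pd_power has_pd_nsq has_pd_ip has_pd_const has_pd_coord that)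
 note eq = this
 show ?thesis unfolding has_pd_pd[OF h1[OF that]] eq by (simp add: distrib_left distrib_right mult_ac add_ac)
 qed
 have s: "(SUM j<d. of_real (x j) * ?D x j) = ?N x" "(SUM j<d. of_real (y j) * ?D x j) = ?L x"
 "(SUM j<d. of_real (y j) * ?C j) = (of_real (nsq d y) :: complex)"
 by (simp_all add: nsq_def ip_def sq_eq)
 have "laplacian d (%x. ?N x ^ m * ?L x ^ l) x
 = ?A * ?N x ^ (m - 1 - 1) * ?L x ^ l * ?N x
 + of_nat d * (?E * ?N x ^ (m - 1) * ?L x ^ l)
 + ?B * ?N x ^ (m - 1) * ?L x ^ (l - 1) * ?L x
 + of_nat (l * (l - 1)) * ?N x ^ m * ?L x ^ (l - 1 - 1) * of_real (nsq d y)"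
 unfolding laplacian_def using h2 by (simp add: sum.distrib sum_cmult[symmetric] s)
 also have "?A * ?N x ^ (m - 1 - 1) * ?L x ^ l * ?N x = ?A * ?N x ^ (m - 1) * ?L x ^ l"
 by (cases "m - 1") simp_all
 also have "?B * ?N x ^ (m - 1) * ?L x ^ (l - 1) * ?L x = ?B * ?N x ^ (m - 1) * ?L x ^ l"
 by (cases l) simp_all
 also have "?A * ?N x ^ (m - 1) * ?L x ^ l + of_nat d * (?E * ?N x ^ (m - 1) * ?L x ^ l)
 + ?B * ?N x ^ (m - 1) * ?L x ^ l
 = (?A + of_nat d * ?E + ?B) * (?N x ^ (m - 1) * ?L x ^ l)"
 by (simp only: distrib_right mult.assoc)
 also have "?A + of_nat d * ?E + ?B = ?E * (of_nat d + 2 * of_nat l + 2 * (of_nat (m - 1) :: complex))"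
 by (cases m) (simp_all add: algebra_simps)
 finally show ?thesis by (simp only: diff_diff_left one_add_one mult_ac)
qed

theorem HH_zonal: assumes d: "0 < d" shows "HH d k (zonal d k y)"
 unfolding HH_def
proof (intro conjI allI HP_zonal)
 let ?A = "%m. of_nat ((k - 2 * m) * (k - 2 * m - 1))"
 let ?B = "%m. of_real (zc d k (Suc m)) * (of_nat (2 * Suc m) * of_nat (d + 2 * (k - 2 * Suc m) + 2 * (Suc m - 1)))"
 let ?C = "%m. d + 2 * k - 2 * m - 4"
 let ?D = "%m. - zc d k m * (real (k - 2 * m) * real (k - 2 * m - 1))"
 fix x
 let ?N = "of_real (nsq d x) :: complex" and ?L = "of_real (ip d y x) :: complex" and ?Y = "of_real (nsq d y) :: complex"
 let ?K = "k div 2"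
 let ?f = "%m x. of_real (nsq d x) ^ m * of_real (ip d y x) ^ (k - 2 * m) :: complex"
 let ?c = "%m. of_real (zc d k m) * ?Y ^ m"
 define a where "a m = ?c m * (of_nat (2 * m) * of_nat (d + 2 * (k - 2 * m) + 2 * (m - 1)) * ?N ^ (m - 1) * ?L ^ (k - 2 * m))" for m
 define b where "b m = ?c m * (?A m * ?Y * ?N ^ m * ?L ^ (k - 2 * m - 2))" for m
 have HPf: "HP d k (?f m)" if "m <= ?K" for m
 using HP_mult[OF HP_power[OF HP_nsq, where n=m] HP_power[OF HP_ip, where n="k - 2 * m"]] that by (simp add: mult.commute[of m])
 have "laplacian d (zonal d k y) x = laplacian d (%x. SUM m:{..?K}. ?c m * ?f m x) x"
 by (simp add: zonal_def[abs_def] mult_ac)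
 also have "... = (SUM m:{..?K}. ?c m * laplacian d (?f m) x)"
 proof -
 have "laplacian d (%x. SUM m:J. ?c m * ?f m x) x = (SUM m:J. ?c m * laplacian d (?f m) x)" if "finite J" "J <= {..?K}" for J
 using that
 proof (induction J)
 case empty
 thus ?case using laplacian_HP_0(1)[OF HP_const] by simp
 next
 case (insert m J)
 have "laplacian d (%x. ?c m * ?f m x + (SUM m:J. ?c m * ?f m x)) x = laplacian d (%x. ?c m * ?f m x) x + laplacian d (%x. SUM m:J. ?c m * ?f m x) x"
 using insert.prems by (intro laplacian_add[where k=k] HP_sum HP_cmult HPf) auto
 also have "... = ?c m * laplacian d (?f m) x + (SUM m:J. ?c m * laplacian d (?f m) x)"
 proof -
 have "laplacian d (%x. SUM m:J. ?c m * ?f m x) x = (SUM m:J. ?c m * laplacian d (?f m) x)"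
 by (rule insert.IH) (use insert.prems in auto)
 moreover have "laplacian d (%x. ?c m * ?f m x) x = ?c m * laplacian d (?f m) x"
 by (rule laplacian_cmult[OF HPf]) (use insert.prems in auto)
 ultimately show ?thesis by (simp only:)
 qed
 finally show ?case by (simp only: sum.insert[OF insert(1,2)])
 qed
 thus ?thesis by simp
 qed
 also have "... = (SUM m:{..?K}. a m + b m)"
 unfolding laplacian_nsq_ip_power a_def b_def by (intro sum.cong refl) (simp add: distrib_left mult_ac)
 \<comment> \<open>Shifting the index pairs the part of term \<open>m + 1\<close> that lost a factor
   \<open>|x|\<^sup>2\<close> with the part of term \<open>m\<close> that lost two factors of the
   scalar product. The ends vanish: \<open>a 0\<close> has the factor \<open>m = 0\<close>, and
   \<open>k - 2 * ?K\<close> is 0 or 1.\<close>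
 also have "... = (SUM m<?K. a (Suc m) + b m) + (a 0 + b ?K)"
 by (simp add: sum.distrib lessThan_Suc_atMost[symmetric] sum.lessThan_Suc_shift[of a] del: sum.lessThan_Suc) simp
 also have "a 0 = 0" by (simp add: a_def)
 also have "b ?K = 0" by (cases "even k") (auto simp: b_def elim!: evenE oddE)
 also have "(SUM m<?K. a (Suc m) + b m) = 0"
 proof (intro sum.neutral ballI)
 fix m assume "m : {..<?K}"
 hence m: "2 * m + 2 <= k" by auto
 hence e: "d + 2 * (k - 2 * Suc m) + 2 * (Suc m - 1) = ?C m" by simp
 have nz: "2 * real (Suc m) * real (?C m) ~= 0" using d m by simp
 have "zc d k (Suc m) * (2 * real (Suc m) * real (?C m)) = ?D m"
 unfolding zc.simps by (simp only: times_divide_eq_left nonzero_mult_div_cancel_right[OF nz])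
 hence "zc d k (Suc m) * (real (2 * Suc m) * real (?C m)) = ?D m"
 by (simp only: of_nat_mult of_nat_numeral)
 from arg_cong[OF this, of complex_of_real]
 have "?B m
 = - (of_real (zc d k m) * ?A m :: complex)"
 unfolding e by (simp only: of_real_mult of_real_minus of_real_of_nat_eq of_nat_mult mult_minus_left)
 moreover have "a (Suc m) = (?B m)
 * (?Y ^ Suc m * ?N ^ m * ?L ^ (k - 2 * m - 2))"
 proof -
 have "k - 2 * Suc m = k - 2 * m - 2" "Suc m - 1 = m" by simp_all
 thus ?thesis unfolding a_def e by (simp only: mult_ac)
 qed
 ultimately have "a (Suc m) = - (of_real (zc d k m) * ?A m) * (?Y ^ Suc m * ?N ^ m * ?L ^ (k - 2 * m - 2))"
 by simp
 moreover have "b m = (of_real (zc d k m) * ?A m) * (?Y ^ Suc m * ?N ^ m * ?L ^ (k - 2 * m - 2))"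
 unfolding b_def by (simp only: power_Suc mult_ac)
 ultimately show "a (Suc m) + b m = 0" by simp
 qed
 finally show "laplacian d (zonal d k y) x = 0" by simp
qed

text \<open>Every term except \<open>m = 0\<close> contains a factor \<open>|x|\<^sup>2\<close> and
  is orthogonal to \<open>Q\<close>; the remaining one is \<open>HH_inner_power\<close>.\<close>

theorem zonal_reproducing:
 assumes Q: "HH d k Q" shows "(LINT x|gd d. zonal d k y x * Q x) = fact k * Q y"
proof -
 let ?A = "%x m' m. of_real (nsq d x) ^ m' * of_real (ip d y x) ^ (k - 2 * m)"
 let ?t = "%m x. of_real (zc d k m) * (of_real (nsq d y) ^ m * of_real (nsq d x) ^ m) * of_real (ip d y x) ^ (k - 2 * m) * Q x"
 have HQ: "HP d k Q" using Q by (rule HH_imp_HP)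
 have z: "(LINT x|gd d. ?t m x) = (if m = 0 then fact k * Q y else 0)" if "m : {..k div 2}" for m
 proof (cases m)
 case 0
 thus ?thesis using HH_inner_power[OF Q, of y] by (simp add: mult.commute)
 next
 case (Suc m')
 have "HP d (m' * 2 + (k - 2 * m) * 1) (%x. ?A x m' m)"
 by (intro HP_mult HP_power HP_nsq HP_ip)
 from HH_orth_nsq[OF Q this]
 have "(LINT x|gd d. Q x * (of_real (nsq d x) * (?A x m' m))) = 0"
 using that Suc by simp
 moreover have "(LINT x|gd d. ?t m x) = (LINT x|gd d. (of_real (zc d k m) * of_real (nsq d y) ^ m) * (Q x * (of_real (nsq d x) * (?A x m' m))))"
 unfolding Suc by (intro int_cong refl) (simp only: power_Suc mult_ac)
 ultimately show ?thesis unfolding int_cmult using Suc by simp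
 qed
 have "(LINT x|gd d. zonal d k y x * Q x) = (LINT x|gd d. (SUM m<=k div 2. ?t m x))"
 by (simp add: zonal_def sum_distrib_right)
 also have "... = (SUM m<=k div 2. (LINT x|gd d. ?t m x))"
 by (intro int_sum int_tame tame_mult tame_const tame_power tame_HP[OF HQ] tame_HP[OF HP_nsq] tame_HP[OF HP_ip])
 also have "... = (SUM m<=k div 2. if m = 0 then fact k * Q y else 0)" by (intro sum.cong refl z)
 finally show ?thesis by simp
qed

definition zonal_diag :: "nat => nat => real" where "zonal_diag d k = (SUM m<=k div 2. zc d k m)"

lemma zonal_self: "zonal d k x x = of_real (zonal_diag d k * nsq d x ^ k)"
proof -
 have "nsq d x ^ m * nsq d x ^ m * nsq d x ^ (k - 2 * m) = nsq d x ^ k" if "m <= k div 2" for m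
 using that by (simp flip: power_add mult_2)
 moreover have "ip d x x = nsq d x" by (simp add: ip_def nsq_def sq_eq)
 ultimately show ?thesis
 unfolding zonal_def zonal_diag_def sum_distrib_right of_real_sum
 by (intro sum.cong refl) (simp flip: of_real_power of_real_mult add: mult.assoc)
qed

text \<open>Degree one in each variable, so all pure second derivatives vanish. The polynomial needs
  \<open>k\<close> distinct coordinates, hence \<open>k <= d\<close>.\<close>

lemma HH_monomial: assumes "k <= d" shows "HH d k (%x. \<Prod>i<k. complex_of_real (x i))"
 unfolding HH_def
proof (intro conjI allI)
 let ?A = "%x. \<Prod>i<k. complex_of_real (x i)"
 show "HP d k ?A"
 using HP_monomial[of "{..<k}" d "%_. 1"] assms by simp
 fix x
 have "pd j (pd j ?A) x = 0" for j
 proof (cases "j < k")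
 case True
 let ?R = "%x. \<Prod>i\<in>{..<k} - {j}. complex_of_real (x i)"
 have R: "has_pd j ?R (%_. 0)" unfolding has_pd_def
 proof
 fix x
 have "(%s. ?R (x(j := s))) = (%s. ?R x)" by (intro ext prod.cong refl) auto
 thus "((%s. ?R (x(j := s))) has_vector_derivative 0) (at (x j))" by simp
 qed
 have "(\<Prod>i<k. complex_of_real (x i)) = of_real (x j) * ?R x" for x
 using True by (intro prod.remove) auto
 hence "pd j ?A = (%x. (if j = j then 1 else 0) * ?R x + of_real (x j) * 0)"
 using has_pd_pd[OF has_pd_mult[OF has_pd_coord R]] by simp
 thus ?thesis using has_pd_pd[OF R] by simp
 next
 case False
 have "(%s. \<Prod>i<k. complex_of_real ((x(j := s)) i)) = (%s. \<Prod>i<k. complex_of_real (x i))" for x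
 using False by (intro ext prod.cong refl) auto
 hence "has_pd j ?A (%_. 0)" unfolding has_pd_def by simp
 thus ?thesis using has_pd_pd[OF has_pd_const[of j 0]] by (simp add: has_pd_pd)
 qed
 thus "laplacian d ?A x = 0" by (simp add: laplacian_def)
qed

lemma gaussian_monomial_sq:
 assumes "k <= d" shows "(LINT x|gd d. (\<Prod>i<k. complex_of_real (x i)) * (\<Prod>i<k. complex_of_real (x i))) = 1"
proof -
 let ?N = "density lborel nd"
 let ?A = "%x. \<Prod>i<k. complex_of_real (x i)"
 let ?B = "%s. complex_of_real s * of_real s"
 let ?f = "%i s. if i < k then complex_of_real s * of_real s else 1"
 have i: "integrable ?N (%s. ?B s)"
 proof (rule int_bd[OF integrable_std_normal_one_plus_power[of 2]])
 show "AE s in ?N. norm (?B s) <= norm ((1 + abs s) ^ 2)"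
 proof (rule AE_I2)
 fix s :: real
 have "abs s ^ 2 <= (1 + abs s) ^ 2" by (intro power_mono) auto
 thus "norm (?B s) <= norm ((1 + abs s) ^ 2)" by (simp add: norm_mult sq_eq)
 qed
 qed measurable
 have "(LINT s|?N. s *\<^sub>R complex_of_real s) = (LINT s|?N. 1)"
 by (rule std_normal_by_parts[where C=1 and n=1])
 (auto intro!: has_vector_derivative_of_real[where D=1, simplified] derivative_eq_intros)
 hence one: "(LINT s|?N. ?B s) = 1"
 using std_normal.prob_space by (simp add: scaleR_of_real)
 have "(?A x) * (?A x) = (\<Prod>i<d. ?f i (x i))" for x
 proof -
 have "(\<Prod>i<d. ?f i (x i)) = (\<Prod>i\<in>{..<k}. ?f i (x i))"
 using assms by (intro prod.mono_neutral_right) auto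
 also have "... = (\<Prod>i<k. complex_of_real (x i) * of_real (x i))" by (intro prod.cong) auto
 finally show ?thesis by (simp add: prod.distrib)
 qed
 hence "(LINT x|gd d. (?A x) * (?A x)) = (LINT x|gd d. (\<Prod>i<d. ?f i (x i)))" by simp
 also have "... = (\<Prod>i<d. (LINT s|?N. ?f i s))"
 unfolding gd_def
 proof (rule gaussP.product_integral_prod)
 show "integrable ?N (%s. ?f i s)" for i by (cases "i < k") (simp_all add: i std_normal.integrable_const)
 qed simp
 also have "... = 1"
 proof (intro prod.neutral ballI)
 show "(LINT s|?N. ?f i s) = 1" for i using std_normal.prob_space by (cases "i < k") (simp_all add: one)
 qed
 finally show ?thesis .
qed

text \<open>The bound is the nonnegativity of the squared norm of \<open>Z - fact k * Q\<close>,
  where \<open>Q\<close> is the product of the first \<open>k\<close> coordinates and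
  \<open>Z\<close> the zonal kernel at the point \<open>y\<close> with these coordinates 1 and the
  others 0. There \<open>Q y = 1\<close> and \<open>|y|\<^sup>2 = k\<close>, whatever
  \<open>d\<close> is.\<close>

theorem zonal_diag_ge:
 assumes k: "k <= d" and d: "0 < d" shows "fact k <= zonal_diag d k * real k ^ k"
proof -
 let ?Q = "%x. \<Prod>i<k. complex_of_real (x i)"
 let ?A = "zonal_diag d k * real k ^ k - fact k"
 let ?y = "%i. if i < k then 1 else 0 :: real"
 let ?Z = "zonal d k ?y" and ?c = "fact k :: complex"
 have HQ: "HH d k ?Q" by (rule HH_monomial[OF k])
 have tQ: "tame d ?Q" and tZ: "tame d ?Z" using tame_HP HH_imp_HP HQ HP_zonal by blast+
 have nsq_y: "nsq d ?y = real k"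
 proof -
 have "nsq d ?y = (SUM i:{..<k}. 1)"
 unfolding nsq_def using k by (intro sum.mono_neutral_cong_right) auto
 thus ?thesis by simp
 qed
 have 1: "(LINT x|gd d. ?Z x * ?Q x) = ?c" using zonal_reproducing[OF HQ, of ?y] by simp
 have 2: "(LINT x|gd d. ?Z x * ?Z x) = ?c * of_real (zonal_diag d k * real k ^ k)"
 using zonal_reproducing[OF HH_zonal[OF d], of k ?y ?y] zonal_self[of d k ?y] by (simp add: nsq_y)
 have "complex_of_real (LINT x|gd d. (norm (?Z x - ?c * ?Q x))^2) = (LINT x|gd d. ?Z x * ?Z x - 2 * ?c * (?Z x * ?Q x) + ?c * ?c * (?Q x * ?Q x))"
 unfolding integral_complex_of_real[symmetric] complex_norm_square
 by (intro int_cong refl) (simp add: algebra_simps)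
 also have "... = (LINT x|gd d. ?Z x * ?Z x) - 2 * ?c * (LINT x|gd d. ?Z x * ?Q x) + ?c * ?c * (LINT x|gd d. ?Q x * ?Q x)"
 using int_tame[OF tame_mult[OF tZ tZ]] int_tame[OF tame_mult[OF tZ tQ]] int_tame[OF tame_mult[OF tQ tQ]]
 by simp
 also have "... = of_real (fact k * ?A)"
 unfolding 1 2 gaussian_monomial_sq[OF k] by (simp add: algebra_simps)
 finally have "(LINT x|gd d. (norm (?Z x - ?c * ?Q x))^2) = fact k * ?A"
 by (simp only: of_real_eq_iff)
 moreover have "0 <= (LINT x|gd d. (norm (?Z x - ?c * ?Q x))^2)" by simp
 ultimately have "0 <= (fact k :: real) * ?A" by simp
 thus ?thesis using fact_gt_zero[where 'a=real, of k] unfolding zero_le_mult_iff by linarith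
qed

section \<open>The zonal kernel as an operator on Lp of Gaussian measure\<close>

lemma integrable_tame_mult_Lp:
 assumes B: "tame d B" and [measurable]: "F : bm (ld d)" and p: "1 < p"
 and F: "integrable (gd d) (%w. norm (F w) powr p)"
 shows "integrable (gd d) (%w. B w * F w)"
proof -
 let ?A = "%w. 1 + norm (B w)"
 define q where "q = p / (p - 1)"
 have q: "1 < q" "1 / p + 1 / q = 1" using p by (auto simp: q_def field_simps)
 obtain n where n: "q <= real n" using real_arch_simple by blast
 have [measurable]: "B : bm (gd d)" "F : bm (gd d)"
 using tame_measurable_gd[OF B] assms(2) by (auto simp: measurable_cong_sets[OF sets_ld_gd refl])
 have iB: "integrable (gd d) (%w. (?A w) ^ n)"
 by (rule integrable_tame_real) (unfold of_real_power of_real_add of_real_1, intro tame_power tame_add tame_const tame_norm B)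
 show ?thesis
 proof (rule int_bd[OF int_add[OF F iB]])
 show "AE w in gd d. norm (B w * F w) <= norm (norm (F w) powr p + (?A w) ^ n)"
 proof (rule AE_I2)
 fix w
 have "norm (F w) * norm (B w) <= norm (F w) powr p / p + norm (B w) powr q / q"
 by (rule Youngs_inequality) (use p q in auto)
 also have "... <= norm (F w) powr p + norm (B w) powr q"
 using p q by (intro add_mono) (auto simp: divide_le_eq mult_le_cancel_left1)
 also have "norm (B w) powr q <= (?A w) powr q" using q by (intro powr_mono2) auto
 also have "... <= (?A w) powr real n" using n by (intro powr_mono) auto
 also have "... = (?A w) ^ n" by (rule powr_realpow) (simp add: add_pos_nonneg)
 finally show "norm (B w * F w) <= norm (norm (F w) powr p + (?A w) ^ n)"
 by (simp add: norm_mult mult.commute)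
 qed
 qed measurable
qed

lemma Hoelder_powr:
 fixes f g :: "'a => real"
 assumes [measurable]: "f : bm M" "g : bm M" and p: "1 < p" "1 < q" "1 / p + 1 / q = 1"
 and f: "!!x. 0 <= f x" "(NN x|M. en (f x powr p)) <= en (A powr p)" "0 <= A"
 and g: "!!x. 0 <= g x" "(NN x|M. en (g x powr q)) <= en (B powr q)" "0 <= B"
 shows "(NN x|M. en (f x * g x)) <= en (A * B)"
proof -
 let ?A = "%A' B' x. en (A' * B') * (en (1 / p * (1 / A' powr p)) * en (f x powr p) + en (1 / q * (1 / B' powr q)) * en (g x powr q))"
 let ?B = "%A' B'. A' * B' * (1 / p * (1 / A' powr p) * A' powr p + 1 / q * (1 / B' powr q) * B' powr q)"
 let ?C = "%A' B' x. (A' * B') * (1 / p * (1 / A' powr p) * f x powr p + 1 / q * (1 / B' powr q) * g x powr q)"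
 let ?D = "(NN x|M. en (f x * g x))"
 \<comment> \<open>\<open>A\<close> and \<open>B\<close> may be 0, so Young's inequality is
   normalised by slightly larger numbers, which then shrink to \<open>A\<close> and
   \<open>B\<close>.\<close>
 have key: "?D <= en (A' * B')" if A': "A < A'" and B': "B < B'" for A' B'
 proof -
 have pos: "0 < A'" "0 < B'" using that f(3) g(3) by auto
 have en: "en (c * (a * u + b * v)) = en c * (en a * en u + en b * en v)"
 if "0 <= c" "0 <= a" "0 <= b" "0 <= u" "0 <= v" for a b c u v
 using that by (simp add: en_mult ennreal_plus)
 have y: "f x * g x <= ?C A' B' x" for x
 proof -
 have "(f x / A') * (g x / B') <= (f x / A') powr p / p + (g x / B') powr q / q"
 by (rule Youngs_inequality) (use p f(1) g(1) pos in auto)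
 hence "(A' * B') * ((f x / A') * (g x / B')) <= (A' * B') * ((f x / A') powr p / p + (g x / B') powr q / q)"
 using pos by (intro mlm) auto
 thus ?thesis using pos f(1) g(1) by (simp add: powr_divide field_simps)
 qed
 have "?D <= (NN x|M. ?A A' B' x)"
 proof (intro nn_mono)
 fix x
 have "en (f x * g x) <= en (?C A' B' x)"
 using y by (rule en_leI)
 also have "... = ?A A' B' x"
 using pos p by (intro en) auto
 finally show "en (f x * g x) <= ?A A' B' x" .
 qed
 also have "... = en (A' * B') * (en (1 / p * (1 / A' powr p)) * (NN x|M. en (f x powr p)) + en (1 / q * (1 / B' powr q)) * (NN x|M. en (g x powr q)))"
 by (simp add: nn_cmult nn_integral_add)
 also have "... <= en (A' * B') * (en (1 / p * (1 / A' powr p)) * en (A' powr p) + en (1 / q * (1 / B' powr q)) * en (B' powr q))"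
 proof (intro mlm add_mono)
 show "(NN x|M. en (f x powr p)) <= en (A' powr p)"
 by (rule order_trans[OF f(2)], intro en_leI powr_mono2) (use p f A' in auto)
 show "(NN x|M. en (g x powr q)) <= en (B' powr q)"
 by (rule order_trans[OF g(2)], intro en_leI powr_mono2) (use p g B' in auto)
 qed auto
 also have "... = en (?B A' B')"
 using pos p by (intro en[symmetric]) auto
 also have "?B A' B' = A' * B'"
 using pos p by simp
 finally show ?thesis .
 qed
 have lim: "((%e. en ((A + e) * (B + e))) \<longlongrightarrow> en ((A + 0) * (B + 0))) (at_right 0)"
 by (intro tendsto_ennrealI tendsto_intros)
 have ev: "eventually (%e. ?D <= en ((A + e) * (B + e))) (at_right 0)"
 using eventually_at_right_less[of "0::real"] by eventually_elim (rule key; simp)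
 show ?thesis using tendsto_lowerbound[OF lim ev] by simp
qed

lemma HH_cnj: assumes "HH d k P" shows "HH d k (%x. cnj (P x))"
 unfolding HH_def
proof (intro conjI allI HP_cnj[OF HH_imp_HP[OF assms]])
 let ?A = "%x. cnj (P x)"
 fix x
 have HP: "HP d k P" using assms by (rule HH_imp_HP)
 have "pd j (pd j ?A) x = cnj (pd j (pd j P) x)" if j: "j < d" for j
 proof -
 have 1: "pd j ?A = (%x. cnj (pd j P x))"
 by (intro has_pd_pd has_pd_cnj HP_has_pd[OF HP])
 show ?thesis unfolding 1
 by (intro fun_cong[OF has_pd_pd] has_pd_cnj HP_has_pd[OF HP_0_or_pd[OF HP j]])
 qed
 hence "laplacian d ?A x = cnj (laplacian d P x)" by (simp add: laplacian_def)
 thus "laplacian d ?A x = 0" using assms by (simp add: HH_def)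
qed

text \<open>Hypercontractive factors for \<open>p\<close> and for the dual exponent
  \<open>p / (p - 1)\<close>, times the factor of the reproducing formula.\<close>

definition hyp_const :: "real => nat => real" where
 "hyp_const p k = (p + 1) powr (real k / 2) * (p / (p - 1) + 1) powr (real k / 2) * fact k"

text \<open>The image \<open>u\<close> is harmonic of degree \<open>k\<close>, and by the
  reproducing formula its squared norm is \<open>fact k\<close> times the scalar product of
  \<open>F\<close> and \<open>u\<close>. Hoelder, with hypercontractivity of \<open>u\<close> at the
  dual exponent, bounds the 2-norm of \<open>u\<close> by the \<open>p\<close>-norm of
  \<open>F\<close>; hypercontractivity at \<open>p\<close> returns to the \<open>p\<close>-norm of
  \<open>u\<close>.\<close>

theorem zonal_bound:
 assumes d: "0 < d" and Fm [measurable]: "F : bm (ld d)" and p: "1 < p"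
 shows "(NN z|gd d. np p (LINT w|gd d. zonal d k z w * F w))
 <= en (hyp_const p k powr p) * (NN w|gd d. np p (F w))"
proof (cases "(NN w|gd d. np p (F w)) = \<infinity>")
 case True
 have "0 < hyp_const p k"
 proof -
 have "0 < p / (p - 1) + 1" using p by (intro add_pos_pos divide_pos_pos) auto
 thus ?thesis unfolding hyp_const_def using p by (intro mult_pos_pos) auto
 qed
 thus ?thesis unfolding True by (simp add: ennreal_mult_top)
next
 case False
 define q where "q = p / (p - 1)"
 have q: "1 < q" "1 / p + 1 / q = 1" "1 / q + 1 / p = 1" using p by (auto simp: q_def field_simps)
 have [measurable]: "F : bm (gd d)" using Fm by (simp add: measurable_cong_sets[OF sets_ld_gd refl])
 have iF: "integrable (gd d) (%w. norm (F w) powr p)"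
 using False by (intro integrableI_nonneg) (auto simp: top.not_eq_extremum)
 define I where "I = (LINT w|gd d. norm (F w) powr p)"
 have I: "(NN w|gd d. np p (F w)) = en I" "0 <= I"
 using nn_integral_eq_integral[OF iF] by (auto simp: I_def)
 have FB: "integrable (gd d) (%w. B w * F w)" if "HP d k B" for B
 by (rule integrable_tame_mult_Lp[OF tame_HP[OF that] Fm p iF])
 define u where "u z = (LINT w|gd d. zonal d k z w * F w)" for z
 have HPu: "HP d k u" unfolding u_def using sep_integral(2)[OF sep_zonal FB] .
 have HHu: "HH d k u"
 unfolding HH_def
 proof (intro conjI allI HPu)
 fix z
 have "laplacian d (%z. zonal d k z w) z = 0" for w
 proof -
 have "(%z. zonal d k z w) = zonal d k w" by (intro ext zonal_commute)
 thus ?thesis using HH_zonal[OF d, of k w] unfolding HH_def by simp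
 qed
 moreover have "laplacian d u z = (LINT w|gd d. laplacian d (%z. zonal d k z w) z * F w)"
 unfolding u_def[abs_def] by (rule sep_integral(4)[OF sep_zonal FB])
 ultimately show "laplacian d u z = 0" by simp
 qed
 have HHv: "HH d k (%z. cnj (u z))" by (rule HH_cnj[OF HHu])
 have tu: "tame d u" "tame d (%z. cnj (u z))" using tame_HP HPu HP_cnj by blast+
 have [measurable]: "u : bm (gd d)" by (rule tame_measurable_gd[OF tu(1)])
 define S where "S = (LINT z|gd d. (norm (u z))^2)"
 have S0: "0 <= S" by (simp add: S_def)
 have S_eq: "complex_of_real S = fact k * (LINT w|gd d. cnj (u w) * F w)"
 proof -
 have "complex_of_real S = (LINT z|gd d. u z * cnj (u z))"
 unfolding S_def integral_complex_of_real[symmetric] complex_norm_square ..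
 also have "... = (LINT w|gd d. (LINT z|gd d. zonal d k z w * cnj (u z)) * F w)"
 proof -
 have "(LINT z|gd d. (LINT w|gd d. zonal d k z w * F w) * cnj (u z)) = (LINT w|gd d. (LINT z|gd d. zonal d k z w * cnj (u z)) * F w)"
 by (rule conjunct1[OF sep_fubini[OF sep_zonal]], erule FB, rule int_tame[OF tame_mult[OF tame_HP tu(2)]])
 thus ?thesis by (simp only: u_def[symmetric])
 qed
 also have "... = (LINT w|gd d. fact k * (cnj (u w) * F w))"
 proof (intro int_cong refl)
 fix w
 have "(%z. zonal d k z w) = zonal d k w" by (intro ext zonal_commute)
 hence "(LINT z|gd d. zonal d k z w * cnj (u z)) = fact k * cnj (u w)"
 using zonal_reproducing[OF HHv, of w] by (simp add: fun_eq_iff)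
 thus "(LINT z|gd d. zonal d k z w * cnj (u z)) * F w = fact k * (cnj (u w) * F w)" by simp
 qed
 finally show ?thesis by simp
 qed
 define A where "A = I powr (1 / p)"
 define B where "B = (q + 1) powr (real k / 2) * S powr (1 / 2)"
 have AB: "0 <= A" "0 <= B" by (simp_all add: A_def B_def)
 have Ap: "A powr p = I" using p I(2) by (simp add: A_def powr_powr)
 have Bq: "B powr q = (q + 1) powr (real k * q / 2) * S powr (q / 2)"
 using q(1) by (simp add: B_def powr_mult powr_powr)
 have "en (norm (LINT w|gd d. cnj (u w) * F w)) <= (NN w|gd d. norm (cnj (u w) * F w))"
 by (rule integral_norm_bound_ennreal[OF FB[OF HP_cnj[OF HPu]]])
 also have "... = (NN w|gd d. en (norm (F w) * norm (u w)))" by (simp add: norm_mult mult.commute)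
 also have "... <= en (A * B)"
 proof (rule Hoelder_powr[OF _ _ p q(1,2)])
 show "(NN x|gd d. np p (F x)) <= en (A powr p)" by (simp add: Ap I)
 show "(NN x|gd d. np q (u x)) <= en (B powr q)"
 using HH_powr_le[OF HHu q(1)] by (simp add: Bq S_def)
 qed (auto simp: AB)
 finally have "norm (LINT w|gd d. cnj (u w) * F w) <= A * B" using AB by (subst (asm) ennreal_le_iff) auto
 moreover have "S = norm (complex_of_real S)" using S0 by simp
 ultimately have "S <= fact k * (A * B)" unfolding S_eq norm_mult by simp
 also have "... = fact k * A * (q + 1) powr (real k / 2) * sqrt S" using S0 by (simp add: B_def powr_half_sqrt)
 finally have sS': "sqrt S * sqrt S <= (fact k * A * (q + 1) powr (real k / 2)) * sqrt S" using S0 by simp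
 \<comment> \<open>The factor \<open>sqrt S\<close> is cancelled from
   \<open>S <= C * sqrt S\<close>; it may be 0.\<close>
 have sS: "sqrt S <= fact k * A * (q + 1) powr (real k / 2)"
 proof (cases "S = 0")
 case False
 hence "0 < sqrt S" using S0 by simp
 from mult_right_le_imp_le[OF sS' this] show ?thesis .
 qed (use AB in simp)
 have "S powr (p / 2) = sqrt S powr p" using S0 by (simp add: powr_half_sqrt[symmetric] powr_powr)
 also have "... <= (fact k * A * (q + 1) powr (real k / 2)) powr p" using sS p S0 by (intro powr_mono2) auto
 also have "... = (fact k * (q + 1) powr (real k / 2)) powr p * I" using AB Ap by (simp add: powr_mult)
 finally have Sp: "S powr (p / 2) <= (fact k * (q + 1) powr (real k / 2)) powr p * I" .
 have "(NN z|gd d. np p (u z)) <= en ((p + 1) powr (real k * p / 2) * S powr (p / 2))"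
 using HH_powr_le[OF HHu p] by (simp add: S_def)
 also have "... <= en ((p + 1) powr (real k * p / 2) * ((fact k * (q + 1) powr (real k / 2)) powr p * I))"
 by (intro en_leI mlm Sp) simp
 also have "(p + 1) powr (real k * p / 2) * ((fact k * (q + 1) powr (real k / 2)) powr p * I) = hyp_const p k powr p * I"
 using p by (simp add: hyp_const_def q_def powr_mult powr_powr)
 also have "en (hyp_const p k powr p * I) = en (hyp_const p k powr p) * en I"
 using I(2) by (simp add: en_mult)
 finally show ?thesis unfolding I(1) u_def .
qed

section \<open>Gaussian averages of directional operators\<close>

lemma emeasure_gd_space [simp]: "emeasure (gd d) (space (gd d)) = 1"
 by (rule prob_space.emeasure_space_1[OF prob_space_gd])

lemma Jensen_gd:
 fixes f :: "_ => complex"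
 assumes [measurable]: "f : bm (gd d)" and p: "1 < p"
 shows "np p (LINT z|gd d. f z) <= (NN z|gd d. np p (f z))"
proof -
 let ?A = "(LINT z|gd d. 1 * norm (f z)) powr p"
 have "norm (LINT z|gd d. f z) powr p <= ?A"
 using p by (intro powr_mono2) auto
 hence "np p (LINT z|gd d. f z) <= en ?A" by (rule en_leI)
 also have "... <= (NN z|gd d. en 1 * np p (f z))"
 by (rule nn_integral_Jensen_powr[where k="%_. 1", OF _ _ _ _ _ p]) auto
 finally show ?thesis by simp
qed

lemma AE_gd_nonzero:
 assumes "0 < d" shows "AE z in gd d. EX i<d. z i ~= 0"
proof -
 have "AE s in density lborel nd. s ~= 0"
 by (subst AE_density) (auto intro: AE_mp[OF AE_lborel_singleton[of 0]])
 hence "AE z in gd d. z 0 ~= 0"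
 unfolding gd_def using assms by (intro AE_PiM_component std_normal.prob_space_axioms) auto
 thus ?thesis using assms by (auto elim!: eventually_mono)
qed

lemma measurable_gd_eq: "bm (gd d) = bm (ld d)"
 by (rule measurable_cong_sets[OF sets_ld_gd refl])

lemma borel_measurable_dtr_pair [measurable (raw)]:
 assumes g: "(%(z, x). g z x) : bm (ld d \<Otimes>\<^sub>M ld d)"
 and [measurable]: "a : bm M" "b : bm M" "z : measurable M (ld d)" "x : measurable M (ld d)"
 shows "(%y. dtr d (a y) (b y) (z y) (g (z y)) (x y)) : bm M"
proof -
 have "(%yx. (%(z, x). g z x) (z (fst yx), snd yx)) : bm (M \<Otimes>\<^sub>M ld d)"
 by (rule measurable_compose[OF _ g]) measurable
 hence "(%yx. g (z (fst yx)) (snd yx)) : bm (M \<Otimes>\<^sub>M ld d)" by simp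
 from borel_measurable_dtr[OF this, of a b z x] show ?thesis by simp
qed

text \<open>Jensen moves the power inside the probability average over \<open>z\<close>; Fubini then
  leaves \<open>dtr_maximal\<close> for each nonzero \<open>z\<close>. The function acted upon may
  depend on \<open>z\<close>, as \<open>Mop\<close> requires.\<close>

theorem avg_max:
 fixes n :: nat and a b :: "nat => (nat => real) => real"
 assumes d: "0 < d" and g [measurable]: "(%(z, x). g z x) : bm (ld d \<Otimes>\<^sub>M ld d)"
 and a [measurable]: "!!i. a i : bm (ld d)" and b [measurable]: "!!i. b i : bm (ld d)"
 and pos: "!!i z. EX j<d. z j ~= 0 ==> 0 < a i z" and p: "1 < p"
 shows "(NN x|ld d. (SUP i\<in>{..<n}. np p (LINT z|gd d. dtr d (a i z) (b i z) z (g z) x)))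
 <= en ((10 ^ 8 * line_const p) powr p) * (NN z|gd d. (NN x|ld d. np p (g z x)))"
proof -
 let ?A = "%i z x. np p (dtr d (a i z) (b i z) z (g z) x)"
 let ?B = "%i x. np p (LINT z|gd d. dtr d (a i z) (b i z) z (g z) x)"
 let ?C = "%z x. np p (g z x)"
 let ?D = "%x. (NN z|gd d. (SUP i\<in>{..<n}. ?A i z x))"
 let ?E = "(10 ^ 8 * line_const p) powr p"
 let ?F = "bm (ld d \<Otimes>\<^sub>M gd d)"
 interpret P: pair_sigma_finite "ld d" "gd d" by (rule pair_sigma_finite_ld)
 have D [measurable]: "(%(x, z). dtr d (a i z) (b i z) z (g z) x) : ?F" for i
 proof -
 have "(%y. dtr d (a i (snd y)) (b i (snd y)) (snd y) (g (snd y)) (fst y)) : bm (ld d \<Otimes>\<^sub>M ld d)"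
 by (rule borel_measurable_dtr_pair[OF g]) measurable
 thus ?thesis by (simp add: case_prod_unfold measurable_cong_sets[OF sets_pair_measure_cong[OF refl sets_ld_gd] refl])
 qed
 have gz [measurable]: "g z : bm (ld d)" if "z : space (ld d)" for z
 using measurable_Pair2[OF g that] by simp
 have [measurable]: "(%z. dtr d (a i z) (b i z) z (g z) x) : bm (gd d)" if "x : space (ld d)" for i x
 using measurable_Pair2[OF D that] by simp
 have S [measurable]: "(%(x, z). SUP i\<in>{..<n}. ?A i z x) : ?F"
 proof -
 have "(%y. SUP i\<in>{..<n}. np p ((%(x, z). dtr d (a i z) (b i z) z (g z) x) y)) : ?F"
 by measurable
 thus ?thesis by (simp add: case_prod_unfold)
 qed
 have "(NN x|ld d. (SUP i\<in>{..<n}. ?B i x))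
 <= (NN x|ld d. ?D x)"
 proof (intro nn_mono SUP_least)
 fix x i assume x: "x : space (ld d)" and i: "i : {..<n}"
 note [measurable] = x
 have "?B i x <= (NN z|gd d. ?A i z x)"
 by (rule Jensen_gd[OF _ p]) measurable
 also have "... <= ?D x"
 using i by (intro nn_mono SUP_upper)
 finally show "?B i x <= ?D x" .
 qed
 also have "... = (NN z|gd d. (NN x|ld d. (SUP i\<in>{..<n}. ?A i z x)))"
 by (rule P.Fubini'[OF S, symmetric])
 also have "... <= (NN z|gd d. en ?E * (NN x|ld d. ?C z x))"
 proof (rule nn_integral_mono_AE)
 show "AE z in gd d. (NN x|ld d. (SUP i\<in>{..<n}. ?A i z x))
 <= en ?E * (NN x|ld d. ?C z x)"
 using AE_gd_nonzero[OF d] AE_space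
 proof eventually_elim
 case (elim z)
 thus ?case by (intro dtr_maximal gz pos p) (auto simp: space_gd)
 qed
 qed
 also have "... = en ?E * (NN z|gd d. (NN x|ld d. ?C z x))"
 proof (rule nn_cmult)
 have "(%z. (NN x|ld d. ?C z x)) : bm (ld d)" using sigma_finite_ld[of d]
 by (intro sigma_finite_measure.borel_measurable_nn_integral) measurable
 thus "(%z. (NN x|ld d. ?C z x)) : bm (gd d)" by (simp add: measurable_gd_eq)
 qed
 finally show ?thesis .
qed

lemma dtr_cmult: "dtr d a b z (%x. c * f x) x = c * dtr d a b z f x"
 unfolding dtr_def int_cmult[symmetric] by (simp add: scaleR_of_real mult_ac)

lemma enorm_nsq: "enorm d z = sqrt (nsq d z)" by (simp add: enorm_def nsq_def)

lemma borel_measurable_nsq [measurable]: "nsq d : bm (ld d)"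
proof -
 have "(%x. SUM i<d. (x i)^2) : bm (ld d)"
 by (intro borel_measurable_sum borel_measurable_power ld_comp) simp
 thus ?thesis by (simp add: nsq_def[abs_def])
qed

lemma borel_measurable_enorm [measurable]: "enorm d : bm (ld d)"
 unfolding enorm_nsq[abs_def] by measurable

lemma enorm_pos: "EX j<d. z j ~= 0 ==> 0 < enorm d z"
 by (auto simp: enorm_def intro!: sum_pos2)

lemma enorm_nonneg [simp]: "0 <= enorm d z" by (simp add: enorm_nsq)

text \<open>The inner truncation is \<open>e < |r| <= 1 / e\<close> without rescaling by
  \<open>|w|\<close>; this gives the explicit radial multiplier \<open>Jm\<close>.\<close>

definition Uop :: "nat => nat => real => ((nat => real) => complex) => (nat => real) => (nat => real) => complex" where
 "Uop d k e g z x = (LINT w|gd d. zonal d k z w * dtr d e (1 / e) w g x)"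

definition Mop :: "nat => nat => real => real => real => ((nat => real) => complex) => (nat => real) => complex" where
 "Mop d k e t N g x = (LINT z|gd d. dtr d (t / enorm d z) (N / enorm d z) z (Uop d k e g z) x)"

text \<open>Dividing by \<open>|z|\<close> makes the truncation one of \<open>|r * z|\<close>, as
  polar coordinates require. The outer radius \<open>N\<close> keeps the Fourier integrals
  absolutely convergent; it is removed in \<open>Rop_limit\<close>.\<close>

definition Rop :: "nat => ((nat => real) => complex) => real => real => ((nat => real) => complex) => (nat => real) => complex" where
 "Rop d P t N f x = (LINT z|gd d. P z * dtr d (t / enorm d z) (N / enorm d z) z f x)"

definition Sop :: "nat => ((nat => real) => complex) => real => ((nat => real) => complex) => (nat => real) => complex" where
 "Sop d P e f x = (LINT z|gd d. P z * dtr d e (1 / e) z f x)"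

lemma borel_measurable_zonal [measurable (raw)]:
 "f : measurable M (ld d) ==> g : measurable M (ld d) ==> (%y. zonal d k (f y) (g y)) : bm M"
 by (rule sep_measurable[OF sep_zonal])

lemma borel_measurable_integral_gd [measurable (raw)]:
 fixes h :: "'a => (nat => real) => complex"
 assumes "(%(y, w). h y w) : bm (M \<Otimes>\<^sub>M ld d)"
 shows "(%y. (LINT w|gd d. h y w)) : bm M"
 using assms sigma_finite_gd[of d]
 by (intro sigma_finite_measure.borel_measurable_lebesgue_integral) (simp_all add: measurable_cong_sets[OF sets_pair_measure_cong[OF refl sets_ld_gd] refl])

lemma borel_measurable_Uop [measurable (raw)]:
 assumes [measurable]: "g : bm (ld d)" "z : measurable M (ld d)" "x : measurable M (ld d)"
 shows "(%y. Uop d k e g (z y) (x y)) : bm M"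
 unfolding Uop_def by measurable

lemma borel_measurable_Mop [measurable (raw)]:
 assumes [measurable]: "g : bm (ld d)" "x : measurable M (ld d)"
 shows "(%y. Mop d k e t N g (x y)) : bm M"
proof -
 have "(%(z, x). Uop d k e g z x) : bm (ld d \<Otimes>\<^sub>M ld d)" by measurable
 hence [measurable]: "(%y. dtr d (t / enorm d (snd y)) (N / enorm d (snd y)) (snd y) (Uop d k e g (snd y)) (x (fst y))) : bm (M \<Otimes>\<^sub>M ld d)"
 by (rule borel_measurable_dtr_pair) measurable
 have "(%(y, z). dtr d (t / enorm d z) (N / enorm d z) z (Uop d k e g z) (x y)) : bm (M \<Otimes>\<^sub>M ld d)"
 unfolding case_prod_unfold by measurable
 thus ?thesis unfolding Mop_def by (rule borel_measurable_integral_gd)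
qed

lemma borel_measurable_Rop [measurable (raw)]:
 assumes P: "HP d k P" and [measurable]: "f : bm (ld d)" "x : measurable M (ld d)" "t : bm M"
 shows "(%y. Rop d P (t y) N f (x y)) : bm M"
proof -
 note [measurable] = HP_measurable[OF P]
 show ?thesis unfolding Rop_def by measurable
qed

lemma borel_measurable_Sop [measurable (raw)]:
 assumes P: "HP d k P" and [measurable]: "f : bm (ld d)" "x : measurable M (ld d)"
 shows "(%y. Sop d P e f (x y)) : bm M"
proof -
 note [measurable] = HP_measurable[OF P]
 show ?thesis unfolding Sop_def by measurable
qed

text \<open>Three factors: \<open>avg_max\<close> for the outer maximal operator,
  \<open>zonal_bound\<close> for the zonal kernel, and \<open>dtr_maximal\<close> with a single
  truncation for the inner Hilbert transform.\<close>

theorem Mop_maximal: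
 fixes n :: nat and t N :: "nat => real"
 assumes d: "0 < d" and g [measurable]: "g : bm (ld d)" and e: "0 < e" and t: "!!i. 0 < t i" and p: "1 < p"
 shows "(NN x|ld d. (SUP i\<in>{..<n}. np p (Mop d k e (t i) (N i) g x)))
 <= en (((10 ^ 8 * line_const p)^2 * hyp_const p k) powr p) * (NN x|ld d. np p (g x))"
proof -
 let ?A = "10 ^ 8 * line_const p"
 let ?B = "%w x. np p (dtr d e (1 / e) w g x)"
 let ?C = "en (?A powr p) * (NN x|ld d. np p (g x))"
 let ?D = "%z x. np p (Uop d k e g z x)"
 let ?E = "(NN x|ld d. (SUP i\<in>{..<n}. np p (Mop d k e (t i) (N i) g x)))"
 let ?F = "hyp_const p k"
 let ?G = "%x. (NN w|gd d. ?B w x)"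
 let ?H = "?A powr p * (?F powr p * ?A powr p)"
 interpret P: pair_sigma_finite "ld d" "gd d" by (rule pair_sigma_finite_ld)
 have U [measurable]: "(%(z, x). Uop d k e g z x) : bm (ld d \<Otimes>\<^sub>M ld d)" by measurable
 have U' [measurable]: "(%(x, z). ?D z x) : bm (ld d \<Otimes>\<^sub>M gd d)" by measurable
 have D' [measurable]: "(%(x, w). ?B w x) : bm (ld d \<Otimes>\<^sub>M gd d)" by measurable
 have hyp: "0 <= ?F" using p by (simp add: hyp_const_def)
 have A0: "0 <= ?A" using line_const_ge(1)[OF p] by simp
 have "?E
 <= en (?A powr p) * (NN z|gd d. (NN x|ld d. ?D z x))"
 unfolding Mop_def
 by (rule avg_max[where a="%i z. t i / enorm d z" and b="%i z. N i / enorm d z", OF d U _ _ _ p]) (auto intro!: divide_pos_pos t enorm_pos)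
 also have "(NN z|gd d. (NN x|ld d. ?D z x))
 = (NN x|ld d. (NN z|gd d. ?D z x))"
 by (rule P.Fubini'[OF U'])
 also have "... <= (NN x|ld d. en (?F powr p) * (?G x))"
 proof (intro nn_mono)
 fix x assume [measurable]: "x : space (ld d)"
 show "(NN z|gd d. ?D z x) <= en (?F powr p) * (?G x)"
 unfolding Uop_def by (rule zonal_bound[OF d _ p]) measurable
 qed
 also have "... = en (?F powr p) * (NN x|ld d. (?G x))"
 by (intro nn_cmult P.M2.borel_measurable_nn_integral) simp
 also have "(NN x|ld d. (?G x))
 = (NN w|gd d. (NN x|ld d. ?B w x))"
 by (rule P.Fubini'[OF D', symmetric])
 also have "... <= (NN w|gd d. ?C)"
 proof (rule nn_integral_mono_AE)
 show "AE w in gd d. (NN x|ld d. ?B w x) <= ?C"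
 using AE_gd_nonzero[OF d] AE_space
 proof eventually_elim
 case (elim z)
 have "(NN x|ld d. (SUP i\<in>{..<1::nat}. ?B z x)) <= ?C"
 using elim e by (intro dtr_maximal p g) (auto simp: space_gd)
 thus ?case by (simp add: lessThan_Suc)
 qed
 qed
 also have "... = ?C" by simp
 finally have "?E
 <= en (?A powr p) * (en (?F powr p) * ?C)"
 by (simp add: mlm)
 also have "... = en ?H * (NN x|ld d. np p (g x))"
 by (subst en_mult, simp, simp, subst en_mult) (simp_all add: mult.assoc)
 also have "?H = (?A^2 * ?F) powr p"
 proof -
 have "a powr p * (h powr p * a powr p) = (a^2 * h) powr p" if "0 <= a" "0 <= h" for a h :: real
 using that by (simp add: powr_mult sq_eq)
 from this[OF A0 hyp] show ?thesis .
 qed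
 finally show ?thesis .
qed

text \<open>A qualitative bound by \<open>f\<close> itself: the moment of \<open>P\<close> makes its
  constant depend on \<open>P\<close> and \<open>d\<close>. It serves for dominating functions and
  for the error of approximation.\<close>

lemma weighted_avg_max:
 fixes n :: nat and a b :: "nat => (nat => real) => real"
 assumes d: "0 < d" and P: "HP d k P" and f [measurable]: "f : bm (ld d)"
 and a: "!!i. a i : bm (ld d)" and b: "!!i. b i : bm (ld d)"
 and pos: "!!i z. EX j<d. z j ~= 0 ==> 0 < a i z" and p: "1 < p"
 shows "(NN x|ld d. (SUP i\<in>{..<n}. np p (LINT z|gd d. P z * dtr d (a i z) (b i z) z f x)))
 <= en ((10 ^ 8 * line_const p) powr p) * ((NN z|gd d. np p (P z)) * (NN x|ld d. np p (f x)))"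
proof -
 let ?A = "(NN z|gd d. (NN x|ld d. np p (P z * f x)))"
 let ?B = "(NN x|ld d. np p (f x))"
 note [measurable] = HP_measurable[OF P]
 have [measurable]: "P : bm (gd d)" using HP_measurable[OF P] by (simp add: measurable_gd_eq)
 have "(%(z, x). P z * f x) : bm (ld d \<Otimes>\<^sub>M ld d)" by measurable
 from avg_max[where n=n, OF d this a b pos p]
 have "(NN x|ld d. (SUP i\<in>{..<n}. np p (LINT z|gd d. P z * dtr d (a i z) (b i z) z f x)))
 <= en ((10 ^ 8 * line_const p) powr p) * ?A"
 unfolding dtr_cmult by simp
 also have "?A = (NN z|gd d. np p (P z) * ?B)"
 by (subst nn_cmult[symmetric]) (auto simp: norm_mult powr_mult en_mult)
 also have "... = (NN z|gd d. np p (P z)) * ?B"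
 by (intro nn_integral_multc) measurable
 finally show ?thesis .
qed

lemma HH_powr_finite: assumes "HH d k P" "1 < p" shows "(NN z|gd d. np p (P z)) < \<infinity>"
 using order_le_less_trans[OF HH_powr_le[OF assms]] by (simp add: ennreal_less_top)

section \<open>Polar coordinates\<close>

text \<open>The half line is exhausted by compact intervals that the map \<open>r -> 1 / r\<close>
  carries onto themselves.\<close>

lemma nn_integral_reciprocal_pos:
 fixes f :: "real => ennreal"
 assumes [measurable]: "f : bm borel"
 shows "(NN r|lborel. f (1 / r) * en (1 / r^2) * indicator {0<..} r) = (NN s|lborel. f s * indicator {0<..} s)"
proof -
 let ?I = "%n. {1 / (real n + 2)..real n + 2}"
 let ?A = "%n s. indicator (?I n) s"
 let ?B = "%h s. h s * indicator {0<..} s"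
 have inc: "incseq (%n s. h s * ?A n s)" for h :: "real => ennreal"
 proof (intro incseq_SucI le_funI mlm)
 fix n s
 have "1 / (real (Suc n) + 2) <= 1 / (real n + 2)" by (intro divide_left_mono) auto
 hence "?I n <= ?I (Suc n)" by auto
 thus "(?A n s :: ennreal) <= indicator (?I (Suc n)) s" by (auto simp: ind_def)
 qed simp
 have lim: "(%n. (NN s|lborel. h s * ?A n s)) ----> (NN s|lborel. ?B h s)"
 if [measurable]: "h : bm borel" for h :: "real => ennreal"
 proof (rule nn_integral_LIMSEQ[OF inc])
 fix s :: real
 show "(%n. h s * ?A n s) ----> ?B h s"
 proof (rule tendsto_eventually, cases "0 < s")
 case True
 obtain N where N: "max s (1 / s) < real N" using reals_Archimedean2 by blast
 show "\<forall>\<^sub>F n in sequentially. h s * ?A n s = ?B h s"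
 proof (rule eventually_sequentiallyI)
 fix n assume "N <= n"
 hence "s <= real n + 2" "1 / s <= real n + 2" using N by auto
 hence "s : ?I n" using True by (simp add: field_simps)
 thus "h s * ?A n s = ?B h s" using True by simp
 qed
 next
 case False
 have "s ~: ?I n" for n
 proof
 assume "s : ?I n"
 hence "1 / (real n + 2) <= s" by simp
 moreover have "0 < 1 / (real n + 2)" by simp
 ultimately show False using False by linarith
 qed
 thus "\<forall>\<^sub>F n in sequentially. h s * ?A n s = ?B h s" using False by simp
 qed
 qed measurable
 have sub: "(NN s|lborel. f s * ?A n s) = (NN r|lborel. f (1 / r) * en (1 / r^2) * ?A n r)" for n
 proof -
 let ?a = "1 / (real n + 2)" and ?b = "real n + 2"
 have "?a < 1" by simp
 also have "1 < ?b" by simp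
 finally have ab: "?a < ?b" "0 < ?a" by simp_all
 \<comment> \<open>The reflection makes the substitution \<open>r -> - 1 / r\<close>
   increasing.\<close>
 have "(NN s|lborel. f s * ?A n s) = (NN s|lborel. f (- s) * indicator (?I n) (- s))"
 using nn_integral_lborel_minus[of "%s. f s * ?A n s" 0] by simp
 also have "... = (NN s|lborel. f (- s) * indicator {- 1 / ?a .. - 1 / ?b} s)"
 by (intro nn_cong) (auto simp: ind_def)
 also have "... = (NN r|lborel. f (- (- 1 / r)) * en (1 / r^2) * indicator {?a .. ?b} r)"
 proof (rule nn_integral_substitution_aux)
 show "((%r. - 1 / r) has_real_derivative 1 / r^2) (at r)" if "r : {?a .. ?b}" for r
 proof -
 have "r ~= 0" using that ab by auto
 thus ?thesis by (auto intro!: derivative_eq_intros simp: sq_eq)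
 qed
 show "continuous_on {?a .. ?b} (%r. 1 / r^2)" using ab by (intro continuous_intros) auto
 qed (use ab in auto)
 finally show ?thesis by simp
 qed
 have "(%n. (NN s|lborel. f s * ?A n s)) ----> (NN r|lborel. f (1 / r) * en (1 / r^2) * indicator {0<..} r)"
 unfolding sub by (rule lim) measurable
 from LIMSEQ_unique[OF this lim[OF assms]] show ?thesis .
qed

lemma nn_integral_reciprocal:
 fixes f :: "real => ennreal"
 assumes [measurable]: "f : bm borel"
 shows "(NN r|lborel. f (1 / r) * en (1 / r^2)) = (NN s|lborel. f s)"
proof -
 have split: "(NN s|lborel. h s) = (NN s|lborel. h s * indicator {0<..} s) + (NN s|lborel. h (- s) * indicator {0<..} s)"
 if [measurable]: "h : bm borel" for h :: "real => ennreal"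
 proof -
 have "(NN s|lborel. h s) = (NN s|lborel. h s * indicator {0<..} s + h s * indicator {0<..} (- s))"
 by (rule nn_integral_cong_AE) (rule AE_mp[OF AE_lborel_singleton[of 0]], auto simp: ind_def)
 also have "... = (NN s|lborel. h s * indicator {0<..} s) + (NN s|lborel. h s * indicator {0<..} (- s))"
 by (intro nn_integral_add) auto
 also have "(NN s|lborel. h s * indicator {0<..} (- s)) = (NN s|lborel. h (- s) * indicator {0<..} s)"
 using nn_integral_lborel_minus[of "%s. h s * indicator {0<..} (- s)" 0] by simp
 finally show ?thesis .
 qed
 show ?thesis
 unfolding split[OF assms] by (subst split) (simp_all add: nn_integral_reciprocal_pos[of f] nn_integral_reciprocal_pos[of "%s. f (- s)", simplified])
qed

lemma Gamma_half_nat: "Gamma (real j + 1 / 2) = fact (2 * j) * sqrt pi / (4 ^ j * fact j)"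
proof (induction j)
 case 0 thus ?case by (simp add: Gamma_one_half_real)
next
 case (Suc j)
 have "Gamma (real (Suc j) + 1 / 2) = (real j + 1 / 2) * Gamma (real j + 1 / 2)"
 proof -
 have "real j + 1 / 2 ~: \<int>\<^sub>\<le>\<^sub>0" by (auto dest: nonpos_Ints_nonpos)
 from Gamma_plus1[OF this] show ?thesis by (simp add: add_ac)
 qed
 also have "... = fact (2 * Suc j) * sqrt pi / (4 ^ Suc j * fact (Suc j))"
 proof -
 have f: "fact (2 * Suc j) = 4 * (real j + 1) * (real j + 1 / 2) * fact (2 * j)" by (simp add: algebra_simps)
 have g: "(4::real) ^ Suc j * fact (Suc j) = 4 * (real j + 1) * (4 ^ j * fact j)" by simp
 have "(4 * (real j + 1) * (real j + 1 / 2) * fact (2 * j)) * sqrt pi / (4 * (real j + 1) * (4 ^ j * fact j))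
 = (real j + 1 / 2) * (fact (2 * j) * sqrt pi / (4 ^ j * fact j))"
 by (simp add: divide_simps)
 thus ?thesis unfolding Suc.IH f g ..
 qed
 finally show ?case .
qed

lemma gaussian_abs_moment:
 "(NN s|lborel. en (abs s ^ n * exp (- s\<^sup>2 / 2))) = en (2 powr ((real n + 1) / 2) * Gamma ((real n + 1) / 2))"
proof -
 let ?A = "%s. nd s * abs s ^ n"
 let ?B = "(real n + 1) / 2"
 let ?C = "%j. sqrt (2 / pi) * 2 ^ j * fact j"
 let ?D = "sqrt (2 * pi)"
 let ?E = "%j. fact (2 * j) / (2 ^ j * fact j)"
 have e: "abs s ^ n * exp (- s\<^sup>2 / 2) = ?D * (?A s)" for s :: real
 by (simp add: std_normal_density_def)
 have *: "(NN s|lborel. en (abs s ^ n * exp (- s\<^sup>2 / 2))) = en (?D * m)"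
 if "has_bochner_integral lborel (%s. ?A s) m" for m
 unfolding e
 using has_bochner_integral_mult_right[OF that, of "?D"]
 by (subst nn_integral_eq_integral) (auto simp: has_bochner_integral_iff)
 show ?thesis
 proof (cases "even n")
 case True
 then obtain j where j: "n = 2 * j" by (elim evenE)
 have "has_bochner_integral lborel (%s. ?A s) (?E j)"
 using std_normal_moment_even[of j] by (simp add: j power_even_abs)
 moreover have "?D * (?E j) = 2 powr ?B * Gamma ?B"
 proof -
 have "?B = real j + 1 / 2" by (simp add: j)
 moreover have "2 powr (real j + 1 / 2) = 2 ^ j * sqrt 2" by (simp add: powr_add powr_realpow powr_half_sqrt)
 moreover have "(4::real) ^ j = 2 ^ j * 2 ^ j" by (simp flip: pow_mult)
 ultimately show ?thesis by (simp only: Gamma_half_nat) (simp add: real_sqrt_mult)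
 qed
 ultimately show ?thesis using *[of "?E j"] by simp
 next
 case False
 then obtain j where j: "n = 2 * j + 1" by (elim oddE)
 have "has_bochner_integral lborel (%s. ?A s) (?C j)"
 using std_normal_moment_abs_odd[of j] by (simp add: j)
 moreover have "?D * (?C j) = 2 powr ?B * Gamma ?B"
 proof -
 have "?B = 1 + real j" by (simp add: j)
 moreover have "2 powr (1 + real j) = 2 * 2 ^ j" by (simp add: powr_add powr_realpow)
 moreover have "?D * (?C j) = 2 * 2 ^ j * fact j"
 proof -
 have "?D * sqrt (2 / pi) = 2" by (simp flip: real_sqrt_mult)
 thus ?thesis by (simp only: mult.assoc[symmetric])
 qed
 ultimately show ?thesis by (simp only: Gamma_fact)
 qed
 ultimately show ?thesis using *[of "?C j"] by simp
 qed
qed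

lemma nn_integral_radial:
 assumes a: "0 < a"
 shows "(NN r|lborel. en (exp (- a\<^sup>2 / (2 * r^2)) / abs r ^ (n + 2)))
 = en (2 powr ((real n + 1) / 2) * Gamma ((real n + 1) / 2) / a ^ (n + 1))"
proof -
 let ?A = "%r. exp (- a\<^sup>2 / (2 * r^2)) / abs r ^ (n + 2)"
 let ?B = "(real n + 1) / 2"
 let ?f = "%s. en (abs s ^ n * exp (- (a * s)\<^sup>2 / 2))"
 have "en (?A r) = ?f (1 / r) * en (1 / r^2)" for r :: real
 proof -
 have "?A r = abs (1 / r) ^ n * exp (- (a * (1 / r))\<^sup>2 / 2) * (1 / r^2)"
 proof -
 have "abs r ^ (n + 2) = abs r ^ n * r^2" unfolding power_add power2_abs ..
 thus ?thesis by (simp add: power_divide pow_mult mult_ac del: power_add)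
 qed
 thus ?thesis by (simp only: en_mult[symmetric] zero_le_power abs_ge_zero exp_ge_zero mult_nonneg_nonneg zero_le_divide_1_iff zero_le_power2)
 qed
 hence "(NN r|lborel. en (?A r)) = (NN s|lborel. ?f s)"
 using nn_integral_reciprocal[of ?f] by simp
 also have "... = en (1 / a) * (NN s|lborel. ?f ((1 / a) * s))"
 using nn_integral_real_affine[of ?f "1 / a" 0] a by simp
 also have "... = en (1 / a) * (NN s|lborel. en (1 / a ^ n) * en (abs s ^ n * exp (- s\<^sup>2 / 2)))"
 using a by (simp add: en_mult[symmetric] abs_mult power_divide)
 also have "... = en (1 / a) * (en (1 / a ^ n) * en (2 powr ?B * Gamma ?B))"
 by (subst nn_cmult) (simp_all only: gaussian_abs_moment, measurable)
 also have "... = en (2 powr ?B * Gamma ?B / a ^ (n + 1))"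
 using a by (simp add: en_mult[symmetric] Gamma_real_nonneg)
 finally show ?thesis .
qed

text \<open>The Gaussian normalisation times the radial integral of
  \<open>nn_integral_radial\<close> with \<open>n + 1 = k + d\<close>.\<close>

definition polar_const :: "nat => nat => real" where
 "polar_const d k = (2 * pi) powr (- real d / 2) * (2 powr (real (k + d) / 2) * Gamma (real (k + d) / 2))"

lemma gdens_vscale: "gdens d (vscale d c y) = (2 * pi) powr (- real d / 2) * exp (- (c * enorm d y)\<^sup>2 / 2)"
proof -
 have "(SUM i<d. (vscale d c y i)^2) = c^2 * (SUM i<d. (y i)^2)"
 by (simp add: vscale_def pow_mult sum_cmult)
 also have "... = (c * enorm d y)^2" by (simp add: enorm_def pow_mult sum_nonneg)
 finally show ?thesis by (simp add: gdens_eq)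
qed

lemma vscale_vscale: "vscale d a (vscale d b x) = vscale d (a * b) x"
 by (auto simp: vscale_def mult.assoc)

lemma AE_ld_enorm_pos: assumes "0 < d" shows "AE y in ld d. 0 < enorm d y"
proof -
 have "AE y in gd d. EX i<d. y i ~= 0" by (rule AE_gd_nonzero[OF assms])
 hence "AE y in ld d. 0 < gdens d y --> (EX i<d. y i ~= 0)"
 unfolding gd_density by (subst (asm) AE_density) auto
 moreover have "0 < gdens d y" for y by (simp add: gdens_eq)
 ultimately show ?thesis by (auto elim!: eventually_mono intro: enorm_pos)
qed

text \<open>For fixed \<open>r\<close> the substitution \<open>y = r * z\<close> turns the Gaussian
  density into \<open>exp (- |y|\<^sup>2 / (2 * r\<^sup>2))\<close>; the integral over
  \<open>r\<close> of this against \<open>1 / |r| ^ (k + d + 1)\<close> is the homogeneous kernel.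
  Surface measure on the sphere does not enter.\<close>

theorem nn_integral_polar:
 assumes d: "0 < d" and [measurable]: "\<Phi> : bm (ld d)"
 shows "(NN z|gd d. (NN r|lborel. en (1 / abs r ^ (k + 1)) * \<Phi> (vscale d r z)))
 = (NN y|ld d. en (polar_const d k / enorm d y ^ (k + d)) * \<Phi> y)"
proof -
 let ?A = "%r z. en (1 / abs r ^ (k + 1)) * \<Phi> (vscale d r z)"
 let ?B = "%y r. exp (- (enorm d y)\<^sup>2 / (2 * r^2))"
 let ?C = "%z r. en (gdens d z) * (?A r z)"
 let ?D = "%y. en (polar_const d k / enorm d y ^ (k + d)) * \<Phi> y"
 let ?E = "%r. en (1 / abs r ^ d)"
 interpret P: pair_sigma_finite "ld d" "lborel :: real measure" by (rule pair_sigma_finite_ld)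
 let ?c = "(2 * pi) powr (- real d / 2)"
 have "(NN z|gd d. (NN r|lborel. ?A r z))
 = (NN z|ld d. en (gdens d z) * (NN r|lborel. ?A r z))"
 unfolding gd_density by (subst nn_integral_density) (auto intro!: lborel.borel_measurable_nn_integral)
 also have "... = (NN z|ld d. (NN r|lborel. ?C z r))"
 proof (intro nn_cong)
 fix z assume [measurable]: "z : space (ld d)"
 show "en (gdens d z) * (NN r|lborel. ?A r z)
 = (NN r|lborel. ?C z r)"
 by (rule nn_cmult[symmetric]) measurable
 qed
 also have "... = (NN r|lborel. (NN z|ld d. ?C z r))"
 by (rule P.Fubini'[symmetric]) measurable
 also have "... = (NN r|lborel. (NN y|ld d. en (?c * ?B y r / abs r ^ (k + d + 1)) * \<Phi> y))"
 proof (rule nn_integral_cong_AE, rule AE_mp[OF AE_lborel_singleton[of 0]], intro AE_I2 impI)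
 fix r :: real assume r: "r ~= 0"
 let ?f = "%y. en (?c * ?B y r / abs r ^ (k + 1)) * \<Phi> y"
 have "(NN z|ld d. ?C z r) = (NN z|ld d. ?f (vscale d r z))"
 proof (intro nn_cong)
 fix z assume "z : space (ld d)"
 have "enorm d (vscale d r z) ^ 2 = r^2 * (enorm d z)^2"
 by (simp add: enorm_def vscale_def pow_mult sum_cmult sum_nonneg)
 moreover have "gdens d z = ?c * exp (- (enorm d z)\<^sup>2 / 2)"
 by (simp add: gdens_eq enorm_def sum_nonneg)
 ultimately show "?C z r = ?f (vscale d r z)"
 using r by (simp add: en_mult[symmetric] mult.assoc[symmetric])
 qed
 also have "... = ?E r * (NN y|ld d. ?f y)"
 proof -
 have "(NN y|ld d. ?f y) = en (abs r ^ d) * (NN z|ld d. ?f (vscale d r z))"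
 by (rule nn_integral_ld_vscale[OF r, symmetric]) measurable
 moreover have "?E r * en (abs r ^ d) = 1" using r by (simp add: en_mult[symmetric])
 ultimately show ?thesis by (simp only: mult.assoc[symmetric] mult_1)
 qed
 also have "... = (NN y|ld d. en (1 / abs r ^ d) * ?f y)" by (rule nn_cmult[symmetric]) measurable
 also have "... = (NN y|ld d. en (?c * ?B y r / abs r ^ (k + d + 1)) * \<Phi> y)"
 proof (intro nn_cong)
 fix y
 have "1 / abs r ^ d * (?c * ?B y r / abs r ^ (k + 1)) = ?c * ?B y r / abs r ^ (k + d + 1)"
 by (simp add: power_add)
 moreover have "?E r * en (?c * ?B y r / abs r ^ (k + 1)) = en (1 / abs r ^ d * (?c * ?B y r / abs r ^ (k + 1)))"
 by (rule en_mult[symmetric]) auto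
 ultimately show "?E r * ?f y = en (?c * ?B y r / abs r ^ (k + d + 1)) * \<Phi> y"
 by (simp only: mult.assoc[symmetric])
 qed
 finally show "(NN z|ld d. ?C z r) = ..." .
 qed
 also have "... = (NN y|ld d. (NN r|lborel. en (?c * ?B y r / abs r ^ (k + d + 1)) * \<Phi> y))"
 by (rule P.Fubini') measurable
 also have "... = (NN y|ld d. ?D y)"
 proof (rule nn_integral_cong_AE, rule AE_mp[OF AE_ld_enorm_pos[OF d]], intro AE_I2 impI)
 fix y assume y: "0 < enorm d y"
 obtain n where n: "k + d = n + 1" using d by (metis Suc_eq_plus1 add_gr_0 gr0_implies_Suc)
 have "(NN r|lborel. en (?c * ?B y r / abs r ^ (k + d + 1)) * \<Phi> y)
 = (NN r|lborel. en ?c * en (?B y r / abs r ^ (n + 2))) * \<Phi> y"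
 by (subst nn_integral_multc) (simp_all add: n en_mult[symmetric] del: power_Suc)
 also have "... = en ?c * en (2 powr ((real n + 1) / 2) * Gamma ((real n + 1) / 2) / enorm d y ^ (n + 1)) * \<Phi> y"
 by (subst nn_cmult) (simp_all only: nn_integral_radial[OF y], measurable)
 also have "... = ?D y"
 unfolding polar_const_def n
 by (simp add: en_mult[symmetric] Gamma_real_nonneg add.commute del: power_Suc)
 finally show "(NN r|lborel. en (?c * ?B y r / abs r ^ (k + d + 1)) * \<Phi> y)
 = ?D y" .
 qed
 finally show ?thesis .
qed

lemma HP_enorm_bound: assumes "HP d k P" obtains C where "0 <= C" "!!x. norm (P x) <= C * enorm d x ^ k"
proof -
 obtain C where C: "0 <= C" "!!x. norm (P x) <= C * l1 d x ^ k" using HP_bound[OF assms] by blast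
 have l1: "l1 d x <= real d * enorm d x" for x
 proof -
 have "abs (x i) <= enorm d x" if "i < d" for i
 unfolding enorm_def by (rule real_le_rsqrt) (use that in \<open>auto intro!: member_le_sum\<close>)
 hence "l1 d x <= (SUM i<d. enorm d x)" unfolding l1_def by (intro sum_mono) auto
 thus ?thesis by simp
 qed
 have "norm (P x) <= (C * real d ^ k) * enorm d x ^ k" for x
 proof -
 have "norm (P x) <= C * (real d * enorm d x) ^ k"
 by (rule order_trans[OF C(2)]) (intro mlm power_mono l1 C(1) l1_nonneg)
 thus ?thesis by (simp add: pow_mult mult_ac)
 qed
 moreover have "0 <= C * real d ^ k" using C(1) by simp
 ultimately show ?thesis using that by blast
qed

lemma measurable_vdiff [measurable (raw)]:
 assumes [measurable]: "g : measurable M (ld d)" shows "(%y. vdiff d x (g y)) : measurable M (ld d)"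
 unfolding vdiff_def
proof (rule measurable_ldI)
 fix i assume i: "i < d"
 have [measurable]: "(%y. g y i) : bm M"
 using measurable_compose[OF assms ld_comp[OF i]] by simp
 show "(%y. x i - g y i) : bm M" by measurable
qed

lemma measurable_vdiff2 [measurable (raw)]:
 assumes [measurable]: "g : measurable M (ld d)" "h : measurable M (ld d)" shows "(%y. vdiff d (h y) (g y)) : measurable M (ld d)"
proof -
 have "vdiff d (h y) (g y) = vadd d (h y) (- 1) (g y)" for y by (auto simp: vdiff_def vadd_def)
 thus ?thesis by simp
qed

lemma nn_integral_vdiff:
 assumes [measurable]: "f : bm (ld d)"
 shows "(NN y|ld d. f (vdiff d x y)) = (NN y|ld d. f y)"
 using nn_integral_ld_affine[of "-1" f d x] by (simp add: vdiff_def)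

lemma integrable_powr_vdiff:
 assumes [measurable]: "f : bm (ld d)" and f: "(NN y|ld d. np p (f y)) < \<infinity>"
 shows "integrable (ld d) (%y. norm (f (vdiff d x y) :: complex) powr p)"
proof (rule integrableI_nonneg)
 let ?A = "(NN y|ld d. np p (f (vdiff d x y)))"
 have "?A = (NN y|ld d. np p (f y))"
 by (rule nn_integral_vdiff[of "%y. np p (f y)"]) measurable
 thus "?A < \<infinity>" using f by simp
qed auto

text \<open>Outside the ball of radius \<open>t\<close>, \<open>1 / |y| ^ d\<close> is at most a
  constant times \<open>W\<close>, the product of the \<open>1 / (1 + |y i|)\<close>, whose
  \<open>q\<close>-th power is integrable for the dual exponent \<open>q > 1\<close>. Young's
  inequality does the rest.\<close>

lemma kernel_integrable:
 assumes P: "HP d k P" and f [measurable]: "f : bm (ld d)" and p: "1 < p"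
 and fin: "(NN y|ld d. np p (f y)) < \<infinity>" and t: "0 < t" and S: "S : sets borel" "S <= {t<..}"
 shows "integrable (ld d) (%y. (indicator S (enorm d y) / enorm d y ^ (k + d)) *\<^sub>R (P y * f (vdiff d x y)))"
proof -
 let ?A = "%x y. norm (f (vdiff d x y))"
 let ?B = "%y x. norm ((indicator S (enorm d y) / enorm d y ^ (k + d)) *\<^sub>R (P y * f (vdiff d x y)))"
 let ?C = "%y i. 1 + abs (y i)"
 let ?D = "%y. \<Prod>i<d. ?C y i"
 note [measurable] = HP_measurable[OF P] S(1)
 obtain C where C: "0 <= C" "!!x. norm (P x) <= C * enorm d x ^ k" using HP_enorm_bound[OF P] by blast
 define K where "K = 1 + 1 / t"
 have K: "0 < K" using t by (simp add: K_def add_pos_pos)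
 define W where "W y = (\<Prod>i<d. (?C y i) powr - 1)" for y :: "nat => real"
 define q where "q = p / (p - 1)"
 have q: "1 < q" "1 / p + 1 / q = 1" using p by (auto simp: q_def field_simps)
 have W0: "0 <= W y" for y by (simp add: W_def prod_nonneg)
 have Wq: "integrable (ld d) (%y. W y powr q)"
 proof -
 have "W y powr q = (\<Prod>i<d. (?C y i) powr - q)" for y
 unfolding W_def by (subst prod_powr_distrib) (simp_all only: powr_powr mult_minus_left mult_1 powr_ge_zero)
 moreover have "integrable (ld d) (%y. \<Prod>i<d. (?C y i) powr - q)"
 unfolding ld_def using q(1) by (intro lebP.product_integrable_prod integrable_one_plus_abs_powr) auto
 ultimately show ?thesis by simp
 qed
 have dec: "1 / enorm d y ^ d <= K ^ d * W y" if "t < enorm d y" for y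
 proof -
 have e0: "0 < enorm d y" using that t by simp
 have "?C y i <= K * enorm d y" if i: "i < d" for i
 proof -
 have "abs (y i) <= enorm d y" unfolding enorm_def by (rule real_le_rsqrt) (use i in \<open>auto intro!: member_le_sum\<close>)
 moreover have "1 <= enorm d y / t" using `t < enorm d y` t by simp
 ultimately show ?thesis by (simp add: K_def distrib_right)
 qed
 hence "(?D y) <= (\<Prod>i<d. K * enorm d y)" by (intro prod_mono) auto
 hence le: "(?D y) <= K ^ d * enorm d y ^ d" by (simp add: pow_mult)
 have pos: "0 < (?D y)" by (intro prod_pos) auto
 have "W y = 1 / (?D y)"
 unfolding W_def by (simp add: powr_minus_divide prod_dividef)
 thus ?thesis using le pos e0 by (simp add: field_simps)
 qed
 show ?thesis
 proof (rule int_bd)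
 show "integrable (ld d) (%y. C * K ^ d * (W y powr q + ?A x y powr p))"
 by (intro int_mult int_add Wq integrable_powr_vdiff[OF f fin])
 show "AE y in ld d. ?B y x
 <= norm (C * K ^ d * (W y powr q + ?A x y powr p))"
 proof (rule AE_I2)
 fix y
 have rhs0: "0 <= C * K ^ d * (W y powr q + ?A x y powr p)" using C(1) K by simp
 show "?B y x
 <= norm (C * K ^ d * (W y powr q + ?A x y powr p))"
 proof (cases "enorm d y : S")
 case True
 hence ty: "t < enorm d y" using S(2) by auto
 hence e0: "0 < enorm d y" using t by simp
 have "?B y x
 = norm (P y) / enorm d y ^ (k + d) * ?A x y"
 using True e0 by (simp add: norm_mult)
 also have "... <= C * enorm d y ^ k / enorm d y ^ (k + d) * ?A x y"
 using e0 by (intro mrm divide_right_mono C) auto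
 also have "... = C * (1 / enorm d y ^ d) * ?A x y" using e0 by (simp add: power_add)
 also have "... <= C * (K ^ d * W y) * ?A x y"
 by (intro mrm mlm dec ty C(1)) auto
 also have "... = C * K ^ d * (W y * ?A x y)" by simp
 also have "... <= C * K ^ d * (W y powr q + ?A x y powr p)"
 proof (intro mlm)
 have "?A x y * W y <= ?A x y powr p / p + W y powr q / q"
 by (rule Youngs_inequality) (use p q W0 in auto)
 also have "... <= ?A x y powr p + W y powr q"
 using p q by (intro add_mono) (auto simp: divide_le_eq mult_le_cancel_left1)
 finally show "W y * ?A x y <= W y powr q + ?A x y powr p" by (simp add: mult.commute)
 qed (use C(1) K in simp)
 finally show ?thesis using rhs0 by simp
 qed (use rhs0 in simp)
 qed
 qed measurable
qed

lemma distr_polar: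
 assumes d: "0 < d"
 shows "distr (density (gd d \<Otimes>\<^sub>M lborel) (%(z, r). en (1 / abs r ^ (k + 1)))) (ld d) (%(z, r). vscale d r z)
 = density (ld d) (%y. en (polar_const d k / enorm d y ^ (k + d)))"
proof (rule measure_eqI)
 let ?A = "distr (density (gd d \<Otimes>\<^sub>M lborel) (%(z, r). en (1 / abs r ^ (k + 1)))) (ld d) (%(z, r). vscale d r z)"
 let ?B = "%A. emeasure (density (ld d) (%y. en (polar_const d k / enorm d y ^ (k + d)))) A"
 interpret P: pair_sigma_finite "gd d" "lborel :: real measure" by (rule pair_sigma_finite_ld)
 fix A assume "A : sets ?A"
 hence [measurable]: "A : sets (ld d)" by simp
 have "emeasure ?A A
 = (NN zr|gd d \<Otimes>\<^sub>M lborel. en (1 / abs (snd zr) ^ (k + 1)) * indicator A (vscale d (snd zr) (fst zr)))"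
 by (subst nn_integral_indicator[symmetric], simp, subst nn_integral_distr, measurable, subst nn_integral_density)
 (simp_all add: case_prod_unfold)
 also have "... = (NN z|gd d. (NN r|lborel. en (1 / abs r ^ (k + 1)) * indicator A (vscale d r z)))"
 by (subst lborel.nn_integral_fst[symmetric]) simp_all
 also have "... = (NN y|ld d. en (polar_const d k / enorm d y ^ (k + d)) * indicator A y)"
 by (rule nn_integral_polar[OF d]) measurable
 also have "... = ?B A"
 by (simp add: emeasure_density)
 finally show "emeasure ?A A
 = ?B A" .
qed simp

lemma polar_const_pos: "0 < d ==> 0 < polar_const d k"
 unfolding polar_const_def by (intro mult_pos_pos Gamma_real_pos) auto

lemma integral_polar:
 fixes h :: "(nat => real) => complex"
 assumes d: "0 < d" and h [measurable]: "h : bm (ld d)"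
 and int: "integrable (ld d) (%y. (1 / enorm d y ^ (k + d)) *\<^sub>R h y)"
 shows "integrable (gd d \<Otimes>\<^sub>M lborel) (%(z, r). (1 / abs r ^ (k + 1)) *\<^sub>R h (vscale d r z))"
 and "(LINT zr|(gd d \<Otimes>\<^sub>M lborel). (1 / abs (snd zr) ^ (k + 1)) *\<^sub>R h (vscale d (snd zr) (fst zr)))
 = of_real (polar_const d k) * (LINT y|ld d. (1 / enorm d y ^ (k + d)) *\<^sub>R h y)"
proof -
 let ?A = "(LINT zr|(gd d \<Otimes>\<^sub>M lborel). (1 / abs (snd zr) ^ (k + 1)) *\<^sub>R h (vscale d (snd zr) (fst zr)))"
 let ?B = "polar_const d k"
 let ?C = "%y. (?B / enorm d y ^ (k + d)) *\<^sub>R h y"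
 let ?D = "of_real ?B * (LINT y|ld d. (1 / enorm d y ^ (k + d)) *\<^sub>R h y)"
 let ?\<mu> = "density (gd d \<Otimes>\<^sub>M lborel) (%(z, r :: real). en (1 / abs r ^ (k + 1)))"
 let ?\<nu> = "density (ld d) (%y. en (?B / enorm d y ^ (k + d)))"
 have e: "?C y = ?B *\<^sub>R ((1 / enorm d y ^ (k + d)) *\<^sub>R h y)" for y by simp
 have pc: "0 <= ?B" using polar_const_pos[OF d, of k] by simp
 have T: "(%(z, r). vscale d r z) : measurable ?\<mu> (ld d)" by measurable
 have "integrable (ld d) (%y. ?C y)" unfolding e by (intro integrable_scaleR_right int)
 hence "integrable ?\<nu> h" using pc by (subst integrable_density) auto
 hence 1: "integrable ?\<mu> (%zr. h (case zr of (z, r) => vscale d r z))"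
 unfolding distr_polar[OF d, symmetric] using integrable_distr_eq[OF T h] by (simp add: case_prod_unfold)
 hence 2: "integrable ?\<mu> (%zr. h (vscale d (snd zr) (fst zr)))" by (simp add: case_prod_unfold)
 thus "integrable (gd d \<Otimes>\<^sub>M lborel) (%(z, r). (1 / abs r ^ (k + 1)) *\<^sub>R h (vscale d r z))"
 by (simp add: case_prod_unfold integrable_density)
 have "?A = (LINT zr|?\<mu>. h (vscale d (snd zr) (fst zr)))"
 by (simp add: case_prod_unfold integral_density)
 also have "... = (LINT y|?\<nu>. h y)"
 unfolding distr_polar[OF d, symmetric] by (subst integral_distr[OF T h]) (simp add: case_prod_unfold)
 also have "... = (LINT y|ld d. ?C y)"
 using pc by (intro integral_density) auto
 also have "... = ?D"
 unfolding e scaleR_of_real[of "?B"] by (rule int_cmult)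
 finally show "?A
 = ?D" .
qed

section \<open>The truncated Riesz transform as an average of Hilbert transforms\<close>

definition KT :: "nat => nat => ((nat => real) => complex) => real set => ((nat => real) => complex) => (nat => real) => complex" where
 "KT d k P S f x = (LINT y|ld d. (indicator S (enorm d y) / enorm d y ^ (k + d)) *\<^sub>R (P y * f (vdiff d x y)))"

lemma enorm_vscale: "enorm d (vscale d r z) = abs r * enorm d z"
 by (simp add: enorm_def vscale_def pow_mult sum_cmult[symmetric] real_sqrt_mult)

lemma vdiff_vscale: "vdiff d x (vscale d r z) = vadd d x (- r) z"
 by (auto simp: vdiff_def vscale_def vadd_def)

text \<open>Applied to \<open>P y * f (x - y)\<close> restricted to \<open>|y|\<close> in
  \<open>S\<close>; homogeneity of \<open>P\<close> pulls the power of \<open>r\<close> out.\<close>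

theorem KT_polar:
 assumes d: "0 < d" and k: "odd k" and P: "HP d k P" and f [measurable]: "f : bm (ld d)" and p: "1 < p"
 and fin: "(NN y|ld d. np p (f y)) < \<infinity>" and t: "0 < t" and S [measurable]: "S : sets borel" "S <= {t<..}"
 shows "integrable (gd d \<Otimes>\<^sub>M lborel) (%(z, r). P z * ((indicator S (abs r * enorm d z) / r) *\<^sub>R f (vadd d x (- r) z)))"
 and "(LINT z|gd d. P z * (LINT r|lborel. (indicator S (abs r * enorm d z) / r) *\<^sub>R f (vadd d x (- r) z)))
 = of_real (polar_const d k) * KT d k P S f x"
proof -
 let ?A = "%r z. (indicator S (abs r * enorm d z) / r) *\<^sub>R f (vadd d x (- r) z)"
 let ?B = "(LINT z|gd d. P z * (LINT r|lborel. ?A r z))"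
 let ?C = "of_real (polar_const d k) * KT d k P S f x"
 interpret PP: pair_sigma_finite "gd d" "lborel :: real measure" by (rule pair_sigma_finite_ld)
 note [measurable] = HP_measurable[OF P]
 let ?h = "%y. indicator S (enorm d y) *\<^sub>R (P y * f (vdiff d x y))"
 have h [measurable]: "?h : bm (ld d)" by measurable
 have e: "(1 / enorm d y ^ (k + d)) *\<^sub>R ?h y = (indicator S (enorm d y) / enorm d y ^ (k + d)) *\<^sub>R (P y * f (vdiff d x y))" for y by simp
 have int: "integrable (ld d) (%y. (1 / enorm d y ^ (k + d)) *\<^sub>R ?h y)"
 unfolding e by (rule kernel_integrable[OF P f p fin t S])
 \<comment> \<open>Here the oddness of \<open>k\<close> enters: it turns the radial weight into the
   odd kernel \<open>1 / r\<close> of the Hilbert transform.\<close>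
 have sgn: "1 / abs r ^ (k + 1) * r ^ k = 1 / r" for r :: real
 proof (cases "r = 0")
 case False
 have "abs r ^ (k + 1) = r ^ (k + 1)" by (rule power_even_abs) (use k in simp)
 thus ?thesis using False by simp
 qed simp
 have eq: "(1 / abs r ^ (k + 1)) *\<^sub>R ?h (vscale d r z) = P z * (?A r z)" for z r
 proof -
 have "P (vscale d r z) = of_real r ^ k * P z" by (rule HP_homogeneous[OF P]) (simp add: vscale_def)
 hence "(1 / abs r ^ (k + 1)) *\<^sub>R ?h (vscale d r z)
 = P z * (((1 / abs r ^ (k + 1) * r ^ k) * indicator S (abs r * enorm d z)) *\<^sub>R f (vadd d x (- r) z))"
 by (simp add: enorm_vscale vdiff_vscale scaleR_of_real mult_ac)
 thus ?thesis unfolding sgn by simp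
 qed
 show i: "integrable (gd d \<Otimes>\<^sub>M lborel) (%(z, r). P z * (?A r z))"
 using integral_polar(1)[OF d h int] unfolding eq .
 have "?B
 = (LINT z|gd d. (LINT r|lborel. P z * (?A r z)))"
 by (simp only: int_cmult)
 also have "... = (LINT zr|(gd d \<Otimes>\<^sub>M lborel). (case zr of (z, r) => P z * (?A r z)))"
 by (rule PP.integral_fst[OF i])
 also have "... = ?C"
 using integral_polar(2)[OF d h int] unfolding eq e KT_def case_prod_unfold .
 finally show "?B
 = ?C" .
qed

lemma Rop_KT:
 assumes d: "0 < d" and k: "odd k" and P: "HP d k P" and f [measurable]: "f : bm (ld d)" and p: "1 < p"
 and fin: "(NN y|ld d. np p (f y)) < \<infinity>" and t: "0 < t" and x [measurable]: "x : space (ld d)"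
 shows "Rop d P t N f x = of_real (polar_const d k) * KT d k P {t<..N} f x"
proof -
 let ?A = "%z t. P z * (LINT r|lborel. (indicator {t<..N} (abs r * enorm d z) / r) *\<^sub>R f (vadd d x (- r) z))"
 have "Rop d P t N f x = (LINT z|gd d. ?A z t)"
 unfolding Rop_def
 proof (rule Bochner_Integration.integral_cong_AE)
 note [measurable] = HP_measurable[OF P]
 show "(%z. P z * dtr d (t / enorm d z) (N / enorm d z) z f x) : bm (gd d)" unfolding measurable_gd_eq by measurable
 show "(%z. ?A z t) : bm (gd d)" unfolding measurable_gd_eq by measurable
 show "AE z in gd d. P z * dtr d (t / enorm d z) (N / enorm d z) z f x = ?A z t"
 using AE_gd_nonzero[OF d]
 proof eventually_elim
 case (elim z)
 hence "0 < enorm d z" by (rule enorm_pos)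
 hence "indicator {r. t / enorm d z < abs r & abs r <= N / enorm d z} r = (indicator {t<..N} (abs r * enorm d z) :: real)" for r
 by (auto simp: ind_def field_simps)
 thus ?case by (simp add: dtr_def)
 qed
 qed
 also have "... = of_real (polar_const d k) * KT d k P {t<..N} f x"
 by (rule KT_polar(2)[OF d k P f p fin t]) auto
 finally show ?thesis .
qed

section \<open>The Bochner relation for truncated kernels\<close>

abbreviation ex :: "nat => (nat => real) => (nat => real) => complex" where
 "ex d xi x \<equiv> exp (\<i> * of_real (ip d xi x))"

lemma borel_measurable_ip [measurable (raw)]:
 assumes [measurable]: "f : measurable M (ld d)" "g : measurable M (ld d)" shows "(%y. ip d (f y) (g y)) : bm M"
proof -
 have [measurable]: "(%y. f y i) : bm M" "(%y. g y i) : bm M" if "i < d" for i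
 using measurable_compose[OF assms(1) ld_comp[OF that]] measurable_compose[OF assms(2) ld_comp[OF that]] by simp_all
 have "(%y. SUM i<d. f y i * g y i) : bm M" by (intro borel_measurable_sum borel_measurable_times) auto
 thus ?thesis by (simp add: ip_def)
qed

lemma borel_measurable_ip_fixed [measurable]: "ip d xi : bm (ld d)"
proof -
 have "(%y. SUM i<d. xi i * y i) : bm (ld d)"
 by (intro borel_measurable_sum borel_measurable_times ld_comp borel_measurable_const) auto
 thus ?thesis by (simp add: ip_def[abs_def])
qed

lemma norm_ex [simp]: "norm (exp (\<i> * of_real t)) = 1" by simp

lemma integral_ld_vscale:
 fixes f :: "(nat => real) => complex"
 assumes r: "r ~= 0" and f [measurable]: "f : bm (ld d)"
 shows "(LINT x|ld d. f x) = of_real (abs r ^ d) * (LINT x|ld d. f (vscale d r x))"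
proof -
 let ?A = "distr (ld d) (ld d) (vscale d r)"
 let ?B = "abs r ^ d"
 have T: "vscale d r : measurable (ld d) (ld d)" by measurable
 have "ld d = density ?A (%_. en ?B)"
 using ld_affine[OF r, of d "%_. 0"] by (simp add: vscale_def[abs_def])
 hence "(LINT x|ld d. f x) = (LINT x|density ?A (%_. en ?B). f x)" by simp
 also have "... = (LINT x|?A. abs r ^ d *\<^sub>R f x)"
 by (rule integral_density) auto
 also have "... = (LINT x|ld d. abs r ^ d *\<^sub>R f (vscale d r x))"
 by (rule integral_distr[OF T]) measurable
 also have "... = of_real ?B * (LINT x|ld d. f (vscale d r x))"
 unfolding scaleR_of_real by (rule int_cmult)
 finally show ?thesis .
qed

lemma integral_gd_ld:
 fixes f :: "(nat => real) => complex"
 assumes [measurable]: "f : bm (ld d)"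
 shows "(LINT z|gd d. f z) = (LINT z|ld d. of_real (gdens d z) * f z)"
 unfolding gd_density by (subst integral_density) (auto simp: gdens_nonneg scaleR_of_real)

lemma ip_vscale: "ip d (vscale d r x) y = r * ip d x y" "ip d x (vscale d r y) = r * ip d x y"
 by (simp_all add: ip_def vscale_def sum_cmult mult_ac)

lemma nsq_enorm: "nsq d x = (enorm d x)^2" by (simp add: enorm_nsq)

text \<open>The extra Gaussian is absorbed by a dilation, after which Hecke's identity applies. What
  matters is that \<open>c\<close> does not depend on \<open>Y\<close>.\<close>

lemma HH_fourier_gauss:
 assumes a: "0 <= a"
 shows "EX c. ALL Y. HH d k Y --> (LINT z|gd d. Y z * of_real (exp (- a * nsq d z)) * ex d xi z) = c * Y xi"
proof -
 let ?A = "%Y. (LINT z|gd d. Y z * of_real (exp (- a * nsq d z)) * ex d xi z)"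
 \<comment> \<open>Chosen so that the Gaussian density times \<open>exp (- a * |z|\<^sup>2)\<close>
   is the density at \<open>z / s\<close>.\<close>
 define s where "s = 1 / sqrt (1 + 2 * a)"
 have s: "0 < s" "(1 / s)^2 = 1 + 2 * a" using a by (simp_all add: s_def)
 have "?A Y
 = (of_real (s ^ d) * of_real s ^ k * \<i> ^ k * of_real s ^ k * of_real (exp (- nsq d (vscale d s xi) / 2))) * Y xi" if Y: "HH d k Y" for Y
 proof -
 have HP: "HP d k Y" using Y by (rule HH_imp_HP)
 note [measurable] = HP_measurable[OF HP]
 let ?F = "%z. of_real (gdens d (vscale d (1 / s) z)) * (Y z * ex d xi z)"
 have sc: "Y (vscale d s z) = of_real s ^ k * Y z" for z by (rule HP_homogeneous[OF HP]) (simp add: vscale_def)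
 have g: "gdens d z * exp (- a * nsq d z) = gdens d (vscale d (1 / s) z)" for z
 proof -
 have "gdens d z = (2 * pi) powr (- real d / 2) * exp (- nsq d z / 2)" by (simp add: gdens_eq nsq_def)
 moreover have "(1 / s * enorm d z)^2 = (1 + 2 * a) * nsq d z" unfolding pow_mult s(2) nsq_enorm ..
 hence "exp (- (1 / s * enorm d z)\<^sup>2 / 2) = exp (- nsq d z / 2) * exp (- a * nsq d z)"
 by (simp add: exp_add[symmetric] distrib_right add_divide_distrib)
 ultimately show ?thesis by (simp add: gdens_vscale)
 qed
 have gs: "gdens d (vscale d (1 / s) (vscale d s z)) = gdens d z" for z
 unfolding vscale_vscale using s(1) by (simp add: gdens_def vscale_def)
 have "?A Y = (LINT z|ld d. ?F z)"
 by (subst integral_gd_ld, measurable) (simp add: g[symmetric] mult_ac)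
 also have "... = of_real (abs s ^ d) * (LINT z|ld d. ?F (vscale d s z))" using s(1) by (intro integral_ld_vscale) auto
 also have "(LINT z|ld d. ?F (vscale d s z)) = (LINT z|ld d. of_real (gdens d z) * (of_real s ^ k * (Y z * ex d (vscale d s xi) z)))"
 unfolding gs sc ip_vscale by (simp add: mult_ac)
 also have "... = (LINT z|gd d. of_real s ^ k * (Y z * ex d (vscale d s xi) z))"
 by (rule integral_gd_ld[symmetric]) measurable
 also have "... = of_real s ^ k * (\<i> ^ k * Y (vscale d s xi) * of_real (exp (- nsq d (vscale d s xi) / 2)))"
 unfolding int_cmult HH_fourier[OF Y] ..
 finally show ?thesis using s(1) by (simp add: sc mult_ac)
 qed
 thus ?thesis by blast
qed

text \<open>The Bochner relation: with a radial weight, the Fourier integral of \<open>Y\<close> is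
  \<open>Y xi\<close> times a factor that does not depend on \<open>Y\<close>. It is stated
  cross-multiplied, because \<open>P xi\<close> and \<open>Y xi\<close> may be 0.\<close>

definition exch :: "nat => ((nat => real) => complex) => ((nat => real) => complex) => (nat => real) => (real => real) => bool" where
 "exch d P Y xi w <-> P xi * (LINT z|gd d. Y z * of_real (w (nsq d z)) * ex d xi z) = Y xi * (LINT z|gd d. P z * of_real (w (nsq d z)) * ex d xi z)"

lemma exch_integrable:
 assumes Y: "HP d k Y" and w [measurable]: "w : bm borel" and b: "!!s. 0 <= s ==> abs (w s) <= B"
 shows "integrable (gd d) (%z. Y z * of_real (w (nsq d z)) * ex d xi z)"
proof -
 have "tame d (%z. of_real (w (nsq d z)))" by (rule tame_bounded[of _ _ B]) (auto intro: b)
 moreover have "tame d (ex d xi)" by (rule tame_bounded[of _ _ 1]) auto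
 ultimately show ?thesis by (intro int_tame tame_mult tame_HP[OF Y])
qed

lemma exch_limit:
 assumes P: "HP d k P" and Y: "HP d k Y" and wn: "!!n. w n : bm borel" and v: "v : bm borel"
 and b: "!!n s. 0 <= s ==> abs (w n s) <= B" and l: "!!s. 0 <= s ==> (%n. w n s) ----> v s"
 and e: "!!n. exch d P Y xi (w n)"
 shows "exch d P Y xi v"
proof -
 let ?A = "%Q z n. Q z * of_real (w n (nsq d z)) * ex d xi z"
 let ?B = "%n. P xi * (LINT z|gd d. Y z * of_real (w n (nsq d z)) * ex d xi z)"
 let ?C = "%z. of_real (v (nsq d z))"
 note [measurable] = wn v
 have lim: "(%n. (LINT z|gd d. ?A Q z n)) ----> (LINT z|gd d. Q z * ?C z * ex d xi z)" if Q: "HP d k Q" for Q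
 proof (rule dom_conv)
 note [measurable] = HP_measurable[OF Q]
 show "(%z. Q z * ?C z * ex d xi z) : bm (gd d)" unfolding measurable_gd_eq by measurable
 show "(%z. ?A Q z n) : bm (gd d)" for n unfolding measurable_gd_eq by measurable
 show "integrable (gd d) (%z. norm (Q z) * B)"
 using integrable_norm[OF int_tame[OF tame_HP[OF Q]]] by simp
 show "AE z in gd d. (%n. ?A Q z n) ----> Q z * ?C z * ex d xi z"
 by (intro AE_I2 tendsto_intros l) simp
 show "AE z in gd d. norm (?A Q z n) <= norm (Q z) * B" for n
 by (intro AE_I2) (simp add: norm_mult mlm b)
 qed
 have "?B ----> P xi * (LINT z|gd d. Y z * ?C z * ex d xi z)"
 by (intro tendsto_intros lim Y)
 moreover have "?B ----> Y xi * (LINT z|gd d. P z * ?C z * ex d xi z)"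
 using e unfolding exch_def by (simp only:) (intro tendsto_intros lim P)
 ultimately show ?thesis unfolding exch_def by (rule LIMSEQ_unique)
qed

lemma exch_sum:
 assumes P: "HP d k P" and Y: "HP d k Y" and w [measurable]: "!!i. w i : bm borel"
 and b: "!!i s. 0 <= s ==> abs (w i s) <= B" and e: "!!i. exch d P Y xi (w i)"
 shows "exch d P Y xi (%s. SUM i:I. a i * w i s)"
proof -
 let ?A = "%Q. (LINT z|gd d. Q z * of_real (SUM i:I. a i * w i (nsq d z)) * ex d xi z)"
 let ?B = "%Q z i. Q z * of_real (w i (nsq d z)) * ex d xi z"
 have s: "?A Q
 = (SUM i:I. of_real (a i) * (LINT z|gd d. ?B Q z i))" if Q: "HP d k Q" for Q
 proof -
 have "?A Q
 = (LINT z|gd d. (SUM i:I. of_real (a i) * (?B Q z i)))"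
 by (intro int_cong refl) (simp add: sum_cmult sum_distrib_right mult_ac)
 also have "... = (SUM i:I. (LINT z|gd d. of_real (a i) * (?B Q z i)))"
 by (intro int_sum int_mult exch_integrable[OF Q w b])
 finally show ?thesis by (simp only: int_cmult)
 qed
 show ?thesis using e unfolding exch_def s[OF P] s[OF Y] sum_cmult
 by (intro sum.cong refl) (simp add: mult.left_commute)
qed

lemma exch_exp: assumes "HH d k P" "HH d k Y" shows "exch d P Y xi (%s. exp (- s) ^ i)"
proof -
 obtain c where c: "!!Y. HH d k Y ==> (LINT z|gd d. Y z * of_real (exp (- real i * nsq d z)) * ex d xi z) = c * Y xi"
 using HH_fourier_gauss[of "real i" d k xi] by auto
 have e: "exp (- s) ^ i = exp (- real i * s)" for s by (simp add: exp_of_nat_mult[symmetric])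
 show ?thesis unfolding exch_def e c[OF assms(1)] c[OF assms(2)] by simp
qed

text \<open>By Weierstrass approximation in the variable \<open>exp (- |z|\<^sup>2)\<close>.\<close>

lemma exch_continuous:
 assumes P: "HH d k P" and Y: "HH d k Y" and h: "continuous_on UNIV h"
 shows "exch d P Y xi (%s. h (exp (- s)))"
proof -
 let ?A = "%n. 1 / real (Suc n)"
 have HP: "HP d k P" "HP d k Y" using P Y by (auto intro: HH_imp_HP)
 have [measurable]: "h : bm borel" using h by (rule borel_measurable_continuous_onI)
 have hc: "continuous_on {0..1} h" using h continuous_on_subset by blast
 have "EX g. real_polynomial_function g & (ALL u:{0..1}. abs (h u - g u) < ?A n)" for n
 proof -
 obtain g where "real_polynomial_function g" "!!u. u : {0..1} ==> abs (h u - g u) < ?A n"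
 by (rule Stone_Weierstrass_real_polynomial_function[OF _ hc, of "?A n"]) auto
 thus ?thesis by blast
 qed
 then obtain g where g: "!!n. real_polynomial_function (g n)" "!!n u. u : {0..1} ==> abs (h u - g n u) < ?A n" by metis
 have u01: "exp (- s) : {0..1}" if "0 <= s" for s :: real using that by simp
 have "compact (h ` {0..1})" by (rule compact_continuous_image[OF hc]) simp
 then obtain B where B: "!!u. u : {0..1} ==> abs (h u) <= B" using compact_imp_bounded bounded_iff by (metis image_eqI real_norm_def)
 show ?thesis
 proof (rule exch_limit[OF HP, where w="%n s. g n (exp (- s))" and B="B + 1"])
 have "continuous_on UNIV (g n)" for n
 using g(1)[of n] continuous_on_polymonial_function real_polynomial_function_eq[of "g n"]
 by (metis continuous_at_imp_continuous_on continuous_real_polymonial_function)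
 hence [measurable]: "g n : bm borel" for n by (rule borel_measurable_continuous_onI)
 show "(%s. g n (exp (- s))) : bm borel" for n by measurable
 show "(%s. h (exp (- s))) : bm borel" by measurable
 show "abs (g n (exp (- s))) <= B + 1" if "0 <= s" for n s
 proof -
 have "?A n <= 1" by simp
 thus ?thesis using g(2)[OF u01[OF that], of n] B[OF u01[OF that]] by linarith
 qed
 show "(%n. g n (exp (- s))) ----> h (exp (- s))" if "0 <= s" for s
 proof -
 have "(%n. h (exp (- s)) - g n (exp (- s))) ----> 0"
 by (rule Lim_null_comparison[OF _ LIMSEQ_inverse_real_of_nat])
 (use g(2)[OF u01[OF that]] in \<open>auto intro!: always_eventually less_imp_le simp: inverse_eq_divide\<close>)
 from tendsto_diff[OF tendsto_const[of "h (exp (- s))"] this] show ?thesis by simp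
 qed
 show "exch d P Y xi (%s. g n (exp (- s)))" for n
 proof -
 obtain a m where a: "g n = (%x. SUM i<=m. a i * x ^ i)" using g(1)[of n] real_polynomial_function_iff_sum by blast
 show ?thesis unfolding a by (rule exch_sum[OF HP _ _ exch_exp[OF P Y], where B=1]) (auto intro!: power_le_one)
 qed
 qed
qed

text \<open>The indicator is a bounded pointwise limit of continuous ramps in the variable
  \<open>exp (- s)\<close>, which equal 1 from \<open>exp (- b)\<close> upwards.\<close>

lemma exch_indicator:
 assumes P: "HH d k P" and Y: "HH d k Y"
 shows "exch d P Y xi (%s. indicator {..b} s)"
proof -
 have HP: "HP d k P" "HP d k Y" using P Y by (auto intro: HH_imp_HP)
 define c where "c = exp (- b)"
 let ?h = "%n u. max 0 (1 - real n * max 0 (c - u))"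
 show ?thesis
 proof (rule exch_limit[OF HP, where w="%n s. ?h n (exp (- s))" and B=1])
 show "exch d P Y xi (%s. ?h n (exp (- s)))" for n
 by (rule exch_continuous[OF P Y, of "?h n"]) (intro continuous_intros)
 show "(%n. ?h n (exp (- s))) ----> indicator {..b} s" for s :: real
 proof (cases "s <= b")
 case True
 hence "c <= exp (- s)" by (simp add: c_def)
 thus ?thesis using True by simp
 next
 case False
 hence cs: "0 < c - exp (- s)" by (simp add: c_def)
 obtain N where N: "1 / (c - exp (- s)) < real N" using reals_Archimedean2 by blast
 have "\<forall>\<^sub>F n in sequentially. ?h n (exp (- s)) = 0"
 proof (rule eventually_sequentiallyI)
 fix n assume "N <= n"
 hence "1 / (c - exp (- s)) <= real n" using N by (auto intro: order_trans less_imp_le)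
 hence "1 <= real n * (c - exp (- s))" using cs by (simp add: field_simps)
 thus "?h n (exp (- s)) = 0" using cs by simp
 qed
 thus ?thesis using False by (simp add: tendsto_eventually)
 qed
 qed (auto simp: abs_if max_def)
qed

text \<open>A shell in \<open>|z|\<close> is a difference of two balls. Both polynomials scale by
  \<open>r ^ k\<close> under \<open>xi -> r * xi\<close>, so the factor cancels for nonzero
  \<open>r\<close>.\<close>

lemma exch_annulus:
 assumes P: "HH d k P" and Y: "HH d k Y" and t: "0 <= t" and r: "r ~= 0"
 shows "P xi * (LINT z|gd d. Y z * of_real (indicator {t<..N} (abs r * enorm d z)) * ex d (vscale d r xi) z)
 = Y xi * (LINT z|gd d. P z * of_real (indicator {t<..N} (abs r * enorm d z)) * ex d (vscale d r xi) z)"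
proof (cases "t <= N")
 case False
 hence "{t<..N} = {}" by auto
 thus ?thesis by simp
next
 case True
 have HP: "HP d k P" "HP d k Y" using P Y by (auto intro: HH_imp_HP)
 let ?w = "%c s. indicator {..(c / abs r)^2} s :: real"
 have le: "abs r * enorm d z <= c <-> nsq d z <= (c / abs r)^2" if "0 <= c" for c z
 proof -
 have "abs r * enorm d z <= c <-> enorm d z <= c / abs r" using r by (simp add: field_simps)
 also have "... <-> (enorm d z)^2 <= (c / abs r)^2" using that by (intro power_mono_iff[symmetric]) auto
 finally show ?thesis by (simp add: nsq_enorm)
 qed
 have ind: "indicator {t<..N} (abs r * enorm d z) = (SUM i:{0,1::nat}. (if i = 0 then -1 else 1) * ?w (if i = 0 then t else N) (nsq d z))" for z
 using le[of t z] le[of N z] t True by (auto simp: ind_def)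
 have "exch d P Y (vscale d r xi) (%s. SUM i:{0,1::nat}. (if i = 0 then -1 else 1) * ?w (if i = 0 then t else N) s)"
 by (rule exch_sum[OF HP, where B=1]) (auto intro: exch_indicator[OF P Y])
 hence A: "P (vscale d r xi) * (LINT z|gd d. Y z * of_real (indicator {t<..N} (abs r * enorm d z)) * ex d (vscale d r xi) z)
 = Y (vscale d r xi) * (LINT z|gd d. P z * of_real (indicator {t<..N} (abs r * enorm d z)) * ex d (vscale d r xi) z)"
 unfolding exch_def ind .
 have s: "Q (vscale d r xi) = of_real r ^ k * Q xi" if "HP d k Q" for Q
 by (rule HP_homogeneous[OF that]) (simp add: vscale_def)
 have "a * X = b * Z" if "a' * X = b' * Z" "a' = c * a" "b' = c * b" "c ~= 0" for a b a' b' c X Z :: complex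
 using that by simp
 from this[OF A s[OF HP(1)] s[OF HP(2)]] show ?thesis using r by simp
qed

lemma pair_integrable_bound:
 fixes K :: "'a => 'b => complex" and f :: "'a => complex" and g :: "'b => real"
 assumes "pair_sigma_finite M N" and K: "(%(x, y). K x y) : bm (M \<Otimes>\<^sub>M N)"
 and f: "integrable M f" and g: "integrable N g" and g0: "!!y. 0 <= g y" and b: "!!x y. norm (K x y) <= norm (f x) * g y"
 shows "integrable (M \<Otimes>\<^sub>M N) (%(x, y). K x y)"
proof -
 interpret P: pair_sigma_finite M N by fact
 have [measurable]: "f : bm M" "g : bm N" using f g by auto
 have "integrable (M \<Otimes>\<^sub>M N) (%(x, y). norm (f x) * g y)"
 proof (rule P.Fubini_integrable)
 show "integrable M (%x. (LINT y|N. norm (case (x, y) of (x, y) => norm (f x) * g y)))"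
 using f g0 by (simp add: abs_mult)
 show "AE x in M. integrable N (%y. case (x, y) of (x, y) => norm (f x) * g y)" using g by simp
 qed measurable
 thus ?thesis
 by (rule int_bd[OF _ K]) (use b g0 in \<open>auto simp: abs_mult\<close>)
qed

section \<open>Fourier multipliers of the averaged operators\<close>

definition FT :: "nat => ((nat => real) => complex) => (nat => real) => complex" where
 "FT d a x = (LINT xi|ld d. a xi * ex d xi x)"

text \<open>For \<open>0 < a <= b\<close> this is \<open>2 * ln (b / a)\<close>; depending on the
  quotient alone, it does not change when both radii are divided by \<open>|z|\<close>.\<close>

definition lnc :: "real => real => real" where
 "lnc a b = (LINT r|lborel. indicator {r. a < abs r & abs r <= b} r / abs r)"

text \<open>The Fourier multiplier of the truncated Hilbert transform, at frequency
  \<open>u\<close>.\<close>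

definition hm :: "real => real => real => complex" where
 "hm a b u = (LINT r|lborel. (indicator {r. a < abs r & abs r <= b} r / r) *\<^sub>R exp (\<i> * of_real (- r * u)))"

lemma lnc_integrable:
 assumes "0 < a | b <= a" shows "integrable lborel (%r::real. indicator {r. a < abs r & abs r <= b} r / abs r)"
proof (cases "b <= a")
 case True
 hence "{r. a < abs r & abs r <= b} = {}" by auto
 thus ?thesis by simp
next
 case False
 hence a: "0 < a" using assms by simp
 have "integrable lborel (%r::real. (1 / a) * indicator {- b..b} r)"
 by (intro int_mult integrable_real_indicator) (auto simp: emeasure_lborel_Icc_eq)
 thus ?thesis
 proof (rule int_bd)
 show "AE r in lborel. norm (indicator {r. a < abs r & abs r <= b} r / abs r) <= norm ((1 / a) * indicator {- b..b} r)"
 using a by (intro AE_I2) (auto simp: ind_def field_simps)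
 qed measurable
qed

lemma lnc_nonneg: "0 <= lnc a b" unfolding lnc_def by (intro integral_nonneg_AE AE_I2) auto

lemma hm_bound: "norm (hm a b u) <= lnc a b"
 unfolding hm_def lnc_def by (rule order_trans[OF integral_norm_bound]) simp

lemma hm_measurable [measurable (raw)]:
 assumes [measurable]: "a : bm M" "b : bm M" "u : bm M"
 shows "(%x. hm (a x) (b x) (u x)) : bm M"
proof -
 let ?A = "%x r. if a x < abs r & abs r <= b x then 1 else 0"
 have "(%x. (LINT r|lborel. ((?A x r) / r) *\<^sub>R exp (\<i> * of_real (- r * u x)))) : bm M"
 by measurable
 moreover have "(?A x r) = (indicator {r. a x < abs r & abs r <= b x} r :: real)" for x r
 by (auto simp: ind_def)
 ultimately show ?thesis by (simp add: hm_def)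
qed

lemma lnc_scale: assumes e: "0 < e" shows "lnc (t / e) (N / e) = lnc t N"
proof -
 let ?f = "%r. indicator {r. t / e < abs r & abs r <= N / e} r / abs r"
 have "lnc (t / e) (N / e) = abs (1 / e) *\<^sub>R (LINT r|lborel. ?f (0 + (1 / e) * r))"
 unfolding lnc_def using e by (intro lborel_integral_real_affine) auto
 also have "... = (LINT r|lborel. (1 / e) * ?f ((1 / e) * r))" unfolding int_cmult using e by simp
 also have "... = lnc t N" unfolding lnc_def
 using e by (intro int_cong refl) (auto simp: ind_def abs_mult field_simps)
 finally show ?thesis .
qed

lemma ip_vadd: "ip d xi (vadd d x r z) = ip d xi x + r * ip d xi z"
 by (simp add: ip_def vadd_def sum.distrib sum_cmult distrib_left mult_ac)

lemma ex_vadd: "ex d xi (vadd d x (- r) z) = ex d xi x * exp (\<i> * of_real (- r * ip d xi z))"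
proof -
 have "\<i> * of_real (ip d xi (vadd d x (- r) z)) = \<i> * of_real (ip d xi x) + \<i> * of_real (- r * ip d xi z)"
 unfolding ip_vadd of_real_add by (rule distrib_left)
 thus ?thesis by (simp only: exp_add)
qed

lemma measurable_ip_fixed2 [measurable (raw)]:
 assumes f: "f : measurable M (ld d)"
 shows "(%y. ip d (f y) x) : bm M" "(%y. ip d x (f y)) : bm M"
 using measurable_compose[OF f borel_measurable_ip_fixed] by (simp_all add: ip_commute[of d _ x])

lemma dtr_FT:
 assumes ab: "0 < a | b <= a" and A: "integrable (ld d) A"
 shows "dtr d a b z (FT d A) x = (LINT xi|ld d. A xi * ex d xi x * hm a b (ip d xi z))"
proof -
 interpret P: pair_sigma_finite "ld d" "lborel :: real measure" by (rule pair_sigma_finite_ld)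
 have [measurable]: "A : bm (ld d)" using A by auto
 let ?k = "%r. indicator {r. a < abs r & abs r <= b} r / r :: real"
 let ?K = "%xi r. A xi * ex d xi x * (?k r *\<^sub>R exp (\<i> * of_real (- r * ip d xi z)))"
 have int: "integrable (ld d \<Otimes>\<^sub>M lborel) (%(xi, r). ?K xi r)"
 by (rule pair_integrable_bound[OF P.pair_sigma_finite_axioms _ A lnc_integrable[OF ab]]) (measurable, auto simp: norm_mult mult_ac)
 have "dtr d a b z (FT d A) x = (LINT r|lborel. (LINT xi|ld d. ?K xi r))"
 proof -
 have "?k r *\<^sub>R FT d A (vadd d x (- r) z) = (LINT xi|ld d. ?K xi r)" for r
 unfolding FT_def ex_vadd scaleR_of_real int_cmult[symmetric]
 by (intro int_cong refl) (simp only: mult_ac)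
 thus ?thesis by (simp only: dtr_def)
 qed
 also have "... = (LINT xi|ld d. (LINT r|lborel. ?K xi r))" by (rule P.Fubini_integral[OF int])
 also have "... = (LINT xi|ld d. A xi * ex d xi x * hm a b (ip d xi z))"
 unfolding hm_def by (simp only: int_cmult)
 finally show ?thesis .
qed

lemma integrable_gd_mult_bounded:
 assumes Y: "HP d k Y" and [measurable]: "h : bm (ld d)" and b: "!!z. norm (h z) <= c"
 shows "integrable (gd d) (%z. Y z * h z)"
 by (intro int_tame tame_mult tame_HP[OF Y] tame_bounded[of _ _ c] assms)

lemma avg_dtr_FT:
 assumes Y: "HP d k Y" and A: "integrable (ld d) A"
 and a [measurable]: "a : bm (ld d)" and b [measurable]: "b : bm (ld d)"
 and ab: "!!z. 0 < a z | b z <= a z" and c: "!!z. lnc (a z) (b z) <= c"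
 shows "(LINT z|gd d. Y z * dtr d (a z) (b z) z (FT d A) x) = (LINT xi|ld d. A xi * ex d xi x * (LINT z|gd d. Y z * hm (a z) (b z) (ip d xi z)))"
proof -
 interpret P: pair_sigma_finite "ld d" "gd d" by (rule pair_sigma_finite_ld)
 note [measurable] = HP_measurable[OF Y]
 have [measurable]: "A : bm (ld d)" using A by auto
 have c0: "0 <= c" using lnc_nonneg c order_trans by blast
 let ?K = "%xi z. (A xi * ex d xi x) * (Y z * hm (a z) (b z) (ip d xi z))"
 have m: "(%(xi, z). ?K xi z) : bm (ld d \<Otimes>\<^sub>M gd d)" by measurable
 have int: "integrable (ld d \<Otimes>\<^sub>M gd d) (%(xi, z). ?K xi z)"
 proof (rule pair_integrable_bound[OF P.pair_sigma_finite_axioms m A])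
 show "integrable (gd d) (%z. norm (Y z) * c)" using integrable_norm[OF int_tame[OF tame_HP[OF Y]]] by simp
 show "norm (?K xi z) <= norm (A xi) * (norm (Y z) * c)" for xi z
 unfolding norm_mult using order_trans[OF hm_bound c] by (auto intro!: mlm)
 qed (use c0 in simp)
 have "(LINT z|gd d. Y z * dtr d (a z) (b z) z (FT d A) x) = (LINT z|gd d. (LINT xi|ld d. ?K xi z))"
 unfolding dtr_FT[OF ab A] int_cmult[symmetric] by (simp add: mult_ac)
 also have "... = (LINT xi|ld d. (LINT z|gd d. ?K xi z))" by (rule P.Fubini_integral[OF int])
 finally show ?thesis by (simp only: int_cmult)
qed

text \<open>The radial factor in the multiplier of \<open>Sop\<close>; without the truncation it
  would be \<open>gm k / c ^ k\<close>.\<close>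

definition Jm :: "nat => real => real => real" where
 "Jm k e c = (LINT r|lborel. indicator {r. e < abs r & abs r <= 1 / e} r * (abs r ^ (k - 1) * exp (- (c * r)\<^sup>2 / 2)))"

text \<open>After Fubini, Hecke's identity is used at \<open>- r * xi\<close>. Since
  \<open>k\<close> is odd, \<open>(- r) ^ k / r\<close> equals \<open>- |r| ^ (k - 1)\<close>, which
  gives the sign.\<close>

lemma avg_hm:
 assumes k: "odd k" and Y: "HH d k Y" and e: "0 < e"
 shows "(LINT z|gd d. Y z * hm e (1 / e) (ip d xi z)) = - (\<i> ^ k) * Y xi * of_real (Jm k e (enorm d xi))"
proof -
 let ?A = "%r. exp (- (enorm d xi * r)\<^sup>2 / 2)"
 let ?B = "- (\<i> ^ k) * Y xi"
 interpret P: pair_sigma_finite "gd d" "lborel :: real measure" by (rule pair_sigma_finite_ld)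
 have HP: "HP d k Y" using Y by (rule HH_imp_HP)
 note [measurable] = HP_measurable[OF HP]
 let ?i = "%r. indicator {r. e < abs r & abs r <= 1 / e} r :: real"
 let ?K = "%z r. Y z * ((?i r / r) *\<^sub>R exp (\<i> * of_real (- r * ip d xi z)))"
 have int: "integrable (gd d \<Otimes>\<^sub>M lborel) (%(z, r). ?K z r)"
 by (rule pair_integrable_bound[OF P.pair_sigma_finite_axioms _ int_tame[OF tame_HP[OF HP]] lnc_integrable[of e "1 / e"]])
 (measurable, use e in \<open>auto simp: norm_mult mult_ac\<close>)
 have "(LINT z|gd d. Y z * hm e (1 / e) (ip d xi z)) = (LINT z|gd d. (LINT r|lborel. ?K z r))"
 unfolding hm_def by (simp only: int_cmult)
 also have "... = (LINT r|lborel. (LINT z|gd d. ?K z r))" by (rule P.Fubini_integral[OF int, symmetric])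
 also have "... = (LINT r|lborel. ?B * of_real (?i r * (abs r ^ (k - 1) * ?A r)))"
 proof (intro int_cong refl)
 fix r
 have "(LINT z|gd d. ?K z r) = of_real (?i r / r) * (LINT z|gd d. Y z * ex d (vscale d (- r) xi) z)"
 unfolding int_cmult[symmetric] ip_vscale scaleR_of_real by (simp add: mult_ac)
 also have "... = of_real (?i r / r) * (\<i> ^ k * (of_real (- r) ^ k * Y xi) * of_real (?A r))"
 proof -
 have "Y (vscale d (- r) xi) = of_real (- r) ^ k * Y xi" by (rule HP_homogeneous[OF HP]) (simp add: vscale_def)
 moreover have "nsq d (vscale d (- r) xi) = (enorm d xi * r)^2" by (simp add: nsq_enorm enorm_vscale pow_mult)
 ultimately show ?thesis unfolding HH_fourier[OF Y] by simp
 qed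
 also have "... = ?B * of_real (- (?i r / r * (- r) ^ k) * ?A r)"
 by (simp add: mult_ac)
 also have "- (?i r / r * (- r) ^ k) = ?i r * abs r ^ (k - 1)"
 proof (cases "r = 0")
 case False
 obtain j where j: "k = 2 * j + 1" using k by (elim oddE)
 show ?thesis using False by (simp add: j power_mult)
 qed (use e in simp)
 finally show "(LINT z|gd d. ?K z r) = ?B * of_real (?i r * (abs r ^ (k - 1) * ?A r))"
 by (simp only: mult.assoc)
 qed
 also have "... = - (\<i> ^ k) * Y xi * of_real (Jm k e (enorm d xi))"
 unfolding Jm_def int_cmult integral_complex_of_real ..
 finally show ?thesis .
qed

text \<open>The integral of \<open>|r| ^ (k - 1) * exp (- r\<^sup>2 / 2)\<close> over the line; it
  is also the quotient of \<open>polar_const d k\<close> by \<open>riesz_const d k\<close>.\<close>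

definition gm :: "nat => real" where "gm k = 2 powr (real k / 2) * Gamma (real k / 2)"

lemma gm_pos: "0 < k ==> 0 < gm k" unfolding gm_def by (intro mult_pos_pos Gamma_real_pos) auto

lemma Jm_nonneg: "0 <= Jm k e c" unfolding Jm_def by (intro integral_nonneg_AE AE_I2) auto

lemma Jm_full:
 assumes k: "0 < k" and c: "0 < c"
 shows "has_bochner_integral lborel (%r. abs r ^ (k - 1) * exp (- (c * r)\<^sup>2 / 2)) (gm k / c ^ k)"
proof (rule has_bochner_integral_nn_integral)
 let ?f = "%r. en (abs r ^ (k - 1) * exp (- (c * r)\<^sup>2 / 2))"
 have ck: "c ^ k = c * c ^ (k - 1)" using k by (simp add: power_eq_if)
 have e: "(real (k - 1) + 1) / 2 = real k / 2" using k by simp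
 have "(NN r|lborel. ?f r) = en (1 / c) * (NN r|lborel. ?f ((1 / c) * r))"
 using nn_integral_real_affine[of ?f "1 / c" 0] c by simp
 also have "... = en (1 / c) * (NN s|lborel. en (1 / c ^ (k - 1)) * en (abs s ^ (k - 1) * exp (- s\<^sup>2 / 2)))"
 using c by (simp add: en_mult[symmetric] abs_mult power_divide)
 also have "... = en (1 / c) * (en (1 / c ^ (k - 1)) * en (gm k))"
 unfolding gm_def e[symmetric] gaussian_abs_moment[symmetric] by (subst nn_cmult) simp_all
 also have "... = en (gm k / c ^ k)"
 using c gm_pos[OF k] by (simp add: en_mult[symmetric] ck)
 finally show "(NN r|lborel. ?f r) = en (gm k / c ^ k)" .
qed (use c gm_pos[OF k] in auto)

lemma Jm_bound: assumes k: "0 < k" and c: "0 <= c" shows "Jm k e c * c ^ k <= gm k"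
proof (cases "c = 0")
 case True thus ?thesis using gm_pos[OF k] by (simp add: zero_power[OF k])
next
 case False
 hence c: "0 < c" using c by simp
 note h = Jm_full[OF k c, unfolded has_bochner_integral_iff]
 have "Jm k e c <= (LINT r|lborel. abs r ^ (k - 1) * exp (- (c * r)\<^sup>2 / 2))"
 unfolding Jm_def
 proof (rule integral_mono)
 show "integrable lborel (%r. indicator {r. e < abs r & abs r <= 1 / e} r * (abs r ^ (k - 1) * exp (- (c * r)\<^sup>2 / 2)))"
 using integrable_mult_indicator[of "{r. e < abs r & abs r <= 1 / e}", OF _ conjunct1[OF h]] by simp
 qed (use h in \<open>auto simp: ind_def\<close>)
 thus ?thesis using h c by (simp add: pos_le_divide_eq)
qed

lemma Jm_lim:
 assumes k: "0 < k" and c: "0 < c" shows "(%n. Jm k (1 / real (Suc n)) c * c ^ k) ----> gm k"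
proof -
 let ?A = "%r. abs r ^ (k - 1) * exp (- (c * r)\<^sup>2 / 2)"
 let ?B = "%n. 1 / real (Suc n)"
 let ?C = "%r. abs r"
 let ?D = "%n r. indicator {r. ?B n < ?C r & ?C r <= 1 / (?B n)} r * (?A r)"
 let ?E = "%n r. indicator {r. ?B n < ?C r & ?C r <= 1 / (?B n)} r"
 note h = Jm_full[OF k c, unfolded has_bochner_integral_iff]
 have "(%n. Jm k (?B n) c) ----> (LINT r|lborel. ?A r)"
 unfolding Jm_def
 proof (rule dom_conv[OF _ _ conjunct1[OF h]])
 have "AE r in lborel. r ~= (0::real)" by (rule AE_lborel_singleton)
 thus "AE r in lborel. (%n. ?D n r)
 ----> ?A r"
 proof eventually_elim
 case (elim r)
 obtain N where N: "max (abs r) (1 / abs r) < real N" using reals_Archimedean2 by blast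
 have "\<forall>\<^sub>F n in sequentially. ?E n r = (1::real)"
 proof (rule eventually_sequentiallyI)
 fix n assume "N <= n"
 hence "?C r <= real (Suc n)" "1 / abs r < real (Suc n)" using N by auto
 thus "?E n r = (1::real)"
 using elim by (auto simp: field_simps)
 qed
 hence "\<forall>\<^sub>F n in sequentially. ?D n r
 = ?A r" by eventually_elim simp
 thus ?case by (rule tendsto_eventually)
 qed
 qed (auto simp: ind_def)
 hence "(%n. Jm k (?B n) c * c ^ k) ----> gm k / c ^ k * c ^ k" using h by (intro tendsto_intros) simp
 thus ?thesis using c by simp
qed

lemma Jm_measurable [measurable]: "(%c. Jm k e c) : bm borel"
 unfolding Jm_def by measurable

text \<open>The multiplier of \<open>Rop\<close>. It is never computed: a bound and
  \<open>TR_exchange\<close> suffice.\<close>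

definition TR :: "nat => real => real => ((nat => real) => complex) => (nat => real) => complex" where
 "TR d t N Y xi = (LINT z|gd d. Y z * hm (t / enorm d z) (N / enorm d z) (ip d xi z))"

text \<open>For \<open>|z| = 0\<close> both quotients are 0 by the convention for division, and the
  annulus is empty.\<close>

lemma annulus_good: "0 < t ==> 0 < t / enorm d z | N / enorm d z <= t / enorm d z"
 using enorm_nonneg[of d z] by (cases "enorm d z = 0") (auto simp: less_le)

lemma lnc_annulus: "lnc (t / enorm d z) (N / enorm d z) <= lnc t N"
proof (cases "enorm d z = 0")
 case True
 have "{r::real. 0 < abs r & abs r <= 0} = {}" by auto
 hence "lnc 0 0 = 0" by (simp add: lnc_def)
 thus ?thesis using True lnc_nonneg by simp
next
 case False
 hence "0 < enorm d z" using enorm_nonneg[of d z] by linarith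
 thus ?thesis by (simp add: lnc_scale)
qed

lemma TR_bound: assumes Y: "HP d k Y" shows "norm (TR d t N Y xi) <= (LINT z|gd d. norm (Y z)) * lnc t N"
proof -
 let ?A = "%z. norm (Y z * hm (t / enorm d z) (N / enorm d z) (ip d xi z))"
 note [measurable] = HP_measurable[OF Y]
 have "norm (TR d t N Y xi) <= (LINT z|gd d. ?A z)"
 unfolding TR_def by (rule integral_norm_bound)
 also have "... <= (LINT z|gd d. norm (Y z) * lnc t N)"
 proof (rule integral_mono)
 show "integrable (gd d) (%z. ?A z)"
 by (intro integrable_norm integrable_gd_mult_bounded[OF Y, where c="lnc t N"] order_trans[OF hm_bound lnc_annulus]) measurable
 show "integrable (gd d) (%z. norm (Y z) * lnc t N)" using integrable_norm[OF int_tame[OF tame_HP[OF Y]]] by simp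
 show "?A z <= norm (Y z) * lnc t N" for z
 unfolding norm_mult by (intro mlm order_trans[OF hm_bound lnc_annulus]) simp
 qed
 finally show ?thesis by simp
qed

text \<open>With the \<open>r\<close> integral outside, the inner integral is the Fourier integral
  over a shell in \<open>z\<close> to which \<open>exch_annulus\<close> applies.\<close>

lemma TR_swap:
 assumes Y: "HP d k Y" and t: "0 < t"
 shows "TR d t N Y xi = (LINT r|lborel. of_real (1 / r) * (LINT z|gd d. Y z * of_real (indicator {t<..N} (abs r * enorm d z)) * ex d (vscale d (- r) xi) z))"
proof -
 let ?A = "%z t. norm (Y z) * lnc (t / enorm d z) (N / enorm d z)"
 interpret P: pair_sigma_finite "gd d" "lborel :: real measure" by (rule pair_sigma_finite_ld)
 note [measurable] = HP_measurable[OF Y]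
 let ?i = "%z r. indicator {t<..N} (abs r * enorm d z) :: real"
 have ind: "indicator {r. t / enorm d z < abs r & abs r <= N / enorm d z} r = ?i z r" for z and r :: real
 proof (cases "enorm d z = 0")
 case False
 hence "0 < enorm d z" using enorm_nonneg[of d z] by linarith
 thus ?thesis by (auto simp: ind_def field_simps)
 qed (use t in \<open>auto simp: ind_def\<close>)
 let ?K = "%z r. Y z * ((?i z r / r) *\<^sub>R exp (\<i> * of_real (- r * ip d xi z)))"
 have int: "integrable (gd d \<Otimes>\<^sub>M lborel) (%(z, r). ?K z r)"
 proof (rule P.Fubini_integrable)
 have L: "(LINT r|lborel. norm (?K z r)) = ?A z t" for z
 unfolding lnc_def ind int_cmult[symmetric] by (intro int_cong refl) (simp add: norm_mult)
 have "integrable (gd d) (%z. ?A z t)"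
 proof (rule int_bd)
 show "integrable (gd d) (%z. norm (Y z) * lnc t N)" using integrable_norm[OF int_tame[OF tame_HP[OF Y]]] by simp
 have "(%z. (LINT r|lborel. norm (?K z r))) : bm (gd d)" by measurable
 thus "(%z. ?A z t) : bm (gd d)" unfolding L .
 qed (auto intro!: mlm lnc_annulus simp: abs_mult lnc_nonneg)
 thus "integrable (gd d) (%z. (LINT r|lborel. norm (case (z, r) of (z, r) => ?K z r)))" by (simp only: prod.case L)
 show "AE z in gd d. integrable lborel (%r. case (z, r) of (z, r) => ?K z r)"
 proof (rule AE_I2)
 fix z
 have "integrable lborel (%r. norm (Y z) * (?i z r / abs r))"
 unfolding ind[symmetric] by (intro int_mult lnc_integrable annulus_good t)
 hence "integrable lborel (?K z)"
 by (rule int_bd) (measurable, auto simp: norm_mult mult_ac)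
 thus "integrable lborel (%r. case (z, r) of (z, r) => ?K z r)" by simp
 qed
 qed measurable
 have "TR d t N Y xi = (LINT z|gd d. (LINT r|lborel. ?K z r))"
 unfolding TR_def hm_def ind by (simp only: int_cmult)
 also have "... = (LINT r|lborel. (LINT z|gd d. ?K z r))" by (rule P.Fubini_integral[OF int, symmetric])
 also have "... = (LINT r|lborel. of_real (1 / r) * (LINT z|gd d. Y z * of_real (indicator {t<..N} (abs r * enorm d z)) * ex d (vscale d (- r) xi) z))"
 unfolding int_cmult[symmetric] ip_vscale scaleR_of_real by (simp add: mult_ac)
 finally show ?thesis .
qed

lemma TR_exchange:
 assumes P: "HH d k P" and Y: "HH d k Y" and t: "0 < t" shows "P xi * TR d t N Y xi = Y xi * TR d t N P xi"
proof -
 have HP: "HP d k P" "HP d k Y" using P Y by (auto intro: HH_imp_HP)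
 let ?I = "%Q r. of_real (1 / r) * (LINT z|gd d. Q z * of_real (indicator {t<..N} (abs r * enorm d z)) * ex d (vscale d (- r) xi) z)"
 have "P xi * TR d t N Y xi = (LINT r|lborel. P xi * ?I Y r)"
 unfolding TR_swap[OF HP(2) t] by (rule int_cmult[symmetric])
 also have "... = (LINT r|lborel. Y xi * ?I P r)"
 proof (intro int_cong refl)
 fix r :: real
 show "P xi * ?I Y r = Y xi * ?I P r"
 proof (cases "r = 0")
 case False
 have sw: "p * (c * X) = y * (c * Z)" if "p * X = y * Z" for p X y Z c :: complex
 proof -
 have "p * (c * X) = c * (p * X)" by (rule mult.left_commute)
 also have "... = y * (c * Z)" unfolding that by (rule mult.left_commute)
 finally show ?thesis .
 qed
 show ?thesis by (rule sw) (use exch_annulus[OF P Y, of t "- r" xi N] t False in simp)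
 qed simp
 qed
 also have "... = Y xi * TR d t N P xi"
 unfolding TR_swap[OF HP(1) t] by (rule int_cmult)
 finally show ?thesis .
qed

lemma sep_bound: "sep d k l \<Phi> ==> EX C>=0. ALL z w. norm (\<Phi> z w) <= C * enorm d z ^ k * enorm d w ^ l"
proof (induction rule: sep.induct)
 case (sep_prod A B)
 obtain C where C: "0 <= C" "!!x. norm (A x) <= C * enorm d x ^ k" using HP_enorm_bound[OF sep_prod(1)] by blast
 obtain D where D: "0 <= D" "!!x. norm (B x) <= D * enorm d x ^ l" using HP_enorm_bound[OF sep_prod(2)] by blast
 have "norm (A z * B w) <= C * D * enorm d z ^ k * enorm d w ^ l" for z w
 proof -
 have "norm (A z * B w) <= (C * enorm d z ^ k) * (D * enorm d w ^ l)"
 unfolding norm_mult using C D by (intro mult_mono) auto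
 thus ?thesis by (simp add: mult_ac)
 qed
 thus ?case using C D by (intro exI[of _ "C * D"]) auto
next
 case (sep_add \<Phi> \<Psi>)
 then obtain C D where C: "0 <= C" "!!z w. norm (\<Phi> z w) <= C * enorm d z ^ k * enorm d w ^ l"
 and D: "0 <= D" "!!z w. norm (\<Psi> z w) <= D * enorm d z ^ k * enorm d w ^ l" by blast
 have "norm (\<Phi> z w + \<Psi> z w) <= (C + D) * enorm d z ^ k * enorm d w ^ l" for z w
 using norm_triangle_ineq[of "\<Phi> z w" "\<Psi> z w"] C(2)[of z w] D(2)[of z w] by (simp add: distrib_right)
 thus ?case using C D by (intro exI[of _ "C + D"]) auto
qed

definition rmult :: "nat => nat => real => ((nat => real) => complex) => (nat => real) => complex" where
 "rmult d k e Y xi = - (\<i> ^ k) * Y xi * of_real (Jm k e (enorm d xi))"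

lemma borel_measurable_Jm_enorm [measurable (raw)]:
 assumes [measurable]: "f : measurable M (ld d)" shows "(%y. Jm k e (enorm d (f y))) : bm M"
 by (rule measurable_compose[OF _ Jm_measurable]) measurable

lemma rmult_bound:
 assumes k: "0 < k" and C: "0 <= C" "norm (Y xi) <= C * enorm d xi ^ k"
 shows "norm (rmult d k e Y xi) <= C * gm k"
proof -
 have "norm (rmult d k e Y xi) = norm (Y xi) * Jm k e (enorm d xi)"
 by (simp add: rmult_def norm_mult norm_power Jm_nonneg)
 also have "... <= C * enorm d xi ^ k * Jm k e (enorm d xi)" by (intro mrm C Jm_nonneg)
 also have "... = C * (Jm k e (enorm d xi) * enorm d xi ^ k)" by simp
 also have "... <= C * gm k" by (intro mlm Jm_bound k C(1)) auto
 finally show ?thesis .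
qed

lemma integrable_mult_bounded:
 fixes A m :: "_ => complex"
 assumes A: "integrable M A" and m: "m : bm M" and b: "!!x. norm (m x) <= c"
 shows "integrable M (%x. A x * m x)"
proof (rule int_bd)
 have c0: "0 <= c" using order_trans[OF norm_ge_zero b] .
 show "integrable M (%x. norm (A x) * c)" using A by simp
 show "(%x. A x * m x) : bm M" using A m by measurable
 show "AE x in M. norm (A x * m x) <= norm (norm (A x) * c)"
 using b c0 by (auto simp: norm_mult abs_mult intro!: mlm)
qed

lemma Sop_FT:
 assumes k: "odd k" and Y: "HH d k Y" and e: "0 < e" and A: "integrable (ld d) A"
 shows "Sop d Y e (FT d A) x = FT d (%xi. A xi * rmult d k e Y xi) x" "integrable (ld d) (%xi. A xi * rmult d k e Y xi)"
proof -
 let ?A = "%xi. A xi * rmult d k e Y xi"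
 have HP: "HP d k Y" using Y by (rule HH_imp_HP)
 note [measurable] = HP_measurable[OF HP]
 have "Sop d Y e (FT d A) x = (LINT xi|ld d. A xi * ex d xi x * (LINT z|gd d. Y z * hm e (1 / e) (ip d xi z)))"
 unfolding Sop_def using e by (intro avg_dtr_FT[OF HP A, where c="lnc e (1 / e)"]) auto
 also have "... = FT d ?A x"
 unfolding avg_hm[OF k Y e] rmult_def FT_def by (intro int_cong refl) (simp only: mult_ac)
 finally show "Sop d Y e (FT d A) x = FT d ?A x" .
 obtain C where C: "0 <= C" "!!x. norm (Y x) <= C * enorm d x ^ k" using HP_enorm_bound[OF HP] by blast
 have k0: "0 < k" using k by (rule odd_pos)
 show "integrable (ld d) ?A"
 proof (rule integrable_mult_bounded[OF A])
 show "rmult d k e Y : bm (ld d)" unfolding rmult_def[abs_def] by measurable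
 show "norm (rmult d k e Y xi) <= C * gm k" for xi by (rule rmult_bound[OF k0 C(1,2)])
 qed
qed

lemma Rop_FT:
 assumes P: "HP d k P" and t: "0 < t" and A: "integrable (ld d) A"
 shows "Rop d P t N (FT d A) x = (LINT xi|ld d. A xi * ex d xi x * TR d t N P xi)"
 unfolding Rop_def TR_def
 by (rule avg_dtr_FT[OF P A, where c="lnc t N"]) (measurable, intro annulus_good t, rule lnc_annulus)

lemma Uop_Sop: "Uop d k e g z = Sop d (zonal d k z) e g"
 by (simp add: Uop_def Sop_def fun_eq_iff)

text \<open>\<open>zonal d k z xi\<close> is read as a polynomial in \<open>z\<close> at the pole
  \<open>xi\<close>; so the average over \<open>z\<close> becomes \<open>TR\<close> of the zonal
  polynomial with pole at the frequency itself.\<close>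

lemma Mop_FT:
 assumes k: "odd k" and d: "0 < d" and e: "0 < e" and t: "0 < t" and A: "integrable (ld d) A"
 shows "Mop d k e t N (FT d A) x = (LINT xi|ld d. A xi * ex d xi x * (- (\<i> ^ k) * of_real (Jm k e (enorm d xi)) * TR d t N (zonal d k xi) xi))"
proof -
 let ?A = "%xi. A xi * ex d xi x * (- (\<i> ^ k) * of_real (Jm k e (enorm d xi)) * TR d t N (zonal d k xi) xi)"
 let ?B = "%C z. C * gm k * enorm d z ^ k * lnc t N"
 let ?C = "%z xi. rmult d k e (zonal d k z) xi"
 interpret P: pair_sigma_finite "ld d" "gd d" by (rule pair_sigma_finite_ld)
 have [measurable]: "A : bm (ld d)" using A by auto
 have k0: "0 < k" using k by (rule odd_pos)
 let ?h = "%xi z. hm (t / enorm d z) (N / enorm d z) (ip d xi z)"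
 obtain C where C: "0 <= C" "!!z w. norm (zonal d k z w) <= C * enorm d z ^ k * enorm d w ^ k"
 using sep_bound[OF sep_zonal] by blast
 have rb: "norm (?C z xi) <= C * gm k * enorm d z ^ k" for z xi
 proof -
 have "0 <= C * enorm d z ^ k" using C(1) by simp
 from rmult_bound[where Y="zonal d k z" and xi=xi and e=e, OF k0 this C(2)] show ?thesis by (simp add: mult_ac)
 qed
 let ?K = "%xi z. (A xi * ex d xi x) * (?C z xi * ?h xi z)"
 have m: "(%(xi, z). ?K xi z) : bm (ld d \<Otimes>\<^sub>M gd d)" unfolding rmult_def by measurable
 have int: "integrable (ld d \<Otimes>\<^sub>M gd d) (%(xi, z). ?K xi z)"
 proof (rule pair_integrable_bound[OF P.pair_sigma_finite_axioms m A])
 have "tame d (%z. of_real (?B C z))"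
 proof -
 have "norm (of_real (enorm d z) :: complex) <= 1 * (1 + l1 d z) ^ 1" for z
 proof -
 have "enorm d z <= l1 d z" using L2_set_le_sum_abs[of z "{..<d}"] by (simp add: enorm_def l1_def L2_set_def)
 thus ?thesis by simp
 qed
 hence "tame d (%z. of_real (enorm d z))" unfolding tame_def by (intro conjI) (measurable, blast)
 thus ?thesis unfolding of_real_mult of_real_power by (intro tame_mult tame_const tame_power)
 qed
 thus "integrable (gd d) (%z. ?B C z)" by (rule integrable_tame_real)
 show "0 <= ?B C z" for z using C(1) gm_pos[OF k0] lnc_nonneg by simp
 show "norm (?K xi z) <= norm (A xi) * (?B C z)" for xi z
 proof -
 have "norm (?C z xi) * norm (?h xi z) <= (C * gm k * enorm d z ^ k) * lnc t N"
 using C(1) gm_pos[OF k0] by (intro mult_mono rb order_trans[OF hm_bound lnc_annulus]) auto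
 thus ?thesis by (simp add: norm_mult mlm)
 qed
 qed
 have "Mop d k e t N (FT d A) x = (LINT z|gd d. (LINT xi|ld d. ?K xi z))"
 unfolding Mop_def
 proof (intro int_cong refl)
 fix z
 have U: "Uop d k e (FT d A) z = FT d (%xi. A xi * ?C z xi)"
 unfolding Uop_Sop by (rule ext) (rule Sop_FT(1)[OF k HH_zonal[OF d] e A])
 show "dtr d (t / enorm d z) (N / enorm d z) z (Uop d k e (FT d A) z) x = (LINT xi|ld d. ?K xi z)"
 unfolding U dtr_FT[OF annulus_good[OF t] Sop_FT(2)[OF k HH_zonal[OF d] e A]]
 by (intro int_cong refl) (simp only: mult_ac)
 qed
 also have "... = (LINT xi|ld d. (LINT z|gd d. ?K xi z))" by (rule P.Fubini_integral[OF int])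
 also have "... = (LINT xi|ld d. ?A xi)"
 proof (intro int_cong refl)
 fix xi
 have "(LINT z|gd d. ?K xi z) = A xi * ex d xi x * (LINT z|gd d. (- (\<i> ^ k) * of_real (Jm k e (enorm d xi))) * (zonal d k xi z * ?h xi z))"
 unfolding int_cmult[symmetric] rmult_def zonal_commute[of d k xi]
 by (intro int_cong refl) (simp only: mult_ac)
 thus "(LINT z|gd d. ?K xi z) = ?A xi"
 unfolding TR_def int_cmult .
 qed
 finally show ?thesis .
qed

text \<open>The multiplier of the composition contains \<open>P xi * TR\<close> of the zonal
  polynomial at \<open>xi\<close>. By \<open>TR_exchange\<close> this is
  \<open>zonal d k xi xi\<close> times the multiplier of \<open>Rop\<close> for \<open>P\<close>.
  The factor \<open>|xi| ^ (2 * k)\<close> from the diagonal completes two factors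
  \<open>Jm\<close>, each tending to \<open>gm k\<close>; dominated convergence finishes.\<close>

theorem Mop_Sop_limit:
 assumes k: "odd k" and d: "0 < d" and P: "HH d k P" and t: "0 < t" and A: "integrable (ld d) A"
 shows "(%n. Mop d k (1 / real (Suc n)) t N (Sop d P (1 / real (Suc n)) (FT d A)) x)
 ----> - of_real (zonal_diag d k * (gm k)^2) * Rop d P t N (FT d A) x"
proof -
 let ?A = "%xi. TR d t N (zonal d k xi) xi"
 let ?B = "(gm k)^2"
 let ?C = "\<i> ^ k * \<i> ^ k"
 have HP: "HP d k P" using P by (rule HH_imp_HP)
 note [measurable] = HP_measurable[OF HP]
 have [measurable]: "A : bm (ld d)" using A by auto
 have k0: "0 < k" using k by (rule odd_pos)
 let ?e = "%n. 1 / real (Suc n)"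
 let ?c = "- of_real (zonal_diag d k) :: complex"
 let ?J = "%n xi. Jm k (?e n) (enorm d xi) * enorm d xi ^ k"
 let ?G = "%xi. ?c * (A xi * ex d xi x * TR d t N P xi)"
 \<comment> \<open>The minus sign of the limit: \<open>k\<close> is odd.\<close>
 have ik: "?C = - 1"
 proof -
 have "?C = (\<i>^2) ^ k" by (simp add: pow_mult[symmetric] sq_eq)
 thus ?thesis using k by simp
 qed
 have eq: "Mop d k (?e n) t N (Sop d P (?e n) (FT d A)) x = (LINT xi|ld d. of_real ((?J n xi)^2) * ?G xi)" for n
 proof -
 have e: "0 < ?e n" by simp
 have S: "Sop d P (?e n) (FT d A) = FT d (%xi. A xi * rmult d k (?e n) P xi)"
 by (rule ext) (rule Sop_FT(1)[OF k P e A])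
 show ?thesis unfolding S Mop_FT[OF k d e t Sop_FT(2)[OF k P e A]]
 proof (intro int_cong refl)
 fix xi
 let ?j = "of_real (Jm k (?e n) (enorm d xi)) :: complex"
 have "P xi * ?A xi = of_real (zonal_diag d k * nsq d xi ^ k) * TR d t N P xi"
 using TR_exchange[OF P HH_zonal[OF d, of k xi] t, of xi N] by (simp only: zonal_self)
 moreover have "A xi * rmult d k (?e n) P xi * ex d xi x * (- (\<i> ^ k) * ?j * ?A xi)
 = ?C * (?j * ?j) * (A xi * ex d xi x) * (P xi * ?A xi)"
 unfolding rmult_def by (simp only: mult_minus_left mult_minus_right minus_minus mult_ac)
 moreover have "nsq d xi ^ k = enorm d xi ^ k * enorm d xi ^ k" by (simp add: nsq_enorm pow_mult[symmetric] sq_eq)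
 ultimately show "A xi * rmult d k (?e n) P xi * ex d xi x * (- (\<i> ^ k) * ?j * ?A xi) = of_real ((?J n xi)^2) * ?G xi"
 by (simp add: ik sq_eq mult_ac)
 qed
 qed
 have TRm [measurable]: "TR d t N P : bm (ld d)" unfolding TR_def[abs_def] by measurable
 have iG: "integrable (ld d) ?G"
 proof -
 have "integrable (ld d) (%xi. A xi * (ex d xi x * TR d t N P xi))"
 by (rule integrable_mult_bounded[OF A, where c="(LINT z|gd d. norm (P z)) * lnc t N"]) (measurable, simp add: norm_mult TR_bound[OF HP])
 thus ?thesis by (simp add: mult.assoc)
 qed
 have "(%n. (LINT xi|ld d. of_real ((?J n xi)^2) * ?G xi)) ----> (LINT xi|ld d. of_real ?B * ?G xi)"
 proof (rule dom_conv)
 show "integrable (ld d) (%xi. (gm k)^2 * norm (?G xi))" by (intro int_mult integrable_norm iG)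
 show "AE xi in ld d. (%n. of_real ((?J n xi)^2) * ?G xi) ----> of_real ?B * ?G xi"
 using AE_ld_enorm_pos[OF d] by eventually_elim (intro tendsto_intros Jm_lim k0)
 show "AE xi in ld d. norm (of_real ((?J n xi)^2) * ?G xi) <= (gm k)^2 * norm (?G xi)" for n
 proof (rule AE_I2)
 fix xi
 have "(?J n xi)^2 <= ?B" by (intro power_mono Jm_bound k0) (auto simp: Jm_nonneg)
 thus "norm (of_real ((?J n xi)^2) * ?G xi) <= (gm k)^2 * norm (?G xi)"
 unfolding norm_mult[of "of_real _"] norm_of_real by (intro mrm) auto
 qed
 qed measurable
 also have "(LINT xi|ld d. of_real ?B * ?G xi) = - of_real (zonal_diag d k * (gm k)^2) * Rop d P t N (FT d A) x"
 unfolding Rop_FT[OF HP t A] int_cmult[symmetric] by (intro int_cong refl) simp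
 finally show ?thesis unfolding eq .
qed

section \<open>The Fourier class and the limits of truncations\<close>

text \<open>On this class all the operators are absolutely convergent Fourier integrals at every
  point, so limits can be taken in the multipliers.\<close>

definition nice :: "nat => ((nat => real) => complex) => bool" where
 "nice d f <-> (EX A. integrable (ld d) A & f = FT d A)"

lemma FT_measurable [measurable (raw)]:
 assumes A: "A : bm (ld d)" and [measurable]: "g : measurable M (ld d)"
 shows "(%y. FT d A (g y)) : bm M"
proof -
 note [measurable] = A
 show ?thesis unfolding FT_def
 by (rule sigma_finite_measure.borel_measurable_lebesgue_integral[OF sigma_finite_ld]) measurable
qed

lemma nice_measurable: "nice d f ==> f : bm (ld d)"
 unfolding nice_def using FT_measurable[of _ d "%x. x" "ld d"] by auto

text \<open>Only the odd part of the exponential survives against \<open>1 / r\<close>, and the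
  integral of \<open>sin (r * u) / r\<close> is the sine integral.\<close>

lemma hm_Si:
 assumes a: "0 < a" "a <= b" shows "hm a b u = - (\<i> * of_real (2 * Si (b * u) - 2 * Si (a * u)))"
proof -
 let ?A = "of_real (2 * Si (b * u) - 2 * Si (a * u))"
 let ?i = "%r. indicator {r. a < abs r & abs r <= b} r :: real"
 let ?h = "%r. (?i r / r) *\<^sub>R exp (\<i> * of_real (- r * u))"
 define q where "q r = u * sinc (r * u)" for r
 have q: "q r = sin (r * u) / r" if "r ~= 0" for r using that by (cases "u = 0") (auto simp: q_def)
 let ?s = "%c r. q r * indicator {- c..c} r"
 have int: "integrable lborel ?h"
 by (rule int_bd[OF lnc_integrable[of a b]]) (use a in auto)
 have Si_minus: "Si (- x) = - Si x" for x
 using Si_neg[of x] Si_neg[of "- x"] by (cases "0 <= x") auto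
 have F: "has_bochner_integral lborel (?s c) (2 * Si (c * u))" if "0 <= c" for c
 proof -
 have "DERIV (%r. Si (r * u)) r :> q r" for r
 unfolding q_def mult.commute[of u] by (rule DERIV_chain2[OF DERIV_Si]) (auto intro!: derivative_eq_intros)
 moreover have "isCont q r" for r unfolding q_def[abs_def]
 by (intro continuous_intros isCont_o2[OF _ isCont_sinc])
 ultimately have "has_bochner_integral lborel (?s c) (Si (c * u) - Si (- c * u))"
 using that by (intro has_bochner_integral_FTC_Icc_real) auto
 thus ?thesis by (simp add: Si_minus)
 qed
 \<comment> \<open>Adding the value at \<open>- r\<close> cancels the cosine and doubles the sine;
   \<open>q\<close> fills the removable singularity at 0.\<close>
 have pt: "?h r + ?h (0 - r) = of_real (?s b r - ?s a r) * (- (2 * \<i>))" for r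
 proof (cases "a < abs r & abs r <= b")
 case True
 hence "?s b r - ?s a r = sin (r * u) / r" using a q[of r] by (auto simp: ind_def)
 thus ?thesis using True by (simp only:) (simp add: exp_eq_polar cis.ctr complex_eq_iff)
 next
 case False
 thus ?thesis using a by (auto simp: ind_def)
 qed
 have "2 * hm a b u = hm a b u + hm a b u" by simp
 also have "... = (LINT r|lborel. ?h r + ?h (0 - r))"
 using int integrable_lborel_minus[of ?h 0] integral_lborel_minus[of ?h 0]
 unfolding hm_def by (subst Bochner_Integration.integral_add) auto
 also have "... = ?A * (- (2 * \<i>))"
 using has_bochner_integral_diff[OF F[of b] F[of a]] a
 unfolding pt integral_mult_left_zero integral_complex_of_real by (simp only: has_bochner_integral_iff)
 finally have "2 * hm a b u = 2 * - (\<i> * ?A)" by (simp only: mult_ac mult_minus_left mult_minus_right)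
 thus ?thesis by (metis mult_left_cancel zero_neq_numeral)
qed

text \<open>Boundedness of the sine integral gives a bound that does not grow with the truncation,
  unlike \<open>lnc\<close>. It is what dominates the limits.\<close>

lemma hm_uniform_bound:
 obtains C where "0 <= C" "!!a b u. 0 < a | b <= a ==> norm (hm a b u) <= C"
proof -
 obtain B where B: "!!T. abs (Si T) <= B" using bounded_Si by blast
 have B0: "0 <= B" using B[of 0] by linarith
 have "norm (hm a b u) <= 4 * B" if "0 < a | b <= a" for a b u
 proof (cases "b <= a")
 case True
 hence "{r. a < abs r & abs r <= b} = {}" by auto
 thus ?thesis using B0 by (simp add: hm_def)
 next
 case False
 thus ?thesis using that B[of "b * u"] B[of "a * u"]
 by (simp add: hm_Si norm_mult del: of_real_diff of_real_mult)
 qed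
 with B0 show ?thesis by (intro that[of "4 * B"]) auto
qed

lemma hm_lim:
 assumes a: "!!n. 0 < a n" "a ----> 0" and b: "filterlim b at_top sequentially"
 shows "(%n. hm (a n) (b n) u) ----> - (\<i> * of_real (pi * sgn u))"
proof -
 let ?A = "%n. 2 * Si (b n * u) - 2 * Si (a n * u)"
 have Si_minus: "Si (- x) = - Si x" for x
 using Si_neg[of x] Si_neg[of "- x"] by (cases "0 <= x") auto
 have "\<forall>\<^sub>F n in sequentially. hm (a n) (b n) u = - (\<i> * of_real (?A n))"
 using filterlim_at_top_dense[THEN iffD1, OF b, rule_format, of 1] order_tendstoD(2)[OF a(2) zero_less_one]
 by eventually_elim (intro hm_Si a(1), linarith)
 moreover have "(%n. ?A n) ----> pi * sgn u - 0"
 proof (rule tendsto_diff)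
 have "(%n. 2 * Si (a n * u)) ----> 2 * Si (0 * u)"
 by (intro tendsto_intros isCont_tendsto_compose[OF isCont_Si] a)
 moreover have s0: "Si 0 = 0" using Si_minus[of 0] by simp
 ultimately show "(%n. 2 * Si (a n * u)) ----> 0" by simp
 have "(%n. 2 * (sgn u * Si (b n * abs u))) ----> 2 * (sgn u * (pi / 2))" if "u ~= 0"
 by (intro tendsto_intros filterlim_compose[OF Si_at_top] filterlim_at_top_mult_tendsto_pos[OF tendsto_const _ b]) (use that in auto)
 moreover have "sgn u * Si (b n * abs u) = Si (b n * u)" if "u ~= 0" for n
 using that Si_minus[of "b n * u"] by (auto simp: sgn_if abs_if)
 ultimately show "(%n. 2 * Si (b n * u)) ----> pi * sgn u"
 using s0 by (cases "u = 0") (auto simp: mult.commute)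
 qed
 hence "(%n. - (\<i> * of_real (?A n))) ----> - (\<i> * of_real (pi * sgn u - 0))"
 by (intro tendsto_minus tendsto_mult tendsto_const tendsto_of_real)
 ultimately show ?thesis by (simp add: tendsto_cong)
qed

text \<open>The limit is the same for all truncations that exhaust the half line, with or without
  rescaling by \<open>|z|\<close>; so \<open>Rop\<close> and \<open>Sop\<close> have a common limit.
  The bounds \<open>c n\<close> may grow, as they only justify Fubini for each
  \<open>n\<close>.\<close>

lemma avg_dtr_limit:
 assumes d: "0 < d" and Y: "HP d k Y" and A: "integrable (ld d) A"
 and m [measurable]: "!!n. a n : bm (ld d)" "!!n. b n : bm (ld d)"
 and ab: "!!n z. 0 < a n z | b n z <= a n z" and c: "!!n z. lnc (a n z) (b n z) <= c n"
 and lim: "!!z n. 0 < enorm d z ==> 0 < a n z" "!!z. 0 < enorm d z ==> (%n. a n z) ----> 0"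
 "!!z. 0 < enorm d z ==> filterlim (%n. b n z) at_top sequentially"
 shows "(%n. (LINT z|gd d. Y z * dtr d (a n z) (b n z) z (FT d A) x))
 ----> (LINT xi|ld d. A xi * ex d xi x * (LINT z|gd d. Y z * - (\<i> * of_real (pi * sgn (ip d xi z)))))"
 unfolding avg_dtr_FT[OF Y A m ab c]
proof -
 let ?A = "%z xi. Y z * - (\<i> * of_real (pi * sgn (ip d xi z)))"
 let ?B = "%C. (LINT z|gd d. norm (Y z) * C)"
 note [measurable] = HP_measurable[OF Y]
 have [measurable]: "A : bm (ld d)" using A by auto
 obtain C where C: "0 <= C" "!!a b u. 0 < a | b <= a ==> norm (hm a b u) <= C" using hm_uniform_bound by blast
 have iY: "integrable (gd d) (%z. norm (Y z) * C)" using integrable_norm[OF int_tame[OF tame_HP[OF Y]]] by simp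
 let ?T = "%n xi. (LINT z|gd d. Y z * hm (a n z) (b n z) (ip d xi z))"
 have bd: "norm (Y z * hm (a n z) (b n z) (ip d xi z)) <= norm (Y z) * C" for n z xi
 unfolding norm_mult by (intro mlm C(2) ab) simp
 have iT: "integrable (gd d) (%z. Y z * hm (a n z) (b n z) (ip d xi z))" for n xi
 by (rule integrable_gd_mult_bounded[OF Y]) (measurable, rule C(2)[OF ab])
 have TC: "norm (?T n xi) <= (?B C)" for n xi
 by (rule order_trans[OF integral_norm_bound integral_mono[OF integrable_norm[OF iT] iY bd]])
 have AEz: "AE z in gd d. 0 < enorm d z" using AE_gd_nonzero[OF d] by eventually_elim (rule enorm_pos)
 have T: "(%n. ?T n xi) ----> (LINT z|gd d. ?A z xi)" for xi
 proof (rule dom_conv[OF _ _ iY])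
 show "AE z in gd d. (%n. Y z * hm (a n z) (b n z) (ip d xi z)) ----> ?A z xi"
 using AEz by eventually_elim (intro tendsto_intros hm_lim lim)
 show "AE z in gd d. norm (Y z * hm (a n z) (b n z) (ip d xi z)) <= norm (Y z) * C" for n using bd by simp
 qed measurable
 show "(%n. (LINT xi|ld d. A xi * ex d xi x * ?T n xi))
 ----> (LINT xi|ld d. A xi * ex d xi x * (LINT z|gd d. ?A z xi))"
 proof (rule dom_conv)
 show "integrable (ld d) (%xi. norm (A xi) * (?B C))" using A by simp
 show "AE xi in ld d. (%n. A xi * ex d xi x * ?T n xi)
 ----> A xi * ex d xi x * (LINT z|gd d. ?A z xi)"
 by (intro AE_I2 tendsto_mult tendsto_const T)
 show "AE xi in ld d. norm (A xi * ex d xi x * ?T n xi) <= norm (A xi) * (?B C)" for n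
 using TC[of n] by (intro AE_I2) (simp add: norm_mult mlm)
 qed measurable
qed

section \<open>The maximal inequality on the Fourier class\<close>

locale riesz_kernel =
 fixes d k :: nat and P :: "(nat => real) => complex" and p :: real
 assumes k_le: "k <= d" and k_odd: "odd k" and HH_P: "HH d k P" and p_gt: "1 < p"
begin

lemma k_pos: "0 < k" and d_pos: "0 < d"
 using odd_pos[OF k_odd] k_le by auto

lemma HP_P: "HP d k P" using HH_P by (rule HH_imp_HP)

lemmas P_measurable [measurable] = HP_measurable[OF HP_P]

definition pow_int :: "((nat => real) => complex) => ennreal" where
 "pow_int f = (NN x|ld d. np p (f x))"

definition Lp :: "((nat => real) => complex) => bool" where
 "Lp f <-> f : bm (ld d) & pow_int f < \<infinity>"

lemma LpD [dest]: assumes "Lp f" shows "f : bm (ld d)" "(NN x|ld d. np p (f x)) < \<infinity>"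
 using assms by (auto simp: Lp_def pow_int_def)

text \<open>This is \<open>gm k\<close> times the truncated Riesz transform of the theorem:
  \<open>polar_const\<close> replaces \<open>riesz_const\<close>.\<close>

definition RT :: "real => ((nat => real) => complex) => (nat => real) => complex" where
 "RT t f x = of_real (polar_const d k) * KT d k P {t<..} f x"

text \<open>The \<open>p\<close>-th power stands inside the supremum, so that bounds on norms become
  bounds on plain integrals.\<close>

definition maxR :: "((nat => real) => complex) => (nat => real) => ennreal" where
 "maxR f x = (SUP t\<in>{0<..}. np p (RT t f x))"

definition VL :: "((nat => real) => complex) => (nat => real) => complex" where
 "VL f x = Lim (at_right 0) (%t. RT t f x)"

lemma KT_limit:
 assumes f: "Lp f" and t: "0 < t" and S: "!!n. S n : sets borel" "!!n. S n <= {t<..}" "T : sets borel" "T <= {t<..}"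
 and l: "!!s. \<forall>\<^sub>F n in sequentially. s : S n <-> s : T"
 shows "(%n. KT d k P (S n) f x) ----> KT d k P T f x"
proof -
 let ?A = "%n y. (indicator (S n) (enorm d y) / enorm d y ^ (k + d)) *\<^sub>R (P y * f (vdiff d x y))"
 let ?B = "%t y. (indicator {t<..} (enorm d y) / enorm d y ^ (k + d)) *\<^sub>R (P y * f (vdiff d x y))"
 let ?C = "%y. (indicator T (enorm d y) / enorm d y ^ (k + d)) *\<^sub>R (P y * f (vdiff d x y))"
 note [measurable] = S(1,3) LpD(1)[OF f]
 have int: "integrable (ld d) (%y. ?B t y)"
 by (rule kernel_integrable[OF HP_P LpD(1)[OF f] p_gt LpD(2)[OF f] t]) auto
 show ?thesis
 unfolding KT_def
 proof (rule dom_conv[OF _ _ integrable_norm[OF int]])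
 show "AE y in ld d. (%n. ?A n y)
 ----> ?C y"
 proof (rule AE_I2)
 fix y
 have "\<forall>\<^sub>F n in sequentially. ?A n y
 = ?C y"
 using l[of "enorm d y"] by eventually_elim (simp add: ind_def)
 thus "(%n. ?A n y)
 ----> ?C y" by (rule tendsto_eventually)
 qed
 show "AE y in ld d. norm (?A n y)
 <= norm (?B t y)" for n
 proof (rule AE_I2)
 fix y
 show "norm (?A n y)
 <= norm (?B t y)"
 using S(2)[of n] by (cases "enorm d y : S n") (auto simp: ind_def)
 qed
 qed measurable
qed

lemma Rop_limit:
 assumes f: "Lp f" and t: "0 < t" and x: "x : space (ld d)"
 shows "(%n. Rop d P t (real n) f x) ----> RT t f x"
 unfolding RT_def Rop_KT[OF d_pos k_odd HP_P LpD(1)[OF f] p_gt LpD(2)[OF f] t x]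
proof (intro tendsto_intros KT_limit[OF f t])
 fix s :: real
 obtain n where n: "s <= real n" using real_arch_simple by blast
 show "\<forall>\<^sub>F n in sequentially. s : {t<..real n} <-> s : {t<..}"
 using eventually_ge_at_top[of n] by eventually_elim (use n in auto)
qed auto

lemma RT_measurable [measurable]: assumes f: "f : bm (ld d)" shows "RT t f : bm (ld d)"
proof -
 note [measurable] = f
 have "(%x. (LINT y|ld d. (indicator {t<..} (enorm d y) / enorm d y ^ (k + d)) *\<^sub>R (P y * f (vdiff d x y)))) : bm (ld d)"
 by (rule sigma_finite_measure.borel_measurable_lebesgue_integral[OF sigma_finite_ld]) measurable
 thus ?thesis unfolding RT_def[abs_def] KT_def by measurable
qed

lemma RT_add: assumes "Lp f" "Lp g" "0 < t" shows "RT t (%x. f x + g x) x = RT t f x + RT t g x"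
proof -
 have i: "integrable (ld d) (%y. (indicator {t<..} (enorm d y) / enorm d y ^ (k + d)) *\<^sub>R (P y * h (vdiff d x y)))" if "Lp h" for h
 by (rule kernel_integrable[OF HP_P LpD(1)[OF that] p_gt LpD(2)[OF that] assms(3)]) auto
 show ?thesis unfolding RT_def KT_def distrib_left scaleR_add_right
 by (subst Bochner_Integration.integral_add[OF i[OF assms(1)] i[OF assms(2)]]) (rule distrib_left)
qed

lemma tendsto_pow: "(f \<longlongrightarrow> l) F ==> ((%n. np p (f n :: complex)) \<longlongrightarrow> np p l) F"
 using p_gt by (intro tendsto_ennrealI tendsto_powr' tendsto_norm tendsto_const) auto

lemma SUP_lim_le_liminf:
 fixes g :: "nat => 'i => ennreal"
 assumes "!!i. i : I ==> (%m. g m i) ----> l i"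
 shows "(SUP i\<in>I. l i) <= liminf (%m. SUP i\<in>I. g m i)"
proof (rule SUP_least)
 fix i assume i: "i : I"
 have "l i = liminf (%m. g m i)" using lim_imp_Liminf[OF _ assms[OF i]] by simp
 also have "... <= liminf (%m. SUP i\<in>I. g m i)" using i by (intro Liminf_mono always_eventually allI SUP_upper)
 finally show "l i <= liminf (%m. SUP i\<in>I. g m i)" .
qed

lemma Rop_measurable' [measurable]: "f : bm (ld d) ==> Rop d P t N f : bm (ld d)"
 by (rule borel_measurable_Rop[OF HP_P, of f "%x. x" "ld d" "%_. t"]) auto

lemma Sop_measurable' [measurable]: "f : bm (ld d) ==> Sop d P e f : bm (ld d)"
 by (rule borel_measurable_Sop[OF HP_P, of f "%x. x" "ld d"]) auto

text \<open>\<open>RT\<close> is continuous from the right in \<open>t\<close>, by dominated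
  convergence, so rational radii suffice.\<close>

lemma maxR_countable:
 assumes f: "Lp f"
 obtains q :: "nat => real" where "!!i. 0 < q i" "!!x. maxR f x = (SUP n. SUP i\<in>{..<n}. np p (RT (q i) f x))"
proof -
 let ?Q = "{r : \<rat>. 0 < r} :: real set"
 let ?A = "%t x. np p (RT t f x)"
 have cnt: "countable ?Q" using countable_rat by (rule countable_subset[rotated]) auto
 have ne: "?Q ~= {}" by (auto intro!: exI[of _ 1])
 define q where "q = from_nat_into ?Q"
 have rq: "range q = ?Q" unfolding q_def by (rule range_from_nat_into[OF ne cnt])
 have q0: "0 < q i" for i using rq by auto
 moreover have "maxR f x = (SUP n. SUP i\<in>{..<n}. np p (RT (q i) f x))" (is "_ = ?R") for x
 proof (rule antisym)
 show "?R <= maxR f x" unfolding maxR_def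
 proof (intro SUP_least)
 fix n i
 show "np p (RT (q i) f x) <= (SUP t\<in>{0<..}. ?A t x)"
 by (rule SUP_upper) (simp add: q0)
 qed
 have le: "?A r x <= ?R" if "r : ?Q" for r
 proof -
 have "r : range q" using that by (simp only: rq)
 then obtain i where i: "r = q i" by (rule rangeE)
 show ?thesis unfolding i by (rule SUP_upper2[of "Suc i"], simp, rule SUP_upper) simp
 qed
 show "maxR f x <= ?R" unfolding maxR_def
 proof (rule SUP_least)
 fix t :: real assume "t : {0<..}"
 hence t: "0 < t" by simp
 have "EX r:\<rat>. t < r & r < t + 1 / real (Suc n)" for n by (rule Rats_dense_in_real) simp
 then obtain s where s: "!!n. s n : \<rat>" "!!n. t < s n" "!!n. s n < t + 1 / real (Suc n)" by metis
 have lim: "(%n. t + 1 / real (Suc n)) ----> t + 0"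
 by (intro tendsto_intros LIMSEQ_Suc[OF lim_1_over_n])
 have sl: "s ----> t"
 using s(2,3) by (intro tendsto_sandwich[OF _ _ tendsto_const lim[unfolded add_0_right]] always_eventually allI less_imp_le)
 have "(%n. RT (s n) f x) ----> RT t f x" unfolding RT_def
 proof (intro tendsto_intros KT_limit[OF f t])
 show "\<forall>\<^sub>F n in sequentially. u : {s n<..} <-> u : {t<..}" for u
 proof (cases "t < u")
 case True
 from order_tendstoD(2)[OF sl this] show ?thesis by eventually_elim (use True in auto)
 next
 case False
 hence "\<not> s n < u" for n using s(2)[of n] by linarith
 thus ?thesis using False by simp
 qed
 show "{s n<..} <= {t<..}" for n using s(2)[of n] by auto
 qed auto
 from tendsto_pow[OF this] show "?A t x <= ?R"
 proof (rule LIMSEQ_le_const2, intro exI allI impI le)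
 show "s n : ?Q" for n using s(1)[of n] less_trans[OF t s(2)[of n]] by simp
 qed
 qed
 qed
 ultimately show ?thesis using that by blast
qed

lemma maxR_measurable [measurable]: assumes f: "Lp f" shows "maxR f : bm (ld d)"
proof -
 note [measurable] = LpD(1)[OF f]
 obtain q :: "nat => real" where q: "!!x. maxR f x = (SUP n. SUP i\<in>{..<n}. np p (RT (q i) f x))"
 by (rule maxR_countable[OF f]) blast
 have "(%x. SUP n. SUP i\<in>{..<n}. np p (RT (q i) f x)) : bm (ld d)" by measurable
 thus ?thesis by (simp add: q[symmetric])
qed

text \<open>Reduction to finitely many two-sided truncations: the outer radius tends to infinity by
  Fatou's lemma, then countably many radii are reached by monotone convergence.\<close>

lemma maxR_bound:
 assumes f: "Lp f" and K: "!!n (t :: nat => real) N. (!!i. 0 < t i) ==> (NN x|ld d. (SUP i\<in>{..<n::nat}. np p (Rop d P (t i) (N i) f x))) <= K"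
 shows "(NN x|ld d. maxR f x) <= K"
proof -
 let ?A = "%n t x. (SUP i\<in>{..<n}. np p (RT (t i) f x))"
 note [measurable] = LpD(1)[OF f]
 have fin: "(NN x|ld d. ?A n t x) <= K" if t: "!!i. 0 < t i" for t :: "nat => real" and n
 proof -
 have "(NN x|ld d. ?A n t x)
 <= (NN x|ld d. liminf (%m. SUP i\<in>{..<n}. np p (Rop d P (t i) (real m) f x)))"
 by (intro nn_mono SUP_lim_le_liminf tendsto_pow Rop_limit f t)
 also have "... <= liminf (%m. (NN x|ld d. (SUP i\<in>{..<n}. np p (Rop d P (t i) (real m) f x))))"
 by (intro nn_integral_liminf) measurable
 also have "... <= liminf (%m. K)" by (intro Liminf_mono always_eventually allI K[where N="%_. real _"] t)
 finally show ?thesis by (simp add: Liminf_const)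
 qed
 obtain q :: "nat => real" where q: "!!i. 0 < q i" "!!x. maxR f x = (SUP n. SUP i\<in>{..<n}. np p (RT (q i) f x))"
 by (rule maxR_countable[OF f]) blast
 have "(NN x|ld d. maxR f x) = (SUP n. (NN x|ld d. ?A n q x))"
 unfolding q(2) by (intro nn_integral_monotone_convergence_SUP) (auto simp: incseq_def le_fun_def intro!: SUP_subset_mono)
 also have "... <= K" by (intro SUP_least fin q(1))
 finally show ?thesis .
qed

definition Cw :: ennreal where
 "Cw = en ((10 ^ 8 * line_const p) powr p) * (NN z|gd d. np p (P z))"

lemma Cw_finite: "Cw < \<infinity>"
 unfolding Cw_def using HH_powr_finite[OF HH_P p_gt] by (simp add: ennreal_mult_less_top)

lemma weak_bound: assumes f: "Lp f" shows "(NN x|ld d. maxR f x) <= Cw * pow_int f"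
proof (rule maxR_bound[OF f])
 fix n :: nat and t N :: "nat => real" assume t: "!!i. 0 < t i"
 show "(NN x|ld d. (SUP i\<in>{..<n}. np p (Rop d P (t i) (N i) f x))) <= Cw * pow_int f"
 unfolding Rop_def Cw_def pow_int_def mult.assoc
 by (rule weighted_avg_max[where a="%i z. t i / enorm d z" and b="%i z. N i / enorm d z", OF d_pos HP_P LpD(1)[OF f] _ _ _ p_gt])
 (auto intro!: divide_pos_pos t enorm_pos)
qed

text \<open>Supplies the dominating function for the convergence of
  \<open>Sop d P (1 / real (Suc m)) f\<close> in \<open>nice_bound\<close>.\<close>

lemma Sop_weak_bound:
 assumes f: "Lp f" shows "(NN x|ld d. (SUP m. np p (Sop d P (1 / real (Suc m)) f x))) <= Cw * pow_int f"
proof -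
 let ?A = "%m x. np p (Sop d P (1 / real (Suc m)) f x)"
 let ?B = "%g. (SUP n. SUP i\<in>{..<n}. g i)"
 note [measurable] = LpD(1)[OF f]
 have e: "(SUP m. g m) = ?B g" for g :: "nat => ennreal"
 proof (rule antisym)
 show "(SUP m. g m) <= ?B g"
 proof (rule SUP_least)
 fix m show "g m <= ?B g"
 by (rule SUP_upper2[of "Suc m"], simp, rule SUP_upper) simp
 qed
 show "?B g <= (SUP m. g m)" by (intro SUP_least SUP_upper) simp
 qed
 have "(NN x|ld d. (SUP m. ?A m x))
 = (SUP n. (NN x|ld d. (SUP i\<in>{..<n}. ?A i x)))"
 unfolding e[of "%m. ?A m x" for x]
 by (intro nn_integral_monotone_convergence_SUP) (auto simp: incseq_def le_fun_def intro!: SUP_subset_mono)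
 also have "... <= Cw * pow_int f"
 proof (rule SUP_least)
 fix n :: nat
 show "(NN x|ld d. (SUP i\<in>{..<n}. ?A i x)) <= Cw * pow_int f"
 unfolding Sop_def Cw_def pow_int_def mult.assoc
 by (rule weighted_avg_max[where a="%i z. 1 / real (Suc i)" and b="%i z. 1 / (1 / real (Suc i))", OF d_pos HP_P LpD(1)[OF f] _ _ _ p_gt]) auto
 qed
 finally show ?thesis .
qed

lemma nice_limits:
 assumes f: "nice d f" "Lp f" and x: "x : space (ld d)"
 shows "((%t. RT t f x) \<longlongrightarrow> VL f x) (at_right 0)" "(%n. Sop d P (1 / real (Suc n)) f x) ----> VL f x"
proof -
 let ?A = "%n. 1 / real (Suc n)"
 obtain A where A: "integrable (ld d) A" and fA: "f = FT d A" using f(1) unfolding nice_def by blast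
 define V where "V = (LINT xi|ld d. A xi * ex d xi x * (LINT z|gd d. P z * - (\<i> * of_real (pi * sgn (ip d xi z)))))"
 have S: "(%n. Sop d P (?A n) f x) ----> V" unfolding Sop_def fA V_def
 proof (rule avg_dtr_limit[OF d_pos HP_P A, where c="%n. lnc (?A n) (1 / (?A n))"])
 show "(%n. ?A n) ----> 0" by (rule LIMSEQ_Suc[OF lim_1_over_n])
 show "filterlim (%n. 1 / (?A n)) at_top sequentially"
 using filterlim_compose[OF filterlim_real_sequentially filterlim_Suc] by simp
 qed auto
 have R: "((%t. RT t f x) \<longlongrightarrow> V) (at_right 0)"
 unfolding tendsto_at_iff_sequentially
 proof (intro allI impI)
 fix X :: "nat => real" assume X: "ALL i. X i : {0<..} - {0}" "X ----> 0"
 hence X0: "0 < X n" for n by simp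
 \<comment> \<open>The outer radius is chosen along the sequence so that it tends to infinity while
   the two-sided truncation stays close to \<open>RT\<close>; \<open>avg_dtr_limit\<close> then
   covers both radii at once.\<close>
 have "EX m>=n. dist (Rop d P (X n) (real m) f x) (RT (X n) f x) < ?A n" for n
 using metric_LIMSEQ_D[OF Rop_limit[OF f(2) X0[of n] x], of "?A n"] by (auto intro: max.cobounded1 max.cobounded2)
 then obtain m where m: "!!n. n <= m n" "!!n. dist (Rop d P (X n) (real (m n)) f x) (RT (X n) f x) < ?A n" by metis
 have mt: "filterlim (%n. real (m n)) at_top sequentially"
 by (rule filterlim_at_top_mono[OF filterlim_real_sequentially]) (use m(1) in auto)
 have r: "(%n. Rop d P (X n) (real (m n)) f x) ----> V" unfolding Rop_def fA V_def
 proof (rule avg_dtr_limit[OF d_pos HP_P A, where c="%n. lnc (X n) (real (m n))"])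
 fix z assume z: "0 < enorm d z"
 show "(%n. X n / enorm d z) ----> 0" using tendsto_divide[OF X(2) tendsto_const[of "enorm d z"]] z by simp
 show "filterlim (%n. real (m n) / enorm d z) at_top sequentially"
 using filterlim_tendsto_pos_mult_at_top[OF tendsto_const[of "1 / enorm d z"] _ mt] z by simp
 show "0 < X n / enorm d z" for n using X0 z by simp
 next
 fix n z
 show "0 < X n / enorm d z | real (m n) / enorm d z <= X n / enorm d z" by (rule annulus_good[OF X0])
 show "lnc (X n / enorm d z) (real (m n) / enorm d z) <= lnc (X n) (real (m n))" by (rule lnc_annulus)
 qed measurable
 have "(%n. Rop d P (X n) (real (m n)) f x - RT (X n) f x) ----> 0"
 by (rule tendsto_norm_zero_cancel, rule tendsto_sandwich[OF _ _ tendsto_const LIMSEQ_Suc[OF lim_1_over_n]])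
 (use m(2) in \<open>auto simp: dist_norm intro!: always_eventually less_imp_le\<close>)
 from tendsto_diff[OF r this] show "((%t. RT t f x) o X) ----> V" by (simp add: comp_def)
 qed
 have "VL f x = V" unfolding VL_def by (rule tendsto_Lim[OF _ R]) simp
 thus "((%t. RT t f x) \<longlongrightarrow> VL f x) (at_right 0)" "(%n. Sop d P (?A n) f x) ----> VL f x"
 using R S by simp_all
qed

definition Cn :: real where
 "Cn = (10 ^ 8 * line_const p)^2 * hyp_const p k / (zonal_diag d k * (gm k)^2)"

lemma zonal_diag_pos: "0 < zonal_diag d k"
proof -
 have "0 < (fact k :: real)" by simp
 also have "... <= zonal_diag d k * real k ^ k" by (rule zonal_diag_ge[OF k_le d_pos])
 finally show ?thesis using k_pos by (simp add: zero_less_mult_iff)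
qed

text \<open>\<open>Mop_maximal\<close> is applied to \<open>Sop d P e f\<close> with
  \<open>e = 1 / (m + 1)\<close>. As \<open>m\<close> grows, Fatou's lemma turns the left side into
  a multiple of the maximal \<open>Rop f\<close>. The constant \<open>c\<close> of the limit enters
  \<open>Cn\<close> as a divisor.\<close>

theorem nice_bound:
 assumes f: "nice d f" "Lp f"
 shows "(NN x|ld d. maxR f x) <= en (Cn powr p) * pow_int (VL f)"
proof (rule maxR_bound[OF f(2)])
 let ?A = "(10 ^ 8 * line_const p)^2 * hyp_const p k"
 fix n :: nat and t N :: "nat => real" assume t: "!!i. 0 < t i"
 note [measurable] = LpD(1)[OF f(2)]
 obtain A where A: "integrable (ld d) A" "f = FT d A" using f(1) unfolding nice_def by blast
 let ?S = "%m. Sop d P (1 / real (Suc m)) f"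
 let ?M = "%m i. Mop d k (1 / real (Suc m)) (t i) (N i) (?S m)"
 let ?K = "en (?A powr p)"
 define c where "c = zonal_diag d k * (gm k)^2"
 have c: "0 < c" using zonal_diag_pos gm_pos[OF k_pos] by (simp add: c_def)
 have hyp: "0 <= hyp_const p k" using p_gt by (simp add: hyp_const_def)
 have lim: "(%m. np p (?M m i x)) ----> en (c powr p) * np p (Rop d P (t i) (N i) f x)" for i x
 proof -
 have "(%m. ?M m i x) ----> - of_real c * Rop d P (t i) (N i) f x"
 unfolding A(2) c_def by (rule Mop_Sop_limit[OF k_odd d_pos HH_P t A(1)])
 from tendsto_pow[OF this] show ?thesis using c by (simp add: norm_mult powr_mult en_mult)
 qed
 \<comment> \<open>Fatou would point the wrong way on the right side; the convergence comes from the
   dominating function of \<open>Sop_weak_bound\<close>.\<close>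
 have S_lim: "(%m. pow_int (?S m)) ----> pow_int (VL f)"
 proof -
 have VLm [measurable]: "VL f : bm (ld d)"
 by (rule borel_measurable_LIMSEQ_metric[OF _ nice_limits(2)[OF f]]) measurable
 show ?thesis unfolding pow_int_def
 proof (rule nn_integral_dominated_convergence)
 show "(NN x|ld d. (SUP m. np p (?S m x))) < \<infinity>"
 using order_le_less_trans[OF Sop_weak_bound[OF f(2)]] Cw_finite f(2) by (simp add: Lp_def ennreal_mult_less_top)
 show "AE x in ld d. np p (?S m x) <= (SUP m. np p (?S m x))" for m
 by (intro AE_I2 SUP_upper) simp
 show "AE x in ld d. (%m. np p (?S m x)) ----> np p (VL f x)"
 by (intro AE_I2 tendsto_pow nice_limits f)
 qed measurable
 qed
 have Mm [measurable]: "?M m i : bm (ld d)" for m i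
 by (rule borel_measurable_Mop[of _ d "%x. x" "ld d"]) measurable
 have "en (c powr p) * (NN x|ld d. (SUP i\<in>{..<n}. np p (Rop d P (t i) (N i) f x)))
 = (NN x|ld d. (SUP i\<in>{..<n}. en (c powr p) * np p (Rop d P (t i) (N i) f x)))"
 by (subst nn_cmult[symmetric], measurable) (simp add: SUP_mult_left_ennreal)
 also have "... <= (NN x|ld d. liminf (%m. SUP i\<in>{..<n}. np p (?M m i x)))"
 by (intro nn_mono SUP_lim_le_liminf lim)
 also have "... <= liminf (%m. (NN x|ld d. (SUP i\<in>{..<n}. np p (?M m i x))))"
 by (intro nn_integral_liminf) measurable
 also have "... <= liminf (%m. ?K * pow_int (?S m))"
 unfolding pow_int_def by (intro Liminf_mono always_eventually allI Mop_maximal d_pos t p_gt) simp_all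
 also have "... = ?K * pow_int (VL f)"
 by (rule lim_imp_Liminf[OF _ ennreal_tendsto_cmult[OF _ S_lim]]) auto
 finally have le: "en (c powr p) * (NN x|ld d. (SUP i\<in>{..<n}. np p (Rop d P (t i) (N i) f x))) <= ?K * pow_int (VL f)" .
 have "(NN x|ld d. (SUP i\<in>{..<n}. np p (Rop d P (t i) (N i) f x)))
 = en (1 / c powr p) * (en (c powr p) * (NN x|ld d. (SUP i\<in>{..<n}. np p (Rop d P (t i) (N i) f x))))"
 proof -
 have "en (1 / c powr p) * en (c powr p) = 1" using c by (subst en_mult[symmetric]) auto
 thus ?thesis by (simp only: mult.assoc[symmetric] mult_1)
 qed
 also have "... <= en (1 / c powr p) * (?K * pow_int (VL f))" by (intro mlm le) simp
 also have "... = en (1 / c powr p * ?A powr p) * pow_int (VL f)"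
 by (subst en_mult) (simp_all add: mult.assoc)
 also have "1 / c powr p * ?A powr p = Cn powr p"
 proof -
 have "1 / c powr p * b powr p = (b / c) powr p" if "0 <= b" for b using that c by (simp add: powr_divide)
 from this[of "?A"] show ?thesis using hyp by (simp only: Cn_def c_def zero_le_power2 mult_nonneg_nonneg)
 qed
 finally show "(NN x|ld d. (SUP i\<in>{..<n}. np p (Rop d P (t i) (N i) f x))) <= en (Cn powr p) * pow_int (VL f)" .
qed

end

section \<open>Density of the Fourier class in Lp\<close>

lemma integrable_ld_vscale:
 fixes F :: "(nat => real) => complex"
 assumes r: "r ~= 0" and F: "integrable (ld d) F" shows "integrable (ld d) (%x. F (vscale d r x))"
proof (rule integrableI_bounded)
 let ?A = "(NN x|ld d. en (norm (F (vscale d r x))))"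
 have [measurable]: "F : bm (ld d)" using F by auto
 show "(%x. F (vscale d r x)) : bm (ld d)" by measurable
 have "en (abs r ^ d) * ?A = (NN x|ld d. en (norm (F x)))"
 by (rule nn_integral_ld_vscale[OF r, of "%x. en (norm (F x))"]) measurable
 also have "... < \<infinity>" using F by (simp add: integrable_iff_bounded)
 finally show "?A < \<infinity>" using r by (auto simp: ennreal_mult_less_top ennreal_mult_eq_top_iff less_top)
qed

lemma integrable_gdens_tame: assumes h: "tame d h" shows "integrable (ld d) (%x. of_real (gdens d x) * h x)"
proof -
 note [measurable] = tame_measurable[OF h]
 have "integrable (density (ld d) (%x. en (gdens d x))) h" using int_tame[OF h] by (simp add: gd_density)
 hence "integrable (ld d) (%x. gdens d x *\<^sub>R h x)" by (subst (asm) integrable_density) (auto simp: gdens_nonneg)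
 thus ?thesis by (simp add: scaleR_of_real)
qed

definition smooth :: "nat => real => ((nat => real) => complex) => (nat => real) => complex" where
 "smooth d s u x = (LINT w|gd d. u (vadd d x s w))"

lemma integral_ld_vadd:
 fixes f :: "(nat => real) => complex"
 assumes s: "s ~= 0" and f [measurable]: "f : bm (ld d)"
 shows "(LINT y|ld d. f y) = of_real (abs s ^ d) * (LINT w|ld d. f (vadd d x s w))"
proof -
 let ?A = "distr (ld d) (ld d) (vadd d x s)"
 let ?B = "abs s ^ d"
 have T: "vadd d x s : measurable (ld d) (ld d)" unfolding vadd_def[abs_def]
 by (rule measurable_ldI) (intro borel_measurable_add borel_measurable_times borel_measurable_const ld_comp)
 have "ld d = density ?A (%_. en ?B)"
 using ld_affine[OF s, of d x] by (simp add: vadd_def[abs_def])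
 hence "(LINT y|ld d. f y) = (LINT y|density ?A (%_. en ?B). f y)" by simp
 also have "... = (LINT y|?A. abs s ^ d *\<^sub>R f y)"
 by (rule integral_density) auto
 also have "... = (LINT w|ld d. abs s ^ d *\<^sub>R f (vadd d x s w))"
 by (rule integral_distr[OF T]) measurable
 also have "... = of_real ?B * (LINT w|ld d. f (vadd d x s w))"
 unfolding scaleR_of_real by (rule int_cmult)
 finally show ?thesis .
qed

text \<open>The Gaussian is its own Fourier transform, so convolution with a Gaussian lands in the Fourier class.\<close>

lemma smooth_nice:
 assumes u: "integrable (ld d) u" and s: "0 < s" shows "nice d (smooth d s u)"
proof -
 let ?B = "measurable (ld d) (ld d)"
 interpret PP: pair_sigma_finite "ld d" "gd d" by (rule pair_sigma_finite_ld)
 have [measurable]: "u : bm (ld d)" using u by auto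
 \<comment> \<open>\<open>b\<close> is the Fourier transform of \<open>u\<close> at the frequency
   \<open>\<zeta> / s\<close>. It is bounded, so its product with the Gaussian density is
   integrable, which gives the coefficient function \<open>?A\<close> after the dilation by
   \<open>- s\<close>.\<close>
 define b where "b \<zeta> = (LINT y|ld d. u y * exp (\<i> * of_real (1 / s * ip d \<zeta> y)))" for \<zeta>
 have bm [measurable]: "b : bm (ld d)" unfolding b_def[abs_def]
 by (rule sigma_finite_measure.borel_measurable_lebesgue_integral[OF sigma_finite_ld]) measurable
 have tb: "tame d b"
 by (rule tame_bounded[OF bm, of "(LINT y|ld d. norm (u y))"], unfold b_def, rule order_trans[OF integral_norm_bound]) (simp add: norm_mult)
 let ?p = "of_real ((2 * pi) powr (- real d / 2)) :: complex"
 let ?G = "%xi. of_real (gdens d (vscale d (- s) xi)) * b (vscale d (- s) xi)"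
 let ?A = "%xi. (of_real (1 / s ^ d) * ?p * of_real (abs (- s) ^ d)) * ?G xi"
 have s0: "- s ~= 0" using s by simp
 have iA: "integrable (ld d) ?A"
 by (intro int_mult integrable_ld_vscale[OF s0 integrable_gdens_tame[OF tb]])
 have "smooth d s u x = FT d ?A x" for x
 proof -
 let ?v = "%y. vscale d (1 / s) (vdiff d y x)"
 let ?x = "%\<zeta>. exp (\<i> * of_real (- 1 / s * ip d \<zeta> x))"
 let ?e = "%y \<zeta>. exp (\<i> * of_real (1 / s * ip d \<zeta> y)) * ?x \<zeta>"
 have gv: "gdens d (?v (vadd d x s w)) = gdens d w" for w
 using s by (simp add: gdens_def vscale_def vdiff_def vadd_def)
 have vm [measurable]: "?v : ?B"
 proof -
 have "(%y. vdiff d y x) : ?B" unfolding vdiff_def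
 by (rule measurable_ldI) (intro borel_measurable_diff borel_measurable_const ld_comp)
 thus ?thesis by measurable
 qed
 have am [measurable]: "(%w. vadd d x s w) : ?B" unfolding vadd_def
 by (rule measurable_ldI) (intro borel_measurable_add borel_measurable_times borel_measurable_const ld_comp)
 have xe: "?x (vscale d (- s) xi) = ex d xi x" for xi using s by (simp add: ip_vscale)
 have exv: "ex d (?v y) \<zeta> = ?e y \<zeta>" for y \<zeta>
 proof -
 have "ip d (?v y) \<zeta> = (SUM i<d. 1 / s * (\<zeta> i * y i) + - 1 / s * (\<zeta> i * x i))"
 unfolding ip_def vscale_def vdiff_def by (intro sum.cong refl) (simp add: algebra_simps diff_divide_distrib)
 hence "ip d (?v y) \<zeta> = 1 / s * ip d \<zeta> y + - 1 / s * ip d \<zeta> x"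
 unfolding ip_def by (simp only: sum.distrib sum_cmult)
 thus ?thesis by (simp only: of_real_add distrib_left exp_add)
 qed
 have gF: "of_real (gdens d (?v y)) * u y = ?p * (LINT \<zeta>|gd d. u y * ?e y \<zeta>)" for y
 unfolding int_cmult exv[symmetric] gaussian_char by (simp add: gdens_eq nsq_def)
 have int: "integrable (ld d \<Otimes>\<^sub>M gd d) (%(y, \<zeta>). u y * ?e y \<zeta>)"
 by (rule pair_integrable_bound[OF PP.pair_sigma_finite_axioms _ u, where g="%_. 1"])
 (measurable, auto simp: norm_mult intro: finite_measure.integrable_const prob_space.finite_measure prob_space_gd)
 have "smooth d s u x = (LINT w|ld d. of_real (gdens d (?v (vadd d x s w))) * u (vadd d x s w))"
 unfolding smooth_def gv by (rule integral_gd_ld) measurable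
 also have "... = of_real (1 / s ^ d) * (LINT y|ld d. of_real (gdens d (?v y)) * u y)"
 using s by (subst (2) integral_ld_vadd[of s _ d x]) auto
 also have "(LINT y|ld d. of_real (gdens d (?v y)) * u y) = ?p * (LINT \<zeta>|gd d. (LINT y|ld d. u y * ?e y \<zeta>))"
 unfolding gF int_cmult PP.Fubini_integral[OF int] ..
 also have "(LINT \<zeta>|gd d. (LINT y|ld d. u y * ?e y \<zeta>)) = (LINT \<zeta>|gd d. b \<zeta> * ?x \<zeta>)"
 unfolding b_def mult.assoc[symmetric] integral_mult_left_zero ..
 also have "... = (LINT \<zeta>|ld d. of_real (gdens d \<zeta>) * (b \<zeta> * ?x \<zeta>))"
 by (rule integral_gd_ld) measurable
 also have "... = of_real (abs (- s) ^ d) * (LINT xi|ld d. of_real (gdens d (vscale d (- s) xi)) * (b (vscale d (- s) xi) * ?x (vscale d (- s) xi)))"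
 by (rule integral_ld_vscale[OF s0]) measurable
 finally show ?thesis unfolding FT_def mult.assoc int_cmult xe .
 qed
 thus ?thesis unfolding nice_def using iA by blast
qed

lemma nice_add: assumes "nice d f" "nice d g" shows "nice d (%x. f x + g x)"
proof -
 obtain A B where A: "integrable (ld d) A" "f = FT d A" and B: "integrable (ld d) B" "g = FT d B"
 using assms unfolding nice_def by blast
 have ie: "integrable (ld d) (%xi. C xi * ex d xi y)" if "integrable (ld d) C" for C y
 by (rule integrable_mult_bounded[OF that, where c=1]) auto
 have "(%x. f x + g x) = FT d (%xi. A xi + B xi)"
 unfolding A(2) B(2) FT_def distrib_right by (intro ext Bochner_Integration.integral_add[symmetric] ie A B)
 thus ?thesis unfolding nice_def using int_add[OF A(1) B(1)] by blast
qed

lemma nice_cmult: assumes "nice d f" shows "nice d (%x. c * f x)"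
proof -
 obtain A where A: "integrable (ld d) A" "f = FT d A" using assms unfolding nice_def by blast
 have "(%x. c * f x) = FT d (%xi. c * A xi)"
 unfolding A(2) FT_def mult.assoc by (intro ext int_cmult[symmetric])
 thus ?thesis unfolding nice_def using int_mult[OF A(1)] by blast
qed

lemma AE_gd_imp_ld: assumes "AE x in gd d. Q x" shows "AE x in ld d. Q x"
proof -
 have "AE x in ld d. 0 < gdens d x --> Q x"
 using assms unfolding gd_density by (subst (asm) AE_density) auto
 moreover have "0 < gdens d x" for x by (simp add: gdens_eq)
 ultimately show ?thesis by simp
qed

lemma AE_ld_component_neq: assumes "i < d" shows "AE x in ld d. x i ~= c"
proof (rule AE_gd_imp_ld)
 have "AE s in density lborel nd. s ~= c"
 by (subst AE_density) (auto intro: AE_mp[OF AE_lborel_singleton[of c]])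
 thus "AE x in gd d. x i ~= c"
 unfolding gd_def using assms by (intro AE_PiM_component std_normal.prob_space_axioms) auto
qed

definition bx :: "nat => (nat => real) => (nat => real) => (nat => real) set" where
 "bx d a b = {x : space (ld d). ALL i<d. a i < x i & x i <= b i}"

lemma bx_PiE: "bx d a b = (\<Pi>\<^sub>E i\<in>{..<d}. {a i<..b i})"
 unfolding bx_def ld_def space_PiM by (rule set_eqI) (simp add: PiE_iff, blast)

lemma sets_bx [measurable]: "bx d a b : sets (ld d)"
 unfolding bx_PiE ld_def by (rule sets_PiM_I_finite) simp_all

lemma emeasure_bx_finite: "emeasure (ld d) (bx d a b) < \<infinity>"
proof -
 have "emeasure (ld d) (bx d a b) = (\<Prod>i<d. emeasure lborel {a i<..b i})"
 unfolding bx_PiE ld_def by (rule lebP.emeasure_PiM) simp_all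
 also have "... < \<infinity>"
 proof -
 have "emeasure lborel {a i<..b i} ~= \<infinity>" for i
 by (cases "a i <= b i") simp_all
 thus ?thesis by (simp add: less_top[symmetric] ennreal_prod_eq_top)
 qed
 finally show ?thesis .
qed

text \<open>These orthants are closed under intersection, which suits the induction over disjoint
  unions in \<open>appr_ind_bounded\<close>.\<close>

lemma sets_ld_generated: "sets (ld d) = sigma_sets (space (ld d)) (range (%a. {x : space (ld d). ALL i<d. x i <= a i}))"
proof (rule antisym)
 let ?G = "range (%a. {x : space (ld d). ALL i<d. x i <= a i})"
 let ?A = "sigma_sets (space (ld d)) ?G"
 let ?B = "%i y. (\<Union>n. {x : space (ld d). ALL j<d. x j <= (if j = i then y else real n)})"
 have G: "?G <= Pow (space (ld d))" by auto
 let ?N = "sigma (space (ld d)) ?G"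
 have sN: "sets ?N = ?A" "space ?N = space (ld d)" using G by (simp_all add: sets_measure_of space_measure_of)
 have m: "(%x. x i) : bm ?N" if i: "i < d" for i
 proof (rule borel_measurableI_le)
 fix y :: real
 have "{x : space ?N. x i <= y} = ?B i y"
 proof (intro equalityI subsetI)
 fix x assume x: "x : {x : space ?N. x i <= y}"
 obtain n where n: "Max (insert 0 (x ` {..<d})) <= real n" using real_arch_simple by blast
 have "x j <= real n" if "j < d" for j using that by (intro order_trans[OF _ n] Max_ge) auto
 thus "x : ?B i y" using x sN by auto
 qed (use i sN in \<open>auto split: if_splits\<close>)
 also have "... : sets ?N" unfolding sN by (intro sigma_sets.Union sigma_sets.Basic) auto
 finally show "{x : space ?N. x i <= y} : sets ?N" .
 qed
 have "{f : \<Pi>\<^sub>E i\<in>{..<d}. space lborel. f i : A} : ?A" if "i < d" "A : sets lborel" for i and A :: "real set"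
 proof -
 have "(%x. x i) -` A Int space ?N : sets ?N" using m[OF that(1)] by (rule measurable_sets) (use that in simp)
 moreover have "(%x. x i) -` A Int space ?N = {f : \<Pi>\<^sub>E i\<in>{..<d}. space lborel. f i : A}"
 unfolding sN by (auto simp: ld_def space_PiM)
 ultimately show ?thesis unfolding sN by simp
 qed
 note gen = this
 show "sets (ld d) <= ?A"
 proof -
 have s: "space (ld d) = (\<Pi>\<^sub>E i\<in>{..<d}. space lborel)" by (simp add: ld_def space_PiM)
 have "sets (ld d) = sigma_sets (space (ld d)) {{f : \<Pi>\<^sub>E i\<in>{..<d}. space lborel. f i : A} | i A. i : {..<d} & A : sets lborel}"
 unfolding s by (simp only: ld_def sets_PiM_single)
 also have "... <= ?A"
 by (rule sigma_sets_mono) (use gen in blast)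
 finally show ?thesis .
 qed
 show "?A <= sets (ld d)"
 proof (rule sets.sigma_sets_subset, safe)
 fix a :: "nat => real"
 have e: "{x : space (ld d). ALL i<d. x i <= a i} = (\<Pi>\<^sub>E i\<in>{..<d}. {..a i})"
 unfolding ld_def space_PiM by (rule set_eqI) (simp add: PiE_iff, blast)
 show "{x : space (ld d). ALL i<d. x i <= a i} : sets (ld d)"
 unfolding e unfolding ld_def by (rule sets_PiM_I_finite) simp_all
 qed
qed

context riesz_kernel
begin

lemma pw_add_le:
 "np p (a + b :: complex) <= en (2 powr p) * (np p a + np p b)"
proof -
 have "norm (a + b) powr p <= (norm a + norm b) powr p" using p_gt by (intro powr_mono2 norm_triangle_ineq) auto
 also have "... <= 2 powr p * (norm a powr p + norm b powr p)" using p_gt by (intro powr_add_le) auto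
 finally show ?thesis by (simp add: en_leI flip: en_mult ennreal_plus)
qed

lemma pow_int_add:
 assumes [measurable]: "f : bm (ld d)" "g : bm (ld d)"
 shows "pow_int (%x. f x + g x) <= en (2 powr p) * (pow_int f + pow_int g)"
proof -
 have "pow_int (%x. f x + g x) <= (NN x|ld d. en (2 powr p) * (np p (f x) + np p (g x)))"
 unfolding pow_int_def by (intro nn_mono pw_add_le)
 also have "... = en (2 powr p) * (pow_int f + pow_int g)"
 unfolding pow_int_def by (simp add: nn_cmult nn_integral_add)
 finally show ?thesis .
qed

lemma pow_int_cmult:
 assumes [measurable]: "f : bm (ld d)"
 shows "pow_int (%x. c * f x) = np p c * pow_int f"
 unfolding pow_int_def by (simp add: norm_mult powr_mult en_mult nn_cmult)

lemma Lp_add: assumes "Lp f" "Lp g" shows "Lp (%x. f x + g x)"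
proof -
 have [measurable]: "f : bm (ld d)" "g : bm (ld d)" using assms by auto
 have "pow_int (%x. f x + g x) <= en (2 powr p) * (pow_int f + pow_int g)" by (rule pow_int_add) measurable
 also have "... < \<infinity>" using assms by (simp add: Lp_def ennreal_mult_less_top)
 finally show ?thesis unfolding Lp_def by simp
qed

lemma Lp_cmult: assumes "Lp f" shows "Lp (%x. c * f x)"
proof -
 have [measurable]: "f : bm (ld d)" using assms by auto
 show ?thesis using assms pow_int_cmult[of f c] unfolding Lp_def by (simp add: ennreal_mult_less_top)
qed

lemma Lp_diff: assumes "Lp f" "Lp g" shows "Lp (%x. f x - g x)"
 using Lp_add[OF assms(1) Lp_cmult[OF assms(2), of "-1"]] by simp

text \<open>Membership in the Lp closure of the Fourier class. It is carried from boxes to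
  measurable sets of finite measure, to simple functions and to all of Lp.\<close>

definition appr :: "((nat => real) => complex) => bool" where
 "appr f <-> Lp f & (ALL e>0. EX g. nice d g & Lp g & pow_int (%x. f x - g x) <= en e)"

lemma pow_int_add_small:
 assumes "f : bm (ld d)" "g : bm (ld d)"
 and "pow_int f <= en (e / (2 * 2 powr p))" "pow_int g <= en (e / (2 * 2 powr p))" and e: "0 < e"
 shows "pow_int (%x. f x + g x) <= en e"
proof -
 have "pow_int (%x. f x + g x) <= en (2 powr p) * (pow_int f + pow_int g)" by (rule pow_int_add) fact+
 also have "... <= en (2 powr p) * (en (e / (2 * 2 powr p)) + en (e / (2 * 2 powr p)))"
 by (intro mlm add_mono assms) simp
 also have "... = en e" using e by (simp add: ennreal_plus[symmetric] en_mult[symmetric] del: ennreal_plus)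
 finally show ?thesis .
qed

lemma appr_add: assumes "appr f" "appr h" shows "appr (%x. f x + h x)"
 unfolding appr_def
proof (intro conjI allI impI)
 have L: "Lp f" "Lp h" using assms by (auto simp: appr_def)
 show "Lp (%x. f x + h x)" by (rule Lp_add[OF L])
 fix e :: real assume e: "0 < e"
 hence e': "0 < e / (2 * 2 powr p)" by simp
 obtain g where g: "nice d g" "Lp g" "pow_int (%x. f x - g x) <= en (e / (2 * 2 powr p))" using assms(1) e' unfolding appr_def by blast
 obtain g' where g': "nice d g'" "Lp g'" "pow_int (%x. h x - g' x) <= en (e / (2 * 2 powr p))" using assms(2) e' unfolding appr_def by blast
 have "pow_int (%x. (f x - g x) + (h x - g' x)) <= en e"
 using LpD(1)[OF Lp_diff[OF L(1) g(2)]] LpD(1)[OF Lp_diff[OF L(2) g'(2)]] g(3) g'(3) e by (rule pow_int_add_small)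
 thus "EX g. nice d g & Lp g & pow_int (%x. f x + h x - g x) <= en e"
 by (intro exI[of _ "%x. g x + g' x"] conjI nice_add Lp_add g g') (simp add: algebra_simps)
qed

lemma appr_cmult: assumes "appr f" shows "appr (%x. c * f x)"
 unfolding appr_def
proof (intro conjI allI impI)
 have L: "Lp f" using assms by (auto simp: appr_def)
 show "Lp (%x. c * f x)" by (rule Lp_cmult[OF L])
 fix e :: real assume e: "0 < e"
 let ?e = "e / (norm c powr p + 1)"
 have e': "0 < ?e" using e by (simp add: add_nonneg_pos)
 obtain g where g: "nice d g" "Lp g" "pow_int (%x. f x - g x) <= en ?e" using assms e' unfolding appr_def by blast
 have "pow_int (%x. c * (f x - g x)) = np p c * pow_int (%x. f x - g x)"
 using LpD(1)[OF Lp_diff[OF L g(2)]] by (rule pow_int_cmult)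
 also have "... <= np p c * en ?e" by (intro mlm g) simp
 also have "... = en (norm c powr p * ?e)" using e' by (intro en_mult[symmetric]) auto
 also have "... <= en e"
 proof (rule en_leI)
 have "norm c powr p * e <= e * (norm c powr p + 1)" using e by (simp add: distrib_left)
 thus "norm c powr p * ?e <= e" by (simp add: divide_le_eq add_nonneg_pos)
 qed
 finally have "pow_int (%x. c * f x - c * g x) <= en e" by (simp add: right_diff_distrib)
 thus "EX g. nice d g & Lp g & pow_int (%x. c * f x - g x) <= en e"
 by (intro exI[of _ "%x. c * g x"] conjI nice_cmult Lp_cmult g)
qed

lemma appr_approx:
 assumes L: "Lp f" and a: "!!e. 0 < e ==> EX h. appr h & pow_int (%x. f x - h x) <= en e"
 shows "appr f"
 unfolding appr_def
proof (intro conjI allI impI L)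
 fix e :: real assume e: "0 < e"
 hence e': "0 < e / (2 * 2 powr p)" by simp
 obtain h where h: "appr h" "pow_int (%x. f x - h x) <= en (e / (2 * 2 powr p))" using a[OF e'] by blast
 have Lh: "Lp h" using h(1) by (simp add: appr_def)
 obtain g where g: "nice d g" "Lp g" "pow_int (%x. h x - g x) <= en (e / (2 * 2 powr p))" using h(1) e' unfolding appr_def by blast
 have "pow_int (%x. (f x - h x) + (h x - g x)) <= en e"
 using LpD(1)[OF Lp_diff[OF L Lh]] LpD(1)[OF Lp_diff[OF Lh g(2)]] h(2) g(3) e by (rule pow_int_add_small)
 thus "EX g. nice d g & Lp g & pow_int (%x. f x - g x) <= en e" using g by auto
qed

lemma tendsto_zero_ennreal_small:
 fixes F :: "nat => ennreal" assumes "F ----> 0" "0 < e" shows "EX n. F n <= en e"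
proof -
 have "\<forall>\<^sub>F n in sequentially. F n < en e" using assms by (intro order_tendstoD) auto
 thus ?thesis using eventually_happens'[OF sequentially_bot] less_imp_le by blast
qed

text \<open>Dominated convergence with \<open>3 * norm (f x)\<close>. The factor 2 in the hypothesis
  matches the usual approximation by simple functions.\<close>

lemma appr_limit:
 assumes L: "Lp f" and h: "!!n. appr (h n)" and l: "!!x. x : space (ld d) ==> (%n. h n x) ----> f x"
 and b: "!!n x. x : space (ld d) ==> norm (h n x) <= 2 * norm (f x)"
 shows "appr f"
proof (rule appr_approx[OF L])
 let ?A = "%x h n. np p (f x - h n x)"
 let ?B = "%x. en (3 powr p) * np p (f x)"
 fix e :: real assume e: "0 < e"
 have [measurable]: "f : bm (ld d)" "h n : bm (ld d)" for n using L h by (auto simp: appr_def)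
 have "(%n. pow_int (%x. f x - h n x)) ----> (NN x|ld d. 0)"
 unfolding pow_int_def
 proof (rule nn_integral_dominated_convergence)
 show "(NN x|ld d. ?B x) < \<infinity>"
 using LpD(2)[OF L] by (simp add: nn_cmult ennreal_mult_less_top)
 show "AE x in ld d. ?A x h n <= ?B x" for n
 proof (rule AE_I2)
 fix x assume x: "x : space (ld d)"
 have "norm (f x - h n x) <= 3 * norm (f x)" using norm_triangle_ineq4[of "f x" "h n x"] b[OF x, of n] by linarith
 hence "norm (f x - h n x) powr p <= (3 * norm (f x)) powr p" using p_gt by (intro powr_mono2) auto
 hence "?A x h n <= en (3 powr p * norm (f x) powr p)" by (intro en_leI) (simp add: powr_mult)
 thus "?A x h n <= ?B x" by (simp add: en_mult)
 qed
 show "AE x in ld d. (%n. ?A x h n) ----> 0"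
 proof (rule AE_I2)
 fix x assume x: "x : space (ld d)"
 have "(%n. f x - h n x) ----> f x - f x" by (intro tendsto_intros l x)
 from tendsto_pow[OF this] show "(%n. ?A x h n) ----> 0" using p_gt by simp
 qed
 qed measurable
 hence "(%n. pow_int (%x. f x - h n x)) ----> 0" by simp
 from tendsto_zero_ennreal_small[OF this e] show "EX h. appr h & pow_int (%x. f x - h x) <= en e" using h by blast
qed

abbreviation ind :: "(nat => real) set => (nat => real) => complex" where
 "ind A x \<equiv> of_real (indicator A x)"

lemma Lp_ind: assumes "A : sets (ld d)" "emeasure (ld d) A < \<infinity>" shows "Lp (ind A)"
proof -
 have "np p (ind A x) = indicator A x" for x using p_gt by (auto simp: ind_def)
 thus ?thesis unfolding Lp_def pow_int_def using assms by simp
qed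

text \<open>Convolution with a Gaussian of width \<open>1 / (n + 1)\<close>. The error is bounded by
  the mean of the L1 distances between the indicator and its translates, and these tend to
  0.\<close>

lemma appr_box: "appr (ind (bx d a b))"
proof -
 let ?u = "ind (bx d a b)"
 have [measurable]: "?u : bm (ld d)" by measurable
 have iu: "integrable (ld d) ?u"
 using emeasure_bx_finite[of d a b] by (intro integrable_of_real integrable_real_indicator) auto
 have Lu: "Lp ?u" by (rule Lp_ind[OF sets_bx emeasure_bx_finite])
 interpret PP: pair_sigma_finite "ld d" "gd d" by (rule pair_sigma_finite_ld)
 let ?s = "%n. 1 / real (Suc n)"
 let ?g = "%n. smooth d (?s n) ?u"
 let ?D = "%n w. (NN x|ld d. en (norm (?u x - ?u (vadd d x (?s n) w))))"
 have ng: "nice d (?g n)" for n by (rule smooth_nice[OF iu]) simp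
 have gm [measurable]: "?g n : bm (ld d)" for n by (rule nice_measurable[OF ng])
 have le: "pow_int (%x. ?u x - ?g n x) <= (NN w|gd d. ?D n w)" for n
 proof -
 have "pow_int (%x. ?u x - ?g n x) <= (NN x|ld d. (NN w|gd d. en (norm (?u x - ?u (vadd d x (?s n) w)))))"
 unfolding pow_int_def
 proof (intro nn_mono)
 fix x assume x [measurable]: "x : space (ld d)"
 have i: "integrable (gd d) (%w. ?u (vadd d x (?s n) w))"
 by (rule finite_measure.integrable_const_bound[where B=1]) (auto intro: prob_space.finite_measure prob_space_gd simp: measurable_gd_eq)
 have c: "integrable (gd d) (%w. ?u x)" by (intro finite_measure.integrable_const prob_space.finite_measure prob_space_gd)
 have e: "?u x - ?g n x = (LINT w|gd d. ?u x - ?u (vadd d x (?s n) w))"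
 unfolding smooth_def Bochner_Integration.integral_diff[OF c i] using prob_space.prob_space[OF prob_space_gd[of d]] by simp
 have "norm (?u x - ?g n x) <= (LINT w|gd d. norm (?u x - ?u (vadd d x (?s n) w)))" unfolding e by (rule integral_norm_bound)
 also have "... <= (LINT w|gd d. 1)"
 proof (rule integral_mono)
 show "norm (?u x - ?u (vadd d x (?s n) w)) <= 1" for w by (auto simp: ind_def)
 qed (use i c in \<open>auto intro: finite_measure.integrable_const prob_space.finite_measure prob_space_gd\<close>)
 also have "... = 1" using prob_space.prob_space[OF prob_space_gd[of d]] by simp
 finally have n1: "norm (?u x - ?g n x) <= 1" .
 \<comment> \<open>The difference is at most 1 in modulus, so its \<open>p\<close>-th power is below
   the first power and L1 estimates suffice for every \<open>p\<close>.\<close>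
 have "norm (?u x - ?g n x) powr p <= norm (?u x - ?g n x) powr 1"
 using n1 p_gt by (intro powr_mono') simp_all
 hence "np p (?u x - ?g n x) <= en (norm (?u x - ?g n x))" by (intro en_leI) simp
 also have "... <= (NN w|gd d. en (norm (?u x - ?u (vadd d x (?s n) w))))"
 unfolding e by (rule integral_norm_bound_ennreal) (use i c in auto)
 finally show "np p (?u x - ?g n x) <= (NN w|gd d. en (norm (?u x - ?u (vadd d x (?s n) w))))" .
 qed
 also have "... = (NN w|gd d. ?D n w)" by (rule PP.Fubini'[symmetric]) measurable
 finally show ?thesis .
 qed
 let ?m = "emeasure (ld d) (bx d a b)"
 have um: "(NN x|ld d. en (norm (?u x))) = ?m"
 by (simp add: nn_integral_indicator[symmetric] ennreal_indicator[symmetric] del: nn_integral_indicator)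
 have Db: "?D n w <= ?m + ?m" if "w : space (ld d)" for n w
 proof -
 note [measurable] = that
 have "?D n w <= (NN x|ld d. en (norm (?u x)) + en (norm (?u (vadd d x (?s n) w))))"
 proof (intro nn_mono)
 fix x
 from en_leI[OF norm_triangle_ineq4[of "?u x" "?u (vadd d x (?s n) w)"]]
 show "en (norm (?u x - ?u (vadd d x (?s n) w))) <= en (norm (?u x)) + en (norm (?u (vadd d x (?s n) w)))"
 by (simp only: ennreal_plus norm_ge_zero)
 qed
 also have "... = ?m + (NN x|ld d. en (norm (?u (vadd d x (?s n) w))))"
 by (subst nn_integral_add) (simp_all add: um[simplified])
 also have "(NN x|ld d. en (norm (?u (vadd d x (?s n) w)))) = ?m"
 unfolding um[symmetric] by (rule nn_integral_ld_vadd[of "%x. en (norm (?u x))"]) measurable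
 finally show ?thesis .
 qed
 have D0: "(%n. ?D n w) ----> 0" if w [measurable]: "w : space (ld d)" for w
 proof -
 let ?B = "bx d (%i. a i - abs (w i)) (%i. b i + abs (w i))"
 have "(%n. ?D n w) ----> (NN x|ld d. 0)"
 proof (rule nn_integral_dominated_convergence)
 show "(NN x|ld d. indicator ?B x) < \<infinity>" using emeasure_bx_finite by simp
 show "AE x in ld d. en (norm (?u x - ?u (vadd d x (?s n) w))) <= indicator ?B x" for n
 proof (rule AE_I2)
 fix x assume x: "x : space (ld d)"
 have sw: "abs (?s n * w i) <= abs (w i)" for i
 using mrm[of "?s n" 1 "abs (w i)"] by (simp add: abs_mult)
 have "x : ?B" if "x : bx d a b"
 unfolding bx_def
 proof (intro CollectI conjI allI impI x)
 fix i assume "i < d"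
 hence "a i < x i" "x i <= b i" using that unfolding bx_def by auto
 thus "a i - abs (w i) < x i" "x i <= b i + abs (w i)" by linarith+
 qed
 moreover have "x : ?B" if "vadd d x (?s n) w : bx d a b"
 unfolding bx_def
 proof (intro CollectI conjI allI impI x)
 fix i assume "i < d"
 hence "a i < x i + ?s n * w i" "x i + ?s n * w i <= b i" using that unfolding bx_def vadd_def by auto
 thus "a i - abs (w i) < x i" "x i <= b i + abs (w i)" using sw[of i] by linarith+
 qed
 ultimately show "en (norm (?u x - ?u (vadd d x (?s n) w))) <= indicator ?B x"
 by (cases "x : bx d a b"; cases "vadd d x (?s n) w : bx d a b") simp_all
 qed
 \<comment> \<open>Off the faces of the box, small translates of \<open>x\<close> lie on the same
   side of every face.\<close>
 have "AE x in ld d. ALL i:{..<d}. x i ~= a i & x i ~= b i"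
 proof (rule AE_finite_allI)
 fix i assume "i : {..<d}"
 hence "i < d" by simp
 from AE_ld_component_neq[OF this, of "a i"] AE_ld_component_neq[OF this, of "b i"]
 show "AE x in ld d. x i ~= a i & x i ~= b i" by eventually_elim simp
 qed simp
 thus "AE x in ld d. (%n. en (norm (?u x - ?u (vadd d x (?s n) w)))) ----> 0"
 using AE_space
 proof eventually_elim
 case (elim x)
 have ev: "\<forall>\<^sub>F n in sequentially. ALL i:{..<d}. (a i < x i + ?s n * w i <-> a i < x i) & (x i + ?s n * w i <= b i <-> x i <= b i)"
 proof (rule eventually_ball_finite[OF finite_lessThan], rule ballI)
 fix i assume i: "i : {..<d}"
 have l: "(%n. x i + ?s n * w i) ----> x i + 0 * w i"
 by (intro tendsto_intros LIMSEQ_Suc[OF lim_1_over_n])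
 hence l: "(%n. x i + ?s n * w i) ----> x i" by simp
 have 1: "\<forall>\<^sub>F n in sequentially. a i < x i + ?s n * w i <-> a i < x i"
 proof (cases "a i < x i")
 case True
 from order_tendstoD(1)[OF l True] show ?thesis by eventually_elim (use True in simp)
 next
 case False
 moreover have "x i ~= a i" using elim(1) i by blast
 ultimately have "x i < a i" by linarith
 from order_tendstoD(2)[OF l this] show ?thesis by eventually_elim (use False in auto)
 qed
 have 2: "\<forall>\<^sub>F n in sequentially. x i + ?s n * w i <= b i <-> x i <= b i"
 proof (cases "x i < b i")
 case True
 from order_tendstoD(2)[OF l True] show ?thesis by eventually_elim (use True in auto)
 next
 case False
 moreover have "x i ~= b i" using elim(1) i by blast
 ultimately have bi: "b i < x i" by linarith
 from order_tendstoD(1)[OF l bi] show ?thesis by eventually_elim (use bi in auto)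
 qed
 from 1 2 show "\<forall>\<^sub>F n in sequentially. (a i < x i + ?s n * w i <-> a i < x i) & (x i + ?s n * w i <= b i <-> x i <= b i)"
 by (rule eventually_conj)
 qed
 hence "\<forall>\<^sub>F n in sequentially. en (norm (?u x - ?u (vadd d x (?s n) w))) = 0"
 proof eventually_elim
 case (elim n)
 have v: "vadd d x (?s n) w : space (ld d)" by (simp add: vadd_def ld_def space_PiM)
 have "vadd d x (?s n) w : bx d a b <-> (ALL i<d. a i < x i + ?s n * w i & x i + ?s n * w i <= b i)"
 using v by (simp add: bx_def vadd_def)
 also have "... <-> (ALL i<d. a i < x i & x i <= b i)" using elim by (metis lessThan_iff)
 also have "... <-> x : bx d a b" using `x : space (ld d)` by (simp add: bx_def)
 finally show ?case by (simp add: ind_def)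
 qed
 thus ?case by (rule tendsto_eventually)
 qed
 qed measurable
 thus ?thesis by simp
 qed
 have Dm: "(%w. ?D n w) : bm (gd d)" for n
 unfolding measurable_gd_eq by (rule sigma_finite_measure.borel_measurable_nn_integral[OF sigma_finite_ld]) measurable
 have "(%n. (NN w|gd d. ?D n w)) ----> (NN w|gd d. 0)"
 proof (rule nn_integral_dominated_convergence[OF Dm])
 show "(NN w|gd d. ?m + ?m) < \<infinity>" using emeasure_bx_finite[of d a b] by simp
 show "AE w in gd d. ?D n w <= ?m + ?m" for n by (rule AE_I2) (rule Db, simp add: space_gd)
 show "AE w in gd d. (%n. ?D n w) ----> 0" by (rule AE_I2) (rule D0, simp add: space_gd)
 qed auto
 hence lim: "(%n. (NN w|gd d. ?D n w)) ----> 0" by simp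
 show ?thesis unfolding appr_def
 proof (intro conjI allI impI Lu)
 fix e :: real assume e: "0 < e"
 have e': "0 < min e 1" using e by simp
 obtain n where "(NN w|gd d. ?D n w) <= en (min e 1)" using tendsto_zero_ennreal_small[OF lim e'] by blast
 hence n: "pow_int (%x. ?u x - ?g n x) <= en (min e 1)" using le[of n] by (rule order_trans[rotated])
 have "Lp (%x. ?u x - ?g n x)" unfolding Lp_def
 proof
 show "(%x. ?u x - ?g n x) : bm (ld d)" by measurable
 show "pow_int (%x. ?u x - ?g n x) < \<infinity>" by (rule order_le_less_trans[OF n]) simp
 qed
 from Lp_diff[OF Lu this] have "Lp (?g n)" by simp
 moreover have "en (min e 1) <= en e" by (intro en_leI) simp
 ultimately show "EX g. nice d g & Lp g & pow_int (%x. ?u x - g x) <= en e"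
 using ng n order_trans by blast
 qed
qed

lemma appr_zero: "appr (%_. 0)"
 using appr_cmult[OF appr_box, of 0] by simp

lemma appr_sum: "finite I ==> (!!i. i : I ==> appr (h i)) ==> appr (%x. SUM i:I. h i x)"
 by (induction I rule: finite_induct) (auto intro: appr_zero appr_add)

text \<open>Induction over a generator closed under intersection. The fixed cube keeps all measures
  finite, so complements and disjoint unions stay in Lp.\<close>

lemma appr_ind_bounded:
 assumes A: "A : sets (ld d)" shows "appr (ind (A Int bx d (%_. - m) (%_. m)))"
proof -
 let ?Q = "bx d (%_. - m) (%_. m)"
 let ?G = "range (%a. {x : space (ld d). ALL i<d. x i <= a i})"
 let ?A = "%A. (\<Union>i. A i) Int ?Q"
 let ?B = "%a b. {x : space (ld d). ALL i<d. x i <= a i} Int {x : space (ld d). ALL i<d. x i <= b i}"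
 let ?C = "%n A x. ind ((\<Union>i<n. A i) Int ?Q) x"
 have fin: "emeasure (ld d) (B Int ?Q) < \<infinity>" if "B : sets (ld d)" for B
 by (rule order_le_less_trans[OF emeasure_mono emeasure_bx_finite[of d "%_. - m" "%_. m"]]) (use that in auto)
 have Is: "Int_stable ?G"
 proof (rule Int_stableI, clarify)
 fix a b :: "nat => real"
 have "?B a b = {x : space (ld d). ALL i<d. x i <= min (a i) (b i)}" by auto
 thus "?B a b : ?G"
 by (simp only: rangeI[of "%a. {x : space (ld d). ALL i<d. x i <= a i}" "%i. min (a i) (b i)"])
 qed
 have Gp: "?G <= Pow (space (ld d))" by auto
 have "A : sigma_sets (space (ld d)) ?G" using A by (simp only: sets_ld_generated)
 from Is Gp this show ?thesis
 proof (induction A rule: sigma_sets_induct_disjoint)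
 case (basic A)
 then obtain a where a: "A = {x : space (ld d). ALL i<d. x i <= a i}" by auto
 have "A Int ?Q = bx d (%_. - m) (%i. min (a i) m)" unfolding a bx_def by auto
 thus ?case using appr_box by simp
 next
 case empty thus ?case using appr_zero by simp
 next
 case (compl A)
 have "ind ((space (ld d) - A) Int ?Q) = (%x. ind ?Q x + (- 1) * ind (A Int ?Q) x)"
 by (auto simp: fun_eq_iff ind_def bx_def)
 thus ?case using appr_add[OF appr_box appr_cmult[OF compl(2), of "- 1"], of "%_. - m" "%_. m"] by simp
 next
 case (union A)
 have As: "A i : sets (ld d)" for i using union(2) by (auto simp: sets_ld_generated)
 show ?case
 proof (rule appr_limit)
 show "Lp (ind (?A A))" using As by (intro Lp_ind fin) auto
 show "appr (%x. SUM i<n. ind (A i Int ?Q) x)" for n by (intro appr_sum union(3)) auto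
 have s: "(SUM i<n. ind (A i Int ?Q) x) = ?C n A x" for n x
 proof (cases "x : ?Q")
 case True
 have "indicator (\<Union>i<n. A i) x = (SUM i<n. indicator (A i) x :: real)"
 by (rule indicator_UN_disjoint) (use union(1) in \<open>auto simp: disjoint_family_on_def\<close>)
 thus ?thesis using True by (simp add: indicator_inter_arith)
 qed (simp add: ind_def)
 show "(%n. SUM i<n. ind (A i Int ?Q) x) ----> ind (?A A) x" for x
 unfolding s
 proof (cases "EX i. x : A i")
 case True
 then obtain i where i: "x : A i" by blast
 have "\<forall>\<^sub>F n in sequentially. ?C n A x = ind (?A A) x"
 using eventually_gt_at_top[of i] by eventually_elim (use i in \<open>auto simp: ind_def\<close>)
 thus "(%n. ?C n A x) ----> ind (?A A) x" by (rule tendsto_eventually)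
 next
 case False
 thus "(%n. ?C n A x) ----> ind (?A A) x" by (simp add: ind_def)
 qed
 show "norm (SUM i<n. ind (A i Int ?Q) x) <= 2 * norm (ind (?A A) x)" for n x
 unfolding s by (auto simp: ind_def)
 qed
 qed
qed

lemma appr_ind:
 assumes A: "A : sets (ld d)" "emeasure (ld d) A < \<infinity>" shows "appr (ind A)"
proof (rule appr_limit[OF Lp_ind[OF A]])
 show "appr (ind (A Int bx d (%_. - real n) (%_. real n)))" for n by (rule appr_ind_bounded[OF A(1)])
 fix x assume x: "x : space (ld d)"
 obtain N where N: "Max (insert 0 ((%i. abs (x i)) ` {..<d})) < real N" using reals_Archimedean2 by blast
 have b: "abs (x i) < real N" if "i < d" for i using that by (intro order_le_less_trans[OF _ N] Max_ge) auto
 have "\<forall>\<^sub>F n in sequentially. ind (A Int bx d (%_. - real n) (%_. real n)) x = ind A x"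
 proof (rule eventually_sequentiallyI)
 fix n assume n: "N <= n"
 have "- real n < x i & x i <= real n" if "i < d" for i using b[OF that] n by auto
 hence "x : bx d (%_. - real n) (%_. real n)" using x by (simp add: bx_def)
 thus "ind (A Int bx d (%_. - real n) (%_. real n)) x = ind A x" by (simp add: ind_def)
 qed
 thus "(%n. ind (A Int bx d (%_. - real n) (%_. real n)) x) ----> ind A x" by (rule tendsto_eventually)
qed (auto simp: ind_def)

theorem nice_dense: assumes f: "Lp f" shows "appr f"
proof -
 let ?A = "%F i y. F i -` {y} Int space (ld d)"
 let ?B = "%F i x. SUM y:F i ` space (ld d) - {0}. y * ind (?A F i y) x"
 let ?C = "%y. (norm y / 2) powr p"
 have [measurable]: "f : bm (ld d)" using f by auto
 obtain F where "(ALL i. simple_function (ld d) (F i)) & (ALL x:space (ld d). (%i. F i x) ----> f x) &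
 (ALL i. ALL x:space (ld d). dist (F i x) 0 <= 2 * dist (f x) 0)"
 using borel_measurable_implies_sequence_metric[of f "ld d" 0] by auto
 hence F: "!!i. simple_function (ld d) (F i)" "!!x. x : space (ld d) ==> (%i. F i x) ----> f x"
 "!!i x. x : space (ld d) ==> dist (F i x) 0 <= 2 * dist (f x) 0" by blast+
 show ?thesis
 proof (rule appr_limit[OF f, where h="%i x. SUM y:F i ` space (ld d) - {0}. y * ind (?A F i y) x"])
 have rep: "(?B F i x) = F i x" if x: "x : space (ld d)" for i x
 proof -
 have fin: "finite (F i ` space (ld d))" using F(1) by (rule simple_functionD)
 have "(?B F i x) = (SUM y:F i ` space (ld d) - {0}. if y = F i x then y else 0)"
 using x by (intro sum.cong refl) (auto simp: ind_def)
 also have "... = F i x" using fin x by (auto simp: sum.delta')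
 finally show ?thesis .
 qed
 show "appr (%x. SUM y:F i ` space (ld d) - {0}. y * ind (?A F i y) x)" for i
 proof (intro appr_sum appr_cmult appr_ind)
 show "finite (F i ` space (ld d) - {0})" using F(1) simple_functionD by blast
 fix y assume y: "y : F i ` space (ld d) - {0}"
 show s: "?A F i y : sets (ld d)" using F(1) by (rule simple_functionD)
 \<comment> \<open>Chebyshev: where the simple function has the value \<open>y\<close>, the modulus
   of \<open>f\<close> is at least \<open>norm y / 2\<close>; since \<open>y\<close> is nonzero the
   level set has finite measure.\<close>
 have "en (?C y) * emeasure (ld d) (?A F i y) = (NN x|ld d. en (?C y) * indicator (?A F i y) x)"
 using s by (simp add: nn_integral_cmult_indicator)
 also have "... <= pow_int f" unfolding pow_int_def
 proof (intro nn_mono)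
 fix x assume x: "x : space (ld d)"
 show "en (?C y) * indicator (?A F i y) x <= np p (f x)"
 proof (cases "F i x = y")
 case True
 hence "norm y / 2 <= norm (f x)" using F(3)[OF x, of i] by simp
 hence "?C y <= norm (f x) powr p" using p_gt by (intro powr_mono2) auto
 thus ?thesis using True x by (simp add: en_leI)
 qed simp
 qed
 also have "... < \<infinity>" using f by (simp add: Lp_def)
 finally show "emeasure (ld d) (?A F i y) < \<infinity>"
 using y by (auto simp: ennreal_mult_less_top ennreal_mult_eq_top_iff less_top)
 qed
 show "(%i. SUM y:F i ` space (ld d) - {0}. y * ind (?A F i y) x) ----> f x" if "x : space (ld d)" for x
 unfolding rep[OF that] by (rule F(2)[OF that])
 show "norm (?B F i x) <= 2 * norm (f x)" if "x : space (ld d)" for i x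
 unfolding rep[OF that] using F(3)[OF that, of i] by simp
 qed
qed

end

section \<open>From the Fourier class to all of Lp\<close>

context riesz_kernel
begin

lemma Cn_nonneg: "0 <= Cn"
 unfolding Cn_def using zonal_diag_pos p_gt by (simp add: hyp_const_def)

lemma RT_le:
 assumes t: "0 < t" and r: "maxR f x = en r" "0 <= r" shows "norm (RT t f x) <= r powr (1 / p)"
proof -
 let ?A = "norm (RT t f x) powr p"
 have "en ?A <= en r"
 unfolding r(1)[symmetric] maxR_def using t by (intro SUP_upper) simp
 hence "?A <= r" using r(2) by simp
 hence "?A powr (1 / p) <= r powr (1 / p)" using p_gt by (intro powr_mono2) auto
 thus ?thesis using p_gt by (simp add: powr_powr)
qed

lemma pw_RT_le_maxR: "0 < t ==> np p (RT t f x) <= maxR f x"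
 unfolding maxR_def by (intro SUP_upper) simp

text \<open>At such a point the truncations of \<open>g n\<close> converge to those of
  \<open>f\<close> uniformly in \<open>t\<close>, so the limits in \<open>n\<close> and in
  \<open>t\<close> may be exchanged.\<close>

theorem limit_of_approximants:
 assumes f: "Lp f" and g: "!!n. nice d (g n)" "!!n. Lp (g n)" and x: "x : space (ld d)"
 and r: "!!n. maxR (%x. f x - g n x) x = en (r n)" "!!n. 0 <= r n" "r ----> 0"
 shows "((%t. RT t f x) \<longlongrightarrow> VL f x) (at_right 0)"
 and "np p (VL (g n) x - VL f x) <= maxR (%x. f x - g n x) x"
proof -
 let ?d = "%n. r n powr (1 / p)" and ?h = "%n x. f x - g n x" and ?a = "%n. VL (g n) x"
 have Lh: "Lp (?h n)" for n by (rule Lp_diff[OF f g(2)])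
 have d0: "?d ----> 0"
 by (rule tendsto_zero_powrI[OF r(3) tendsto_const]) (use p_gt r(2) in auto)
 have split: "RT t (g n) x - RT t f x = - RT t (?h n) x" if "0 < t" for t n
 using RT_add[OF g(2)[of n] Lh[of n] that, of x] by simp
 have hle: "norm (RT t (g n) x - RT t f x) <= ?d n" if "0 < t" for t n
 unfolding split[OF that] norm_minus_cancel by (rule RT_le[OF that r(1,2)])
 have lim: "((%t. RT t (g n) x) \<longlongrightarrow> ?a n) (at_right 0)" for n by (rule nice_limits(1)[OF g x])
 have pos: "\<forall>\<^sub>F t in at_right 0. 0 < (t::real)" by (rule eventually_at_right_less)
 have dist_le: "dist (?a n) (?a m) <= ?d n + ?d m" for n m
 proof (rule tendsto_upperbound[OF tendsto_dist[OF lim[of n] lim[of m]]])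
 show "\<forall>\<^sub>F t in at_right 0. dist (RT t (g n) x) (RT t (g m) x) <= ?d n + ?d m"
 using pos
 proof eventually_elim
 case (elim t)
 thus ?case
 using dist_triangle2[of "RT t (g n) x" "RT t (g m) x" "RT t f x"] hle[of t n] hle[of t m] by (simp add: dist_norm)
 qed
 qed simp
 have "Cauchy ?a"
 proof (rule metric_CauchyI)
 fix e :: real assume e: "0 < e"
 have "\<forall>\<^sub>F n in sequentially. ?d n < e / 2" using d0 e by (intro order_tendstoD) auto
 then obtain N where N: "!!n. n >= N ==> ?d n < e / 2" by (auto simp: eventually_sequentially)
 have "dist (?a m) (?a n) < e" if "m >= N" "n >= N" for m n
 using dist_le[of m n] N[OF that(1)] N[OF that(2)] by simp
 thus "EX M. ALL m>=M. ALL n>=M. dist (?a m) (?a n) < e" by blast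
 qed
 then obtain a where a: "?a ----> a" by (auto simp: Cauchy_convergent_iff convergent_def)
 have "uniform_limit {0<..} (%n t. RT t (g n) x) (%t. RT t f x) sequentially"
 unfolding uniform_limit_iff
 proof (intro allI impI)
 fix e :: real assume "0 < e"
 with d0 have "\<forall>\<^sub>F n in sequentially. ?d n < e" by (intro order_tendstoD)
 thus "\<forall>\<^sub>F n in sequentially. ALL t:{0<..}. dist (RT t (g n) x) (RT t f x) < e"
 by eventually_elim (use hle in \<open>auto simp: dist_norm intro: le_less_trans\<close>)
 qed
 from swap_uniform_limit[OF always_eventually[OF allI[OF lim]] a this]
 have conv: "((%t. RT t f x) \<longlongrightarrow> a) (at_right 0)" by simp
 have V: "VL f x = a" unfolding VL_def by (rule tendsto_Lim[OF _ conv]) simp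
 thus "((%t. RT t f x) \<longlongrightarrow> VL f x) (at_right 0)" using conv by simp
 show "np p (VL (g n) x - VL f x) <= maxR (?h n) x" unfolding V
 proof (rule tendsto_upperbound[OF tendsto_pow[OF tendsto_diff[OF lim conv]]])
 show "\<forall>\<^sub>F t in at_right 0. np p (RT t (g n) x - RT t f x) <= maxR (?h n) x"
 using pos
 proof eventually_elim
 case (elim t)
 thus ?case unfolding split[OF elim] norm_minus_cancel by (rule pw_RT_le_maxR)
 qed
 qed simp
qed

lemma maxR_add_le: assumes "Lp f" "Lp g" shows "maxR (%x. f x + g x) x <= en (2 powr p) * (maxR f x + maxR g x)"
 unfolding maxR_def[of "%x. f x + g x"]
proof (rule SUP_least)
 fix t :: real assume "t : {0<..}"
 hence t: "0 < t" by simp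
 have "np p (RT t (%x. f x + g x) x) <= en (2 powr p) * (np p (RT t f x) + np p (RT t g x))"
 unfolding RT_add[OF assms t] by (rule pw_add_le)
 also have "... <= en (2 powr p) * (maxR f x + maxR g x)"
 by (intro mlm add_mono pw_RT_le_maxR t) simp
 finally show "np p (RT t (%x. f x + g x) x) <= en (2 powr p) * (maxR f x + maxR g x)" .
qed

text \<open>The bound on the Fourier class is applied to approximants; \<open>weak_bound\<close>,
  whose constant may depend on \<open>d\<close> and \<open>P\<close>, makes the errors vanish in the
  limit, so that constant does not survive.\<close>

theorem main_bound:
 assumes f: "Lp f"
 shows "AE x in ld d. ((%t. RT t f x) \<longlongrightarrow> VL f x) (at_right 0)"
 and "(NN x|ld d. maxR f x) <= en ((4 * Cn) powr p) * pow_int (VL f)"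
proof -
 let ?A = "%n. en ((1 / 2) ^ n)"
 let ?B = "pow_int (VL f)"
 let ?C = "2 powr p * (Cn powr p * 2 powr p)"
 let ?D = "(NN x|ld d. maxR f x)"
 let ?E = "%x. ((%t. RT t f x) \<longlongrightarrow> VL f x) (at_right 0)"
 let ?F = "%g n x. np p (VL (g n) x)"
 \<comment> \<open>The errors \<open>2 ^ (- n)\<close> are summable, so almost everywhere the sum of
   the maximal functions of the errors is finite and its terms tend to 0.\<close>
 define g where "g n = (SOME g. nice d g & Lp g & pow_int (%x. f x - g x) <= ?A n)" for n :: nat
 have "nice d (g n) & Lp (g n) & pow_int (%x. f x - g n x) <= ?A n" for n
 proof -
 have "EX g. nice d g & Lp g & pow_int (%x. f x - g x) <= ?A n"
 using nice_dense[OF f] unfolding appr_def by simp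
 thus ?thesis unfolding g_def by (rule someI_ex)
 qed
 hence g: "!!n. nice d (g n)" "!!n. Lp (g n)" "!!n. pow_int (%x. f x - g n x) <= ?A n" by simp_all
 let ?h = "%n x. f x - g n x"
 have Lh: "Lp (?h n)" for n by (rule Lp_diff[OF f g(2)])
 note [measurable] = maxR_measurable[OF Lh] maxR_measurable[OF g(2)] LpD(1)[OF f]
 define \<epsilon> where "\<epsilon> n = Cw * ?A n" for n
 have hb: "(NN x|ld d. maxR (?h n) x) <= \<epsilon> n" for n
 unfolding \<epsilon>_def by (rule order_trans[OF weak_bound[OF Lh]]) (intro mlm g, simp)
 have "(NN x|ld d. (\<Sum>n. maxR (?h n) x)) = (\<Sum>n. (NN x|ld d. maxR (?h n) x))"
 by (rule nn_integral_suminf) measurable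
 also have "... <= (\<Sum>n. \<epsilon> n)" by (intro suminf_le hb) auto
 also have "... = Cw * (\<Sum>n. ?A n)" unfolding \<epsilon>_def by (rule ennreal_suminf_cmult)
 also have "(\<Sum>n. ?A n) = en 2"
 proof -
 have "(%n. (1 / 2 :: real) ^ n) sums (1 / (1 - 1 / 2))" by (rule geometric_sums) simp
 hence s: "(%n. (1 / 2 :: real) ^ n) sums 2" by simp
 have "(\<Sum>n. ?A n) = en (\<Sum>n. (1 / 2) ^ n)" by (rule suminf_ennreal2[OF _ sums_summable[OF s]]) simp
 thus ?thesis unfolding sums_unique[OF s, symmetric] .
 qed
 also have "Cw * en 2 < \<infinity>" using Cw_finite by (simp add: ennreal_mult_less_top)
 finally have "(NN x|ld d. (\<Sum>n. maxR (?h n) x)) ~= \<infinity>" by simp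
 hence AEs: "AE x in ld d. (\<Sum>n. maxR (?h n) x) ~= \<infinity>" by (intro nn_integral_PInf_AE) measurable
 have AEc: "AE x in ld d. ?E x &
 (ALL n. ?F g n x <= en (2 powr p) * (np p (VL f x) + maxR (?h n) x))"
 using AEs AE_space
 proof eventually_elim
 case (elim x)
 define r where "r n = enn2real (maxR (?h n) x)" for n
 have "maxR (?h n) x ~= \<infinity>" for n
 proof
 assume "maxR (?h n) x = \<infinity>"
 moreover have "(SUM i:{n}. maxR (?h i) x) <= (\<Sum>i. maxR (?h i) x)" by (rule sum_le_suminf) auto
 ultimately show False using elim(1) by (simp add: top_unique)
 qed
 hence r: "maxR (?h n) x = en (r n)" "0 <= r n" for n by (simp_all add: r_def less_top)
 have "summable r" using elim(1) unfolding r(1) by (intro summable_suminf_not_top r(2)) auto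
 hence r0: "r ----> 0" by (rule summable_LIMSEQ_zero)
 note L = limit_of_approximants[where g=g and r=r, OF f g(1,2) elim(2) r r0]
 have "?F g n x <= en (2 powr p) * (np p (VL f x) + maxR (?h n) x)" for n
 using pw_add_le[of "VL f x" "VL (g n) x - VL f x"]
 by (rule order_trans[OF eq_refl order_trans[OF _ mlm[OF add_left_mono[OF L(2)[of n]]]], rotated]) simp_all
 thus ?case using L(1) by blast
 qed
 thus AE1: "AE x in ld d. ?E x" by eventually_elim simp
 \<comment> \<open>\<open>VL f\<close> is a limit almost everywhere only, with unspecified values
   elsewhere; \<open>W\<close> is a measurable version of it.\<close>
 define W where "W x = lim (%m. RT (1 / real (Suc m)) f x)" for x
 have Wm [measurable]: "W : bm (ld d)" unfolding W_def[abs_def] by measurable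
 have AEW: "AE x in ld d. W x = VL f x"
 using AE1
 proof eventually_elim
 case (elim x)
 have "filterlim (%m. 1 / real (Suc m)) (at_right 0) sequentially"
 unfolding filterlim_at by (intro conjI LIMSEQ_Suc[OF lim_1_over_n] always_eventually) simp
 from filterlim_compose[OF elim this] show ?case unfolding W_def by (rule limI)
 qed
 have X: "?B = (NN x|ld d. np p (W x))"
 unfolding pow_int_def using AEW by (intro nn_integral_cong_AE) (auto elim!: eventually_mono)
 let ?c = "en (2 powr p)" and ?k = "en (Cn powr p)"
 have gb: "pow_int (VL (g n)) <= ?c * (?B + \<epsilon> n)" for n
 proof -
 have "pow_int (VL (g n)) <= (NN x|ld d. ?c * (np p (W x) + maxR (?h n) x))"
 unfolding pow_int_def
 proof (rule nn_integral_mono_AE)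
 show "AE x in ld d. ?F g n x <= ?c * (np p (W x) + maxR (?h n) x)"
 using AEc AEW
 proof eventually_elim
 case (elim x)
 thus ?case by (simp only:)
 qed
 qed
 also have "... = ?c * (?B + (NN x|ld d. maxR (?h n) x))"
 unfolding X by (simp add: nn_cmult nn_integral_add)
 also have "... <= ?c * (?B + \<epsilon> n)" by (intro mlm add_mono hb) auto
 finally show ?thesis .
 qed
 have le: "?D <= ?c * (?k * (?c * (?B + \<epsilon> n)) + \<epsilon> n)" for n
 proof -
 have "?D <= (NN x|ld d. ?c * (maxR (g n) x + maxR (?h n) x))"
 using maxR_add_le[OF g(2)[of n] Lh[of n]] by (intro nn_mono) simp
 also have "... = ?c * ((NN x|ld d. maxR (g n) x) + (NN x|ld d. maxR (?h n) x))"
 by (simp add: nn_cmult nn_integral_add)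
 also have "... <= ?c * (?k * pow_int (VL (g n)) + \<epsilon> n)"
 by (intro mlm add_mono nice_bound g hb) simp
 also have "... <= ?c * (?k * (?c * (?B + \<epsilon> n)) + \<epsilon> n)"
 by (intro mlm add_mono gb order_refl) simp_all
 finally show ?thesis .
 qed
 have e0: "\<epsilon> ----> 0"
 proof -
 have "(%n. ?A n) ----> en 0" by (intro tendsto_ennrealI LIMSEQ_power_zero) simp
 from ennreal_tendsto_cmult[OF _ this, of Cw] Cw_finite show ?thesis unfolding \<epsilon>_def[abs_def] by simp
 qed
 have "(%n. ?c * (?k * (?c * (?B + \<epsilon> n)) + \<epsilon> n)) ----> ?c * (?k * (?c * (?B + 0)) + 0)"
 by (intro ennreal_tendsto_cmult tendsto_add tendsto_const e0) auto
 hence "?D <= ?c * (?k * (?c * (?B + 0)) + 0)"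
 by (rule LIMSEQ_le_const) (use le in blast)
 also have "... = en ?C * ?B"
 by (simp add: en_mult mult.assoc)
 \<comment> \<open>One factor \<open>2 powr p\<close> comes from splitting \<open>f\<close> into
   \<open>g n\<close> and the error, the other from comparing \<open>VL (g n)\<close> with
   \<open>VL f\<close>.\<close>
 also have "?C = (4 * Cn) powr p"
 proof -
 have "(4 * Cn) powr p = (2 * (Cn * 2)) powr p" by simp
 also have "... = ?C" using Cn_nonneg by (simp only: powr_mult)
 finally show ?thesis ..
 qed
 finally show "?D <= en ((4 * Cn) powr p) * ?B" .
qed

end

section \<open>Transfer to the completed measure and to the norms of the theorem\<close>

lemma borel_measurable_completion_AE:
 fixes f g :: "'a => complex"
 assumes g: "g : bm M" and AE: "AE x in M. f x = g x" shows "f : bm (completion M)"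
proof (rule measurableI)
 obtain N where N: "N : null_sets M" "{x : space M. f x ~= g x} <= N" using AE unfolding eventually_ae_filter by auto
 fix A :: "complex set" assume A: "A : sets borel"
 have "f -` A Int space (completion M) = (g -` A Int space M - N) \<union> (f -` A Int space M Int N)" using N(2) by auto
 moreover have "g -` A Int space M - N : sets (completion M)"
 using measurable_sets[OF g A] N(1) by (intro sets_completionI_sets) auto
 moreover have "f -` A Int space M Int N : sets (completion M)" by (rule sets_completionI_sub[OF N(1)]) auto
 ultimately show "f -` A Int space (completion M) : sets (completion M)" by (metis sets.Un)
qed simp

lemma integral_completion_AE:
 fixes f g :: "'a => complex"
 assumes g: "g : bm M" and AE: "AE x in M. f x = g x"
 shows "(LINT x|completion M. f x) = (LINT x|M. g x)"
proof -
 have "(LINT x|completion M. f x) = (LINT x|completion M. g x)"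
 by (rule Bochner_Integration.integral_cong_AE[OF borel_measurable_completion_AE[OF assms] measurable_completion[OF g] AE_completion[OF AE]])
 thus ?thesis by (simp add: integral_completion[OF g])
qed

lemma completion_ex_borel_measurable_complex:
 fixes f :: "'a => complex"
 assumes [measurable]: "f : bm (completion M)"
 obtains g where "g : bm M" "AE x in M. f x = g x"
proof -
 obtain u where u: "u : bm M" "AE x in M. Re (f x) = u x"
 using completion_ex_borel_measurable_real[of "%x. Re (f x)" M] by auto
 obtain v where v: "v : bm M" "AE x in M. Im (f x) = v x"
 using completion_ex_borel_measurable_real[of "%x. Im (f x)" M] by auto
 show ?thesis
 proof (rule that[of "%x. Complex (u x) (v x)"])
 show "(%x. Complex (u x) (v x)) : bm M"
 using u(1) v(1) by (simp add: borel_measurable_complex_iff)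
 show "AE x in M. f x = Complex (u x) (v x)" using u(2) v(2) by eventually_elim (simp add: complex_eq_iff)
 qed
qed

text \<open>The map \<open>y -> x - y\<close> preserves Lebesgue measure, hence null sets.\<close>

lemma AE_vdiff: assumes "AE y in ld d. Q y" shows "AE y in ld d. Q (vdiff d x y)"
proof -
 obtain N where N: "N : null_sets (ld d)" "{y : space (ld d). \<not> Q y} <= N" using assms unfolding eventually_ae_filter by auto
 hence [measurable]: "N : sets (ld d)" by auto
 have "(NN y|ld d. indicator N (vdiff d x y)) = (NN y|ld d. indicator N y)"
 by (rule nn_integral_vdiff) measurable
 also have "... = 0" using N(1) by auto
 finally have "AE y in ld d. (indicator N (vdiff d x y) :: ennreal) = 0"
 by (subst (asm) nn_integral_0_iff_AE) auto
 thus ?thesis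
 proof (rule AE_mp, intro AE_I2 impI)
 fix y assume "(indicator N (vdiff d x y) :: ennreal) = 0"
 hence "vdiff d x y ~: N" by (auto simp: ind_def split: if_splits)
 moreover have "vdiff d x y : space (ld d)" by (simp add: vdiff_def ld_def space_PiM)
 ultimately show "Q (vdiff d x y)" using N(2) by auto
 qed
qed

lemma leb_ld: "leb d = completion (ld d)" by (simp add: leb_def ld_def)

lemma space_ld_Rd: "space (ld d) = Rd d" by (simp add: ld_def Rd_def space_PiM)

lemma riesz_const_polar: assumes "0 < k" "0 < d" shows "riesz_const d k = polar_const d k / gm k"
proof -
 have "(2 * pi) powr (- real d / 2) = 1 / (2 powr (real d / 2) * pi powr (real d / 2))"
 by (simp add: powr_minus_divide powr_mult)
 moreover have "2 powr (real (k + d) / 2) = 2 powr (real k / 2) * (2::real) powr (real d / 2)"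
 by (simp add: powr_add[symmetric] add_divide_distrib)
 moreover have "real (k + d) / 2 = (real k + real d) / 2" by simp
 moreover have "G / (Q * H) = 1 / (D * Q) * (K * D * G) / (K * H)" if "D ~= 0" "K ~= 0" for G Q H D K :: real
 using that by simp
 ultimately show ?thesis unfolding riesz_const_def polar_const_def gm_def by simp
qed

lemma ennreal_powr_ennreal: "0 <= a ==> ennreal_powr (en a) q = en (a powr q)"
 by (simp add: ennreal_powr_def)

lemma ennreal_powr_root_le:
 assumes p: "0 < p" and B: "0 < B" and le: "I <= en (B powr p) * J"
 shows "ennreal_powr I (1 / p) <= en B * ennreal_powr J (1 / p)"
proof (cases "J = \<infinity>")
 case True
 thus ?thesis using B by (simp add: ennreal_powr_def ennreal_mult_top)
next
 case False
 then obtain j where j: "J = en j" "0 <= j" by (cases J) auto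
 have "I <= en (B powr p * j)" using le j by (simp add: en_mult)
 then obtain i where i: "I = en i" "0 <= i" "i <= B powr p * j"
 using j(2) by (cases I) (auto simp: top_unique)
 have "i powr (1 / p) <= (B powr p * j) powr (1 / p)" using i p by (intro powr_mono2) auto
 also have "... = B * j powr (1 / p)" using p B j(2) by (simp add: powr_mult powr_powr)
 finally show ?thesis using i j B by (simp add: ennreal_powr_ennreal en_mult[symmetric] en_leI)
qed

text \<open>\<open>4 * Cn\<close> with \<open>1 / zonal_diag d k\<close> replaced by its upper bound
  \<open>real k ^ k / fact k\<close> from \<open>zonal_diag_ge\<close>, which removes the
  dimension.\<close>

definition Bconst :: "real => nat => real" where
 "Bconst p k = 4 * ((10 ^ 8 * line_const p)^2 * hyp_const p k * (real k ^ k / (fact k * (gm k)^2)))"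

lemma hyp_const_pos: "1 < p ==> 0 < hyp_const p k"
proof -
 assume p: "1 < p"
 hence "0 < p / (p - 1) + 1" by (intro add_pos_pos divide_pos_pos) auto
 thus ?thesis unfolding hyp_const_def using p by (intro mult_pos_pos) auto
qed

lemma Bconst_pos: assumes "1 < p" "0 < k" shows "0 < Bconst p k"
 unfolding Bconst_def using assms hyp_const_pos[OF assms(1)] gm_pos[OF assms(2)] line_const_ge(1)[OF assms(1)]
 by (intro mult_pos_pos divide_pos_pos) auto

context riesz_kernel
begin

lemma Cn_le: "4 * Cn <= Bconst p k"
proof -
 let ?N = "(10 ^ 8 * line_const p)^2 * hyp_const p k"
 let ?A = "?N / (gm k)^2 * (real k ^ k / fact k)"
 let ?B = "?N / (gm k)^2 * (1 / zonal_diag d k)"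
 have N0: "0 <= ?N" using hyp_const_pos[OF p_gt, of k] by simp
 have kk: "0 < real k ^ k" using k_pos by simp
 have "1 / zonal_diag d k <= real k ^ k / fact k"
 using zonal_diag_ge[OF k_le d_pos] zonal_diag_pos by (simp add: field_simps)
 hence "?B <= ?A"
 using N0 by (intro mlm) auto
 moreover have "?B = ?N / (zonal_diag d k * (gm k)^2)" by simp
 moreover have "?A = ?N * (real k ^ k / (fact k * (gm k)^2))" by simp
 ultimately show ?thesis unfolding Cn_def Bconst_def by linarith
qed

theorem riesz_bound:
 assumes P0: "!!x. x : Rd d ==> P0 x = P x" and f: "f : Lp_space p (leb d)"
 shows "Lp_norm_nn p (leb d) (riesz_max d k P0 f) <= en (Bconst p k) * Lp_norm p (leb d) (riesz d k P0 f)"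
proof -
 let ?A = "%g x. np p (VL g x)"
 let ?C = "%t y. indicator {t<..} (enorm d y) / enorm d y ^ (k + d)"
 let ?D = "%x. norm (riesz d k P0 f x)"
 let ?E = "completion (ld d)"
 let ?F = "%x. riesz_max d k P0 f x"
 let ?G = "(NN x|ld d. np p (f x))"
 let ?H = "%y x. P0 y / of_real (enorm d y ^ (k + d)) * f (vdiff d x y)"
 have fm: "f : bm ?E" using f by (simp add: Lp_space_def leb_ld)
 obtain g where g [measurable]: "g : bm (ld d)" and fg: "AE x in ld d. f x = g x"
 by (rule completion_ex_borel_measurable_complex[OF fm])
 have c: "0 < gm k" using gm_pos[OF k_pos] .
 have Lg: "Lp g"
 proof -
 have "Lp_norm p (leb d) f < \<infinity>" using f by (simp add: Lp_space_def)
 hence "(NN x|leb d. ennreal_powr (en (norm (f x))) p) < \<infinity>"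
 by (auto simp: Lp_norm_def Lp_norm_nn_def ennreal_powr_def less_top split: if_splits)
 hence "?G < \<infinity>"
 by (simp add: ennreal_powr_ennreal leb_ld nn_integral_completion)
 moreover have "?G = pow_int g"
 unfolding pow_int_def using fg by (intro nn_integral_cong_AE) (auto elim!: eventually_mono)
 ultimately show ?thesis unfolding Lp_def by simp
 qed
 \<comment> \<open>Valid at every \<open>x\<close>, not just almost everywhere: changing
   \<open>f\<close> on a null set changes \<open>y -> f (x - y)\<close> on a null set. The quotient
   of \<open>riesz_const\<close> and \<open>polar_const\<close> gives \<open>1 / gm k\<close>, which
   later cancels between the two sides.\<close>
 have tr: "riesz_trunc d k P0 t f x = of_real (1 / gm k) * RT t g x" for t x
 proof -
 have "(LINT y:{y : Rd d. enorm d y > t}|leb d. ?H y x)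
 = (LINT y|ld d. (?C t y) *\<^sub>R (P y * g (vdiff d x y)))"
 unfolding set_lebesgue_integral_def leb_ld
 proof (rule integral_completion_AE)
 show "(%y. (?C t y) *\<^sub>R (P y * g (vdiff d x y))) : bm (ld d)"
 by measurable
 show "AE y in ld d. indicator {y : Rd d. enorm d y > t} y *\<^sub>R (?H y x)
 = (?C t y) *\<^sub>R (P y * g (vdiff d x y))"
 using AE_vdiff[OF fg, of x] AE_space
 proof eventually_elim
 case (elim y)
 hence y: "y : Rd d" by (simp add: space_ld_Rd)
 show ?case using elim(1) y P0[OF y] by (simp add: ind_def scaleR_of_real)
 qed
 qed
 thus ?thesis
 unfolding riesz_trunc_def RT_def KT_def riesz_const_polar[OF k_pos d_pos] by simp
 qed
 let ?B = "4 * Cn"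
 let ?a = "1 / gm k"
 let ?I = "(NN x|leb d. ennreal_powr (?F x) p)"
 let ?J = "(NN x|leb d. ennreal_powr (en (?D x)) p)"
 have I: "?I <= en (?a powr p) * (NN x|ld d. maxR g x)"
 proof -
 have "ennreal_powr (?F x) p <= en (?a powr p) * maxR g x" for x
 proof (cases "maxR g x = \<infinity>")
 case True
 thus ?thesis using c by (simp add: ennreal_mult_top)
 next
 case False
 then obtain r where r: "maxR g x = en r" "0 <= r" by (cases "maxR g x") auto
 have "?F x <= en (?a * r powr (1 / p))"
 unfolding riesz_max_def tr
 proof (intro SUP_least en_leI)
 fix t :: real assume "t : {0<..}"
 hence "norm (RT t g x) <= r powr (1 / p)" by (intro RT_le r) simp
 hence "?a * norm (RT t g x) <= ?a * r powr (1 / p)" using c by (intro mlm) auto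
 moreover have "norm (of_real ?a * RT t g x) = ?a * norm (RT t g x)" unfolding norm_mult norm_of_real using c by simp
 ultimately show "norm (of_real ?a * RT t g x) <= ?a * r powr (1 / p)" by simp
 qed
 then obtain m where m: "?F x = en m" "0 <= m" "m <= ?a * r powr (1 / p)"
 using c by (cases "?F x") (auto simp: top_unique)
 have "m powr p <= (?a * r powr (1 / p)) powr p" using m p_gt by (intro powr_mono2) auto
 also have "... = ?a powr p * r" unfolding powr_mult powr_powr using p_gt r(2) by simp
 finally show ?thesis unfolding m(1) r(1) ennreal_powr_ennreal[OF m(2)]
 using r(2) by (simp add: en_mult[symmetric] en_leI)
 qed
 hence "?I <= (NN x|ld d. en (?a powr p) * maxR g x)"
 unfolding leb_ld nn_integral_completion by (intro nn_mono)
 also have "... = en (?a powr p) * (NN x|ld d. maxR g x)"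
 using maxR_measurable[OF Lg] by (intro nn_cmult)
 finally show ?thesis .
 qed
 have J: "?J = en (?a powr p) * pow_int (VL g)"
 proof -
 have m: "(%x. ?A g x) : bm ?E"
 proof -
 have seq: "filterlim (%m. 1 / real (Suc m)) (at_right 0) sequentially"
 unfolding filterlim_at by (intro conjI LIMSEQ_Suc[OF lim_1_over_n] always_eventually) simp
 have "AE x in ld d. VL g x = lim (%m. RT (1 / real (Suc m)) g x)"
 using main_bound(1)[OF Lg]
 proof eventually_elim
 case (elim x)
 from filterlim_compose[OF elim seq] show ?case by (rule limI[symmetric])
 qed
 moreover have "(%x. lim (%m. RT (1 / real (Suc m)) g x)) : bm (ld d)" by measurable
 ultimately have [measurable]: "VL g : bm ?E" by (intro borel_measurable_completion_AE)
 show ?thesis by measurable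
 qed
 have "?J = (NN x|ld d. en (?D x powr p))"
 by (simp add: ennreal_powr_ennreal leb_ld nn_integral_completion)
 also have "... = (NN x|ld d. en (?a powr p) * ?A g x)"
 proof (rule nn_integral_cong_AE)
 show "AE x in ld d. en (?D x powr p) = en (?a powr p) * ?A g x"
 using main_bound(1)[OF Lg]
 proof eventually_elim
 case (elim x)
 have "((%t. of_real ?a * RT t g x) \<longlongrightarrow> of_real ?a * VL g x) (at_right 0)" by (intro tendsto_intros elim)
 hence "riesz d k P0 f x = of_real ?a * VL g x" unfolding riesz_def tr by (intro tendsto_Lim) auto
 hence "?D x = ?a * norm (VL g x)" unfolding norm_mult using c by (simp add: norm_divide)
 hence "?D x powr p = ?a powr p * norm (VL g x) powr p" by (simp only: powr_mult)
 thus ?case by (simp only: en_mult powr_ge_zero)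
 qed
 qed
 also have "... = (NN x|?E. en (?a powr p) * ?A g x)"
 by (simp only: nn_integral_completion)
 also have "... = en (?a powr p) * (NN x|?E. ?A g x)"
 by (rule nn_cmult[OF m])
 finally show ?thesis unfolding pow_int_def nn_integral_completion .
 qed
 have "?I <= en (?a powr p) * (en (?B powr p) * pow_int (VL g))"
 by (rule order_trans[OF I]) (intro mlm main_bound(2) Lg, simp)
 also have "... = en (?B powr p) * ?J" unfolding J by (rule mult.left_commute)
 also have "... <= en (Bconst p k powr p) * ?J"
 using Cn_le Cn_nonneg p_gt by (intro mrm en_leI powr_mono2) auto
 finally show ?thesis unfolding Lp_norm_nn_def Lp_norm_def
 using p_gt Bconst_pos[OF p_gt k_pos] by (intro ennreal_powr_root_le) auto
qed

end

section \<open>Growth of the constant in \<open>p\<close>\<close>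

lemma Bconst_eq:
 assumes p: "1 < p" shows "Bconst p k = (4 * 10 ^ 16 * (real k ^ k / (gm k)^2)) *
 ((line_const p)^2 * ((p + 1) powr (real k / 2) * (p / (p - 1) + 1) powr (real k / 2)))"
 unfolding Bconst_def hyp_const_def by (simp add: pow_mult)

text \<open>The two hypercontractive bases are multiplied before the power \<open>k / 2\<close> is
  taken: at either end of the range one of them stays bounded, so a single rate \<open>b\<close>
  describes both.\<close>

lemma Bconst_le:
 assumes p: "1 < p" and k: "0 < k" and a: "line_const p <= a" and b: "(p + 1) * (p / (p - 1) + 1) <= b"
 shows "norm (Bconst p k) <= (4 * 10 ^ 16 * (real k ^ k / (gm k)^2)) * (a^2 * b powr (real k / 2))"
proof -
 let ?A = "(p + 1) powr (real k / 2) * (p / (p - 1) + 1) powr (real k / 2)"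
 have q: "0 <= p / (p - 1) + 1" using p by simp
 have "?A = ((p + 1) * (p / (p - 1) + 1)) powr (real k / 2)"
 using p q by (intro powr_mult[symmetric])
 also have "... <= b powr (real k / 2)" using p q b by (intro powr_mono2 mult_nonneg_nonneg) auto
 finally have "(line_const p)^2 * ?A <= a^2 * b powr (real k / 2)"
 using line_const_ge(1)[OF p] a by (intro mult_mono power_mono) auto
 hence "Bconst p k <= (4 * 10 ^ 16 * (real k ^ k / (gm k)^2)) * (a^2 * b powr (real k / 2))"
 unfolding Bconst_eq[OF p] by (intro mlm) auto
 thus ?thesis using Bconst_pos[OF p k] by simp
qed

lemma Bconst_bigo_at_top:
 assumes k: "0 < k" shows "(%p. Bconst p k) : O[at_top](%p. p powr (2 + real k / 2))"
proof (rule bigoI)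
 let ?K = "4 * 10 ^ 16 * (real k ^ k / (gm k)^2)"
 show "\<forall>\<^sub>F p in at_top. norm (Bconst p k) <= (?K * (4 * 6 powr (real k / 2))) * norm (p powr (2 + real k / 2))"
 using eventually_ge_at_top[of 2]
 proof eventually_elim
 case (elim p)
 have inv: "1 / (p - 1) <= 1" using elim by simp
 have q: "p / (p - 1) = 1 + 1 / (p - 1)" using elim by (simp add: field_simps)
 have a: "line_const p <= 2 * p" unfolding line_const_def using elim inv by linarith
 have b: "(p + 1) * (p / (p - 1) + 1) <= 6 * p"
 proof -
 have "(p + 1) * (p / (p - 1) + 1) <= (2 * p) * 3" unfolding q using elim inv by (intro mult_mono) auto
 thus ?thesis by simp
 qed
 have "norm (Bconst p k) <= ?K * ((2 * p)^2 * (6 * p) powr (real k / 2))" using elim a b by (intro Bconst_le k) auto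
 also have "(2 * p)^2 * (6 * p) powr (real k / 2) = 4 * 6 powr (real k / 2) * p powr (2 + real k / 2)"
 proof -
 have "p powr (2 + real k / 2) = p^2 * p powr (real k / 2)" using elim by (simp add: powr_add)
 moreover have "(6 * p) powr (real k / 2) = 6 powr (real k / 2) * p powr (real k / 2)" using elim by (intro powr_mult)
 ultimately show ?thesis by (simp add: pow_mult)
 qed
 finally show ?case by (simp add: mult.assoc)
 qed
qed

lemma Bconst_bigo_at_1:
 assumes k: "0 < k" shows "(%p. Bconst p k) : O[at_right 1](%p. (p - 1) powr (- 2 - real k / 2))"
proof (rule bigoI)
 let ?K = "4 * 10 ^ 16 * (real k ^ k / (gm k)^2)"
 have "\<forall>\<^sub>F p in at_right 1. p < (2::real)" by (rule order_tendstoD(2)[OF tendsto_ident_at]) simp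
 thus "\<forall>\<^sub>F p in at_right 1. norm (Bconst p k) <= (?K * (9 * 9 powr (real k / 2))) * norm ((p - 1) powr (- 2 - real k / 2))"
 using eventually_at_right_less[of "1::real"]
 proof eventually_elim
 case (elim p)
 let ?e = "p - 1"
 have e: "0 < ?e" "?e < 1" using elim by auto
 have inv: "1 <= 1 / ?e" using e by simp
 have q: "p / ?e = 1 + 1 / ?e" using e by (simp add: field_simps)
 have a: "line_const p <= 3 / ?e"
 proof -
 have "line_const p <= 2 * (1 / ?e) + 1 / ?e" unfolding line_const_def using elim inv by linarith
 thus ?thesis by simp
 qed
 have b: "(p + 1) * (p / ?e + 1) <= 9 / ?e"
 proof -
 have "p / ?e + 1 <= 3 * (1 / ?e)" unfolding q using inv by linarith
 hence "(p + 1) * (p / ?e + 1) <= 3 * (3 * (1 / ?e))" using elim e by (intro mult_mono) auto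
 thus ?thesis by simp
 qed
 have "norm (Bconst p k) <= ?K * ((3 / ?e)^2 * (9 / ?e) powr (real k / 2))" using elim a b by (intro Bconst_le k) auto
 also have "(3 / ?e)^2 * (9 / ?e) powr (real k / 2) = 9 * 9 powr (real k / 2) * ?e powr (- 2 - real k / 2)"
 proof -
 have "?e powr (- 2 - real k / 2) = ?e powr (- 2) * ?e powr (- (real k / 2))" by (simp add: powr_add[symmetric])
 moreover have "?e powr (- 2) = 1 / ?e^2" using e by (simp add: powr_minus_divide)
 moreover have "?e powr (- (real k / 2)) = 1 / ?e powr (real k / 2)" by (rule powr_minus_divide)
 moreover have "(9 / ?e) powr (real k / 2) = 9 powr (real k / 2) / ?e powr (real k / 2)" using e by (simp add: powr_divide)
 ultimately show ?thesis by (simp add: power_divide)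
 qed
 finally show ?case by (simp add: mult.assoc)
 qed
qed

theorem theorem1p2:
  shows "\<exists>B :: real \<Rightarrow> nat \<Rightarrow> real.
    (\<forall>p k. p > 1 \<longrightarrow> odd k \<longrightarrow>
       0 \<le> B p k \<and>
       (\<forall>d P f. k \<le> d \<longrightarrow> spherical_harmonic d k P \<longrightarrow> f \<in> Lp_space p (leb d) \<longrightarrow>
          Lp_norm_nn p (leb d) (riesz_max d k P f)
            \<le> ennreal (B p k) * Lp_norm p (leb d) (riesz d k P f))) \<and>
    (\<forall>k. odd k \<longrightarrow>
       (\<lambda>p. B p k) \<in> O[at_top](\<lambda>p. p powr (2 + real k / 2)) \<and>
       (\<lambda>p. B p k) \<in> O[at_right 1](\<lambda>p. (p - 1) powr (- 2 - real k / 2)))"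
proof (rule exI[of _ Bconst], intro conjI allI impI)
 fix p :: real and k :: nat assume p: "1 < p" and k: "odd k"
 show "0 <= Bconst p k" using Bconst_pos[OF p odd_pos[OF k]] by simp
 fix d P f assume d: "k <= d" and P: "spherical_harmonic d k P" and f: "f : Lp_space p (leb d)"
 obtain P' where P': "HH d k P'" "!!x. x : Rd d ==> P x = P' x" using spherical_harmonic_HH[OF P] by blast
 interpret riesz_kernel d k P' p using d k P'(1) p by unfold_locales
 show "Lp_norm_nn p (leb d) (riesz_max d k P f) <= en (Bconst p k) * Lp_norm p (leb d) (riesz d k P f)"
 by (rule riesz_bound[OF P'(2) f])
next
 fix k :: nat assume "odd k"
 hence k: "0 < k" by (rule odd_pos)
 show "(%p. Bconst p k) : O[at_top](%p. p powr (2 + real k / 2))" by (rule Bconst_bigo_at_top[OF k])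
 show "(%p. Bconst p k) : O[at_right 1](%p. (p - 1) powr (- 2 - real k / 2))" by (rule Bconst_bigo_at_1[OF k])
qed

end
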